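(* Let $k\ge1$, $\mathrm{Ag}=\{1,\dots,k\}$ and $\mathsf{U}^\mathsf{t}\subseteq\{\neg,\mathbf{X},\mathbf{F},\mathbf{G}\}$. Assume there is a function $f_k$, computable in logarithmic space, mapping each instance $(l,C,k')$ of the hitting set problem to an instance of an $\mathrm{ATL}^k$ learning problem such that for every instance $(l,C,k')$: the set of propositions of $f_k((l,C,k'))$ is $\{p,\bar p\}$; all structures in $f_k((l,C,k'))$ are $(0,\emptyset)$-proper $\mathrm{Ag}$-turn-based structures; and the following three statements are equivalent: (i) $(l,C,k')$ is a positive instance of the hitting set problem; (ii) $f_k((l,C,k'))$ is a positive instance of $\mathrm{ATL}^k_{\mathrm{Learn}}(\mathsf{U}^\mathsf{t}\setminus\{\neg\},\emptyset,\emptyset,0)$; (iii) $f_k((l,C,k'))$ is a positive instance of $\mathrm{ATL}^k_{\mathrm{Learn}}(\mathsf{U}^\mathsf{t}\cup\{\mathbf{F},\mathbf{G}\},\emptyset,\emptyset,0)$. Then for every $\mathsf{B}^\mathsf{l}\subseteq\mathrm{Bin}_{lg}$ and every $n\in\mathbb{N}$, the problem $\mathrm{ATL}^k_{\mathrm{Learn}}(\mathsf{U}^\mathsf{t},\emptyset,\mathsf{B}^\mathsf{l},n)$ is NP-complete.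
   Context: Hitting set problem: input $(l,C,k')$ with $l\ge1$, $C=C_1,\dots,C_m$ nonempty subsets of $\{1,\dots,l\}$ whose union is $\{1,\dots,l\}$, and $1\le k'\le l$; answer yes iff there is $H\subseteq\{1,\dots,l\}$ with $|H|\le k'$ and $H\cap C_i\neq\emptyset$ for all $i$. $\mathrm{Bin}_{lg}$ is the set of binary logical operators $\vee,\wedge,\Rightarrow,\Leftarrow,\Leftrightarrow$ and their negations ($x(\neg* )y:=\neg(x*y)$). Concurrent game structures (CGS) with agents $\mathrm{Ag}$: finite states $Q$, initial states $I$, labelling $\pi:Q\to2^{\mathsf{Prop}}$, at each state each agent has finitely many ($\ge1$) actions and a transition function gives the next state from the state and the tuple of actions; size = number of (state, action tuple) pairs plus $|\mathsf{Prop}|$. Strategies map histories to actions; $\mathrm{Out}(q,s)$ is the set of infinite paths from $q$ consistent with a strategy profile $s$ of a coalition. An $\mathrm{Ag}$-turn-based structure is $\langle Q,I,\mathsf{Prop},\pi,\mathrm{AgSt},\mathrm{Succ}\rangle$ with $\mathrm{AgSt}:Q\to\mathrm{Ag}$ and nonempty $\mathrm{Succ}(q)\subseteq Q$, viewed as the CGS in which at $q$ agent $\mathrm{AgSt}(q)$ chooses the next state in $\mathrm{Succ}(q)$ and all other agents have one action. It is $(0,\emptyset)$-proper if $\mathsf{Prop}=\{p,\bar p\}$ and every state is labelled by exactly $\{p\}$ or $\{\bar p\}$. $\mathrm{ATL}^k(\mathsf{Prop},\mathsf{U}^\mathsf{t},\mathsf{B}^\mathsf{t},\mathsf{B}^\mathsf{l})$: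 state formulas $\phi::=p\mid\neg\phi\mid\phi*\phi\ ( *\in\mathsf{B}^\mathsf{l})\mid\langle\!\langle A\rangle\!\rangle\psi$ ($A\subseteq\mathrm{Ag}$), path formulas $\psi::=\circ\phi$ with $\circ\in\mathsf{U}^\mathsf{t}\setminus\{\neg\}$ (or $\phi*\phi$ with $*\in\mathsf{B}^\mathsf{t}$, here $\mathsf{B}^\mathsf{t}=\emptyset$); negation is available only if $\neg\in\mathsf{U}^\mathsf{t}$. $q\models\langle\!\langle A\rangle\!\rangle\psi$ iff some strategy profile of $A$ makes all outcome paths from $q$ satisfy $\psi$, where on a path $\rho$: $\mathbf{X}\phi$ holds iff $\rho[2]\models\phi$, $\mathbf{F}\phi$ iff some $\rho[i]\models\phi$, $\mathbf{G}\phi$ iff all $\rho[i]\models\phi$. A structure satisfies $\phi$ iff all initial states do. Size $|\phi|$ = number of distinct state subformulas ($\langle\!\langle A\rangle\!\rangle(\circ\phi)$ counts as one); $|\phi|_{\mathrm{Bin}}$ = number of distinct subformulas with a binary outermost operator. $\mathrm{ATL}^k_{\mathrm{Learn}}(\mathsf{U}^\mathsf{t},\mathsf{B}^\mathsf{t},\mathsf{B}^\mathsf{l},n)$: input $(\mathsf{Prop},\mathcal{P},\mathcal{N},B)$ with finite sets of $k$-agent CGS and $B$ in unary; yes iff some $\phi$ in the fragment with $|\phi|\le B$ and $|\phi|_{\mathrm{Bin}}\le n$ holds on every structure of $\mathcal{P}$ and fails on every structure of $\mathcal{N}$. *)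

theory Defs
  imports Complex_Main "HOL-Computational_Algebra.Polynomial"
begin

section \<open>Turing machines and complexity classes\<close>

text \<open>
  A machine has a two-way read-only input tape delimited by end markers, a fixed number of
  one-way infinite work tapes, and a write-only output tape. Control states and work symbols
  are initial segments of the naturals; the initial state is 0, the blank is 0, and
  the machine halts when the transition function yields \<open>None\<close>. The same machines
  serve for time (number of steps) and for space (work tape cells only).
\<close>

datatype direction = MoveLeft | Stay | MoveRight

datatype input_symbol = LeftEnd | InBit bool | RightEnd

record tm =
  tm_tapes :: nat
  tm_states :: nat
  tm_symbols :: nat
  tm_delta :: "nat \<Rightarrow> input_symbol \<Rightarrow> nat list \<Rightarrow>
    (nat \<times> direction \<times> (nat \<times> direction) list \<times> bool option) option"

definition wf_tm :: "tm \<Rightarrow> bool" where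
  "wf_tm M \<longleftrightarrow> 0 < tm_states M \<and> 0 < tm_symbols M \<and>
     (\<forall>q a ws q' d acts b.
        q < tm_states M \<longrightarrow> length ws = tm_tapes M \<longrightarrow> set ws \<subseteq> {..<tm_symbols M} \<longrightarrow>
        tm_delta M q a ws = Some (q', d, acts, b) \<longrightarrow>
        q' < tm_states M \<and> length acts = tm_tapes M \<and> fst ` set acts \<subseteq> {..<tm_symbols M})"

record config =
  c_state :: nat
  c_inhead :: nat
  c_tapes :: "(nat \<Rightarrow> nat) list"
  c_heads :: "nat list"
  c_output :: "bool list"

definition init_config :: "tm \<Rightarrow> config" where
  "init_config M =
     \<lparr>c_state = 0, c_inhead = 0, c_tapes = replicate (tm_tapes M) (\<lambda>_. 0),
      c_heads = replicate (tm_tapes M) 0, c_output = []\<rparr>"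

definition read_input :: "bool list \<Rightarrow> nat \<Rightarrow> input_symbol" where
  "read_input x i =
     (if i = 0 then LeftEnd else if i \<le> length x then InBit (x ! (i - 1)) else RightEnd)"

fun move_head :: "direction \<Rightarrow> nat \<Rightarrow> nat" where
  "move_head MoveLeft i = i - 1"
| "move_head Stay i = i"
| "move_head MoveRight i = i + 1"

definition next_action ::
  "tm \<Rightarrow> bool list \<Rightarrow> config \<Rightarrow> (nat \<times> direction \<times> (nat \<times> direction) list \<times> bool option) option"
where
  "next_action M x c =
     tm_delta M (c_state c) (read_input x (c_inhead c))
       (map2 (\<lambda>t h. t h) (c_tapes c) (c_heads c))"

text \<open>The input head cannot leave the delimited input, so it cannot be abused as a counter.\<close>

definition step :: "tm \<Rightarrow> bool list \<Rightarrow> config \<Rightarrow> config" where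
  "step M x c =
     (case next_action M x c of
        None \<Rightarrow> c
      | Some (q, d, acts, b) \<Rightarrow>
          \<lparr>c_state = q,
           c_inhead = min (move_head d (c_inhead c)) (length x + 1),
           c_tapes = map2 (\<lambda>(t, h) (s, _). t(h := s)) (zip (c_tapes c) (c_heads c)) acts,
           c_heads = map2 (\<lambda>h (_, m). move_head m h) (c_heads c) acts,
           c_output = c_output c @ (case b of None \<Rightarrow> [] | Some v \<Rightarrow> [v])\<rparr>)"

definition run :: "tm \<Rightarrow> bool list \<Rightarrow> nat \<Rightarrow> config" where
  "run M x t = (step M x ^^ t) (init_config M)"

definition halts_with :: "tm \<Rightarrow> bool list \<Rightarrow> nat \<Rightarrow> bool list \<Rightarrow> bool" where
  "halts_with M x t y \<longleftrightarrow> next_action M x (run M x t) = None \<and> c_output (run M x t) = y"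

definition polytime_computable :: "(bool list \<Rightarrow> bool list) \<Rightarrow> bool" where
  "polytime_computable g \<longleftrightarrow>
     (\<exists>M. wf_tm M \<and> (\<exists>p :: nat poly. \<forall>x. \<exists>t \<le> poly p (length x). halts_with M x t (g x)))"

text \<open>
  Logarithmic space for a function between structured objects: on the code of every element of
  the domain, the machine writes the code of the value and all work heads stay within
  logarithmic distance of the left end. Nothing is required on strings that are no codes.
\<close>

definition logspace_computable_on ::
  "'a set \<Rightarrow> ('a \<Rightarrow> bool list) \<Rightarrow> ('b \<Rightarrow> bool list) \<Rightarrow> ('a \<Rightarrow> 'b) \<Rightarrow> bool"
where
  "logspace_computable_on D enc_in enc_out f \<longleftrightarrow>
     (\<exists>M. wf_tm M \<and> (\<exists>c :: real. \<forall>a \<in> D.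
        (\<exists>t. halts_with M (enc_in a) t (enc_out (f a))) \<and>
        (\<forall>t. \<forall>h \<in> set (c_heads (run M (enc_in a) t)).
           real h \<le> c * log 2 (real (length (enc_in a)) + 2))))"

text \<open>Unary numbers and \<open>False\<close>-terminated sequences; both codes are prefix-free.\<close>

definition enc_nat :: "nat \<Rightarrow> bool list" where
  "enc_nat n = replicate n True @ [False]"

definition enc_list :: "('a \<Rightarrow> bool list) \<Rightarrow> 'a list \<Rightarrow> bool list" where
  "enc_list e xs = concat (map (\<lambda>x. True # e x) xs) @ [False]"

definition enc_pair :: "bool list \<Rightarrow> bool list \<Rightarrow> bool list" where
  "enc_pair x y = enc_list (\<lambda>b. [b]) x @ y"

definition class_P :: "bool list set set" where
  "class_P = {L. polytime_computable (\<lambda>x. [x \<in> L])}"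

definition class_NP :: "bool list set set" where
  "class_NP = {L. \<exists>V \<in> class_P. \<exists>p :: nat poly.
     \<forall>x. x \<in> L \<longleftrightarrow> (\<exists>y. length y \<le> poly p (length x) \<and> enc_pair x y \<in> V)}"

definition polytime_reducible :: "bool list set \<Rightarrow> bool list set \<Rightarrow> bool" where
  "polytime_reducible L L' \<longleftrightarrow> (\<exists>g. polytime_computable g \<and> (\<forall>x. x \<in> L \<longleftrightarrow> g x \<in> L'))"

definition NP_hard :: "bool list set \<Rightarrow> bool" where
  "NP_hard L \<longleftrightarrow> (\<forall>L' \<in> class_NP. polytime_reducible L' L)"

definition NP_complete :: "bool list set \<Rightarrow> bool" where
  "NP_complete L \<longleftrightarrow> L \<in> class_NP \<and> NP_hard L"


section \<open>The hitting set problem\<close>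

record hitting_set_instance =
  hs_size :: nat
  hs_sets :: "nat set list"
  hs_bound :: nat

definition hs_instance :: "hitting_set_instance \<Rightarrow> bool" where
  "hs_instance h \<longleftrightarrow> 1 \<le> hs_size h \<and>
     (\<forall>C \<in> set (hs_sets h). C \<noteq> {} \<and> C \<subseteq> {1..hs_size h}) \<and>
     \<Union> (set (hs_sets h)) = {1..hs_size h} \<and>
     1 \<le> hs_bound h \<and> hs_bound h \<le> hs_size h"

definition hs_positive :: "hitting_set_instance \<Rightarrow> bool" where
  "hs_positive h \<longleftrightarrow>
     (\<exists>H \<subseteq> {1..hs_size h}. card H \<le> hs_bound h \<and> (\<forall>C \<in> set (hs_sets h). H \<inter> C \<noteq> {}))"

definition enc_hs :: "hitting_set_instance \<Rightarrow> bool list" where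
  "enc_hs h =
     enc_nat (hs_size h) @
     enc_list (\<lambda>C. enc_list enc_nat (sorted_list_of_set C)) (hs_sets h) @
     enc_nat (hs_bound h)"


section \<open>Concurrent game structures\<close>

text \<open>
  The states are \<open>0, \<dots>, cgs_size - 1\<close>, the agents are \<open>1, \<dots>, cgs_agents\<close>, and the actions of
  agent \<open>a\<close> at state \<open>q\<close> are \<open>0, \<dots>, cgs_acts q a - 1\<close>. An action tuple is a list
  whose entry at position \<open>a - 1\<close> is the action of agent \<open>a\<close>.
\<close>

record cgs =
  cgs_agents :: nat
  cgs_size :: nat
  cgs_init :: "nat set"
  cgs_label :: "nat \<Rightarrow> nat set"
  cgs_acts :: "nat \<Rightarrow> nat \<Rightarrow> nat"
  cgs_trans :: "nat \<Rightarrow> nat list \<Rightarrow> nat"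

definition states :: "cgs \<Rightarrow> nat set" where
  "states C = {..<cgs_size C}"

definition action_tuples :: "cgs \<Rightarrow> nat \<Rightarrow> nat list set" where
  "action_tuples C q =
     {\<alpha>. length \<alpha> = cgs_agents C \<and> (\<forall>a \<in> {1..cgs_agents C}. \<alpha> ! (a - 1) < cgs_acts C q a)}"

definition wf_cgs :: "nat set \<Rightarrow> cgs \<Rightarrow> bool" where
  "wf_cgs Props C \<longleftrightarrow>
     cgs_init C \<subseteq> states C \<and>
     (\<forall>q \<in> states C.
        cgs_label C q \<subseteq> Props \<and>
        (\<forall>a \<in> {1..cgs_agents C}. 1 \<le> cgs_acts C q a) \<and>
        (\<forall>\<alpha> \<in> action_tuples C q. cgs_trans C q \<alpha> \<in> states C))"

definition histories :: "cgs \<Rightarrow> nat list set" where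
  "histories C = {h. h \<noteq> [] \<and> set h \<subseteq> states C}"

definition strategy :: "cgs \<Rightarrow> nat \<Rightarrow> (nat list \<Rightarrow> nat) \<Rightarrow> bool" where
  "strategy C a s \<longleftrightarrow> (\<forall>h \<in> histories C. s h < cgs_acts C (last h) a)"

definition strategy_profile :: "cgs \<Rightarrow> nat set \<Rightarrow> (nat \<Rightarrow> nat list \<Rightarrow> nat) \<Rightarrow> bool" where
  "strategy_profile C A S \<longleftrightarrow> (\<forall>a \<in> A. strategy C a (S a))"

text \<open>Paths are indexed from 0.\<close>

definition outcomes :: "cgs \<Rightarrow> nat set \<Rightarrow> nat \<Rightarrow> (nat \<Rightarrow> nat list \<Rightarrow> nat) \<Rightarrow> (nat \<Rightarrow> nat) set" where
  "outcomes C A q S =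
     {\<rho>. \<rho> 0 = q \<and>
         (\<forall>i. \<exists>\<alpha> \<in> action_tuples C (\<rho> i).
            (\<forall>a \<in> A. \<alpha> ! (a - 1) = S a (map \<rho> [0..<Suc i])) \<and>
            \<rho> (Suc i) = cgs_trans C (\<rho> i) \<alpha>)}"

text \<open>
  A turn-based structure is identified with its induced concurrent game structure, in which the
  actions of the owner of a state are numbers for its successors, through an arbitrary
  bijection \<open>e q\<close>.
\<close>

definition turn_based :: "cgs \<Rightarrow> bool" where
  "turn_based C \<longleftrightarrow>
     (\<exists>AgSt Succ e. \<forall>q \<in> states C.
        AgSt q \<in> {1..cgs_agents C} \<and> Succ q \<noteq> {} \<and> Succ q \<subseteq> states C \<and>
        bij_betw (e q) {..<cgs_acts C q (AgSt q)} (Succ q) \<and>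
        (\<forall>a \<in> {1..cgs_agents C} - {AgSt q}. cgs_acts C q a = 1) \<and>
        (\<forall>\<alpha> \<in> action_tuples C q. cgs_trans C q \<alpha> = e q (\<alpha> ! (AgSt q - 1))))"

definition proper_labelling :: "nat \<Rightarrow> nat \<Rightarrow> cgs \<Rightarrow> bool" where
  "proper_labelling p pbar C \<longleftrightarrow> (\<forall>q \<in> states C. cgs_label C q = {p} \<or> cgs_label C q = {pbar})"


section \<open>ATL formulas without binary temporal operators\<close>

datatype unop = OpNot | OpX | OpF | OpG

datatype logical_op = OpOr | OpAnd | OpImp | OpRevImp | OpIff

datatype binop = Plain logical_op | Negated logical_op

datatype sform =
    Prop nat
  | Neg sform
  | is_Bin: Bin binop sform sform
  | Strat "nat set" pform
and pform =
    Next sform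
  | Finally sform
  | Globally sform

fun logical_op_sem :: "logical_op \<Rightarrow> bool \<Rightarrow> bool \<Rightarrow> bool" where
  "logical_op_sem OpOr x y = (x \<or> y)"
| "logical_op_sem OpAnd x y = (x \<and> y)"
| "logical_op_sem OpImp x y = (x \<longrightarrow> y)"
| "logical_op_sem OpRevImp x y = (y \<longrightarrow> x)"
| "logical_op_sem OpIff x y = (x \<longleftrightarrow> y)"

fun binop_sem :: "binop \<Rightarrow> bool \<Rightarrow> bool \<Rightarrow> bool" where
  "binop_sem (Plain f) x y = logical_op_sem f x y"
| "binop_sem (Negated f) x y = (\<not> logical_op_sem f x y)"

primrec sat :: "cgs \<Rightarrow> sform \<Rightarrow> nat \<Rightarrow> bool"
  and path_sat :: "cgs \<Rightarrow> pform \<Rightarrow> (nat \<Rightarrow> nat) \<Rightarrow> bool"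
where
  "sat C (Prop r) q \<longleftrightarrow> r \<in> cgs_label C q"
| "sat C (Neg \<phi>) q \<longleftrightarrow> \<not> sat C \<phi> q"
| "sat C (Bin f \<phi> \<phi>') q \<longleftrightarrow> binop_sem f (sat C \<phi> q) (sat C \<phi>' q)"
| "sat C (Strat A \<psi>) q \<longleftrightarrow>
     (\<exists>S. strategy_profile C A S \<and> (\<forall>\<rho> \<in> outcomes C A q S. path_sat C \<psi> \<rho>))"
| "path_sat C (Next \<phi>) \<rho> \<longleftrightarrow> sat C \<phi> (\<rho> 1)"
| "path_sat C (Finally \<phi>) \<rho> \<longleftrightarrow> (\<exists>i. sat C \<phi> (\<rho> i))"
| "path_sat C (Globally \<phi>) \<rho> \<longleftrightarrow> (\<forall>i. sat C \<phi> (\<rho> i))"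

definition satisfies :: "cgs \<Rightarrow> sform \<Rightarrow> bool" where
  "satisfies C \<phi> \<longleftrightarrow> (\<forall>q \<in> cgs_init C. sat C \<phi> q)"

primrec in_fragment :: "nat \<Rightarrow> nat set \<Rightarrow> unop set \<Rightarrow> binop set \<Rightarrow> sform \<Rightarrow> bool"
  and in_path_fragment :: "nat \<Rightarrow> nat set \<Rightarrow> unop set \<Rightarrow> binop set \<Rightarrow> pform \<Rightarrow> bool"
where
  "in_fragment k Props Ut Bl (Prop r) \<longleftrightarrow> r \<in> Props"
| "in_fragment k Props Ut Bl (Neg \<phi>) \<longleftrightarrow> OpNot \<in> Ut \<and> in_fragment k Props Ut Bl \<phi>"
| "in_fragment k Props Ut Bl (Bin f \<phi> \<phi>') \<longleftrightarrow>
     f \<in> Bl \<and> in_fragment k Props Ut Bl \<phi> \<and> in_fragment k Props Ut Bl \<phi>'"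
| "in_fragment k Props Ut Bl (Strat A \<psi>) \<longleftrightarrow>
     A \<subseteq> {1..k} \<and> in_path_fragment k Props Ut Bl \<psi>"
| "in_path_fragment k Props Ut Bl (Next \<phi>) \<longleftrightarrow> OpX \<in> Ut \<and> in_fragment k Props Ut Bl \<phi>"
| "in_path_fragment k Props Ut Bl (Finally \<phi>) \<longleftrightarrow> OpF \<in> Ut \<and> in_fragment k Props Ut Bl \<phi>"
| "in_path_fragment k Props Ut Bl (Globally \<phi>) \<longleftrightarrow> OpG \<in> Ut \<and> in_fragment k Props Ut Bl \<phi>"

primrec subformulas :: "sform \<Rightarrow> sform set"
  and path_subformulas :: "pform \<Rightarrow> sform set"
where
  "subformulas (Prop r) = {Prop r}"
| "subformulas (Neg \<phi>) = insert (Neg \<phi>) (subformulas \<phi>)"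
| "subformulas (Bin f \<phi> \<phi>') = insert (Bin f \<phi> \<phi>') (subformulas \<phi> \<union> subformulas \<phi>')"
| "subformulas (Strat A \<psi>) = insert (Strat A \<psi>) (path_subformulas \<psi>)"
| "path_subformulas (Next \<phi>) = subformulas \<phi>"
| "path_subformulas (Finally \<phi>) = subformulas \<phi>"
| "path_subformulas (Globally \<phi>) = subformulas \<phi>"

definition formula_size :: "sform \<Rightarrow> nat" where
  "formula_size \<phi> = card (subformulas \<phi>)"

definition binary_size :: "sform \<Rightarrow> nat" where
  "binary_size \<phi> = card {\<chi> \<in> subformulas \<phi>. is_Bin \<chi>}"


section \<open>The learning problem\<close>

record learn_instance =
  li_props :: "nat set"
  li_pos :: "cgs list"
  li_neg :: "cgs list"
  li_bound :: nat

definition wf_learn_instance :: "nat \<Rightarrow> learn_instance \<Rightarrow> bool" where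
  "wf_learn_instance k I \<longleftrightarrow> finite (li_props I) \<and>
     (\<forall>C \<in> set (li_pos I) \<union> set (li_neg I). cgs_agents C = k \<and> wf_cgs (li_props I) C)"

definition learn_positive ::
  "nat \<Rightarrow> unop set \<Rightarrow> binop set \<Rightarrow> nat \<Rightarrow> learn_instance \<Rightarrow> bool"
where
  "learn_positive k Ut Bl n I \<longleftrightarrow>
     (\<exists>\<phi>. in_fragment k (li_props I) Ut Bl \<phi> \<and>
          formula_size \<phi> \<le> li_bound I \<and> binary_size \<phi> \<le> n \<and>
          (\<forall>C \<in> set (li_pos I). satisfies C \<phi>) \<and>
          (\<forall>C \<in> set (li_neg I). \<not> satisfies C \<phi>))"

text \<open>The transition function is tabulated over the action tuples in lexicographic order.\<close>

definition enc_cgs :: "cgs \<Rightarrow> bool list" where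
  "enc_cgs C =
     enc_nat (cgs_size C) @
     enc_list enc_nat (sorted_list_of_set (cgs_init C)) @
     enc_list
       (\<lambda>q. enc_list enc_nat (sorted_list_of_set (cgs_label C q)) @
            enc_list enc_nat (map (cgs_acts C q) [1..<Suc (cgs_agents C)]) @
            enc_list (\<lambda>\<alpha>. enc_nat (cgs_trans C q \<alpha>))
              (product_lists (map (\<lambda>a. [0..<cgs_acts C q a]) [1..<Suc (cgs_agents C)])))
       [0..<cgs_size C]"

definition enc_learn :: "learn_instance \<Rightarrow> bool list" where
  "enc_learn I =
     enc_list enc_nat (sorted_list_of_set (li_props I)) @
     enc_list enc_cgs (li_pos I) @
     enc_list enc_cgs (li_neg I) @
     enc_nat (li_bound I)"

definition ATL_Learn :: "nat \<Rightarrow> unop set \<Rightarrow> binop set \<Rightarrow> nat \<Rightarrow> bool list set" where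
  "ATL_Learn k Ut Bl n =
     {enc_learn I | I. wf_learn_instance k I \<and> learn_positive k Ut Bl n I}"

end

theory Submission
  imports Defs
begin

text \<open>
  Membership in NP: a certificate is a formula written as a straight-line program, and it is
  checked by computing the sets of states that satisfy its subformulas, with fixpoint iterations
  of the coalition predecessor.

  Hardness: by the Cook--Levin theorem every problem in NP reduces to the hitting set problem, and
  the instances produced by \<open>f\<close> are padded with \<open>N\<close> fresh propositions, where \<open>N = n\<close>, or \<open>N = 0\<close>
  if there are no binary operators. A binary operator \<open>g\<close> has a value \<open>c\<close> for its second argument
  at which it is the identity or the negation in the first one; in the structures of \<open>f h\<close> the
  fresh propositions get this value. One-state structures on which \<open>p\<close> and \<open>pbar\<close> agree
  force a separating formula to mention all fresh propositions and one of \<open>p\<close> and \<open>pbar\<close>. With at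
  most \<open>N\<close> binary operators it then has exactly \<open>N\<close> of them and is a tree, so each of them has an
  argument without \<open>p\<close> and \<open>pbar\<close>, which is constant on the structures of \<open>f h\<close>. Hence the binary
  operators act as identities and negations. Since turn-based games are determined, the negations
  can be pushed to the leaf, where they exchange \<open>p\<close> and \<open>pbar\<close>. What remains has neither
  negations nor binary operators, is smaller by at least \<open>2 N\<close>, and may use the duals \<open>F\<close>
  and \<open>G\<close>; this is why the hypothesis with \<open>F\<close> and \<open>G\<close> added is needed.

  Polynomial-time computability is obtained from a closure calculus for functions on tree-coded
  data, which are computed by structured programs over stacks that compile to Turing machines.
\<close>

section \<open>Programs over stacks\<close>


text \<open>The hypothesis supplies two fragments with the same answer, one without negation and one
  with duals added; the fragment with \<open>Bl\<close> and \<open>n\<close> is squeezed between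
  them. Binary operators add real power, so the padding has to use up the whole supply of them on
  propositions that say nothing about the structures of \<open>f h\<close>. Size counts distinct
  subformulas, so sharing could make a formula cheaper than its tree; the counting is therefore done
  on dags, and sharing is excluded only in the extremal case that the padding enforces. An instance
  grows by \<open>2 * N\<close> in its bound, for \<open>N\<close> operators and \<open>N\<close>
  leaves, and by \<open>2 ^ (N + 1)\<close> one-state structures, a constant as \<open>n\<close> is
  fixed. On one state all temporal and strategic operators act as the identity, and as
  \<open>p\<close> and \<open>pbar\<close> agree there, these structures constrain the Boolean
  skeleton but not the choice of the leaf. On the machine side, closure under composition, case
  distinction and size-bounded iteration is proved once and every later function is derived from it.
  Since arbitrary machines can be simulated in this calculus, the given logspace function becomes
  one more function to compose with.\<close>

datatype test = Top nat "bool option set" | Inp "input_symbol set"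

text \<open>A stack is the part of a work tape up to its head, so only its top can be tested.
  \<open>MoveIn\<close> and \<open>Emit\<close> occur only in the wrapper that loads the input and
  writes the result.\<close>

datatype com = Push nat bool | Pop nat | MoveIn direction | Emit bool
  | Seq com com | Cond test com com | While test com

type_synonym store = "nat \<Rightarrow> bool list"
type_synonym mstate = "nat \<times> bool list \<times> store"

definition top_of :: "bool list \<Rightarrow> bool option" where
  "top_of s = (case s of [] \<Rightarrow> None | b # _ \<Rightarrow> Some b)"

lemma top_of_simps [simp]: "top_of [] = None" "top_of (b # s) = Some b"
  by (simp_all add: top_of_def)

fun holds :: "bool list \<Rightarrow> test \<Rightarrow> mstate \<Rightarrow> bool" where
  "holds x (Top r S) (i, out, s) = (top_of (s r) \<in> S)"
| "holds x (Inp S) (i, out, s) = (read_input x i \<in> S)"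

text \<open>The surcharge of 2 pays for the two jumps of compiled conditionals and loops. It is an
  upper bound for the compiled code, since the branch for a false condition needs only one
  jump.\<close>

inductive exec :: "bool list \<Rightarrow> com \<Rightarrow> mstate \<Rightarrow> nat \<Rightarrow> mstate \<Rightarrow> bool" for x where
  Push: "exec x (Push r b) (i, out, s) 1 (i, out, s(r := b # s r))"
| Pop: "exec x (Pop r) (i, out, s) 1 (i, out, s(r := tl (s r)))"
| MoveIn: "exec x (MoveIn d) (i, out, s) 1 (min (move_head d i) (length x + 1), out, s)"
| Emit: "exec x (Emit b) (i, out, s) 1 (i, out @ [b], s)"
| Seq: "exec x c st t st' \<Longrightarrow> exec x d st' t' st'' \<Longrightarrow> exec x (Seq c d) st (t + t') st''"
| CondTrue: "holds x b st \<Longrightarrow> exec x c st t st' \<Longrightarrow> exec x (Cond b c d) st (t + 2) st'"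
| CondFalse: "\<not> holds x b st \<Longrightarrow> exec x d st t st' \<Longrightarrow> exec x (Cond b c d) st (t + 2) st'"
| WhileFalse: "\<not> holds x b st \<Longrightarrow> exec x (While b c) st 1 st"
| WhileTrue: "holds x b st \<Longrightarrow> exec x c st t st' \<Longrightarrow> exec x (While b c) st' t' st'' \<Longrightarrow>
    exec x (While b c) st (t + t' + 2) st''"

text \<open>One step pushes at most one bit. This converts time bounds into size bounds for results,
  without which composition would not preserve polynomial time.\<close>

lemma exec_stack_growth:
  assumes "exec x c st t st'"
  shows "length (snd (snd st') r) \<le> length (snd (snd st) r) + t"
  using assms by induction (auto split: if_splits)

section \<open>Compilation to code with absolute jumps\<close>

datatype instr = IPush nat bool | IPop nat | IMove direction | IEmit bool
  | IJz test nat | IJmp nat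

primrec csize :: "com \<Rightarrow> nat" where
  "csize (Push r b) = 1"
| "csize (Pop r) = 1"
| "csize (MoveIn d) = 1"
| "csize (Emit b) = 1"
| "csize (Seq c d) = csize c + csize d"
| "csize (Cond b c d) = csize c + csize d + 2"
| "csize (While b c) = csize c + 2"

primrec compile :: "com \<Rightarrow> nat \<Rightarrow> instr list" where
  "compile (Push r b) a = [IPush r b]"
| "compile (Pop r) a = [IPop r]"
| "compile (MoveIn d) a = [IMove d]"
| "compile (Emit b) a = [IEmit b]"
| "compile (Seq c d) a = compile c a @ compile d (a + csize c)"
| "compile (Cond b c d) a = IJz b (a + csize c + 2) #
     compile c (a + 1) @ IJmp (a + csize c + csize d + 2) # compile d (a + csize c + 2)"
| "compile (While b c) a = IJz b (a + csize c + 2) # compile c (a + 1) @ [IJmp a]"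

lemma length_compile [simp]: "length (compile c a) = csize c"
  by (induction c arbitrary: a) auto

fun flat_step :: "bool list \<Rightarrow> instr \<Rightarrow> nat \<times> mstate \<Rightarrow> nat \<times> mstate" where
  "flat_step x (IPush r b) (pc, i, out, s) = (Suc pc, i, out, s(r := b # s r))"
| "flat_step x (IPop r) (pc, i, out, s) = (Suc pc, i, out, s(r := tl (s r)))"
| "flat_step x (IMove d) (pc, i, out, s) = (Suc pc, min (move_head d i) (length x + 1), out, s)"
| "flat_step x (IEmit b) (pc, i, out, s) = (Suc pc, i, out @ [b], s)"
| "flat_step x (IJz b n) (pc, st) = (if holds x b st then Suc pc else n, st)"
| "flat_step x (IJmp n) (pc, st) = (n, st)"

definition flat_run :: "bool list \<Rightarrow> instr list \<Rightarrow> nat \<times> mstate \<Rightarrow> nat \<times> mstate" where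
  "flat_run x P c = (if fst c < length P then flat_step x (P ! fst c) c else c)"

primrec code_at :: "instr list \<Rightarrow> nat \<Rightarrow> instr list \<Rightarrow> bool" where
  "code_at P a [] \<longleftrightarrow> True"
| "code_at P a (i # is) \<longleftrightarrow> a < length P \<and> P ! a = i \<and> code_at P (Suc a) is"

lemma code_at_append [simp]:
  "code_at P a (xs @ ys) \<longleftrightarrow> code_at P a xs \<and> code_at P (a + length xs) ys"
  by (induction xs arbitrary: a) auto

lemma code_at_self: "code_at (pre @ P) (length pre) P"
proof (induction P arbitrary: pre)
  case (Cons i P)
  from Cons[of "pre @ [i]"] show ?case by (simp add: nth_append)
qed simp

lemma funpow_trans: "(f ^^ m) a = b \<Longrightarrow> (f ^^ n) b = c \<Longrightarrow> (f ^^ (m + n)) a = c"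
  by (subst add.commute) (simp add: funpow_add)

lemma compile_correct:
  assumes "exec x c st t st'" "code_at P a (compile c a)"
  shows "\<exists>n \<le> t. (flat_run x P ^^ n) (a, st) = (a + csize c, st')"
  using assms
proof (induction arbitrary: a)
  case (Push r b i out s)
  then show ?case by (intro exI[of _ 1]) (simp add: flat_run_def)
next
  case (Pop r i out s)
  then show ?case by (intro exI[of _ 1]) (simp add: flat_run_def)
next
  case (MoveIn d i out s)
  then show ?case by (intro exI[of _ 1]) (simp add: flat_run_def)
next
  case (Emit b i out s)
  then show ?case by (intro exI[of _ 1]) (simp add: flat_run_def)
next
  case (Seq c st t st' d t' st'')
  from Seq.prems have "code_at P a (compile c a)" "code_at P (a + csize c) (compile d (a + csize c))"
    by auto
  from Seq.IH(1)[OF this(1)] Seq.IH(2)[OF this(2)] obtain n n' where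
    "n \<le> t" "(flat_run x P ^^ n) (a, st) = (a + csize c, st')"
    "n' \<le> t'" "(flat_run x P ^^ n') (a + csize c, st') = (a + csize c + csize d, st'')" by blast
  then show ?case
    using funpow_trans[of n "flat_run x P" "(a, st)" _ n'] by (intro exI[of _ "n + n'"]) (auto simp: add.assoc)
next
  case (CondTrue b st c t st' d)
  from CondTrue.prems have *: "code_at P (a + 1) (compile c (a + 1))"
     "P ! a = IJz b (a + csize c + 2)" "a < length P"
     "P ! (a + csize c + 1) = IJmp (a + csize c + csize d + 2)" "a + csize c + 1 < length P"
    by auto
  from CondTrue.IH[OF *(1)] obtain n where n: "n \<le> t"
    "(flat_run x P ^^ n) (a + 1, st) = (a + 1 + csize c, st')" by blast
  have 1: "(flat_run x P ^^ 1) (a, st) = (a + 1, st)" using * CondTrue.hyps by (simp add: flat_run_def)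
  have 3: "(flat_run x P ^^ 1) (a + 1 + csize c, st') = (a + csize c + csize d + 2, st')"
    using * by (simp add: flat_run_def add.commute add.left_commute)
  from funpow_trans[OF 1 funpow_trans[OF n(2) 3]] show ?case
    using n(1) by (intro exI[of _ "1 + (n + 1)"]) auto
next
  case (CondFalse b st d t st' c)
  from CondFalse.prems have *: "code_at P (a + csize c + 2) (compile d (a + csize c + 2))"
     "P ! a = IJz b (a + csize c + 2)" "a < length P"
    by auto
  from CondFalse.IH[OF *(1)] obtain n where n: "n \<le> t"
    "(flat_run x P ^^ n) (a + csize c + 2, st) = (a + csize c + 2 + csize d, st')" by blast
  have 1: "(flat_run x P ^^ 1) (a, st) = (a + csize c + 2, st)"
    using * CondFalse.hyps by (simp add: flat_run_def)
  from funpow_trans[OF 1 n(2)] show ?case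
    using n(1) by (intro exI[of _ "1 + n"]) (auto simp: algebra_simps)
next
  case (WhileFalse b st c)
  then show ?case by (intro exI[of _ 1]) (simp add: flat_run_def)
next
  case (WhileTrue b st c t st' t' st'')
  from WhileTrue.prems have *: "code_at P (a + 1) (compile c (a + 1))"
     "P ! a = IJz b (a + csize c + 2)" "a < length P"
     "P ! (a + csize c + 1) = IJmp a" "a + csize c + 1 < length P"
    by auto
  from WhileTrue.IH(1)[OF *(1)] obtain n where n: "n \<le> t"
    "(flat_run x P ^^ n) (a + 1, st) = (a + 1 + csize c, st')" by blast
  from WhileTrue.IH(2)[OF WhileTrue.prems] obtain n' where n': "n' \<le> t'"
    "(flat_run x P ^^ n') (a, st') = (a + csize (While b c), st'')" by blast
  have 1: "(flat_run x P ^^ 1) (a, st) = (a + 1, st)" using * WhileTrue.hyps by (simp add: flat_run_def)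
  have 3: "(flat_run x P ^^ 1) (a + 1 + csize c, st') = (a, st')"
    using * by (simp add: flat_run_def add.commute add.left_commute)
  from funpow_trans[OF 1 funpow_trans[OF n(2) funpow_trans[OF 3 n'(2)]]] show ?case
    using n(1) n'(1) by (intro exI[of _ "1 + (n + (1 + n'))"]) auto
qed

section \<open>Turing machines with one work tape per stack\<close>

definition bit_code :: "bool \<Rightarrow> nat" where
  "bit_code b = (if b then 2 else 1)"

text \<open>Bits are coded as 1 and 2 because 0, the blank, has to mark the bottom of the
  stack.\<close>

definition symbol_top :: "nat \<Rightarrow> bool option" where
  "symbol_top w = (if w = 0 then None else Some (w = 2))"

fun test_symbols :: "test \<Rightarrow> input_symbol \<Rightarrow> nat list \<Rightarrow> bool" where
  "test_symbols (Top r S) a ws = (symbol_top (ws ! r) \<in> S)"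
| "test_symbols (Inp S) a ws = (a \<in> S)"

definition keep_tapes :: "nat list \<Rightarrow> (nat \<times> direction) list" where
  "keep_tapes ws = map (\<lambda>w. (w, Stay)) ws"

text \<open>State \<open>2 * pc\<close> starts an instruction. A machine writes before it moves, so
  a push takes two steps, first the move to the right and then the write; state
  \<open>2 * pc + 1\<close> stands between them.\<close>

definition stack_delta :: "instr list \<Rightarrow> nat \<Rightarrow> input_symbol \<Rightarrow> nat list \<Rightarrow>
    (nat \<times> direction \<times> (nat \<times> direction) list \<times> bool option) option" where
  "stack_delta P q a ws = (let pc = q div 2; next = 2 * Suc pc in
     if length P \<le> pc then None else
     case P ! pc of
       IPush r b \<Rightarrow>
         if even q then Some (q + 1, Stay, (keep_tapes ws)[r := (ws ! r, MoveRight)], None)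
         else Some (next, Stay, (keep_tapes ws)[r := (bit_code b, Stay)], None)
     | IPop r \<Rightarrow> Some (next, Stay, (keep_tapes ws)[r := (ws ! r, MoveLeft)], None)
     | IMove d \<Rightarrow> Some (next, d, keep_tapes ws, None)
     | IEmit b \<Rightarrow> Some (next, Stay, keep_tapes ws, Some b)
     | IJz t n \<Rightarrow> Some (if test_symbols t a ws then next else 2 * n, Stay, keep_tapes ws, None)
     | IJmp n \<Rightarrow> Some (2 * n, Stay, keep_tapes ws, None))"

fun jump_target :: "instr \<Rightarrow> nat" where
  "jump_target (IJz t n) = n"
| "jump_target (IJmp n) = n"
| "jump_target _ = 0"

text \<open>The sum of all jump targets is a crude bound for each of them; it makes the machine
  well-formed for every code, whether or not its jumps stay inside.\<close>

definition stack_tm :: "instr list \<Rightarrow> nat \<Rightarrow> tm" where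
  "stack_tm P m = \<lparr>tm_tapes = m, tm_states = 2 * Suc (length P + sum_list (map jump_target P)),
     tm_symbols = 3, tm_delta = stack_delta P\<rparr>"

lemma jump_target_le: "pc < length P \<Longrightarrow> jump_target (P ! pc) \<le> sum_list (map jump_target P)"
  by (simp add: member_le_sum_list)

lemma set_keep_tapes_update:
  assumes "set ws \<subseteq> A" "r < length ws \<Longrightarrow> w \<in> A"
  shows "fst ` set ((keep_tapes ws)[r := (w, d)]) \<subseteq> A"
proof (cases "r < length ws")
  case True
  have "set ((keep_tapes ws)[r := (w, d)]) \<subseteq> insert (w, d) (set (keep_tapes ws))"
    by (rule set_update_subset_insert)
  also have "fst ` \<dots> \<subseteq> A" using True assms by (auto simp: keep_tapes_def)
  finally show ?thesis by blast
next
  case False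
  then have "(keep_tapes ws)[r := (w, d)] = keep_tapes ws" by (simp add: keep_tapes_def list_update_beyond)
  with assms show ?thesis by (auto simp: keep_tapes_def)
qed

lemma set_keep_tapes_update_nth:
  assumes "set ws \<subseteq> A"
  shows "fst ` set ((keep_tapes ws)[r := (ws ! r, d)]) \<subseteq> A"
  by (rule set_keep_tapes_update[OF assms]) (use assms nth_mem in blast)

lemma wf_stack_tm: "wf_tm (stack_tm P m)"
  unfolding wf_tm_def
proof (intro conjI allI impI)
  show "0 < tm_states (stack_tm P m)" "0 < tm_symbols (stack_tm P m)" by (simp_all add: stack_tm_def)
next
  fix q a ws q' d acts b
  assume q: "q < tm_states (stack_tm P m)" and l: "length ws = tm_tapes (stack_tm P m)"
    and ws: "set ws \<subseteq> {..<tm_symbols (stack_tm P m)}"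
    and e: "tm_delta (stack_tm P m) q a ws = Some (q', d, acts, b)"
  from e have pc: "q div 2 < length P" by (auto simp: stack_tm_def stack_delta_def Let_def split: if_splits)
  note jump_target_le[OF pc]
  with e pc show "q' < tm_states (stack_tm P m)"
    by (auto simp: stack_tm_def stack_delta_def Let_def split: if_splits instr.splits)
  from e pc l show "length acts = tm_tapes (stack_tm P m)"
    by (auto simp: stack_tm_def stack_delta_def keep_tapes_def Let_def split: if_splits instr.splits)
  from ws have ws: "set ws \<subseteq> {..<3}" by (simp add: stack_tm_def)
  have bc: "bit_code b \<in> {..<3}" for b by (simp add: bit_code_def)
  have keep: "fst ` set (keep_tapes ws) \<subseteq> {..<3}" using ws by (auto simp: keep_tapes_def)
  have "fst ` set acts \<subseteq> {..<3}"
  proof (cases "P ! (q div 2)")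
    case (IPush r b)
    with e pc have "acts = (keep_tapes ws)[r := (ws ! r, MoveRight)] \<or>
        acts = (keep_tapes ws)[r := (bit_code b, Stay)]"
      by (auto simp: stack_tm_def stack_delta_def Let_def split: if_splits)
    with set_keep_tapes_update[OF ws bc] set_keep_tapes_update_nth[OF ws] show ?thesis by metis
  next
    case (IPop r)
    with e pc set_keep_tapes_update_nth[OF ws] show ?thesis
      by (auto simp: stack_tm_def stack_delta_def Let_def)
  qed (use e pc keep in \<open>auto simp: stack_tm_def stack_delta_def Let_def\<close>)
  then show "fst ` set acts \<subseteq> {..<tm_symbols (stack_tm P m)}" by (simp add: stack_tm_def)
qed

text \<open>The blank in cell 0 marks the bottom, the stack grows to the right, and the head will
  stand on its top. Cells beyond the head are left free, because a pop moves the head without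
  erasing.\<close>

definition tape_rep :: "(nat \<Rightarrow> nat) \<Rightarrow> bool list \<Rightarrow> bool" where
  "tape_rep t s \<longleftrightarrow> t 0 = 0 \<and> (\<forall>j < length s. t (Suc j) = bit_code (rev s ! j))"

lemma tape_rep_head: "tape_rep t s \<Longrightarrow> symbol_top (t (length s)) = top_of s"
  by (cases s) (auto simp: tape_rep_def symbol_top_def bit_code_def nth_append)

lemma tape_rep_push: "tape_rep t s \<Longrightarrow> tape_rep (t(Suc (length s) := bit_code b)) (b # s)"
  by (auto simp: tape_rep_def nth_append less_Suc_eq)

lemma tape_rep_pop: "tape_rep t s \<Longrightarrow> tape_rep t (tl s)"
  by (cases s) (auto simp: tape_rep_def nth_append less_Suc_eq)

fun rep :: "bool list \<Rightarrow> nat \<Rightarrow> config \<Rightarrow> nat \<times> mstate \<Rightarrow> bool" where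
  "rep x m c (pc, i, out, s) \<longleftrightarrow> i \<le> length x + 1 \<and> c_state c = 2 * pc \<and> c_inhead c = i \<and> c_output c = out \<and>
     length (c_tapes c) = m \<and> length (c_heads c) = m \<and>
     (\<forall>r < m. c_heads c ! r = length (s r) \<and> tape_rep (c_tapes c ! r) (s r))"

fun test_regs :: "nat \<Rightarrow> test \<Rightarrow> bool" where
  "test_regs m (Top r S) \<longleftrightarrow> r < m"
| "test_regs m (Inp S) \<longleftrightarrow> True"

fun instr_regs :: "nat \<Rightarrow> instr \<Rightarrow> bool" where
  "instr_regs m (IPush r b) \<longleftrightarrow> r < m"
| "instr_regs m (IPop r) \<longleftrightarrow> r < m"
| "instr_regs m (IJz t n) \<longleftrightarrow> test_regs m t"
| "instr_regs m _ \<longleftrightarrow> True"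

primrec com_regs :: "nat \<Rightarrow> com \<Rightarrow> bool" where
  "com_regs m (Push r b) \<longleftrightarrow> r < m"
| "com_regs m (Pop r) \<longleftrightarrow> r < m"
| "com_regs m (MoveIn d) \<longleftrightarrow> True"
| "com_regs m (Emit b) \<longleftrightarrow> True"
| "com_regs m (Seq c d) \<longleftrightarrow> com_regs m c \<and> com_regs m d"
| "com_regs m (Cond b c d) \<longleftrightarrow> test_regs m b \<and> com_regs m c \<and> com_regs m d"
| "com_regs m (While b c) \<longleftrightarrow> test_regs m b \<and> com_regs m c"

lemma compile_regs: "com_regs m c \<Longrightarrow> i \<in> set (compile c a) \<Longrightarrow> instr_regs m i"
  by (induction c arbitrary: a) auto

lemma test_regs_mono: "test_regs m t \<Longrightarrow> m \<le> m' \<Longrightarrow> test_regs m' t"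
  by (cases t) auto

lemma com_regs_mono: "com_regs m c \<Longrightarrow> m \<le> m' \<Longrightarrow> com_regs m' c"
  by (induction c) (auto intro: test_regs_mono)

lemma step_Some:
  assumes "next_action M x c = Some (q, d, acts, b)"
    and "length (c_tapes c) = m" "length (c_heads c) = m" "length acts = m"
  shows "c_state (step M x c) = q" "c_inhead (step M x c) = min (move_head d (c_inhead c)) (length x + 1)"
    "c_output (step M x c) = c_output c @ (case b of None \<Rightarrow> [] | Some v \<Rightarrow> [v])"
    "length (c_tapes (step M x c)) = m" "length (c_heads (step M x c)) = m"
    "r < m \<Longrightarrow> c_tapes (step M x c) ! r = (c_tapes c ! r)(c_heads c ! r := fst (acts ! r))"
    "r < m \<Longrightarrow> c_heads (step M x c) ! r = move_head (snd (acts ! r)) (c_heads c ! r)"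
  using assms by (auto simp: step_def split: prod.splits)

definition tape_reads :: "config \<Rightarrow> nat list" where
  "tape_reads c = map2 (\<lambda>t h. t h) (c_tapes c) (c_heads c)"

lemma next_action_reads:
  "next_action M x c = tm_delta M (c_state c) (read_input x (c_inhead c)) (tape_reads c)"
  by (simp add: next_action_def tape_reads_def)

lemma tape_reads_nth: "r < length (c_tapes c) \<Longrightarrow> r < length (c_heads c) \<Longrightarrow>
   tape_reads c ! r = (c_tapes c ! r) (c_heads c ! r)"
  by (simp add: tape_reads_def)

lemma test_symbols_rep:
  assumes "rep x m c (pc, st)" "test_regs m t"
  shows "test_symbols t (read_input x (c_inhead c)) (tape_reads c) \<longleftrightarrow> holds x t st"
  using assms by (cases st; cases t) (auto simp: tape_reads_nth tape_rep_head)

lemma rep_step: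
  assumes rep: "rep x m c (pc, st)" and pc: "pc < length P" and regs: "instr_regs m (P ! pc)"
  defines "M \<equiv> stack_tm P m"
  shows "\<exists>n \<le> 2. rep x m ((step M x ^^ n) c) (flat_step x (P ! pc) (pc, st))"
proof -
  obtain i out s where st: "st = (i, out, s)" by (cases st)
  define ws where "ws = tape_reads c"
  from rep st have il: "i \<le> length x + 1" and c: "c_state c = 2 * pc" "c_inhead c = i" "c_output c = out"
     "length (c_tapes c) = m" "length (c_heads c) = m"
     "\<And>r. r < m \<Longrightarrow> c_heads c ! r = length (s r)" "\<And>r. r < m \<Longrightarrow> tape_rep (c_tapes c ! r) (s r)"
    by auto
  have lw: "length ws = m" using c by (simp add: ws_def tape_reads_def)
  have wn: "ws ! r = (c_tapes c ! r) (c_heads c ! r)" if "r < m" for r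
    using that c by (simp add: ws_def tape_reads_nth)
  have na: "next_action M x c = stack_delta P (2 * pc) (read_input x i) ws"
    by (simp add: next_action_reads ws_def M_def stack_tm_def c)
  have kn: "keep_tapes ws ! r = (ws ! r, Stay)" if "r < m" for r using that lw by (simp add: keep_tapes_def)
  have lk: "length (keep_tapes ws) = m" using lw by (simp add: keep_tapes_def)
  show ?thesis
  proof (cases "P ! pc")
    case (IPush r b)
    with regs have r: "r < m" by simp
    from IPush pc na have 1: "next_action M x c =
       Some (2 * pc + 1, Stay, (keep_tapes ws)[r := (ws ! r, MoveRight)], None)"
      by (simp add: stack_delta_def)
    define c1 where "c1 = step M x c"
    note s1 = step_Some[OF 1 c(4,5), folded c1_def, simplified, OF lk]
    have h1: "c_heads c1 ! r' = (if r' = r then Suc (length (s r)) else length (s r'))" if "r' < m" for r'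
      using s1(7)[OF that] that c(6) lk kn by (auto simp: nth_list_update)
    have t1: "c_tapes c1 ! r' = c_tapes c ! r'" if "r' < m" for r'
      using s1(6)[OF that] that lk kn[OF that] kn[OF r] wn[OF that]
      by (cases "r' = r") simp_all
    define ws1 where "ws1 = tape_reads c1"
    have lw1: "length (keep_tapes ws1) = m" using s1 by (simp add: ws1_def tape_reads_def keep_tapes_def)
    have kn1: "keep_tapes ws1 ! r = (ws1 ! r, Stay)" if "r < m" for r
      using that lw1 by (simp add: keep_tapes_def)
    have wn1: "ws1 ! r = (c_tapes c1 ! r) (c_heads c1 ! r)" if "r < m" for r
      using that s1 by (simp add: ws1_def tape_reads_nth)
    from IPush pc have 2: "next_action M x c1 =
       Some (2 * Suc pc, Stay, (keep_tapes ws1)[r := (bit_code b, Stay)], None)"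
      by (simp add: stack_delta_def next_action_reads s1 M_def stack_tm_def ws1_def)
    note s2 = step_Some[OF 2 s1(4,5), simplified, OF lw1]
    have "rep x m (step M x c1) (Suc pc, i, out, s(r := b # s r))"
    proof -
      have "c_heads (step M x c1) ! r' = length ((s(r := b # s r)) r')" if "r' < m" for r'
        using s2(7)[OF that] that h1 lw1 kn1 by (auto simp: nth_list_update)
      moreover have "tape_rep (c_tapes (step M x c1) ! r') ((s(r := b # s r)) r')" if "r' < m" for r'
        using s2(6)[OF that] that h1 t1 lw1 kn1 wn1 c(7) tape_rep_push[of "c_tapes c ! r" "s r" b]
        by (auto simp: nth_list_update)
      ultimately show ?thesis using s2 s1 c il by simp
    qed
    then show ?thesis using IPush st by (intro exI[of _ 2]) (simp add: c1_def numeral_2_eq_2)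
  next
    \<comment> \<open>On an empty stack nothing happens on either side: \<open>tl [] = []\<close>,
      and the head cannot leave cell 0.\<close>
    case (IPop r)
    with regs have r: "r < m" by simp
    from IPop pc na have 1: "next_action M x c =
       Some (2 * Suc pc, Stay, (keep_tapes ws)[r := (ws ! r, MoveLeft)], None)"
      by (simp add: stack_delta_def)
    note s1 = step_Some[OF 1 c(4,5), simplified, OF lk]
    have "c_heads (step M x c) ! r' = length ((s(r := tl (s r))) r')" if "r' < m" for r'
      using s1(7)[OF that] that c(6) lk kn by (auto simp: nth_list_update)
    moreover have "tape_rep (c_tapes (step M x c) ! r') ((s(r := tl (s r))) r')" if "r' < m" for r'
      using s1(6)[OF that] that lk kn wn c(7) tape_rep_pop by (auto simp: nth_list_update)
    ultimately have "rep x m (step M x c) (Suc pc, i, out, s(r := tl (s r)))"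
      using s1 c il by simp
    then show ?thesis using IPop st by (intro exI[of _ 1]) simp
  next
    case (IMove d)
    with pc na have 1: "next_action M x c = Some (2 * Suc pc, d, keep_tapes ws, None)"
      by (simp add: stack_delta_def)
    from step_Some[OF 1 c(4,5) lk] c il kn wn IMove st show ?thesis by (intro exI[of _ 1]) simp
  next
    case (IEmit b)
    with pc na have 1: "next_action M x c = Some (2 * Suc pc, Stay, keep_tapes ws, Some b)"
      by (simp add: stack_delta_def)
    from step_Some[OF 1 c(4,5) lk] c il kn wn IEmit st show ?thesis by (intro exI[of _ 1]) simp
  next
    case (IJz t n)
    with regs have "test_regs m t" by simp
    with rep have "test_symbols t (read_input x i) ws \<longleftrightarrow> holds x t st"
      using test_symbols_rep c ws_def by metis
    with IJz pc na have 1: "next_action M x c =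
        Some (2 * (if holds x t st then Suc pc else n), Stay, keep_tapes ws, None)"
      by (simp add: stack_delta_def)
    from step_Some[OF 1 c(4,5) lk] c il kn wn IJz st show ?thesis by (intro exI[of _ 1]) simp
  next
    case (IJmp n)
    with pc na have 1: "next_action M x c = Some (2 * n, Stay, keep_tapes ws, None)"
      by (simp add: stack_delta_def)
    from step_Some[OF 1 c(4,5) lk] c il kn wn IJmp st show ?thesis by (intro exI[of _ 1]) simp
  qed
qed

lemma flat_run_regs: "\<forall>i \<in> set P. instr_regs m i \<Longrightarrow> rep x m c (pc, st) \<Longrightarrow>
  \<exists>t \<le> 2 * n. rep x m ((step (stack_tm P m) x ^^ t) c) ((flat_run x P ^^ n) (pc, st))"
proof (induction n arbitrary: c pc st)
  case 0
  then show ?case by (intro exI[of _ 0]) simp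
next
  case (Suc n)
  show ?case
  proof (cases "pc < length P")
    case True
    with Suc.prems rep_step[OF Suc.prems(2) True] obtain t where t: "t \<le> 2"
      "rep x m ((step (stack_tm P m) x ^^ t) c) (flat_step x (P ! pc) (pc, st))" by auto
    obtain pc' st' where e: "flat_step x (P ! pc) (pc, st) = (pc', st')" by (cases "flat_step x (P ! pc) (pc, st)")
    from Suc.IH[OF Suc.prems(1) t(2)[unfolded e]] obtain t' where t': "t' \<le> 2 * n"
      "rep x m ((step (stack_tm P m) x ^^ t') ((step (stack_tm P m) x ^^ t) c)) ((flat_run x P ^^ n) (pc', st'))"
      by blast
    have "(flat_run x P ^^ Suc n) (pc, st) = (flat_run x P ^^ n) (pc', st')"
      using True e by (simp add: funpow_Suc_right flat_run_def del: funpow.simps)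
    with t t' show ?thesis
      by (intro exI[of _ "t' + t"]) (simp add: funpow_add)
  next
    case False
    then have "flat_run x P (pc, st) = (pc, st)" by (simp add: flat_run_def)
    then have "(flat_run x P ^^ Suc n) (pc, st) = (flat_run x P ^^ n) (pc, st)"
      by (simp add: funpow_Suc_right del: funpow.simps)
    moreover from Suc.IH[OF Suc.prems] obtain t where "t \<le> 2 * n"
      "rep x m ((step (stack_tm P m) x ^^ t) c) ((flat_run x P ^^ n) (pc, st))" by blast
    ultimately show ?thesis by (intro exI[of _ t]) simp
  qed
qed

theorem exec_polytime_computable:
  assumes regs: "com_regs m c"
    and ex: "\<And>x. \<exists>t i s. exec x c (0, [], \<lambda>_. []) t (i, g x, s) \<and> t \<le> poly q (length x)"
  shows "polytime_computable g"
proof -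
  let ?P = "compile c 0"
  let ?M = "stack_tm ?P m"
  \<comment> \<open>The factor 2 comes from pushes, which cost two machine steps.\<close>
  have "\<exists>t \<le> poly (smult 2 q) (length x). halts_with ?M x t (g x)" for x
  proof -
  from ex obtain t i s where e: "exec x c (0, [], \<lambda>_. []) t (i, g x, s)" and t: "t \<le> poly q (length x)"
    by blast
  have "code_at ?P 0 (compile c 0)" using code_at_self[of "[]"] by simp
  from compile_correct[OF e this] obtain n where n: "n \<le> t"
    "(flat_run x ?P ^^ n) (0, 0, [], \<lambda>_. []) = (csize c, i, g x, s)" by auto
  have "rep x m (init_config ?M) (0, 0, [], \<lambda>_. [])"
    by (simp add: init_config_def stack_tm_def tape_rep_def)
  from flat_run_regs[OF _ this, of ?P n] regs n(2) obtain t' where t': "t' \<le> 2 * n"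
    "rep x m ((step ?M x ^^ t') (init_config ?M)) (csize c, i, g x, s)"
    using compile_regs by metis
  \<comment> \<open>The counter has reached \<open>csize c\<close>, the length of the code, where
    \<open>stack_delta\<close> yields \<open>None\<close>.\<close>
  then have "halts_with ?M x t' (g x)"
    by (simp add: halts_with_def run_def next_action_reads stack_delta_def stack_tm_def)
  moreover have "t' \<le> poly (smult 2 q) (length x)" using t' n t by simp
  ultimately show ?thesis by blast
  qed
  with wf_stack_tm[of ?P m] show ?thesis unfolding polytime_computable_def by blast
qed

text \<open>The step count \<open>t\<close> is chosen before the input, the head position and the
  output, so a program with this property neither depends on them nor changes them; only its stacks
  matter.\<close>

definition rb :: "com \<Rightarrow> store \<Rightarrow> nat \<Rightarrow> store \<Rightarrow> bool" where
  "rb c s T s' \<longleftrightarrow> (\<exists>t \<le> T. \<forall>x i out. exec x c (i, out, s) t (i, out, s'))"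

lemma rb_push: "rb (Push r b) s 1 (s(r := b # s r))"
  unfolding rb_def by (blast intro: exec.Push)

lemma rb_pop: "rb (Pop r) s 1 (s(r := tl (s r)))"
  unfolding rb_def by (blast intro: exec.Pop)

lemma rb_seq: "rb c s T s' \<Longrightarrow> rb d s' T' s'' \<Longrightarrow> rb (Seq c d) s (T + T') s''"
  unfolding rb_def by (metis add_mono exec.Seq)

lemma rb_cond_true: "top_of (s r) \<in> S \<Longrightarrow> rb c s T s' \<Longrightarrow> rb (Cond (Top r S) c d) s (T + 2) s'"
  unfolding rb_def by (metis add_mono le_refl exec.CondTrue holds.simps(1))

lemma rb_cond_false: "top_of (s r) \<notin> S \<Longrightarrow> rb d s T s' \<Longrightarrow> rb (Cond (Top r S) c d) s (T + 2) s'"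
  unfolding rb_def by (metis add_mono le_refl exec.CondFalse holds.simps(1))

lemma rb_while_end: "top_of (s r) \<notin> S \<Longrightarrow> rb (While (Top r S) c) s 1 s"
  unfolding rb_def by (metis le_refl exec.WhileFalse holds.simps(1))

lemma rb_while_step: "top_of (s r) \<in> S \<Longrightarrow> rb c s T s' \<Longrightarrow> rb (While (Top r S) c) s' T' s'' \<Longrightarrow>
    rb (While (Top r S) c) s (T + T' + 2) s''"
proof -
  assume b: "top_of (s r) \<in> S" and "rb c s T s'" "rb (While (Top r S) c) s' T' s''"
  then obtain t t' where t: "t \<le> T" "t' \<le> T'" and e: "\<And>x i out. exec x c (i, out, s) t (i, out, s')"
    "\<And>x i out. exec x (While (Top r S) c) (i, out, s') t' (i, out, s'')" unfolding rb_def by blast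
  have "exec x (While (Top r S) c) (i, out, s) (t + t' + 2) (i, out, s'')" for x i out
    by (rule exec.WhileTrue[OF _ e]) (use b in simp)
  with t show ?thesis unfolding rb_def by (intro exI[of _ "t + t' + 2"]) auto
qed

lemma rb_conv: "rb c s T s' \<Longrightarrow> T \<le> T' \<Longrightarrow> s' = s'' \<Longrightarrow> rb c s T' s''"
  unfolding rb_def by (meson le_trans)

lemma rb_size: "rb c s T s' \<Longrightarrow> length (s' r) \<le> length (s r) + T"
proof -
  assume "rb c s T s'"
  then obtain t where "t \<le> T" "exec [] c (0, [], s) t (0, [], s')" unfolding rb_def by blast
  with exec_stack_growth[OF this(2), of r] show ?thesis by simp
qed

section \<open>Macros for moving, copying and clearing stacks\<close>

definition nop :: com where
  "nop = Seq (Push 0 True) (Pop 0)"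

lemma rb_nop: "rb nop s 2 s"
  unfolding nop_def using rb_seq[OF rb_push rb_pop] by (rule rb_conv) (auto simp: fun_eq_iff)

definition clear :: "nat \<Rightarrow> com" where
  "clear r = While (Top r {Some True, Some False}) (Pop r)"

lemma rb_clear: "rb (clear r) s (3 * length (s r) + 1) (s(r := []))"
proof (induction "s r" arbitrary: s)
  case Nil
  note n = Nil(1)[symmetric]
  have "rb (clear r) s 1 s" unfolding clear_def by (rule rb_while_end) (simp add: n)
  then show ?case by (rule rb_conv) (simp_all add: fun_eq_iff n)
next
  case (Cons b l)
  from Cons(1)[of "s(r := tl (s r))"] Cons(2)[symmetric]
  have "rb (clear r) (s(r := tl (s r))) (3 * length l + 1) (s(r := []))" by simp
  then have "rb (clear r) s (1 + (3 * length l + 1) + 2) (s(r := []))"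
    unfolding clear_def using Cons(2)[symmetric] by (intro rb_while_step[OF _ rb_pop]) auto
  then show ?case by (rule rb_conv) (simp_all flip: Cons(2))
qed

definition mv :: "nat \<Rightarrow> nat \<Rightarrow> com" where
  "mv a b = While (Top a {Some True, Some False}) (Cond (Top a {Some True})
     (Seq (Pop a) (Push b True)) (Seq (Pop a) (Push b False)))"

lemma rb_mv: "a \<noteq> b \<Longrightarrow> rb (mv a b) s (6 * length (s a) + 1) (s(a := [], b := rev (s a) @ s b))"
proof (induction "s a" arbitrary: s)
  case Nil
  note n = Nil(1)[symmetric]
  have "rb (mv a b) s 1 s" unfolding mv_def by (rule rb_while_end) (simp add: n)
  then show ?case by (rule rb_conv) (simp_all add: fun_eq_iff n)
next
  case (Cons v l)
  let ?s = "s(a := l, b := v # s b)"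
  have body: "rb (Cond (Top a {Some True}) (Seq (Pop a) (Push b True)) (Seq (Pop a) (Push b False))) s 4 ?s"
  proof (cases v)
    case True
    have e: "rb (Seq (Pop a) (Push b True)) s (1 + 1) ?s"
      by (rule rb_conv[OF rb_seq[OF rb_pop rb_push]]) (use True Cons(2)[symmetric] \<open>a \<noteq> b\<close> in \<open>auto simp: fun_eq_iff\<close>)
    show ?thesis by (rule rb_conv[OF rb_cond_true[OF _ e]]) (use True Cons(2)[symmetric] in simp_all)
  next
    case False
    have e: "rb (Seq (Pop a) (Push b False)) s (1 + 1) ?s"
      by (rule rb_conv[OF rb_seq[OF rb_pop rb_push]]) (use False Cons(2)[symmetric] \<open>a \<noteq> b\<close> in \<open>auto simp: fun_eq_iff\<close>)
    show ?thesis by (rule rb_conv[OF rb_cond_false[OF _ e]]) (use False Cons(2)[symmetric] in simp_all)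
  qed
  from Cons(1)[of ?s] Cons(2)[symmetric] Cons(3)
  have "rb (mv a b) ?s (6 * length l + 1) (s(a := [], b := rev (s a) @ s b))"
    by (simp add: fun_upd_twist)
  then have "rb (mv a b) s (4 + (6 * length l + 1) + 2) (s(a := [], b := rev (s a) @ s b))"
    unfolding mv_def using Cons(2)[symmetric] by (intro rb_while_step[OF _ body[unfolded mv_def]]) (cases v; auto)+
  then show ?case by (rule rb_conv) (simp_all flip: Cons(2))
qed

definition cp2 :: "nat \<Rightarrow> nat \<Rightarrow> nat \<Rightarrow> com" where
  "cp2 a b c = While (Top a {Some True, Some False}) (Cond (Top a {Some True})
     (Seq (Pop a) (Seq (Push b True) (Push c True))) (Seq (Pop a) (Seq (Push b False) (Push c False))))"

lemma rb_cp2: "a \<noteq> b \<Longrightarrow> a \<noteq> c \<Longrightarrow> b \<noteq> c \<Longrightarrow>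
  rb (cp2 a b c) s (7 * length (s a) + 1) (s(a := [], b := rev (s a) @ s b, c := rev (s a) @ s c))"
proof (induction "s a" arbitrary: s)
  case Nil
  note n = Nil(1)[symmetric]
  have "rb (cp2 a b c) s 1 s" unfolding cp2_def by (rule rb_while_end) (simp add: n)
  then show ?case by (rule rb_conv) (simp_all add: fun_eq_iff n)
next
  case (Cons v l)
  let ?s = "s(a := l, b := v # s b, c := v # s c)"
  have body: "rb (Cond (Top a {Some True})
     (Seq (Pop a) (Seq (Push b True) (Push c True))) (Seq (Pop a) (Seq (Push b False) (Push c False)))) s 5 ?s"
  proof (cases v)
    case True
    have e: "rb (Seq (Pop a) (Seq (Push b True) (Push c True))) s (1 + (1 + 1)) ?s"
      by (rule rb_conv[OF rb_seq[OF rb_pop rb_seq[OF rb_push rb_push]]])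
         (use True Cons(2)[symmetric] Cons.prems in \<open>auto simp: fun_eq_iff\<close>)
    show ?thesis by (rule rb_conv[OF rb_cond_true[OF _ e]]) (use True Cons(2)[symmetric] in simp_all)
  next
    case False
    have e: "rb (Seq (Pop a) (Seq (Push b False) (Push c False))) s (1 + (1 + 1)) ?s"
      by (rule rb_conv[OF rb_seq[OF rb_pop rb_seq[OF rb_push rb_push]]])
         (use False Cons(2)[symmetric] Cons.prems in \<open>auto simp: fun_eq_iff\<close>)
    show ?thesis by (rule rb_conv[OF rb_cond_false[OF _ e]]) (use False Cons(2)[symmetric] in simp_all)
  qed
  have "rb (cp2 a b c) ?s (7 * length l + 1) (s(a := [], b := rev (s a) @ s b, c := rev (s a) @ s c))"
    by (rule rb_conv[OF Cons(1)[of ?s]]) (use Cons(2)[symmetric] Cons.prems in \<open>auto simp: fun_eq_iff\<close>)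
  then have "rb (cp2 a b c) s (5 + (7 * length l + 1) + 2) (s(a := [], b := rev (s a) @ s b, c := rev (s a) @ s c))"
    unfolding cp2_def using Cons(2)[symmetric] by (intro rb_while_step[OF _ body]) (cases v; auto)+
  then show ?case by (rule rb_conv) (simp_all flip: Cons(2))
qed

definition mv2 :: "nat \<Rightarrow> nat \<Rightarrow> nat \<Rightarrow> com" where
  "mv2 a b t = Seq (mv a t) (mv t b)"

lemma rb_mv2:
  assumes "a \<noteq> b" "a \<noteq> t" "b \<noteq> t" "s t = []"
  shows "rb (mv2 a b t) s (12 * length (s a) + 2) (s(a := [], b := s a @ s b))"
  unfolding mv2_def
  by (rule rb_conv[OF rb_seq[OF rb_mv rb_mv]]) (use assms in \<open>auto simp: fun_eq_iff\<close>)

definition dup :: "nat \<Rightarrow> nat \<Rightarrow> nat \<Rightarrow> com" where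
  "dup a b t = Seq (mv a t) (cp2 t a b)"

lemma rb_dup:
  assumes "a \<noteq> b" "a \<noteq> t" "b \<noteq> t" "s t = []"
  shows "rb (dup a b t) s (13 * length (s a) + 2) (s(b := s a @ s b))"
  unfolding dup_def
  by (rule rb_conv[OF rb_seq[OF rb_mv rb_cp2]]) (use assms in \<open>auto simp: fun_eq_iff\<close>)

primrec pushes :: "nat \<Rightarrow> bool list \<Rightarrow> com" where
  "pushes r [] = nop"
| "pushes r (b # bs) = Seq (pushes r bs) (Push r b)"

lemma rb_pushes: "rb (pushes r bs) s (length bs + 2) (s(r := bs @ s r))"
proof (induction bs)
  case Nil
  show ?case unfolding pushes.simps by (rule rb_conv[OF rb_nop]) auto
next
  case (Cons b bs)
  show ?case unfolding pushes.simps
    by (rule rb_conv[OF rb_seq[OF Cons rb_push]]) auto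
qed

section \<open>Trees as a prefix code\<close>

datatype tree = Leaf | Node tree tree

text \<open>Preorder with one bit per node. The code is prefix-free, so a pair is just an opening
  bit and two codes without separator, and splitting it needs only a counter of open
  subtrees.\<close>

primrec bits :: "tree \<Rightarrow> bool list" where
  "bits Leaf = [False]"
| "bits (Node a b) = True # bits a @ bits b"

lemma bits_prefix_free: "bits a @ xs = bits b @ ys \<Longrightarrow> a = b \<and> xs = ys"
proof (induction a arbitrary: b xs ys)
  case Leaf
  then show ?case by (cases b) auto
next
  case (Node a1 a2)
  from Node.prems obtain b1 b2 where b: "b = Node b1 b2" by (cases b) auto
  with Node.prems have *: "bits a1 @ bits a2 @ xs = bits b1 @ bits b2 @ ys" by simp
  from Node.IH(1)[OF *] Node.IH(2)[of xs b2 ys] b show ?case by simp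
qed

lemma bits_inj: "bits a = bits b \<Longrightarrow> a = b"
  using bits_prefix_free[of a "[]" b "[]"] by simp

lemma bits_not_Nil [simp]: "bits t \<noteq> []"
  by (cases t) auto

lemma top_of_bits: "top_of (bits t @ xs) = Some (t \<noteq> Leaf)"
  by (cases t) auto

text \<open>The stack \<open>c\<close> counts, in unary, the subtrees still to be read.\<close>

definition split_loop :: "nat \<Rightarrow> nat \<Rightarrow> nat \<Rightarrow> com" where
  "split_loop a b c = While (Top c {Some True}) (Cond (Top a {Some True})
     (Seq (Pop a) (Seq (Push b True) (Push c True))) (Seq (Pop a) (Seq (Push b False) (Pop c))))"

text \<open>Stated with a continuation: the last premise runs the rest of the loop after
  \<open>t\<close>. This makes the induction go through, since the run over the left subtree
  continues with the right one inside the same loop.\<close>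

lemma rb_split_loop:
  assumes "a \<noteq> b" "a \<noteq> c" "b \<noteq> c" "s a = bits t @ rest" "s c = True # w"
    and "rb (split_loop a b c) (s(a := rest, b := rev (bits t) @ s b, c := w)) T s'"
  shows "rb (split_loop a b c) s (7 * length (bits t) + T) s'"
  using assms(4-)
proof (induction t arbitrary: s rest w T)
  case Leaf
  have e: "rb (Cond (Top a {Some True})
     (Seq (Pop a) (Seq (Push b True) (Push c True))) (Seq (Pop a) (Seq (Push b False) (Pop c))))
     s (1 + (1 + 1) + 2) (s(a := rest, b := rev (bits Leaf) @ s b, c := w))"
    by (rule rb_cond_false, use Leaf in simp, rule rb_conv[OF rb_seq[OF rb_pop rb_seq[OF rb_push rb_pop]]])
       (use Leaf assms(1-3) in \<open>auto simp: fun_eq_iff\<close>)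
  show ?case
    unfolding split_loop_def
    by (rule rb_conv[OF rb_while_step[OF _ e Leaf(3)[unfolded split_loop_def]]]) (use Leaf(2) in auto)
next
  case (Node l r)
  let ?s = "s(a := bits l @ bits r @ rest, b := True # s b, c := True # True # w)"
  let ?s2 = "?s(a := bits r @ rest, b := rev (bits l) @ ?s b, c := True # w)"
  have "?s2(a := rest, b := rev (bits r) @ ?s2 b, c := w) = s(a := rest, b := rev (bits (Node l r)) @ s b, c := w)"
    using assms(1-3) by (auto simp: fun_eq_iff)
  then have x: "rb (split_loop a b c) (?s2(a := rest, b := rev (bits r) @ ?s2 b, c := w)) T s'"
    using Node.prems(3) by (simp only:)
  have "rb (split_loop a b c) ?s2 (7 * length (bits r) + T) s'"
    by (rule Node.IH(2)[OF _ _ x]) (use assms(1-3) in auto)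
  then have y: "rb (split_loop a b c) (?s(a := bits r @ rest, b := rev (bits l) @ ?s b, c := True # w))
      (7 * length (bits r) + T) s'" .
  have 2: "rb (split_loop a b c) ?s (7 * length (bits l) + (7 * length (bits r) + T)) s'"
    by (rule Node.IH(1)[OF _ _ y]) (use assms(1-3) in auto)
  have e: "rb (Cond (Top a {Some True})
     (Seq (Pop a) (Seq (Push b True) (Push c True))) (Seq (Pop a) (Seq (Push b False) (Pop c))))
     s (1 + (1 + 1) + 2) ?s"
    by (rule rb_cond_true, use Node.prems in simp, rule rb_conv[OF rb_seq[OF rb_pop rb_seq[OF rb_push rb_push]]])
       (use Node.prems assms(1-3) in \<open>auto simp: fun_eq_iff\<close>)
  show ?case
    unfolding split_loop_def
    by (rule rb_conv[OF rb_while_step[OF _ e 2[unfolded split_loop_def]]]) (use Node.prems(2) in auto)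
qed

definition split :: "nat \<Rightarrow> nat \<Rightarrow> nat \<Rightarrow> com" where
  "split a b c = Seq (Push c True) (split_loop a b c)"

lemma rb_split:
  assumes "a \<noteq> b" "a \<noteq> c" "b \<noteq> c" "s a = bits t @ rest" "s c = []"
  shows "rb (split a b c) s (7 * length (bits t) + 2) (s(a := rest, b := rev (bits t) @ s b))"
proof -
  let ?s = "s(c := [True])"
  have "rb (split_loop a b c) (?s(a := rest, b := rev (bits t) @ ?s b, c := [])) 1
      (s(a := rest, b := rev (bits t) @ s b))"
    unfolding split_loop_def by (rule rb_conv[OF rb_while_end]) (use assms in \<open>auto simp: fun_eq_iff\<close>)
  from rb_split_loop[OF assms(1-3) _ _ this] assms
  have e: "rb (split_loop a b c) ?s (7 * length (bits t) + 1) (s(a := rest, b := rev (bits t) @ s b))" by simp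
  have "rb (Push c True) s 1 ?s" using rb_push[of c True s] assms(5) by simp
  from rb_seq[OF this e] show ?thesis
    unfolding split_def by (rule rb_conv) auto
qed

text \<open>A mismatch empties \<open>a\<close>, which ends the loop, and leaves a flag on
  \<open>f\<close>; if \<open>a\<close> is a proper prefix of \<open>b\<close>, the rest of
  \<open>b\<close> remains as evidence instead.\<close>

definition eq_loop :: "nat \<Rightarrow> nat \<Rightarrow> nat \<Rightarrow> com" where
  "eq_loop a b f = While (Top a {Some True, Some False}) (Cond (Top a {Some True})
     (Cond (Top b {Some True}) (Seq (Pop a) (Pop b)) (Seq (clear a) (Push f True)))
     (Cond (Top b {Some False}) (Seq (Pop a) (Pop b)) (Seq (clear a) (Push f True))))"

lemma rb_eq_loop:
  assumes "a \<noteq> b" "a \<noteq> f" "b \<noteq> f" "s f = []"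
  shows "\<exists>v w. rb (eq_loop a b f) s (10 * length (s a) + 10) (s(a := [], b := v, f := w)) \<and>
     length v \<le> length (s b) \<and> length w \<le> 1 \<and> (v = [] \<and> w = [] \<longleftrightarrow> s a = s b)"
  using assms(4)
proof (induction "s a" arbitrary: s)
  case Nil
  note n = Nil(1)[symmetric]
  have "rb (eq_loop a b f) s 1 s" unfolding eq_loop_def by (rule rb_while_end) (simp add: n)
  then have e: "rb (eq_loop a b f) s (10 * length (s a) + 10) (s(a := [], b := s b, f := []))"
    by (rule rb_conv) (simp_all add: fun_eq_iff n Nil(2))
  show ?case by (rule exI[of _ "s b"], rule exI[of _ "[]"], rule conjI, rule e) (use n in auto)
next
  case (Cons x l)
  define body where "body = Cond (Top a {Some True})
     (Cond (Top b {Some True}) (Seq (Pop a) (Pop b)) (Seq (clear a) (Push f True)))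
     (Cond (Top b {Some False}) (Seq (Pop a) (Pop b)) (Seq (clear a) (Push f True)))"
  have loop: "eq_loop a b f = While (Top a {Some True, Some False}) body"
    by (simp add: eq_loop_def body_def)
  have top: "top_of (s a) \<in> {Some True, Some False}" using Cons(2)[symmetric] by (cases x) auto
  show ?case
  proof (cases "top_of (s b) = Some x")
    case True
    then obtain l' where l': "s b = x # l'" by (cases "s b") auto
    let ?s = "s(a := l, b := l')"
    have e: "rb (Seq (Pop a) (Pop b)) s (1 + 1) ?s"
      by (rule rb_conv[OF rb_seq[OF rb_pop rb_pop]])
         (use l' Cons(2)[symmetric] assms(1-3) in \<open>auto simp: fun_eq_iff\<close>)
    have body: "rb body s (1 + 1 + 2 + 2) ?s"
      unfolding body_def
    proof (cases x)
      assume "x"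
      then show "rb (Cond (Top a {Some True})
         (Cond (Top b {Some True}) (Seq (Pop a) (Pop b)) (Seq (clear a) (Push f True)))
         (Cond (Top b {Some False}) (Seq (Pop a) (Pop b)) (Seq (clear a) (Push f True)))) s (1 + 1 + 2 + 2) ?s"
        by (intro rb_cond_true[OF _ rb_cond_true[OF _ e]]) (use True Cons(2)[symmetric] in simp_all)
    next
      assume "\<not> x"
      then show "rb (Cond (Top a {Some True})
         (Cond (Top b {Some True}) (Seq (Pop a) (Pop b)) (Seq (clear a) (Push f True)))
         (Cond (Top b {Some False}) (Seq (Pop a) (Pop b)) (Seq (clear a) (Push f True)))) s (1 + 1 + 2 + 2) ?s"
        by (intro rb_cond_false[OF _ rb_cond_true[OF _ e]]) (use True Cons(2)[symmetric] in simp_all)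
    qed
    from Cons(1)[of ?s] Cons(3) assms(1-3) obtain v w where vw:
      "rb (eq_loop a b f) ?s (10 * length l + 10) (?s(a := [], b := v, f := w))"
      "length v \<le> length l'" "length w \<le> 1" "v = [] \<and> w = [] \<longleftrightarrow> l = l'" by auto
    have "?s(a := [], b := v, f := w) = s(a := [], b := v, f := w)" by (auto simp: fun_eq_iff)
    with rb_while_step[OF top body vw(1)[unfolded loop]]
    have e: "rb (eq_loop a b f) s (10 * length (s a) + 10) (s(a := [], b := v, f := w))"
      unfolding loop by (elim rb_conv) (simp_all flip: Cons(2))
    show ?thesis
      by (rule exI[of _ v], rule exI[of _ w], rule conjI, rule e) (use vw l' Cons(2)[symmetric] in auto)
  next
    case False
    let ?s = "s(a := [], f := [True])"
    have e: "rb (Seq (clear a) (Push f True)) s (3 * length (s a) + 1 + 1) ?s"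
      by (rule rb_conv[OF rb_seq[OF rb_clear rb_push]])
         (use Cons(3) assms(1-3) in \<open>auto simp: fun_eq_iff\<close>)
    have body: "rb body s (3 * length (s a) + 1 + 1 + 2 + 2) ?s"
      unfolding body_def
    proof (cases x)
      assume "x"
      then show "rb (Cond (Top a {Some True})
         (Cond (Top b {Some True}) (Seq (Pop a) (Pop b)) (Seq (clear a) (Push f True)))
         (Cond (Top b {Some False}) (Seq (Pop a) (Pop b)) (Seq (clear a) (Push f True)))) s (3 * length (s a) + 1 + 1 + 2 + 2) ?s"
        by (intro rb_cond_true[OF _ rb_cond_false[OF _ e]]) (use False Cons(2)[symmetric] in simp_all)
    next
      assume "\<not> x"
      then show "rb (Cond (Top a {Some True})
         (Cond (Top b {Some True}) (Seq (Pop a) (Pop b)) (Seq (clear a) (Push f True)))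
         (Cond (Top b {Some False}) (Seq (Pop a) (Pop b)) (Seq (clear a) (Push f True)))) s (3 * length (s a) + 1 + 1 + 2 + 2) ?s"
        by (intro rb_cond_false[OF _ rb_cond_false[OF _ e]]) (use False Cons(2)[symmetric] in simp_all)
    qed
    have "rb (eq_loop a b f) ?s 1 ?s" unfolding loop
      by (rule rb_while_end) (use assms(1-3) in auto)
    from rb_while_step[OF top body this[unfolded loop]]
    have e: "rb (eq_loop a b f) s (10 * length (s a) + 10) (s(a := [], b := s b, f := [True]))"
      unfolding loop by (elim rb_conv) (use assms(1-3) in \<open>auto simp: fun_eq_iff\<close>)
    show ?thesis
      by (rule exI[of _ "s b"], rule exI[of _ "[True]"], rule conjI, rule e)
         (use False Cons(2)[symmetric] in \<open>auto simp: top_of_def split: list.splits\<close>)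
  qed
qed

lemma com_regs_macros [simp]:
  "com_regs m nop \<longleftrightarrow> 0 < m"
  "com_regs m (clear a) \<longleftrightarrow> a < m"
  "com_regs m (mv a b) \<longleftrightarrow> a < m \<and> b < m"
  "com_regs m (mv2 a b c) \<longleftrightarrow> a < m \<and> b < m \<and> c < m"
  "com_regs m (dup a b c) \<longleftrightarrow> a < m \<and> b < m \<and> c < m"
  "com_regs m (split a b c) \<longleftrightarrow> a < m \<and> b < m \<and> c < m"
  "com_regs m (eq_loop a b c) \<longleftrightarrow> a < m \<and> b < m \<and> c < m"
  by (auto simp: nop_def clear_def mv_def mv2_def dup_def cp2_def split_def split_loop_def eq_loop_def)

lemma com_regs_pushes [simp]: "com_regs m (pushes r bs) \<longleftrightarrow> r < m \<or> bs = [] \<and> 0 < m" if "0 < m"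
  by (induction bs) (use that in auto)

lemma poly_nat_mono: "a \<le> b \<Longrightarrow> poly q a \<le> poly q b" for a b :: nat
  by (induction q) (auto intro: add_mono mult_mono)

section \<open>Polynomial-time functions on tree codes\<close>

text \<open>A bound instead of an exact polynomial: the time expressions of programs then need no
  normalisation, only the closure rules below.\<close>

definition pbd :: "(nat \<Rightarrow> nat) \<Rightarrow> bool" where
  "pbd t \<longleftrightarrow> (\<exists>q :: nat poly. \<forall>n. t n \<le> poly q n)"

lemma pbd_const: "pbd (\<lambda>n. c)"
  unfolding pbd_def by (rule exI[of _ "[:c:]"]) simp

lemma pbd_id: "pbd (\<lambda>n. n)"
  unfolding pbd_def by (rule exI[of _ "[:0, 1:]"]) simp

lemma pbd_add: "pbd s \<Longrightarrow> pbd t \<Longrightarrow> pbd (\<lambda>n. s n + t n)"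
  unfolding pbd_def by (metis add_mono poly_add)

lemma pbd_mult: "pbd s \<Longrightarrow> pbd t \<Longrightarrow> pbd (\<lambda>n. s n * t n)"
  unfolding pbd_def by (metis mult_le_mono poly_mult)

lemma pbd_poly: "pbd t \<Longrightarrow> pbd (\<lambda>n. poly q (t n))"
  unfolding pbd_def by (metis poly_pcompose poly_nat_mono)

lemma pbd_Suc: "pbd t \<Longrightarrow> pbd (\<lambda>n. Suc (t n))"
  using pbd_add[OF pbd_const[of 1]] by simp

lemma pbd_power: "pbd t \<Longrightarrow> pbd (\<lambda>n. t n ^ k)"
  by (induction k) (auto intro: pbd_const pbd_mult)

lemmas pbd_intros = pbd_const pbd_id pbd_add pbd_mult pbd_poly pbd_Suc pbd_power

text \<open>Injectivity is what lets equality of values be decided by comparing codes.\<close>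

class enc =
  fixes tr :: "'a \<Rightarrow> tree"
  assumes tr_inj: "tr x = tr y \<Longrightarrow> x = y"

lemma tr_eq_iff [simp]: "tr x = tr y \<longleftrightarrow> x = y"
  by (auto dest: tr_inj)

definition ser :: "'a :: enc \<Rightarrow> bool list" where
  "ser x = bits (tr x)"

definition sz :: "'a :: enc \<Rightarrow> nat" where
  "sz x = length (bits (tr x))"

lemma length_ser [simp]: "length (ser x) = sz x"
  by (simp add: ser_def sz_def)

lemma sz_pos [simp]: "0 < sz x" "Suc 0 \<le> sz x"
  by (auto simp: sz_def Suc_le_eq)

instantiation tree :: enc
begin
definition "tr_tree (t :: tree) = t"
instance by standard (simp add: tr_tree_def)
end

instantiation unit :: enc
begin
definition "tr_unit (u :: unit) = Leaf"
instance by standard simp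
end

instantiation bool :: enc
begin
definition "tr_bool b = (if b then Node Leaf Leaf else Leaf)"
instance by standard (simp add: tr_bool_def split: if_splits)
end

instantiation prod :: (enc, enc) enc
begin
definition "tr_prod p = Node (tr (fst p)) (tr (snd p))"
instance by standard (simp add: tr_prod_def prod_eq_iff)
end

instantiation list :: (enc) enc
begin
primrec tr_list :: "'a list \<Rightarrow> tree" where
  "tr_list [] = Leaf"
| "tr_list (x # xs) = Node (tr x) (tr_list xs)"
instance
proof
  fix xs ys :: "'a list"
  show "tr xs = tr ys \<Longrightarrow> xs = ys"
  proof (induction xs arbitrary: ys)
    case Nil
    then show ?case by (cases ys) auto
  next
    case (Cons x xs)
    then show ?case by (cases ys) auto
  qed
qed
end

text \<open>Unary, as in \<open>enc_nat\<close>: the size of a number is linear in its value, so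
  loops that run \<open>n\<close> times and lists such as \<open>[0..<n]\<close> are
  polynomial.\<close>

instantiation nat :: enc
begin
definition "tr_nat n = tr (replicate n ())"
instance by standard (auto simp: tr_nat_def dest: arg_cong[of _ _ length])
end

instantiation option :: (enc) enc
begin
definition "tr_option x = (case x of None \<Rightarrow> Leaf | Some y \<Rightarrow> Node (tr y) Leaf)"
instance by standard (auto simp: tr_option_def split: option.splits)
end

lemma tr_simps:
  "tr (a, b) = Node (tr a) (tr b)"
  "tr True = Node Leaf Leaf" "tr False = Leaf"
  "tr (0 :: nat) = Leaf" "tr (Suc n) = Node Leaf (tr n)"
  "tr (None :: 'o :: enc option) = Leaf" "tr (Some x) = Node (tr x) Leaf"
  by (auto simp: tr_prod_def tr_bool_def tr_nat_def tr_option_def tr_unit_def)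

lemma sz_simps [simp]:
  "sz (a, b) = Suc (sz a + sz b)"
  "sz True = 3" "sz False = 1"
  "sz (0 :: nat) = 1" "sz (Suc n) = sz n + 2"
  "sz ([] :: 'l :: enc list) = 1" "sz (x # xs) = Suc (sz x + sz xs)"
  "sz (None :: 'o :: enc option) = 1" "sz (Some x) = sz x + 2"
  "sz () = 1"
  by (auto simp: sz_def tr_simps tr_unit_def)

lemma sz_nat: "sz (n :: nat) = 2 * n + 1"
  by (induction n) auto

lemma sz_bool_le: "sz (b :: bool) \<le> 3"
  by (cases b) auto

lemma sz_append: "sz (xs @ ys) + 1 = sz xs + sz ys"
  by (induction xs) auto

lemma sz_append_le: "sz (xs @ ys) \<le> sz xs + sz ys"
  using sz_append[of xs ys] by simp

lemma sz_list: "sz xs = 1 + length xs + sum_list (map sz xs)"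
  by (induction xs) auto

lemma length_le_sz: "length xs \<le> sz xs"
  by (simp add: sz_list)

lemma sz_mem: "x \<in> set xs \<Longrightarrow> sz x \<le> sz xs"
  by (induction xs) auto

lemma sz_rev [simp]: "sz (rev xs) = sz xs"
  by (simp add: sz_list rev_map[symmetric])

text \<open>Argument and result sit on stack 0; stacks 1 to \<open>m - 1\<close> are scratch, empty
  before and after, and the stacks from \<open>m\<close> on are left unchanged, so a caller can park
  values there. The set \<open>D\<close> admits partial functions, on which case distinctions
  rely.\<close>

definition PFon :: "'a :: enc set \<Rightarrow> ('a \<Rightarrow> 'b :: enc) \<Rightarrow> bool" where
  "PFon D f \<longleftrightarrow> (\<exists>c m. \<exists>q :: nat poly. 0 < m \<and> com_regs m c \<and> (\<forall>x \<in> D. \<forall>s.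
     s 0 = ser x \<longrightarrow> (\<forall>r \<in> {1..<m}. s r = []) \<longrightarrow> rb c s (poly q (sz x)) (s(0 := ser (f x)))))"

abbreviation PF :: "('a :: enc \<Rightarrow> 'b :: enc) \<Rightarrow> bool" where
  "PF \<equiv> PFon UNIV"

lemma PFonI:
  assumes "0 < m" "com_regs m c" "pbd T"
    and "\<And>x s. x \<in> D \<Longrightarrow> s 0 = ser x \<Longrightarrow> (\<And>r. 1 \<le> r \<Longrightarrow> r < m \<Longrightarrow> s r = []) \<Longrightarrow>
           rb c s (T (sz x)) (s(0 := ser (f x)))"
  shows "PFon D f"
proof -
  from assms(3) obtain q where "\<And>n. T n \<le> poly q n" unfolding pbd_def by blast
  with assms show ?thesis unfolding PFon_def
    by (intro exI[of _ c] exI[of _ m] exI[of _ q]) (fastforce intro: rb_conv)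
qed

lemma PFonE:
  assumes "PFon D f"
  obtains c m q where "0 < m" "com_regs m c"
    "\<And>x s. x \<in> D \<Longrightarrow> s 0 = ser x \<Longrightarrow> (\<And>r. 1 \<le> r \<Longrightarrow> r < m \<Longrightarrow> s r = []) \<Longrightarrow>
           rb c s (poly q (sz x)) (s(0 := ser (f x)))"
proof -
  from assms obtain c m q where *: "0 < m" "com_regs m c" "\<And>x s. x \<in> D \<Longrightarrow>
     s 0 = ser x \<Longrightarrow> (\<forall>r \<in> {1..<m}. s r = []) \<Longrightarrow> rb c s (poly q (sz x)) (s(0 := ser (f x)))"
    unfolding PFon_def by blast
  show ?thesis by (rule that[OF *(1,2), of q], rule *(3)) auto
qed

lemma PFon_size:
  assumes "PFon D f"
  shows "\<exists>q. \<forall>x \<in> D. sz (f x) \<le> poly q (sz x)"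
proof -
  from assms obtain c m q where *: "\<And>x s. x \<in> D \<Longrightarrow> s 0 = ser x \<Longrightarrow> (\<And>r. 1 \<le> r \<Longrightarrow> r < m \<Longrightarrow> s r = []) \<Longrightarrow>
           rb c s (poly q (sz x)) (s(0 := ser (f x)))" by (rule PFonE) blast
  have "sz (f x) \<le> poly ([:0, 1:] + q) (sz x)" if "x \<in> D" for x
    using rb_size[OF *[OF that, of "(\<lambda>_. [])(0 := ser x)"], of 0] by simp
  then show ?thesis by blast
qed

lemma PFon_subset: "PFon D f \<Longrightarrow> E \<subseteq> D \<Longrightarrow> PFon E f"
  unfolding PFon_def by blast

lemma PFon_cong: "PFon D f \<Longrightarrow> (\<And>x. x \<in> D \<Longrightarrow> f x = g x) \<Longrightarrow> PFon D g"
  unfolding PFon_def by auto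

text \<open>A program sees codes only, so it computes every function that acts in the same way on
  codes. This yields constructors, selectors and coercions between types at no cost.\<close>

lemma PFon_transfer:
  assumes "PFon E F" "\<And>x. x \<in> D \<Longrightarrow> \<exists>y \<in> E. tr y = tr x \<and> tr (F y) = tr (f x)"
  shows "PFon D f"
proof -
  from assms(1) obtain c m q where *: "0 < m" "com_regs m c" "\<And>x s. x \<in> E \<Longrightarrow> s 0 = ser x \<Longrightarrow> (\<And>r. 1 \<le> r \<Longrightarrow> r < m \<Longrightarrow> s r = []) \<Longrightarrow>
           rb c s (poly q (sz x)) (s(0 := ser (F x)))" by (rule PFonE) blast
  show ?thesis
  proof (rule PFonI[OF *(1,2)])
    fix x s assume x: "x \<in> D" and s: "s 0 = ser x" "\<And>r. 1 \<le> r \<Longrightarrow> r < m \<Longrightarrow> s r = []"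
    from assms(2)[OF x] obtain y where y: "y \<in> E" "tr y = tr x" "tr (F y) = tr (f x)" by blast
    from *(3)[OF y(1), of s] s y(2,3) show "rb c s (poly q (sz x)) (s(0 := ser (f x)))"
      by (auto simp: ser_def sz_def)
  qed (intro pbd_intros)
qed

lemma PF_tree: "PF F \<Longrightarrow> (\<And>x. tr (f x) = F (tr x)) \<Longrightarrow> PF f" for F :: "tree \<Rightarrow> tree"
  by (rule PFon_transfer[of UNIV F]) (auto simp: tr_tree_def)

lemma PFon_comp:
  assumes "PFon D f" "PFon E g" "\<And>x. x \<in> D \<Longrightarrow> f x \<in> E"
  shows "PFon D (\<lambda>x. g (f x))"
proof -
  from assms(1) obtain c m q where f: "0 < m" "com_regs m c" "\<And>x s. x \<in> D \<Longrightarrow> s 0 = ser x \<Longrightarrow> (\<And>r. 1 \<le> r \<Longrightarrow> r < m \<Longrightarrow> s r = []) \<Longrightarrow>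
           rb c s (poly q (sz x)) (s(0 := ser (f x)))" by (rule PFonE) blast
  from assms(2) obtain c' m' q' where g: "0 < m'" "com_regs m' c'" "\<And>x s. x \<in> E \<Longrightarrow> s 0 = ser x \<Longrightarrow> (\<And>r. 1 \<le> r \<Longrightarrow> r < m' \<Longrightarrow> s r = []) \<Longrightarrow>
           rb c' s (poly q' (sz x)) (s(0 := ser (g x)))" by (rule PFonE) blast
  from PFon_size[OF assms(1)] obtain p where p: "\<And>x. x \<in> D \<Longrightarrow> sz (f x) \<le> poly p (sz x)" by blast
  show ?thesis
  proof (rule PFonI)
    show "0 < max m m'" using f by simp
    show "com_regs (max m m') (Seq c c')" using f(2) g(2) by (auto intro: com_regs_mono)
    show "pbd (\<lambda>n. poly q n + poly q' (poly p n))" by (intro pbd_intros)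
    fix x s assume x: "x \<in> D" and s: "s 0 = ser x" "\<And>r. 1 \<le> r \<Longrightarrow> r < max m m' \<Longrightarrow> s r = []"
    have 1: "rb c s (poly q (sz x)) (s(0 := ser (f x)))" by (rule f(3)) (use x s in auto)
    have 2: "rb c' (s(0 := ser (f x))) (poly q' (sz (f x))) (s(0 := ser (f x), 0 := ser (g (f x))))"
      by (rule g(3)) (use assms(3) x s in auto)
    show "rb (Seq c c') s (poly q (sz x) + poly q' (poly p (sz x))) (s(0 := ser (g (f x))))"
      by (rule rb_conv[OF rb_seq[OF 1 2]]) (use poly_nat_mono[OF p[OF x]] in auto)
  qed
qed

lemma PF_comp: "PF g \<Longrightarrow> PFon D f \<Longrightarrow> PFon D (\<lambda>x. g (f x))"
  by (rule PFon_comp) auto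

lemma PF_id: "PFon D (\<lambda>x. x)"
  by (rule PFonI[of 1 nop "\<lambda>_. 2"], simp, simp, rule pbd_const, rule rb_conv[OF rb_nop]) auto

lemma PF_const: "PFon D (\<lambda>x. k)"
proof (rule PFonI[of 1 "Seq (clear 0) (pushes 0 (ser k))" "\<lambda>n. 3 * n + 1 + (sz k + 2)"])
  fix x and s :: store
  assume "s 0 = ser x"
  then show "rb (Seq (clear 0) (pushes 0 (ser k))) s (3 * sz x + 1 + (sz k + 2)) (s(0 := ser k))"
    by (intro rb_conv[OF rb_seq[OF rb_clear rb_pushes]]) auto
qed (simp, simp, intro pbd_intros)

lemma PF_pair:
  assumes "PFon D f" "PFon D g"
  shows "PFon D (\<lambda>x. (f x, g x))"
proof -
  from assms(1) obtain c m q where f: "0 < m" "com_regs m c" "\<And>x s. x \<in> D \<Longrightarrow> s 0 = ser x \<Longrightarrow> (\<And>r. 1 \<le> r \<Longrightarrow> r < m \<Longrightarrow> s r = []) \<Longrightarrow>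
           rb c s (poly q (sz x)) (s(0 := ser (f x)))" by (rule PFonE) blast
  from assms(2) obtain c' m' q' where g: "0 < m'" "com_regs m' c'" "\<And>x s. x \<in> D \<Longrightarrow> s 0 = ser x \<Longrightarrow> (\<And>r. 1 \<le> r \<Longrightarrow> r < m' \<Longrightarrow> s r = []) \<Longrightarrow>
           rb c' s (poly q' (sz x)) (s(0 := ser (g x)))" by (rule PFonE) blast
  from PFon_size[OF assms(1)] obtain p where p: "\<And>x. x \<in> D \<Longrightarrow> sz (f x) \<le> poly p (sz x)" by blast
  \<comment> \<open>Stacks from \<open>k\<close> on are out of reach of both programs:
    \<open>k\<close> keeps the argument, \<open>k + 1\<close> the first result, and
    \<open>k + 2\<close> is scratch.\<close>
  define k where "k = max m m'"
  define P where "P = Seq (dup 0 k (k+2)) (Seq c (Seq (mv2 0 (k+1) (k+2)) (Seq (mv2 k 0 (k+2))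
     (Seq c' (Seq (mv2 (k+1) 0 (k+2)) (Push 0 True))))))"
  show ?thesis
  proof (rule PFonI)
    show "0 < k + 3" by simp
    show "com_regs (k + 3) P" using f(2) g(2) by (auto simp: P_def k_def intro: com_regs_mono)
    show "pbd (\<lambda>n. (13 * n + 2) + (poly q n + ((12 * poly p n + 2) + ((12 * n + 2) + (poly q' n + ((12 * poly p n + 2) + 1))))))" by (intro pbd_intros)
    fix x s assume x: "x \<in> D" and s: "s 0 = ser x" "\<And>r. 1 \<le> r \<Longrightarrow> r < k + 3 \<Longrightarrow> s r = []"
    have k: "k > 0" "k \<ge> m" "k \<ge> m'" using f(1) by (auto simp: k_def)
    let ?s1 = "s(k := ser x)"
    have 1: "rb (dup 0 k (k+2)) s (13 * sz x + 2) ?s1"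
      by (rule rb_conv[OF rb_dup]) (use k s in \<open>auto simp: fun_eq_iff\<close>)
    let ?s2 = "?s1(0 := ser (f x))"
    have 2: "rb c ?s1 (poly q (sz x)) ?s2"
      by (rule f(3)) (use k s x in auto)
    let ?s3 = "?s2(0 := [], k+1 := ser (f x))"
    have 3: "rb (mv2 0 (k+1) (k+2)) ?s2 (12 * poly p (sz x) + 2) ?s3"
      by (rule rb_conv[OF rb_mv2]) (use k s p[OF x] in \<open>auto simp: fun_eq_iff\<close>)
    let ?s4 = "?s3(k := [], 0 := ser x)"
    have 4: "rb (mv2 k 0 (k+2)) ?s3 (12 * sz x + 2) ?s4"
      by (rule rb_conv[OF rb_mv2]) (use k s in \<open>auto simp: fun_eq_iff\<close>)
    let ?s5 = "?s4(0 := ser (g x))"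
    have 5: "rb c' ?s4 (poly q' (sz x)) ?s5"
      by (rule g(3)) (use k s x in auto)
    let ?s6 = "?s5(k+1 := [], 0 := ser (f x) @ ser (g x))"
    have 6: "rb (mv2 (k+1) 0 (k+2)) ?s5 (12 * poly p (sz x) + 2) ?s6"
      by (rule rb_conv[OF rb_mv2]) (use k s p[OF x] in \<open>auto simp: fun_eq_iff\<close>)
    show "rb P s ((13 * sz x + 2) + (poly q (sz x) + ((12 * poly p (sz x) + 2) + ((12 * sz x + 2) + (poly q' (sz x) + ((12 * poly p (sz x) + 2) + 1))))))
       (s(0 := ser (f x, g x)))"
      unfolding P_def
      by (rule rb_conv[OF rb_seq[OF 1 rb_seq[OF 2 rb_seq[OF 3 rb_seq[OF 4 rb_seq[OF 5 rb_seq[OF 6 rb_push]]]]]]])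
         (use k s in \<open>auto simp: fun_eq_iff ser_def tr_simps\<close>)
  qed
qed

text \<open>The top bit of a code tells whether the tree is a leaf. Each branch needs to be
  computable only where it is taken, so selectors can be guarded by their preconditions.\<close>

lemma PF_if_Leaf:
  assumes "PFon D h" "PFon {x \<in> D. tr (h x) \<noteq> Leaf} f" "PFon {x \<in> D. tr (h x) = Leaf} g"
  shows "PFon D (\<lambda>x. if tr (h x) = Leaf then g x else f x)"
proof -
  let ?D1 = "{x \<in> D. tr (h x) \<noteq> Leaf}" and ?D0 = "{x \<in> D. tr (h x) = Leaf}"
  from assms(1) obtain c0 m0 q0 where h: "0 < m0" "com_regs m0 c0" "\<And>x s. x \<in> D \<Longrightarrow> s 0 = ser x \<Longrightarrow> (\<And>r. 1 \<le> r \<Longrightarrow> r < m0 \<Longrightarrow> s r = []) \<Longrightarrow>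
           rb c0 s (poly q0 (sz x)) (s(0 := ser (h x)))" by (rule PFonE) blast
  from assms(2) obtain c m q where f: "0 < m" "com_regs m c" "\<And>x s. x \<in> ?D1 \<Longrightarrow> s 0 = ser x \<Longrightarrow> (\<And>r. 1 \<le> r \<Longrightarrow> r < m \<Longrightarrow> s r = []) \<Longrightarrow>
           rb c s (poly q (sz x)) (s(0 := ser (f x)))" by (rule PFonE) blast
  from assms(3) obtain c' m' q' where g: "0 < m'" "com_regs m' c'" "\<And>x s. x \<in> ?D0 \<Longrightarrow> s 0 = ser x \<Longrightarrow> (\<And>r. 1 \<le> r \<Longrightarrow> r < m' \<Longrightarrow> s r = []) \<Longrightarrow>
           rb c' s (poly q' (sz x)) (s(0 := ser (g x)))" by (rule PFonE) blast
  from PFon_size[OF assms(1)] obtain p where p: "\<And>x. x \<in> D \<Longrightarrow> sz (h x) \<le> poly p (sz x)" by blast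
  define k where "k = max m0 (max m m')"
  let ?back = "Seq (clear 0) (mv2 k 0 (k+1))"
  define P where "P = Seq (dup 0 k (k+1)) (Seq c0 (Cond (Top 0 {Some True}) (Seq ?back c) (Seq ?back c')))"
  show ?thesis
  proof (rule PFonI)
    show "0 < k + 2" by simp
    show "com_regs (k + 2) P" using h(2) f(2) g(2) by (auto simp: P_def k_def intro: com_regs_mono)
    show "pbd (\<lambda>n. (13 * n + 2) + (poly q0 n + ((3 * poly p n + 1 + (12 * n + 2) + (poly q n + poly q' n)) + 2)))" by (intro pbd_intros)
    fix x s assume x: "x \<in> D" and s: "s 0 = ser x" "\<And>r. 1 \<le> r \<Longrightarrow> r < k + 2 \<Longrightarrow> s r = []"
    have k: "k > 0" "k \<ge> m" "k \<ge> m'" "k \<ge> m0" using f(1) by (auto simp: k_def)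
    let ?s1 = "s(k := ser x)"
    have 1: "rb (dup 0 k (k+1)) s (13 * sz x + 2) ?s1"
      by (rule rb_conv[OF rb_dup]) (use k s in \<open>auto simp: fun_eq_iff\<close>)
    let ?s2 = "?s1(0 := ser (h x))"
    have 2: "rb c0 ?s1 (poly q0 (sz x)) ?s2"
      by (rule h(3)) (use k s x in auto)
    have 3: "rb ?back ?s2 (3 * poly p (sz x) + 1 + (12 * sz x + 2)) s"
      by (rule rb_conv[OF rb_seq[OF rb_clear rb_mv2]]) (use k s p[OF x] in \<open>auto simp: fun_eq_iff\<close>)
    have top: "top_of (ser (h x)) = Some (tr (h x) \<noteq> Leaf)"
      using top_of_bits[of "tr (h x)" "[]"] by (simp add: ser_def)
    show "rb P s ((13 * sz x + 2) + (poly q0 (sz x) + ((3 * poly p (sz x) + 1 + (12 * sz x + 2) + (poly q (sz x) + poly q' (sz x))) + 2)))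
       (s(0 := ser (if tr (h x) = Leaf then g x else f x)))"
    proof (cases "tr (h x) = Leaf")
      case True
      have 4: "rb c' s (poly q' (sz x)) (s(0 := ser (g x)))"
        by (rule g(3)) (use k s x True in auto)
      have 5: "rb (Cond (Top 0 {Some True}) (Seq ?back c) (Seq ?back c')) ?s2
          (3 * poly p (sz x) + 1 + (12 * sz x + 2) + poly q' (sz x) + 2) (s(0 := ser (g x)))"
        by (rule rb_cond_false[OF _ rb_seq[OF 3 4]]) (use top True in simp)
      show ?thesis unfolding P_def
        by (rule rb_conv[OF rb_seq[OF 1 rb_seq[OF 2 5]]]) (use True in auto)
    next
      case False
      have 4: "rb c s (poly q (sz x)) (s(0 := ser (f x)))"
        by (rule f(3)) (use k s x False in auto)
      have 5: "rb (Cond (Top 0 {Some True}) (Seq ?back c) (Seq ?back c')) ?s2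
          (3 * poly p (sz x) + 1 + (12 * sz x + 2) + poly q (sz x) + 2) (s(0 := ser (f x)))"
        by (rule rb_cond_true[OF _ rb_seq[OF 3 4]]) (use top False in simp)
      show ?thesis unfolding P_def
        by (rule rb_conv[OF rb_seq[OF 1 rb_seq[OF 2 5]]]) (use False in auto)
    qed
  qed
qed

lemma PF_if:
  assumes "PFon D h" "PFon {x \<in> D. h x} f" "PFon {x \<in> D. \<not> h x} g"
  shows "PFon D (\<lambda>x. if h x then f x else g x)"
proof -
  have "tr (h x) = Leaf \<longleftrightarrow> \<not> h x" for x by (cases "h x") (auto simp: tr_simps)
  with PF_if_Leaf[of D h f g] assms have "PFon D (\<lambda>x. if \<not> h x then g x else f x)" by simp
  then show ?thesis by (rule PFon_cong) simp
qed

fun left :: "tree \<Rightarrow> tree" where "left Leaf = Leaf" | "left (Node a b) = a"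
fun right :: "tree \<Rightarrow> tree" where "right Leaf = Leaf" | "right (Node a b) = b"

lemma PF_left: "PF left"
proof (rule PFonI)
  let ?P = "Cond (Top 0 {Some True}) (Seq (Pop 0) (Seq (split 0 1 2) (Seq (clear 0) (mv 1 0)))) nop"
  show "(0::nat) < 3" "com_regs 3 ?P" by auto
  show "pbd (\<lambda>n. 20 * n + 20)" by (intro pbd_intros)
  fix x :: tree and s :: store assume s: "s 0 = ser x" "\<And>r. 1 \<le> r \<Longrightarrow> r < 3 \<Longrightarrow> s r = []"
  show "rb ?P s (20 * sz x + 20) (s(0 := ser (left x)))"
  proof (cases x)
    case Leaf
    show ?thesis
      by (rule rb_conv[OF rb_cond_false[OF _ rb_nop]]) (use s Leaf in \<open>auto simp: ser_def tr_tree_def\<close>)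
  next
    case (Node a b)
    have 1: "rb (Pop 0) s 1 (s(0 := bits a @ bits b))"
      by (rule rb_conv[OF rb_pop]) (use s Node in \<open>auto simp: ser_def tr_tree_def\<close>)
    have 2: "rb (split 0 1 2) (s(0 := bits a @ bits b)) (7 * length (bits a) + 2) (s(0 := bits b, 1 := rev (bits a)))"
      by (rule rb_conv[OF rb_split]) (use s in \<open>auto simp: fun_eq_iff\<close>)
    show ?thesis
      by (rule rb_conv[OF rb_cond_true[OF _ rb_seq[OF 1 rb_seq[OF 2 rb_seq[OF rb_clear rb_mv]]]]])
         (use s Node in \<open>auto simp: ser_def tr_tree_def sz_def fun_eq_iff\<close>)
  qed
qed

lemma PF_right: "PF right"
proof (rule PFonI)
  let ?P = "Cond (Top 0 {Some True}) (Seq (Pop 0) (Seq (split 0 1 2) (clear 1))) nop"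
  show "(0::nat) < 3" "com_regs 3 ?P" by auto
  show "pbd (\<lambda>n. 20 * n + 20)" by (intro pbd_intros)
  fix x :: tree and s :: store assume s: "s 0 = ser x" "\<And>r. 1 \<le> r \<Longrightarrow> r < 3 \<Longrightarrow> s r = []"
  show "rb ?P s (20 * sz x + 20) (s(0 := ser (right x)))"
  proof (cases x)
    case Leaf
    show ?thesis
      by (rule rb_conv[OF rb_cond_false[OF _ rb_nop]]) (use s Leaf in \<open>auto simp: ser_def tr_tree_def\<close>)
  next
    case (Node a b)
    have 1: "rb (Pop 0) s 1 (s(0 := bits a @ bits b))"
      by (rule rb_conv[OF rb_pop]) (use s Node in \<open>auto simp: ser_def tr_tree_def\<close>)
    have 2: "rb (split 0 1 2) (s(0 := bits a @ bits b)) (7 * length (bits a) + 2) (s(0 := bits b, 1 := rev (bits a)))"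
      by (rule rb_conv[OF rb_split]) (use s in \<open>auto simp: fun_eq_iff\<close>)
    show ?thesis
      by (rule rb_conv[OF rb_cond_true[OF _ rb_seq[OF 1 rb_seq[OF 2 rb_clear]]]])
         (use s Node in \<open>auto simp: ser_def tr_tree_def sz_def fun_eq_iff\<close>)
  qed
qed

lemma PF_eq_pair: "PF (\<lambda>p :: tree \<times> tree. fst p = snd p)"
proof (rule PFonI)
  let ?E = "Cond (Top 1 {None}) (Cond (Top 3 {None}) (pushes 0 (ser True)) (Seq (clear 3) (pushes 0 (ser False))))
     (Seq (clear 1) (Seq (clear 3) (pushes 0 (ser False))))"
  let ?P = "Seq (Pop 0) (Seq (split 0 2 1) (Seq (mv 2 1) (Seq (eq_loop 0 1 3) ?E)))"
  show "(0::nat) < 4" "com_regs 4 ?P" by auto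
  show "pbd (\<lambda>n. 30 * n + 40)" by (intro pbd_intros)
  fix x :: "tree \<times> tree" and s :: store assume s: "s 0 = ser x" "\<And>r. 1 \<le> r \<Longrightarrow> r < 4 \<Longrightarrow> s r = []"
  obtain a b where x: "x = (a, b)" by (cases x)
  have 1: "rb (Pop 0) s 1 (s(0 := bits a @ bits b))"
    by (rule rb_conv[OF rb_pop]) (use s x in \<open>auto simp: ser_def tr_simps tr_tree_def\<close>)
  have 2: "rb (split 0 2 1) (s(0 := bits a @ bits b)) (7 * length (bits a) + 2) (s(0 := bits b, 2 := rev (bits a)))"
    by (rule rb_conv[OF rb_split]) (use s in \<open>auto simp: fun_eq_iff\<close>)
  let ?s = "s(0 := bits b, 1 := bits a)"
  have 3: "rb (mv 2 1) (s(0 := bits b, 2 := rev (bits a))) (6 * length (bits a) + 1) ?s"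
    by (rule rb_conv[OF rb_mv]) (use s in \<open>auto simp: fun_eq_iff\<close>)
  from rb_eq_loop[of 0 1 3 ?s] s obtain v w where vw:
    "rb (eq_loop 0 1 3) ?s (10 * length (bits b) + 10) (?s(0 := [], 1 := v, 3 := w))"
    "length v \<le> length (bits a)" "length w \<le> 1" "v = [] \<and> w = [] \<longleftrightarrow> bits b = bits a" by auto
  have eq: "bits b = bits a \<longleftrightarrow> a = b" by (auto dest: bits_inj)
  let ?s' = "?s(0 := [], 1 := v, 3 := w)"
  have 5: "rb ?E ?s' (3 * length (bits a) + 20) (s(0 := ser (fst x = snd x)))"
  proof (cases "v = []")
    case True
    show ?thesis
    proof (cases "w = []")
      case w: True
      show ?thesis by (rule rb_conv[OF rb_cond_true[OF _ rb_cond_true[OF _ rb_pushes]]])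
        (use s True w vw(4) eq x in \<open>auto simp: fun_eq_iff\<close>)
    next
      case w: False
      show ?thesis by (rule rb_conv[OF rb_cond_true[OF _ rb_cond_false[OF _ rb_seq[OF rb_clear rb_pushes]]]])
        (use s True w vw(3,4) eq x in \<open>auto simp: fun_eq_iff top_of_def split: list.splits\<close>)
    qed
  next
    case False
    show ?thesis by (rule rb_conv[OF rb_cond_false[OF _ rb_seq[OF rb_clear rb_seq[OF rb_clear rb_pushes]]]])
        (use s False vw(2,3,4) eq x in \<open>auto simp: fun_eq_iff top_of_def split: list.splits\<close>)
  qed
  show "rb ?P s (30 * sz x + 40) (s(0 := ser (fst x = snd x)))"
    by (rule rb_conv[OF rb_seq[OF 1 rb_seq[OF 2 rb_seq[OF 3 rb_seq[OF vw(1) 5]]]]])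
       (use x in \<open>auto simp: sz_def tr_simps tr_tree_def\<close>)
qed

text \<open>\<open>M\<close> bounds every intermediate accumulator, not just the last, so that all
  rounds have the same cost. Stack \<open>m\<close> holds the remaining list, \<open>m + 1\<close>
  the accumulator.\<close>

lemma rb_fold_loop:
  fixes stp :: "'a :: enc \<times> 's :: enc \<Rightarrow> 's"
  assumes f: "0 < m" "com_regs m c" "\<And>z s. s 0 = ser z \<Longrightarrow> (\<And>r. 1 \<le> r \<Longrightarrow> r < m \<Longrightarrow> s r = []) \<Longrightarrow>
           rb c s (poly q (sz z)) (s(0 := ser (stp z)))"
    and N: "\<And>x. x \<in> set xs \<Longrightarrow> sz x \<le> N"
    and M: "\<And>n. sz (fold (\<lambda>x s. stp (x, s)) (take n xs) acc) \<le> M"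
    and s: "\<And>r. r < m + 4 \<Longrightarrow> r \<noteq> m \<Longrightarrow> r \<noteq> m + 1 \<Longrightarrow> s r = []" "s m = ser xs" "s (m + 1) = ser acc"
  shows "rb (While (Top m {Some True}) (Seq (Pop m) (Seq (mv2 (m+1) 0 (m+2)) (Seq (split m (m+2) (m+3))
            (Seq (mv (m+2) 0) (Seq (Push 0 True) (Seq c (mv2 0 (m+1) (m+2)))))))))
     s (length xs * (poly q (1 + N + M) + 24 * M + 13 * N + 20) + 1)
     (s(m := ser ([] :: 'a list), m + 1 := ser (fold (\<lambda>x s. stp (x, s)) xs acc)))"
    (is "rb (While ?t ?body) _ _ _")
  using N M s
proof (induction xs arbitrary: acc s)
  case Nil
  show ?case by (rule rb_conv[OF rb_while_end])
    (use Nil in \<open>auto simp: fun_eq_iff ser_def tr_simps\<close>)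
next
  case (Cons x xs)
  have sm: "s m = True # ser x @ ser xs" using Cons.prems by (simp add: ser_def tr_simps)
  have M0: "sz acc \<le> M" using Cons.prems(2)[of 0] by simp
  have M1: "sz (stp (x, acc)) \<le> M" using Cons.prems(2)[of 1] by simp
  have Nx: "sz x \<le> N" using Cons.prems(1) by simp
  let ?s1 = "s(m := ser x @ ser xs)"
  have 1: "rb (Pop m) s 1 ?s1" by (rule rb_conv[OF rb_pop]) (use sm in auto)
  let ?s2 = "?s1(m + 1 := [], 0 := ser acc)"
  have 2: "rb (mv2 (m+1) 0 (m+2)) ?s1 (12 * M + 2) ?s2"
    by (rule rb_conv[OF rb_mv2]) (use f(1) Cons.prems(3-) M0 in \<open>auto simp: fun_eq_iff\<close>)
  let ?s3 = "?s2(m := ser xs, m + 2 := rev (ser x))"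
  have 3: "rb (split m (m+2) (m+3)) ?s2 (7 * N + 2) ?s3"
    by (rule rb_conv[OF rb_split[where t = "tr x" and rest = "ser xs"]])
       (use f(1) Cons.prems(3-) Nx in \<open>auto simp: fun_eq_iff ser_def sz_def\<close>)
  let ?s4 = "?s3(m + 2 := [], 0 := ser x @ ser acc)"
  have 4: "rb (mv (m+2) 0) ?s3 (6 * N + 1) ?s4"
    by (rule rb_conv[OF rb_mv]) (use f(1) Cons.prems(3-) Nx in \<open>auto simp: fun_eq_iff\<close>)
  let ?s5 = "?s4(0 := ser (x, acc))"
  have 5: "rb (Push 0 True) ?s4 1 ?s5"
    by (rule rb_conv[OF rb_push]) (use f(1) Cons.prems(3-) in \<open>auto simp: fun_eq_iff ser_def tr_simps\<close>)
  let ?s6 = "?s5(0 := ser (stp (x, acc)))"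
  have "rb c ?s5 (poly q (sz (x, acc))) ?s6"
    by (rule f(3)) (use f(1) Cons.prems(3-) in auto)
  then have 6: "rb c ?s5 (poly q (1 + N + M)) ?s6"
    by (rule rb_conv) (use Nx M0 in \<open>auto intro: poly_nat_mono\<close>)
  let ?s7 = "s(m := ser xs, m + 1 := ser (stp (x, acc)))"
  have 7: "rb (mv2 0 (m+1) (m+2)) ?s6 (12 * M + 2) ?s7"
    by (rule rb_conv[OF rb_mv2]) (use f(1) Cons.prems(3-) M1 in \<open>auto simp: fun_eq_iff\<close>)
  have body: "rb ?body s (poly q (1 + N + M) + 24 * M + 13 * N + 18) ?s7"
    by (rule rb_conv[OF rb_seq[OF 1 rb_seq[OF 2 rb_seq[OF 3 rb_seq[OF 4 rb_seq[OF 5 rb_seq[OF 6 7]]]]]]]) auto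
  have rest: "rb (While ?t ?body) ?s7 (length xs * (poly q (1 + N + M) + 24 * M + 13 * N + 20) + 1)
      (?s7(m := ser ([] :: 'a list), m + 1 := ser (fold (\<lambda>x s. stp (x, s)) xs (stp (x, acc)))))"
  proof (rule Cons.IH)
    show "sz (fold (\<lambda>x s. stp (x, s)) (take n xs) (stp (x, acc))) \<le> M" for n
      using Cons.prems(2)[of "Suc n"] by simp
  qed (use Cons.prems in auto)
  show ?case
    by (rule rb_conv[OF rb_while_step[OF _ body rest]]) (use sm in \<open>auto simp: fun_eq_iff\<close>)
qed

text \<open>Bounded recursion in the style of Cobham. Iterating a polynomial step alone would allow
  repeated doubling; the size bound on all intermediate results excludes this.\<close>

lemma PFon_fold_base:
  fixes stp :: "'a :: enc \<times> 's :: enc \<Rightarrow> 's"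
  assumes "PF stp"
    and bound: "\<And>xs s n. (xs, s) \<in> D \<Longrightarrow> sz (fold (\<lambda>x s. stp (x, s)) (take n xs) s) \<le> poly Q (sz (xs, s))"
  shows "PFon D (\<lambda>p. fold (\<lambda>x s. stp (x, s)) (fst p) (snd p))"
proof -
  from assms(1) obtain c m q where f: "0 < m" "com_regs m c" "\<And>z s. s 0 = ser z \<Longrightarrow> (\<And>r. 1 \<le> r \<Longrightarrow> r < m \<Longrightarrow> s r = []) \<Longrightarrow>
           rb c s (poly q (sz z)) (s(0 := ser (stp z)))" by (rule PFonE) blast
  let ?body = "Seq (Pop m) (Seq (mv2 (m+1) 0 (m+2)) (Seq (split m (m+2) (m+3))
            (Seq (mv (m+2) 0) (Seq (Push 0 True) (Seq c (mv2 0 (m+1) (m+2)))))))"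
  define P where "P = Seq (Pop 0) (Seq (split 0 (m+2) (m+3)) (Seq (mv (m+2) m) (Seq (mv2 0 (m+1) (m+2))
     (Seq (While (Top m {Some True}) ?body) (Seq (Pop m) (mv2 (m+1) 0 (m+2)))))))"
  define W where "W n = n * (poly q (1 + n + poly Q n) + 24 * poly Q n + 13 * n + 20) + 1" for n
  show ?thesis
  proof (rule PFonI)
    show "0 < m + 4" by simp
    show "com_regs (m + 4) P" using f(1,2) by (auto simp: P_def intro: com_regs_mono)
    show "pbd (\<lambda>n. 1 + ((7 * n + 2) + ((6 * n + 1) + ((12 * n + 2) + (W n + (1 + (12 * poly Q n + 2)))))))"
      unfolding W_def by (intro pbd_intros)
    fix x and s :: store
    assume x: "x \<in> D" and s: "s 0 = ser x" "\<And>r. 1 \<le> r \<Longrightarrow> r < m + 4 \<Longrightarrow> s r = []"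
    obtain xs acc where xa: "x = (xs, acc)" by (cases x)
    let ?r = "fold (\<lambda>x s. stp (x, s)) xs acc"
    have b: "sz (fold (\<lambda>x s. stp (x, s)) (take n xs) acc) \<le> poly Q (sz x)" for n
      using bound x xa by auto
    from b[of "length xs"] have br: "sz ?r \<le> poly Q (sz x)" by simp
    let ?s1 = "s(0 := ser xs @ ser acc)"
    have 1: "rb (Pop 0) s 1 ?s1" by (rule rb_conv[OF rb_pop]) (use s xa in \<open>auto simp: ser_def tr_simps\<close>)
    let ?s2 = "?s1(0 := ser acc, m + 2 := rev (ser xs))"
    have 2: "rb (split 0 (m+2) (m+3)) ?s1 (7 * sz x + 2) ?s2"
      by (rule rb_conv[OF rb_split[where t = "tr xs" and rest = "ser acc"]])
         (use f(1) s xa in \<open>auto simp: fun_eq_iff ser_def sz_def tr_simps\<close>)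
    let ?s3 = "?s2(m + 2 := [], m := ser xs)"
    have 3: "rb (mv (m+2) m) ?s2 (6 * sz x + 1) ?s3"
      by (rule rb_conv[OF rb_mv]) (use f(1) s xa in \<open>auto simp: fun_eq_iff\<close>)
    let ?s4 = "s(0 := [], m := ser xs, m + 1 := ser acc)"
    have 4: "rb (mv2 0 (m+1) (m+2)) ?s3 (12 * sz x + 2) ?s4"
      by (rule rb_conv[OF rb_mv2]) (use f(1) s xa in \<open>auto simp: fun_eq_iff\<close>)
    let ?s5 = "?s4(m := ser ([] :: 'a list), m + 1 := ser ?r)"
    have "rb (While (Top m {Some True}) ?body) ?s4
       (length xs * (poly q (1 + sz x + poly Q (sz x)) + 24 * poly Q (sz x) + 13 * sz x + 20) + 1) ?s5"
    proof (rule rb_fold_loop[OF f])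
      show "sz y \<le> sz x" if "y \<in> set xs" for y using sz_mem[OF that] xa by simp
    qed (use f(1) s b in auto)
    moreover have "length xs \<le> sz x" using length_le_sz[of xs] xa by simp
    then have "length xs * (poly q (1 + sz x + poly Q (sz x)) + 24 * poly Q (sz x) + 13 * sz x + 20) + 1 \<le> W (sz x)"
      unfolding W_def by (intro add_mono mult_le_mono1 order_refl)
    ultimately have 5: "rb (While (Top m {Some True}) ?body) ?s4 (W (sz x)) ?s5"
      by (rule rb_conv) simp
    let ?s6 = "?s5(m := [])"
    have 6: "rb (Pop m) ?s5 1 ?s6" by (rule rb_conv[OF rb_pop]) (auto simp: ser_def)
    have 7: "rb (mv2 (m+1) 0 (m+2)) ?s6 (12 * poly Q (sz x) + 2) (s(0 := ser ?r))"
      by (rule rb_conv[OF rb_mv2]) (use f(1) s br in \<open>auto simp: fun_eq_iff\<close>)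
    show "rb P s (1 + ((7 * sz x + 2) + ((6 * sz x + 1) + ((12 * sz x + 2) + (W (sz x) + (1 + (12 * poly Q (sz x) + 2)))))))
        (s(0 := ser (fold (\<lambda>x s. stp (x, s)) (fst x) (snd x))))"
      unfolding P_def xa fst_conv snd_conv
      using rb_seq[OF 1 rb_seq[OF 2 rb_seq[OF 3 rb_seq[OF 4 rb_seq[OF 5 rb_seq[OF 6 7]]]]]] xa by simp
  qed
qed

named_theorems PF_intro

lemma PF_fst [PF_intro]: "PFon D f \<Longrightarrow> PFon D (\<lambda>x. fst (f x))"
  by (rule PF_comp[of fst]) (rule PF_tree[OF PF_left], simp add: tr_prod_def)

lemma PF_snd [PF_intro]: "PFon D f \<Longrightarrow> PFon D (\<lambda>x. snd (f x))"
  by (rule PF_comp[of snd]) (rule PF_tree[OF PF_right], simp add: tr_prod_def)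

lemmas [PF_intro] = PF_id PF_const PF_pair

lemma PF_comp2: "PF (\<lambda>z. F (fst z) (snd z)) \<Longrightarrow> PFon D f \<Longrightarrow> PFon D g \<Longrightarrow> PFon D (\<lambda>x. F (f x) (g x))"
  using PF_comp[OF _ PF_pair, of "\<lambda>z. F (fst z) (snd z)" D f g] by simp

lemma PF_comp3: "PF (\<lambda>z. F (fst z) (fst (snd z)) (snd (snd z))) \<Longrightarrow> PFon D f \<Longrightarrow> PFon D g \<Longrightarrow> PFon D h \<Longrightarrow>
    PFon D (\<lambda>x. F (f x) (g x) (h x))"
  using PF_comp[OF _ PF_pair[OF _ PF_pair], of "\<lambda>z. F (fst z) (fst (snd z)) (snd (snd z))" D f g h] by simp

lemma PF_eq [PF_intro]:
  fixes f g :: "'a :: enc \<Rightarrow> 'b :: enc"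
  assumes "PFon D f" "PFon D g"
  shows "PFon D (\<lambda>x. f x = g x)"
proof (rule PF_comp2[OF _ assms])
  show "PF (\<lambda>z :: 'b \<times> 'b. fst z = snd z)"
  proof (rule PFon_transfer[OF PF_eq_pair])
    fix x :: "'b \<times> 'b"
    show "\<exists>y \<in> UNIV :: (tree \<times> tree) set. tr y = tr x \<and> tr (fst y = snd y) = tr (fst x = snd x)"
      by (rule bexI[of _ "(tr (fst x), tr (snd x))"]) (simp_all add: tr_prod_def tr_tree_def)
  qed
qed

lemma PF_if' [PF_intro]:
  assumes "PFon D h" "PFon D f" "PFon D g"
  shows "PFon D (\<lambda>x. if h x then f x else g x)"
  by (rule PF_if[OF assms(1) PFon_subset[OF assms(2)] PFon_subset[OF assms(3)]]) auto

lemma PF_not [PF_intro]: "PFon D f \<Longrightarrow> PFon D (\<lambda>x. \<not> f x)"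
  by (rule PFon_cong[OF PF_if'[of D f "\<lambda>_. False" "\<lambda>_. True"]]) (auto intro: PF_const)

lemma PF_conj [PF_intro]: "PFon D f \<Longrightarrow> PFon D g \<Longrightarrow> PFon D (\<lambda>x. f x \<and> g x)"
  by (rule PFon_cong[OF PF_if'[of D f g "\<lambda>_. False"]]) (auto intro: PF_const)

lemma PF_disj [PF_intro]: "PFon D f \<Longrightarrow> PFon D g \<Longrightarrow> PFon D (\<lambda>x. f x \<or> g x)"
  by (rule PFon_cong[OF PF_if'[of D f "\<lambda>_. True" g]]) (auto intro: PF_const)

lemma PF_imp [PF_intro]: "PFon D f \<Longrightarrow> PFon D g \<Longrightarrow> PFon D (\<lambda>x. f x \<longrightarrow> g x)"
  by (rule PFon_cong[OF PF_if'[of D f g "\<lambda>_. True"]]) (auto intro: PF_const)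

lemma PF_Cons [PF_intro]:
  fixes f :: "'a :: enc \<Rightarrow> 'b :: enc"
  assumes "PFon D f" "PFon D g"
  shows "PFon D (\<lambda>x. f x # g x)"
proof (rule PF_comp2[OF _ assms])
  show "PF (\<lambda>z :: 'b \<times> 'b list. fst z # snd z)"
  proof (rule PFon_transfer[OF PF_id])
    fix x :: "'b \<times> 'b list"
    show "\<exists>y \<in> UNIV :: ('b \<times> 'b list) set. tr y = tr x \<and> tr y = tr (fst x # snd x)"
      by (rule bexI[of _ x]) (simp_all add: tr_prod_def)
  qed
qed

lemma PF_hd [PF_intro]:
  fixes f :: "'a :: enc \<Rightarrow> ('b :: enc) list"
  assumes "PFon D f"
  shows "PFon D (\<lambda>x. hd (f x))"
proof (rule PF_comp[OF _ assms])
  have "PFon {xs. xs \<noteq> []} (hd :: 'b list \<Rightarrow> 'b)"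
    by (rule PFon_transfer[OF PF_left]) (auto simp: tr_tree_def neq_Nil_conv)
  \<comment> \<open>\<open>hd []\<close> is unspecified but fixed, hence a constant of the
    program.\<close>
  then have "PF (\<lambda>xs :: 'b list. if xs = [] then hd [] else hd xs)"
    by (intro PF_if) (auto intro: PF_eq PF_id PF_const)
  then show "PF (hd :: 'b list \<Rightarrow> 'b)" by (rule PFon_cong) simp
qed

lemma PF_tl [PF_intro]: "PFon D f \<Longrightarrow> PFon D (\<lambda>x. tl (f x))"
  by (rule PF_comp[of tl], rule PF_tree[OF PF_right]) (case_tac x; simp)

lemma PF_Suc [PF_intro]: "PFon D f \<Longrightarrow> PFon D (\<lambda>x. Suc (f x))"
proof (rule PF_comp[of Suc])
  have "PF (\<lambda>x :: tree. (Leaf, x))" by (intro PF_intro)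
  then show "PF Suc" by (rule PFon_transfer) (auto simp: tr_simps tr_tree_def)
qed

lemma PF_replicate_unit [PF_intro]: "PFon D f \<Longrightarrow> PFon D (\<lambda>x. replicate (f x) ())"
  by (rule PF_comp[of "\<lambda>n. replicate n ()"], rule PF_tree[OF PF_id]) (auto simp: tr_nat_def)

lemma PF_the [PF_intro]:
  fixes f :: "'a :: enc \<Rightarrow> ('b :: enc) option"
  assumes "PFon D f"
  shows "PFon D (\<lambda>x. the (f x))"
proof (rule PF_comp[OF _ assms])
  have "PFon {x. x \<noteq> None} (the :: 'b option \<Rightarrow> 'b)"
    by (rule PFon_transfer[OF PF_left]) (auto simp: tr_tree_def tr_simps)
  then have "PF (\<lambda>x :: 'b option. if x = None then the None else the x)"
    by (intro PF_if) (auto intro: PF_eq PF_id PF_const)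
  then show "PF (the :: 'b option \<Rightarrow> 'b)" by (rule PFon_cong) simp
qed

lemma PFon_fold:
  fixes b :: "'e :: enc \<Rightarrow> 'x :: enc \<Rightarrow> 's :: enc \<Rightarrow> 's"
  assumes l: "PFon D l" and i: "PFon D i" and b: "PF (\<lambda>z. b (fst z) (fst (snd z)) (snd (snd z)))"
    and bound: "\<And>e n. e \<in> D \<Longrightarrow> sz (fold (b e) (take n (l e)) (i e)) \<le> poly Q (sz e)"
  shows "PFon D (\<lambda>e. fold (b e) (l e) (i e))"
proof -
  \<comment> \<open>The step function of the loop has no parameters, so the environment
    \<open>e\<close> travels in the accumulator.\<close>
  define stp where "stp = (\<lambda>(x, e, s). (e, b e x s))"
  have fold_stp: "fold (\<lambda>x s. stp (x, s)) xs (e, s) = (e, fold (b e) xs s)" for xs e s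
    by (induction xs arbitrary: s) (auto simp: stp_def)
  have "PF stp"
  proof -
    have a: "PF (\<lambda>z :: 'x \<times> 'e \<times> 's. (fst (snd z), fst z, snd (snd z)))" by (intro PF_intro)
    have "PF (\<lambda>z :: 'x \<times> 'e \<times> 's. (fst (snd z), b (fst (snd z)) (fst z) (snd (snd z))))"
      using PF_comp[OF b a] by (intro PF_intro) simp
    then show ?thesis by (rule PFon_cong) (auto simp: stp_def)
  qed
  then have f: "PFon ((\<lambda>e. (l e, e, i e)) ` D) (\<lambda>p. fold (\<lambda>x s. stp (x, s)) (fst p) (snd p))"
  proof (rule PFon_fold_base)
    fix xs s n assume "(xs, s) \<in> (\<lambda>e. (l e, e, i e)) ` D"
    then obtain e where e: "e \<in> D" "xs = l e" "s = (e, i e)" by auto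
    have "poly Q (sz e) \<le> poly Q (sz (l e, e, i e))" by (rule poly_nat_mono) simp
    with bound[OF e(1), of n] show "sz (fold (\<lambda>x s. stp (x, s)) (take n xs) s) \<le> poly ([:1, 1:] + Q) (sz (xs, s))"
      by (simp add: e fold_stp)
  qed
  have "PFon D (\<lambda>e. snd (fold (\<lambda>x s. stp (x, s)) (fst (l e, e, i e)) (snd (l e, e, i e))))"
    by (rule PF_snd, rule PFon_comp[OF _ f], intro PF_intro l i) simp
  then show ?thesis by (simp add: fold_stp)
qed

text \<open>The growth per round depends on \<open>e\<close> and \<open>x\<close> but not on
  \<open>s\<close>, so the increments add up over the rounds instead of compounding.\<close>

lemma PFon_fold_add:
  fixes b :: "'e :: enc \<Rightarrow> 'x :: enc \<Rightarrow> 's :: enc \<Rightarrow> 's"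
  assumes l: "PFon D l" and i: "PFon D i" and b: "PF (\<lambda>z. b (fst z) (fst (snd z)) (snd (snd z)))"
    and growth: "\<And>e x s. sz (b e x s) \<le> sz s + poly q (sz e + sz x)"
  shows "PFon D (\<lambda>e. fold (b e) (l e) (i e))"
proof -
  from PFon_size[OF l] obtain p where p: "\<And>e. e \<in> D \<Longrightarrow> sz (l e) \<le> poly p (sz e)" by blast
  from PFon_size[OF i] obtain p' where p': "\<And>e. e \<in> D \<Longrightarrow> sz (i e) \<le> poly p' (sz e)" by blast
  have grow: "sz (fold (b e) xs s) \<le> sz s + length xs * poly q (sz e + N)" if "\<And>x. x \<in> set xs \<Longrightarrow> sz x \<le> N" for e xs s N
    using that
  proof (induction xs arbitrary: s)
    case (Cons x xs)
    have "sz (b e x s) \<le> sz s + poly q (sz e + N)"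
      by (rule order_trans[OF growth]) (use Cons.prems in \<open>auto intro: poly_nat_mono\<close>)
    with Cons.IH[of "b e x s"] Cons.prems show ?case by simp
  qed simp
  have "pbd (\<lambda>n. poly p' n + poly p n * poly q (n + poly p n))" by (intro pbd_intros)
  then obtain Q where Q: "\<And>n. poly p' n + poly p n * poly q (n + poly p n) \<le> poly Q n"
    unfolding pbd_def by blast
  show ?thesis
  proof (rule PFon_fold[OF l i b])
    fix e n assume e: "e \<in> D"
    have 1: "sz x \<le> poly p (sz e)" if "x \<in> set (take n (l e))" for x
      using that p[OF e] sz_mem[of x "l e"] by (auto dest: in_set_takeD)
    have 2: "length (take n (l e)) \<le> poly p (sz e)"
      using p[OF e] length_le_sz[of "l e"] by simp
    have "sz (fold (b e) (take n (l e)) (i e)) \<le> poly p' (sz e) + poly p (sz e) * poly q (sz e + poly p (sz e))"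
      using grow[where xs = "take n (l e)" and e = e and s = "i e", OF 1] p'[OF e] mult_le_mono1[OF 2, of "poly q (sz e + poly p (sz e))"] by linarith
    with Q show "sz (fold (b e) (take n (l e)) (i e)) \<le> poly Q (sz e)" by (meson le_trans)
  qed
qed

section \<open>Lists and numbers\<close>

lemma PF_rev [PF_intro]: "PFon D l \<Longrightarrow> PFon D (\<lambda>e. rev (l e))"
proof -
  assume l: "PFon D l"
  have "PFon D (\<lambda>e. fold (\<lambda>x s. x # s) (l e) [])"
    by (rule PFon_fold_add[where b = "\<lambda>e x s. x # s" and q = "[:1, 1:]"]) ((intro PF_intro l)+, simp)
  then show ?thesis by (simp add: rev_conv_fold)
qed

lemma PF_append [PF_intro]: "PFon D l \<Longrightarrow> PFon D l' \<Longrightarrow> PFon D (\<lambda>e. l e @ l' e)"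
proof -
  assume l: "PFon D l" "PFon D l'"
  have "PFon D (\<lambda>e. fold (\<lambda>x s. x # s) (rev (l e)) (l' e))"
    by (rule PFon_fold_add[where b = "\<lambda>e x s. x # s" and q = "[:1, 1:]"]) ((intro PF_intro l)+, simp)
  moreover have "fold (\<lambda>x s. x # s) (rev xs) ys = xs @ ys" for xs ys :: "'b list"
    by (induction xs) auto
  ultimately show ?thesis by simp
qed

lemma PF_map [PF_intro]:
  assumes l: "PFon D l" and F: "PF (\<lambda>z. F (fst z) (snd z))"
  shows "PFon D (\<lambda>e. map (F e) (l e))"
proof -
  from PFon_size[OF F] obtain p where p: "\<And>z. sz (F (fst z) (snd z)) \<le> poly p (sz z)" by blast
  have "PF (\<lambda>z. F (fst z) (fst (snd z)) # snd (snd z))"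
    by (intro PF_intro PF_comp2[OF F])
  then have "PFon D (\<lambda>e. fold (\<lambda>x s. F e x # s) (l e) [])"
  proof (rule PFon_fold_add[OF l PF_const, where b = "\<lambda>e x s. F e x # s"])
    show "sz (F e x # s) \<le> sz s + poly ([:1:] + pcompose p [:1, 1:]) (sz e + sz x)" for e x s
      using p[of "(e, x)"] by (simp add: poly_pcompose)
  qed
  then have "PFon D (\<lambda>e. rev (fold (\<lambda>x s. F e x # s) (l e) []))" by (rule PF_rev)
  moreover have "fold (\<lambda>x s. F e x # s) xs s = rev (map (F e) xs) @ s" for e xs s
    by (induction xs arbitrary: s) auto
  ultimately show ?thesis by simp
qed

lemma PF_filter [PF_intro]:
  assumes l: "PFon D l" and P: "PF (\<lambda>z. P (fst z) (snd z))"
  shows "PFon D (\<lambda>e. filter (P e) (l e))"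
proof -
  have "PF (\<lambda>z. if P (fst z) (fst (snd z)) then fst (snd z) # snd (snd z) else snd (snd z))"
    by (intro PF_intro PF_comp2[OF P])
  then have "PFon D (\<lambda>e. fold (\<lambda>x s. if P e x then x # s else s) (l e) [])"
    by (rule PFon_fold_add[OF l PF_const, where b = "\<lambda>e x s. if P e x then x # s else s" and q = "[:1, 1:]"]) auto
  then have "PFon D (\<lambda>e. rev (fold (\<lambda>x s. if P e x then x # s else s) (l e) []))" by (rule PF_rev)
  moreover have "fold (\<lambda>x s. if P e x then x # s else s) xs s = rev (filter (P e) xs) @ s" for e xs s
    by (induction xs arbitrary: s) auto
  ultimately show ?thesis by simp
qed

lemma PF_concat [PF_intro]: "PFon D l \<Longrightarrow> PFon D (\<lambda>e. concat (l e))"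
proof -
  assume l: "PFon D l"
  have "sz (rev x @ s) \<le> sz s + poly [:0, 1:] (sz (e :: 'c :: enc) + sz x)" for e and x s :: "'b list"
    using sz_append_le[of "rev x" s] by simp
  then have "PFon D (\<lambda>e. fold (\<lambda>x s. rev x @ s) (l e) [])"
    by (intro PFon_fold_add[where b = "\<lambda>e x s. rev x @ s"]) (intro PF_intro l)+
  then have "PFon D (\<lambda>e. rev (fold (\<lambda>x s. rev x @ s) (l e) []))" by (rule PF_rev)
  moreover have "fold (\<lambda>x s. rev x @ s) xs s = rev (concat xs) @ s" for xs and s :: "'b list"
    by (induction xs arbitrary: s) auto
  ultimately show ?thesis by simp
qed

lemma PF_length [PF_intro]: "PFon D l \<Longrightarrow> PFon D (\<lambda>e. length (l e))"
proof -
  assume l: "PFon D l"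
  have "PFon D (\<lambda>e. fold (\<lambda>x s. Suc s) (l e) 0)"
    by (rule PFon_fold_add[where b = "\<lambda>e x s. Suc s" and q = "[:2:]"]) ((intro PF_intro l)+, simp)
  moreover have "fold (\<lambda>x s. Suc s) xs n = length xs + n" for xs :: "'b list" and n
    by (induction xs arbitrary: n) auto
  ultimately show ?thesis by simp
qed

lemma PF_add [PF_intro]: "PFon D f \<Longrightarrow> PFon D g \<Longrightarrow> PFon D (\<lambda>e. f e + g e :: nat)"
proof -
  assume l: "PFon D f" "PFon D g"
  have "PFon D (\<lambda>e. length (replicate (f e) () @ replicate (g e) ()))" by (intro PF_intro l)
  then show ?thesis by simp
qed

lemma PF_mult [PF_intro]: "PFon D f \<Longrightarrow> PFon D g \<Longrightarrow> PFon D (\<lambda>e. f e * g e :: nat)"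
proof -
  assume l: "PFon D f" "PFon D g"
  have "PF (\<lambda>z :: nat \<times> nat. length (concat (map (\<lambda>_. replicate (snd z) ()) (replicate (fst z) ()))))"
    by (intro PF_intro)
  then have "PF (\<lambda>z :: nat \<times> nat. fst z * snd z)" by (simp add: length_concat comp_def sum_list_replicate)
  from PF_comp2[OF this l] show ?thesis .
qed

lemma PF_sum_list [PF_intro]: "PFon D l \<Longrightarrow> PFon D (\<lambda>e. sum_list (l e) :: nat)"
proof -
  assume l: "PFon D l"
  have "PFon D (\<lambda>e. length (concat (map (\<lambda>n. replicate n ()) (l e))))" by (intro PF_intro l)
  then show ?thesis by (simp add: length_concat comp_def)
qed

lemma PF_Ball [PF_intro]:
  assumes l: "PFon D l" and P: "PF (\<lambda>z. P (fst z) (snd z))"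
  shows "PFon D (\<lambda>e. \<forall>x \<in> set (l e). P e x)"
proof -
  have "PFon D (\<lambda>e. filter (\<lambda>x. \<not> P e x) (l e) = [])" by (intro PF_intro l PF_comp2[OF P])
  then show ?thesis by (simp add: filter_empty_conv)
qed

lemma PF_Bex [PF_intro]:
  assumes l: "PFon D l" and P: "PF (\<lambda>z. P (fst z) (snd z))"
  shows "PFon D (\<lambda>e. \<exists>x \<in> set (l e). P e x)"
proof -
  have "PFon D (\<lambda>e. filter (\<lambda>x. P e x) (l e) \<noteq> [])" by (intro PF_intro l PF_comp2[OF P])
  then show ?thesis by (simp add: filter_empty_conv)
qed

lemma PF_mem [PF_intro]: "PFon D f \<Longrightarrow> PFon D l \<Longrightarrow> PFon D (\<lambda>e. f e \<in> set (l e))"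
proof -
  assume l: "PFon D f" "PFon D l"
  have "PF (\<lambda>z :: 'b \<times> 'b list. \<exists>x \<in> set (snd z). x = fst z)" by (intro PF_intro)
  then have "PF (\<lambda>z :: 'b \<times> 'b list. fst z \<in> set (snd z))" by simp
  from PF_comp2[OF this l] show ?thesis .
qed

lemma sz_tl_le: "sz (tl s) \<le> sz s"
  by (cases s) auto

lemma PF_drop [PF_intro]: "PFon D n \<Longrightarrow> PFon D l \<Longrightarrow> PFon D (\<lambda>e. drop (n e) (l e))"
proof -
  assume l: "PFon D n" "PFon D l"
  have "PFon D (\<lambda>e. fold (\<lambda>x s. tl s) (replicate (n e) ()) (l e))"
    by (rule PFon_fold_add[where b = "\<lambda>e x s. tl s" and q = 0]) ((intro PF_intro l)+, simp add: sz_tl_le)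
  moreover have "fold (\<lambda>x s. tl s) (replicate n ()) xs = drop n xs" for n and xs :: "'b list"
    by (induction n arbitrary: xs) (auto simp: drop_Suc)
  ultimately show ?thesis by simp
qed

lemma PF_minus [PF_intro]: "PFon D f \<Longrightarrow> PFon D g \<Longrightarrow> PFon D (\<lambda>e. f e - g e :: nat)"
proof -
  assume l: "PFon D f" "PFon D g"
  have "PFon D (\<lambda>e. length (drop (g e) (replicate (f e) ())))" by (intro PF_intro l)
  then show ?thesis by simp
qed

lemma PF_le [PF_intro]: "PFon D f \<Longrightarrow> PFon D g \<Longrightarrow> PFon D (\<lambda>e. f e \<le> (g e :: nat))"
proof -
  assume l: "PFon D f" "PFon D g"
  have "PFon D (\<lambda>e. f e - g e = 0)" by (intro PF_intro l)
  then show ?thesis by simp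
qed

lemma PF_less [PF_intro]: "PFon D f \<Longrightarrow> PFon D g \<Longrightarrow> PFon D (\<lambda>e. f e < (g e :: nat))"
proof -
  assume l: "PFon D f" "PFon D g"
  have "PFon D (\<lambda>e. Suc (f e) \<le> g e)" by (intro PF_intro l)
  then show ?thesis by (simp add: Suc_le_eq)
qed

lemma PF_take [PF_intro]: "PFon D n \<Longrightarrow> PFon D l \<Longrightarrow> PFon D (\<lambda>e. take (n e) (l e))"
proof -
  assume l: "PFon D n" "PFon D l"
  have "PFon D (\<lambda>e. rev (drop (length (l e) - n e) (rev (l e))))" by (intro PF_intro l)
  moreover have "take (length xs - (length xs - n)) xs = take n xs" for xs :: "'b list" and n
    by (cases "n \<le> length xs") auto
  ultimately show ?thesis by (simp add: rev_drop)
qed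

text \<open>Indexing with a default, so that positions out of range have a known and computable
  value.\<close>

definition nthd :: "'a \<Rightarrow> 'a list \<Rightarrow> nat \<Rightarrow> 'a" where
  "nthd d xs n = (if drop n xs = [] then d else hd (drop n xs))"

lemma nthd_nth: "n < length xs \<Longrightarrow> nthd d xs n = xs ! n"
  by (simp add: nthd_def hd_drop_conv_nth)

lemma nthd_beyond: "length xs \<le> n \<Longrightarrow> nthd d xs n = d"
  by (simp add: nthd_def)

lemma PF_nthd [PF_intro]: "PFon D d \<Longrightarrow> PFon D l \<Longrightarrow> PFon D n \<Longrightarrow> PFon D (\<lambda>e. nthd (d e) (l e) (n e))"
  unfolding nthd_def by (intro PF_intro)

text \<open>The entry pushed in each round grows with the accumulator, so the additive criterion
  does not apply; the intermediate lists are bounded explicitly by a quadratic expression.\<close>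

lemma PF_upt [PF_intro]: "PFon D m \<Longrightarrow> PFon D n \<Longrightarrow> PFon D (\<lambda>e. [m e..<n e])"
proof -
  assume l: "PFon D m" "PFon D n"
  have fold: "fold (\<lambda>_ s. length s # s) (replicate n ()) xs = rev [length xs..<length xs + n] @ xs" for n xs
    by (induction n arbitrary: xs) (auto simp: upt_rec)
  have size: "sz [0..<n] \<le> 1 + n * (2 * n + 2)" for n
  proof (induction n)
    case (Suc n)
    have "sz [0..<Suc n] + 1 = sz [0..<n] + (2 * n + 3)"
      using sz_append[of "[0..<n]" "[n]"] by (simp add: sz_nat)
    with Suc show ?case by (simp add: algebra_simps)
  qed simp
  have "PFon UNIV (\<lambda>n. fold (\<lambda>_ s. length s # s) (replicate n ()) [])"
  proof (rule PFon_fold[where b = "\<lambda>e x s. length s # s"])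
    fix n m :: nat
    have le: "k * (2 * k + 2) \<le> n * (2 * n + 2)" if "k \<le> n" for k by (intro mult_le_mono) (use that in auto)
    have "fold (\<lambda>_ s. length s # s) (take m (replicate n ())) [] = rev [0..<min m n]"
      unfolding take_replicate fold by simp
    then have "sz (fold (\<lambda>_ s. length s # s) (take m (replicate n ())) []) \<le> 1 + n * (2 * n + 2)"
      using order_trans[OF size[of "min m n"]] le[of "min m n"] by simp
    also have "\<dots> \<le> poly [:1, 2, 2:] (sz n)"
      by (simp add: sz_nat algebra_simps)
    finally show "sz (fold (\<lambda>_ s. length s # s) (take m (replicate n ())) []) \<le> poly [:1, 2, 2:] (sz n)" .
  qed (intro PF_intro)+
  from PF_rev[OF this, unfolded fold] have "PF (\<lambda>n. [0..<n])" by simp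
  from PF_comp[OF this l(2)] have u: "PFon D (\<lambda>e. [0..<n e])" .
  have "PFon D (\<lambda>e. drop (m e) [0..<n e])" by (intro PF_intro l u)
  then show ?thesis by (simp add: drop_upt)
qed

lemma PF_zip [PF_intro]:
  fixes l :: "'a :: enc \<Rightarrow> 'b :: enc list" and l' :: "'a \<Rightarrow> 'c :: enc list"
  assumes l: "PFon D l" "PFon D l'"
  shows "PFon D (\<lambda>e. zip (l e) (l' e))"
proof -
  define b :: "unit \<Rightarrow> 'b \<Rightarrow> 'c list \<times> ('b \<times> 'c) list \<Rightarrow> 'c list \<times> ('b \<times> 'c) list" where
    "b e x s = (if fst s = [] then s else (tl (fst s), (x, hd (fst s)) # snd s))" for e x s
  have size: "sz (b e x s) \<le> sz s + poly [:2, 1:] (sz e + sz x)" for e x s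
    by (cases s; cases "fst s") (auto simp: b_def)
  have b: "PF (\<lambda>z. b (fst z) (fst (snd z)) (snd (snd z)))"
    unfolding b_def by (intro PF_intro)
  have "PF (\<lambda>z :: 'c list \<times> 'b list. fold (b ()) (snd z) (fst z, []))"
  proof -
    have "PF (\<lambda>z :: ('c list \<times> 'b list) \<times> 'b \<times> 'c list \<times> ('b \<times> 'c) list. b () (fst (snd z)) (snd (snd z)))"
      unfolding b_def by (intro PF_intro)
    then show ?thesis
    proof (rule PFon_fold_add[of UNIV "\<lambda>z :: 'c list \<times> 'b list. snd z" "\<lambda>z. (fst z, [])" "\<lambda>e x s. b () x s" "[:2, 1:]", rotated 2])
      show "sz (b () x s) \<le> sz s + poly [:2, 1:] (sz e + sz x)" for e :: "'c list \<times> 'b list" and x s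
        by (rule order_trans[OF size]) simp
    qed (intro PF_intro)+
  qed
  then have "PF (\<lambda>z :: 'c list \<times> 'b list. rev (snd (fold (b ()) (snd z) (fst z, []))))" by (intro PF_intro)
  moreover have "rev (snd (fold (b ()) xs (ys, acc))) = rev acc @ zip xs ys" for xs ys acc
  proof (induction xs arbitrary: ys acc)
    case (Cons x xs)
    note IH = Cons.IH
    show ?case
    proof (cases ys)
      case Nil
      have "fold (b ()) xs ([], acc) = ([], acc)" by (induction xs) (auto simp: b_def)
      moreover have "b () x ([], acc) = ([], acc)" by (simp add: b_def)
      ultimately show ?thesis using Nil by simp
    next
      case (Cons y ys')
      then have "b () x (ys, acc) = (ys', (x, y) # acc)" by (simp add: b_def)
      with IH[of ys' "(x, y) # acc"] Cons show ?thesis by simp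
    qed
  qed simp
  ultimately have "PF (\<lambda>z :: 'c list \<times> 'b list. zip (snd z) (fst z))" by simp
  from PF_comp2[OF this l(2,1)] show ?thesis .
qed

lemma PF_option_case [PF_intro]:
  assumes "PFon D f" "PFon D a" "PF (\<lambda>z. b (fst z) (snd z))"
  shows "PFon D (\<lambda>x. case f x of None \<Rightarrow> a x | Some y \<Rightarrow> b x y)"
proof -
  have "PFon D (\<lambda>x. if f x = None then a x else b x (the (f x)))"
    by (intro PF_intro PF_comp2[OF assms(3)] assms(1,2))
  then show ?thesis by (rule PFon_cong) (auto split: option.splits)
qed

text \<open>A finite table is a nest of conditionals. The range is controlled as well, since the
  simulation of machines needs a uniform bound on the size of the entries.\<close>

lemma PF_finite:
  assumes "finite A"
  shows "\<exists>g. PF g \<and> (\<forall>x \<in> A. g x = f x) \<and> range g \<subseteq> insert d (f ` A)"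
  using assms
proof (induction A)
  case empty
  show ?case by (intro exI[of _ "\<lambda>_. d"]) (auto intro: PF_const)
next
  case (insert a A)
  then obtain g where "PF g" "\<forall>x \<in> A. g x = f x" "range g \<subseteq> insert d (f ` A)" by blast
  then show ?case
    by (intro exI[of _ "\<lambda>x. if x = a then f a else g x"]) (auto intro!: PF_intro)
qed

lemma PF_finite_UNIV: "PF f" for f :: "'a :: {enc, finite} \<Rightarrow> 'b :: enc"
proof -
  obtain g where "PF g" "\<forall>x \<in> UNIV. g x = f x" using PF_finite[OF finite[of UNIV], where f = f] by blast
  then show ?thesis by (simp add: PFon_cong)
qed

lemma PF_funpow:
  fixes F :: "'e :: enc \<Rightarrow> 's :: enc \<Rightarrow> 's"
  assumes n: "PFon D n" and i: "PFon D i" and F: "PF (\<lambda>z. F (fst z) (snd z))"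
    and growth: "\<And>e s. sz (F e s) \<le> sz s + poly q (sz e)"
  shows "PFon D (\<lambda>e. (F e ^^ n e) (i e))"
proof -
  have "PF (\<lambda>z. F (fst z) (snd (snd z)))" by (intro PF_intro PF_comp2[OF F])
  moreover have "PFon D (\<lambda>e. replicate (n e) ())" by (intro PF_intro n)
  ultimately have "PFon D (\<lambda>e. fold (\<lambda>_. F e) (replicate (n e) ()) (i e))"
    using i
  proof (intro PFon_fold_add[where b = "\<lambda>e _ s. F e s" and q = q])
    show "sz (F e s) \<le> sz s + poly q (sz e + sz x)" for e x s
      by (rule order_trans[OF growth]) (simp add: poly_nat_mono)
  qed
  moreover have "fold (\<lambda>_. F e) (replicate n ()) s = (F e ^^ n) s" for e n s
    by (induction n arbitrary: s) (auto simp: funpow_swap1)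
  ultimately show ?thesis by simp
qed

lemma PF_poly [PF_intro]: "PFon D f \<Longrightarrow> PFon D (\<lambda>x. poly q (f x) :: nat)"
proof (rule PF_comp[of "poly q"])
  show "PF (\<lambda>n. poly q n)"
  proof (induction q)
    case 0
    show ?case by (simp add: PF_const)
  next
    case (pCons a q)
    have "PF (\<lambda>n. a + n * poly q n)" by (intro PF_intro pCons.IH)
    then show ?case by simp
  qed
qed

section \<open>Reading the input tape and writing the output tape\<close>

definition exb :: "bool list \<Rightarrow> com \<Rightarrow> mstate \<Rightarrow> nat \<Rightarrow> mstate \<Rightarrow> bool" where
  "exb x c st T st' \<longleftrightarrow> (\<exists>t \<le> T. exec x c st t st')"

lemma exb_rb: "rb c s T s' \<Longrightarrow> exb x c (i, out, s) T (i, out, s')"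
  unfolding rb_def exb_def by blast

lemma exb_conv: "exb x c st T st' \<Longrightarrow> T \<le> T' \<Longrightarrow> st' = st'' \<Longrightarrow> exb x c st T' st''"
  unfolding exb_def by (meson le_trans)

lemma exb_move: "exb x (MoveIn d) (i, out, s) 1 (min (move_head d i) (length x + 1), out, s)"
  unfolding exb_def using exec.MoveIn by blast

lemma exb_emit: "exb x (Emit b) (i, out, s) 1 (i, out @ [b], s)"
  unfolding exb_def using exec.Emit by blast

lemma exb_seq: "exb x c st T st' \<Longrightarrow> exb x d st' T' st'' \<Longrightarrow> exb x (Seq c d) st (T + T') st''"
  unfolding exb_def by (metis add_mono exec.Seq)

lemma exb_cond_true: "holds x b st \<Longrightarrow> exb x c st T st' \<Longrightarrow> exb x (Cond b c d) st (T + 2) st'"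
  unfolding exb_def by (metis add_mono le_refl exec.CondTrue)

lemma exb_cond_false: "\<not> holds x b st \<Longrightarrow> exb x d st T st' \<Longrightarrow> exb x (Cond b c d) st (T + 2) st'"
  unfolding exb_def by (metis add_mono le_refl exec.CondFalse)

lemma exb_while_end: "\<not> holds x b st \<Longrightarrow> exb x (While b c) st 1 st"
  unfolding exb_def by (metis le_refl exec.WhileFalse)

lemma exb_while_step: "holds x b st \<Longrightarrow> exb x c st T st' \<Longrightarrow> exb x (While b c) st' T' st'' \<Longrightarrow>
    exb x (While b c) st (T + T' + 2) st''"
  unfolding exb_def
proof clarify
  fix t t' assume "holds x b st" "t \<le> T" "exec x c st t st'" "t' \<le> T'" "exec x (While b c) st' t' st''"
  then show "\<exists>t\<le>T + T' + 2. exec x (While b c) st t st''"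
    by (intro exI[of _ "t + t' + 2"] conjI exec.WhileTrue) auto
qed

definition seek_end :: com where
  "seek_end = While (Inp {LeftEnd, InBit True, InBit False}) (MoveIn MoveRight)"

lemma exb_seek_end: "i + k = length x + 1 \<Longrightarrow> exb x seek_end (i, out, s) (3 * k + 1) (length x + 1, out, s)"
proof (induction k arbitrary: i)
  case 0
  then show ?case unfolding seek_end_def
    by (intro exb_conv[OF exb_while_end]) (auto simp: read_input_def)
next
  case (Suc k)
  have h: "holds x (Inp {LeftEnd, InBit True, InBit False}) (i, out, s)"
    using Suc.prems by (auto simp: read_input_def)
  have m: "exb x (MoveIn MoveRight) (i, out, s) 1 (Suc i, out, s)"
    by (rule exb_conv[OF exb_move]) (use Suc.prems in auto)
  from Suc.IH[of "Suc i"] Suc.prems have "exb x seek_end (Suc i, out, s) (3 * k + 1) (length x + 1, out, s)" by simp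
  from exb_while_step[OF h m this[unfolded seek_end_def]] show ?case
    unfolding seek_end_def by (rule exb_conv) auto
qed

text \<open>The input is read from right to left, because the code of a list starts with its head
  and so has to be built from the tail.\<close>

definition load_loop :: com where
  "load_loop = While (Inp {InBit True, InBit False})
     (Seq (Cond (Inp {InBit True}) (pushes 0 (True # ser True)) (pushes 0 (True # ser False))) (MoveIn MoveLeft))"

lemma exb_load_loop: "i \<le> length x \<Longrightarrow> s 0 = ser (drop i x) \<Longrightarrow>
   exb x load_loop (i, out, s) (12 * i + 1) (0, out, s(0 := ser x))"
proof (induction i arbitrary: s)
  case 0
  then show ?case unfolding load_loop_def
    by (intro exb_conv[OF exb_while_end]) (auto simp: read_input_def)
next
  case (Suc i)
  have r: "read_input x (Suc i) = InBit (x ! i)" using Suc.prems by (simp add: read_input_def)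
  have d: "drop i x = x ! i # drop (Suc i) x" using Suc.prems by (simp add: Cons_nth_drop_Suc)
  let ?s = "s(0 := ser (drop i x))"
  have "exb x (pushes 0 (True # ser (x ! i))) (Suc i, out, s) 6 (Suc i, out, ?s)"
    by (rule exb_conv[OF exb_rb[OF rb_pushes]]) (use Suc.prems(2) in \<open>auto simp: d ser_def tr_simps tr_bool_def\<close>)
  then have e: "exb x (pushes 0 (True # ser v)) (Suc i, out, s) 6 (Suc i, out, ?s)" if "x ! i = v" for v
    using that by blast
  have "exb x (Cond (Inp {InBit True}) (pushes 0 (True # ser True)) (pushes 0 (True # ser False))) (Suc i, out, s) (6 + 2)
      (Suc i, out, ?s)"
  proof (cases "x ! i = True")
    case True
    show ?thesis by (rule exb_cond_true[OF _ e[OF True]]) (use r True in simp)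
  next
    case False
    then have f: "x ! i = False" by simp
    show ?thesis by (rule exb_cond_false[OF _ e[OF f]]) (use r f in simp)
  qed
  moreover have "exb x (MoveIn MoveLeft) (Suc i, out, ?s) 1 (i, out, ?s)"
    by (rule exb_conv[OF exb_move]) (use Suc.prems in auto)
  ultimately have b: "exb x (Seq (Cond (Inp {InBit True}) (pushes 0 (True # ser True)) (pushes 0 (True # ser False)))
     (MoveIn MoveLeft)) (Suc i, out, s) (6 + 2 + 1) (i, out, ?s)" by (rule exb_seq)
  have h: "holds x (Inp {InBit True, InBit False}) (Suc i, out, s)"
    using r by (cases "x ! i") auto
  have "exb x load_loop (i, out, ?s) (12 * i + 1) (0, out, s(0 := ser x))"
    by (rule exb_conv[OF Suc.IH]) (use Suc.prems in auto)
  from exb_while_step[OF h b this[unfolded load_loop_def]] show ?case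
    unfolding load_loop_def by (rule exb_conv) auto
qed

text \<open>\<open>True\<close> has a code of three bits and \<open>False\<close> of one, hence the
  different numbers of pops.\<close>

definition store_loop :: com where
  "store_loop = While (Top 0 {Some True}) (Seq (Pop 0) (Cond (Top 0 {Some True})
     (Seq (Pop 0) (Seq (Pop 0) (Seq (Pop 0) (Emit True)))) (Seq (Pop 0) (Emit False))))"

lemma exb_store_loop: "s 0 = ser y \<Longrightarrow>
   exb x store_loop (i, out, s) (10 * length y + 1) (i, out @ y, s(0 := ser ([] :: bool list)))"
proof (induction y arbitrary: s out)
  case Nil
  then show ?case unfolding store_loop_def
    by (intro exb_conv[OF exb_while_end]) (auto simp: ser_def)
next
  case (Cons v y)
  let ?s1 = "s(0 := ser v @ ser y)"
  let ?s2 = "s(0 := ser y)"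
  have 1: "exb x (Pop 0) (i, out, s) 1 (i, out, ?s1)"
    by (rule exb_conv[OF exb_rb[OF rb_pop]]) (use Cons.prems in \<open>auto simp: ser_def tr_simps\<close>)
  have 2: "exb x (Cond (Top 0 {Some True})
     (Seq (Pop 0) (Seq (Pop 0) (Seq (Pop 0) (Emit True)))) (Seq (Pop 0) (Emit False))) (i, out, ?s1) 6 (i, out @ [v], ?s2)"
  proof (cases v)
    case True
    show ?thesis
      by (rule exb_conv[OF exb_cond_true[OF _ exb_seq[OF exb_rb[OF rb_pop] exb_seq[OF exb_rb[OF rb_pop] exb_seq[OF exb_rb[OF rb_pop] exb_emit]]]]])
         (use True in \<open>auto simp: ser_def tr_simps\<close>)
  next
    case False
    show ?thesis
      by (rule exb_conv[OF exb_cond_false[OF _ exb_seq[OF exb_rb[OF rb_pop] exb_emit]]])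
         (use False in \<open>auto simp: ser_def tr_simps\<close>)
  qed
  have h: "holds x (Top 0 {Some True}) (i, out, s)" using Cons.prems by (simp add: ser_def tr_simps)
  have "exb x store_loop (i, out @ [v], ?s2) (10 * length y + 1) (i, out @ v # y, s(0 := ser ([] :: bool list)))"
    by (rule exb_conv[OF Cons.IH]) auto
  from exb_while_step[OF h exb_seq[OF 1 2] this[unfolded store_loop_def]] show ?case
    unfolding store_loop_def by (rule exb_conv) auto
qed

lemma sz_bool_list: "sz (x :: bool list) \<le> 4 * length x + 1"
proof (induction x)
  case (Cons b x)
  then show ?case using sz_bool_le[of b] by simp
qed simp

theorem PF_polytime_computable:
  assumes "PF (g :: bool list \<Rightarrow> bool list)"
  shows "polytime_computable g"
proof -
  from assms obtain c m q where f: "0 < m" "com_regs m c" "\<And>x s. s 0 = ser x \<Longrightarrow> (\<And>r. 1 \<le> r \<Longrightarrow> r < m \<Longrightarrow> s r = []) \<Longrightarrow>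
           rb c s (poly q (sz x)) (s(0 := ser (g x)))" by (rule PFonE) blast
  from PFon_size[OF assms] obtain p where p: "\<And>x. sz (g x) \<le> poly p (sz x)" by blast
  let ?P = "Seq seek_end (Seq (MoveIn MoveLeft) (Seq (Push 0 False) (Seq load_loop (Seq c store_loop))))"
  \<comment> \<open>\<open>4 * n + 1\<close> bounds the code size of a word of \<open>n\<close>
    bits; the summands follow the six phases of \<open>?P\<close>.\<close>
  have "pbd (\<lambda>n. (3 * (n + 1) + 1) + (1 + (1 + ((12 * n + 1) + (poly q (4 * n + 1) + (10 * poly p (4 * n + 1) + 1))))))"
    by (intro pbd_intros)
  then obtain r where r: "\<And>n. (3 * (n + 1) + 1) + (1 + (1 + ((12 * n + 1) + (poly q (4 * n + 1) + (10 * poly p (4 * n + 1) + 1))))) \<le> poly r n"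
    unfolding pbd_def by blast
  show ?thesis
  proof (rule exec_polytime_computable)
    show "com_regs m ?P" using f(1,2)
      by (simp add: seek_end_def load_loop_def store_loop_def)
    fix x
    have 1: "exb x seek_end (0, [], \<lambda>_. []) (3 * (length x + 1) + 1) (length x + 1, [], \<lambda>_. [])"
      by (rule exb_seek_end) simp
    have 2: "exb x (MoveIn MoveLeft) (length x + 1, [], \<lambda>_. []) 1 (length x, [], \<lambda>_. [])"
      by (rule exb_conv[OF exb_move]) auto
    let ?s = "(\<lambda>_. [])(0 := ser ([] :: bool list))"
    have 3: "exb x (Push 0 False) (length x, [], \<lambda>_. []) 1 (length x, [], ?s)"
      by (rule exb_conv[OF exb_rb[OF rb_push]]) (auto simp: ser_def)
    have 4: "exb x load_loop (length x, [], ?s) (12 * length x + 1) (0, [], ?s(0 := ser x))"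
      by (rule exb_load_loop) auto
    have "rb c (?s(0 := ser x)) (poly q (sz x)) (?s(0 := ser x, 0 := ser (g x)))"
      by (rule f(3)) auto
    then have 5: "exb x c (0, [], ?s(0 := ser x)) (poly q (4 * length x + 1)) (0, [], ?s(0 := ser x, 0 := ser (g x)))"
      using poly_nat_mono[OF sz_bool_list] exb_conv[OF exb_rb] by blast
    have "length (g x) \<le> poly p (4 * length x + 1)"
      using length_le_sz[of "g x"] p[of x] poly_nat_mono[OF sz_bool_list, of p x] by linarith
    then have 6: "exb x store_loop (0, [], ?s(0 := ser x, 0 := ser (g x))) (10 * poly p (4 * length x + 1) + 1)
       (0, [] @ g x, ?s(0 := ser x, 0 := ser (g x), 0 := ser ([] :: bool list)))"
      by (intro exb_conv[OF exb_store_loop]) auto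
    from exb_conv[OF exb_seq[OF 1 exb_seq[OF 2 exb_seq[OF 3 exb_seq[OF 4 exb_seq[OF 5 6]]]]] r refl]
    show "\<exists>t i s. exec x ?P (0, [], \<lambda>_. []) t (i, g x, s) \<and> t \<le> poly r (length x)"
      unfolding exb_def by auto
  qed
qed

section \<open>Simulation of Turing machines\<close>

instantiation direction :: enc
begin
definition "tr_direction d = tr (case d of MoveLeft \<Rightarrow> 0 :: nat | Stay \<Rightarrow> 1 | MoveRight \<Rightarrow> 2)"
instance by standard (simp add: tr_direction_def split: direction.splits)
end

instantiation input_symbol :: enc
begin
definition "tr_input_symbol d = tr (case d of LeftEnd \<Rightarrow> None | InBit b \<Rightarrow> Some (Some b) | RightEnd \<Rightarrow> Some None)"
instance by standard (simp add: tr_input_symbol_def split: input_symbol.splits)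
end

lemma PF_read_input [PF_intro]: "PFon D x \<Longrightarrow> PFon D i \<Longrightarrow> PFon D (\<lambda>e. read_input (x e) (i e))"
proof -
  assume l: "PFon D x" "PFon D i"
  have "PFon D (\<lambda>e. if i e = 0 then LeftEnd else if i e \<le> length (x e)
     then (if nthd False (x e) (i e - 1) then InBit True else InBit False) else RightEnd)"
    by (intro PF_intro l)
  then show ?thesis by (rule PFon_cong) (auto simp: read_input_def nthd_nth)
qed

lemma PF_move_head [PF_intro]: "PFon D d \<Longrightarrow> PFon D i \<Longrightarrow> PFon D (\<lambda>e. move_head (d e) (i e))"
proof -
  assume l: "PFon D d" "PFon D i"
  have "PFon D (\<lambda>e. if d e = MoveLeft then i e - 1 else if d e = Stay then i e else i e + 1)"
    by (intro PF_intro l)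
  then show ?thesis
  proof (rule PFon_cong)
    show "(if d e = MoveLeft then i e - 1 else if d e = Stay then i e else i e + 1) = move_head (d e) (i e)" for e
      by (cases "d e") auto
  qed
qed

type_synonym sim_tape = "nat list \<times> nat"
type_synonym action = "(nat \<times> direction \<times> (nat \<times> direction) list \<times> bool option) option"

definition sim_write :: "sim_tape \<Rightarrow> nat \<times> direction \<Rightarrow> sim_tape" where
  "sim_write t a = (take (snd t) (fst t) @ fst a # drop (Suc (snd t)) (fst t), move_head (snd a) (snd t))"

text \<open>The transition function is a parameter on tuples, to be filled by a finite table that is
  itself computable.\<close>

definition sim_step :: "(nat \<times> input_symbol \<times> nat list \<Rightarrow> action) \<Rightarrow> bool list \<Rightarrow>
    nat \<times> nat \<times> sim_tape list \<times> bool list \<Rightarrow> nat \<times> nat \<times> sim_tape list \<times> bool list" where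
  "sim_step \<delta> x c = (case \<delta> (fst c, read_input x (fst (snd c)), map (\<lambda>t. nthd 0 (fst t) (snd t)) (fst (snd (snd c)))) of
     None \<Rightarrow> c
   | Some y \<Rightarrow> (fst y,
       (if move_head (fst (snd y)) (fst (snd c)) \<le> length x + 1 then move_head (fst (snd y)) (fst (snd c)) else length x + 1),
       map (\<lambda>z. sim_write (fst z) (snd z)) (zip (fst (snd (snd c))) (fst (snd (snd y)))),
       snd (snd (snd c)) @ (case snd (snd (snd y)) of None \<Rightarrow> [] | Some v \<Rightarrow> [v])))"

lemma PF_sim_write [PF_intro]: "PFon D t \<Longrightarrow> PFon D a \<Longrightarrow> PFon D (\<lambda>e. sim_write (t e) (a e))"
  unfolding sim_write_def by (intro PF_intro)

lemma PF_sim_step: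
  assumes "PF \<delta>"
  shows "PF (\<lambda>z. sim_step \<delta> (fst z) (snd z))"
  unfolding sim_step_def by (intro PF_intro PF_comp[OF assms])

lemma sz_sim_write: "sz (sim_write t a) \<le> sz t + sz a + 4"
proof -
  obtain c h s d where ta: "t = (c, h)" "a = (s, d)" by (cases t; cases a)
  have 1: "sz (take h c @ s # drop (Suc h) c) + 1 = sz (take h c) + Suc (sz s + sz (drop (Suc h) c))"
    using sz_append[of "take h c" "s # drop (Suc h) c"] by simp
  have 2: "sz c + 1 = sz (take h c) + sz (drop h c)" using sz_append[of "take h c" "drop h c"] by simp
  have 3: "sz (drop (Suc h) c) \<le> sz (drop h c)" by (simp add: drop_Suc drop_tl sz_tl_le)
  have "move_head d h \<le> h + 1" by (cases d) auto
  with 1 2 3 show ?thesis by (auto simp: ta sim_write_def sz_nat)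
qed

lemma sz_sim_writes: "sz (map (\<lambda>z. sim_write (fst z) (snd z)) (zip ts acts)) \<le> sz ts + 5 * sz acts"
proof (induction ts acts rule: list_induct2')
  case (4 t ts a acts)
  then show ?case using sz_sim_write[of t a] sz_pos(2)[of a] by simp
qed auto

lemma sz_sim_step:
  assumes K: "\<And>z. sz (\<delta> z) \<le> K"
  shows "sz (sim_step \<delta> x c) \<le> sz c + (10 * K + 20)"
proof -
  obtain q i ts out where c: "c = (q, i, ts, out)" by (metis prod_cases4)
  show ?thesis
  proof (cases "\<delta> (fst c, read_input x (fst (snd c)), map (\<lambda>t. nthd 0 (fst t) (snd t)) (fst (snd (snd c))))")
    case None
    then show ?thesis by (simp add: sim_step_def)
  next
    case (Some y)
    obtain q' d acts b where y: "y = (q', d, acts, b)" by (metis prod_cases4)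
    from K[of "(fst c, read_input x (fst (snd c)), map (\<lambda>t. nthd 0 (fst t) (snd t)) (fst (snd (snd c))))"] Some y
    have k: "sz q' + sz acts \<le> K" by simp
    have 1: "move_head d i \<le> i + 1" by (cases d) auto
    have 2: "sz (out @ (case b of None \<Rightarrow> [] | Some v \<Rightarrow> [v])) \<le> sz out + 5"
      using sz_append_le[of out "[the b]"] sz_bool_le[of "the b"] by (cases b) auto
    have 3: "sz (if move_head d i \<le> length x + 1 then move_head d i else length x + 1) \<le> sz i + 2"
      using 1 by (simp add: sz_nat)
    have 4: "sz (map (\<lambda>z. sim_write (fst z) (snd z)) (zip ts acts)) \<le> sz ts + 5 * sz acts"
      by (rule sz_sim_writes)
    from Some y c have "sz (sim_step \<delta> x c) = Suc (sz q' + Suc (sz (if move_head d i \<le> length x + 1 then move_head d i else length x + 1)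
       + Suc (sz (map (\<lambda>z. sim_write (fst z) (snd z)) (zip ts acts)) + sz (out @ (case b of None \<Rightarrow> [] | Some v \<Rightarrow> [v])))))"
      by (simp add: sim_step_def)
    with k 2 3 4 c show ?thesis by simp
  qed
qed

definition config_ok :: "tm \<Rightarrow> config \<Rightarrow> bool" where
  "config_ok M c \<longleftrightarrow> c_state c < tm_states M \<and> length (c_tapes c) = tm_tapes M \<and>
     length (c_heads c) = tm_tapes M \<and> (\<forall>r < tm_tapes M. \<forall>j. (c_tapes c ! r) j < tm_symbols M)"

lemma config_ok_reads:
  assumes "config_ok M c"
  shows "length (tape_reads c) = tm_tapes M" "set (tape_reads c) \<subseteq> {..<tm_symbols M}"
  using assms by (auto simp: config_ok_def tape_reads_def set_conv_nth)

lemma config_ok_action: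
  assumes "wf_tm M" "config_ok M c" "next_action M x c = Some (q, d, acts, b)"
  shows "q < tm_states M" "length acts = tm_tapes M" "r < tm_tapes M \<Longrightarrow> fst (acts ! r) < tm_symbols M"
proof -
  from assms(1) have wf: "\<And>q a ws q' d acts b.
        q < tm_states M \<Longrightarrow> length ws = tm_tapes M \<Longrightarrow> set ws \<subseteq> {..<tm_symbols M} \<Longrightarrow>
        tm_delta M q a ws = Some (q', d, acts, b) \<Longrightarrow>
        q' < tm_states M \<and> length acts = tm_tapes M \<and> fst ` set acts \<subseteq> {..<tm_symbols M}"
    unfolding wf_tm_def by blast
  from assms(2) have "c_state c < tm_states M" by (simp add: config_ok_def)
  from wf[OF this config_ok_reads[OF assms(2)] assms(3)[unfolded next_action_reads]]
  have w: "q < tm_states M" "length acts = tm_tapes M" "fst ` set acts \<subseteq> {..<tm_symbols M}" by auto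
  then show "q < tm_states M" "length acts = tm_tapes M" by auto
  assume "r < tm_tapes M"
  with w show "fst (acts ! r) < tm_symbols M" by (metis image_eqI lessThan_iff nth_mem subsetD)
qed

lemma config_ok_step:
  assumes wf: "wf_tm M" and ok: "config_ok M c"
  shows "config_ok M (step M x c)"
proof (cases "next_action M x c")
  case None
  with ok show ?thesis by (simp add: step_def)
next
  case (Some y)
  obtain q d acts b where y: "y = (q, d, acts, b)" by (metis prod_cases4)
  from ok have l: "length (c_tapes c) = tm_tapes M" "length (c_heads c) = tm_tapes M" by (auto simp: config_ok_def)
  note act = config_ok_action[OF wf ok Some[unfolded y]]
  note st = step_Some[OF Some[unfolded y] l act(2)]
  from st(1,4,5,6) act(1,3) ok show ?thesis unfolding config_ok_def by auto
qed

lemma config_ok_run: "wf_tm M \<Longrightarrow> config_ok M (run M x t)"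
proof (induction t)
  case 0
  then show ?case by (auto simp: run_def init_config_def config_ok_def wf_tm_def)
next
  case (Suc t)
  then show ?case using config_ok_step[of M "run M x t" x] by (simp add: run_def)
qed

text \<open>Tapes are cut off at a fixed length \<open>L\<close>. After \<open>t\<close> steps no
  head is beyond cell \<open>t\<close>, so as long as \<open>t < L\<close> every access falls inside
  the lists; the cells beyond them are blank, which is the default given to
  \<open>nthd\<close>.\<close>

definition sim_rep :: "nat \<Rightarrow> nat \<Rightarrow> config \<Rightarrow> nat \<times> nat \<times> sim_tape list \<times> bool list \<Rightarrow> bool" where
  "sim_rep L t c s \<longleftrightarrow> c_state c = fst s \<and> c_inhead c = fst (snd s) \<and> c_output c = snd (snd (snd s)) \<and>
     length (fst (snd (snd s))) = length (c_tapes c) \<and> length (c_heads c) = length (c_tapes c) \<and>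
     (\<forall>r < length (c_tapes c). length (fst (fst (snd (snd s)) ! r)) = L \<and>
        snd (fst (snd (snd s)) ! r) = c_heads c ! r \<and> c_heads c ! r \<le> t \<and>
        (\<forall>j. (c_tapes c ! r) j = nthd 0 (fst (fst (snd (snd s)) ! r)) j))"

lemma nthd_write: "h < length c \<Longrightarrow> nthd d (take h c @ s # drop (Suc h) c) j = (if j = h then s else nthd d c j)"
proof -
  assume h: "h < length c"
  then have l: "length (take h c @ s # drop (Suc h) c) = length c" by simp
  show ?thesis
  proof (cases "j < length c")
    case True
    have "take h c @ s # drop (Suc h) c = c[h := s]" using h by (simp add: upd_conv_take_nth_drop)
    then show ?thesis using True h by (simp add: nthd_nth nth_list_update)
  next
    case False
    then show ?thesis using h l by (simp add: nthd_beyond)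
  qed
qed

lemma sim_rep_step:
  assumes wf: "wf_tm M" and ok: "config_ok M c" and rep: "sim_rep L t c s" and t: "t < L"
    and \<delta>: "\<And>q a ws. q < tm_states M \<Longrightarrow> length ws = tm_tapes M \<Longrightarrow> set ws \<subseteq> {..<tm_symbols M} \<Longrightarrow>
      \<delta> (q, a, ws) = tm_delta M q a ws"
  shows "sim_rep L (Suc t) (step M x c) (sim_step \<delta> x s)"
proof -
  obtain q i ts out where s: "s = (q, i, ts, out)" by (metis prod_cases4)
  from rep s have r: "c_state c = q" "c_inhead c = i" "c_output c = out" "length ts = length (c_tapes c)"
     "length (c_heads c) = length (c_tapes c)"
     "\<And>r. r < length (c_tapes c) \<Longrightarrow> length (fst (ts ! r)) = L"
     "\<And>r. r < length (c_tapes c) \<Longrightarrow> snd (ts ! r) = c_heads c ! r"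
     "\<And>r. r < length (c_tapes c) \<Longrightarrow> c_heads c ! r \<le> t"
     "\<And>r j. r < length (c_tapes c) \<Longrightarrow> (c_tapes c ! r) j = nthd 0 (fst (ts ! r)) j"
    unfolding sim_rep_def by auto
  have reads: "map (\<lambda>t. nthd 0 (fst t) (snd t)) ts = tape_reads c"
    by (rule nth_equalityI) (use r in \<open>auto simp: tape_reads_def\<close>)
  have "c_state c < tm_states M" using ok by (simp add: config_ok_def)
  then have d: "\<delta> (q, read_input x i, map (\<lambda>t. nthd 0 (fst t) (snd t)) ts) = next_action M x c"
    unfolding reads next_action_reads using \<delta> config_ok_reads[OF ok] r(1,2) by simp
  show ?thesis
  proof (cases "next_action M x c")
    case None
    with d rep s show ?thesis by (auto simp: sim_step_def step_def sim_rep_def intro: le_SucI)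
  next
    case (Some y)
    obtain q' dd acts b where y: "y = (q', dd, acts, b)" by (metis prod_cases4)
    from ok have l: "length (c_tapes c) = tm_tapes M" "length (c_heads c) = tm_tapes M" by (auto simp: config_ok_def)
    note act = config_ok_action[OF wf ok Some[unfolded y]]
    note st = step_Some[OF Some[unfolded y] l act(2)]
    have mh: "move_head m h \<le> Suc h" for m h by (cases m) auto
    have hL: "c_heads c ! r < L" if "r < tm_tapes M" for r using r(8)[of r] that l t by simp
    let ?ts = "map (\<lambda>z. sim_write (fst z) (snd z)) (zip ts acts)"
    let ?h = "move_head dd i"
    have e: "sim_step \<delta> x s = (q', (if ?h \<le> length x + 1 then ?h else length x + 1), ?ts,
        out @ (case b of None \<Rightarrow> [] | Some v \<Rightarrow> [v]))"
      using d Some y s by (simp add: sim_step_def)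
    have lt: "length ?ts = tm_tapes M" using r(4) l act(2) by simp
    have tn: "?ts ! r = sim_write (ts ! r) (acts ! r)" if "r < tm_tapes M" for r
      using that lt r(4) l act(2) by simp
    have "length (fst (?ts ! r)) = L \<and> snd (?ts ! r) = c_heads (step M x c) ! r \<and> c_heads (step M x c) ! r \<le> Suc t \<and>
       (\<forall>j. (c_tapes (step M x c) ! r) j = nthd 0 (fst (?ts ! r)) j)" if rm: "r < tm_tapes M" for r
    proof (intro conjI allI)
      have rl: "r < length (c_tapes c)" using rm l by simp
      show "length (fst (?ts ! r)) = L"
        using tn[OF rm] hL[OF rm] r(6,7)[OF rl] by (simp add: sim_write_def)
      show "snd (?ts ! r) = c_heads (step M x c) ! r"
        using tn[OF rm] st(7)[OF rm] r(7)[OF rl] by (simp add: sim_write_def)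
      show "c_heads (step M x c) ! r \<le> Suc t"
        using st(7)[OF rm] r(8)[OF rl] order_trans[OF mh] by simp
      fix j
      show "(c_tapes (step M x c) ! r) j = nthd 0 (fst (?ts ! r)) j"
        using tn[OF rm] st(6)[OF rm] hL[OF rm] r(6,7)[OF rl] r(9)[OF rl, of j]
        by (simp add: sim_write_def nthd_write)
    qed
    with e st lt r(2,3) show ?thesis by (auto simp: sim_rep_def)
  qed
qed

text \<open>The number of steps is an argument in unary, so it serves as the clock and fixes the
  length of the tape lists.\<close>

lemma PF_run_output:
  assumes wf: "wf_tm M"
  shows "\<exists>F. PF F \<and> (\<forall>x t. F (x, t) = c_output (run M x t))"
proof -
  let ?A = "{..<tm_states M} \<times> range InBit \<union> {..<tm_states M} \<times> {LeftEnd, RightEnd}"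
  let ?W = "{ws. set ws \<subseteq> {..<tm_symbols M} \<and> length ws = tm_tapes M}"
  define A where "A = (\<lambda>((q, a), ws). (q, a, ws)) ` (?A \<times> ?W)"
  have "finite A" unfolding A_def by (intro finite_imageI finite_cartesian_product finite_lists_length_eq) auto
  from PF_finite[OF this, where f = "\<lambda>(q, a, ws). tm_delta M q a ws" and d = None]
  obtain \<delta> where \<delta>: "PF \<delta>" "\<And>z. z \<in> A \<Longrightarrow> \<delta> z = (\<lambda>(q, a, ws). tm_delta M q a ws) z"
    "range \<delta> \<subseteq> insert None ((\<lambda>(q, a, ws). tm_delta M q a ws) ` A)" by blast
  have \<delta>': "\<delta> (q, a, ws) = tm_delta M q a ws"
    if "q < tm_states M" "length ws = tm_tapes M" "set ws \<subseteq> {..<tm_symbols M}" for q a ws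
  proof -
    have "(q, a, ws) \<in> A" unfolding A_def using that by (cases a) (auto intro!: image_eqI[of _ _ "((q, a), ws)"])
    from \<delta>(2)[OF this] show ?thesis by simp
  qed
  \<comment> \<open>Outside the table \<open>\<delta>\<close> takes no values beyond
    \<open>None\<close> and the table entries, so its values are finitely many and their sizes have
    a common bound \<open>K\<close>.\<close>
  have "finite (range \<delta>)" using \<delta>(3) \<open>finite A\<close> by (meson finite_imageI finite_insert finite_subset)
  then have "finite (sz ` range \<delta>)" by simp
  then obtain K where K: "\<And>z. sz (\<delta> z) \<le> K" by (metis finite_nat_set_iff_bounded_le imageI rangeI)
  define i0 :: "nat \<Rightarrow> nat \<times> nat \<times> sim_tape list \<times> bool list" where
    "i0 t = (0, 0, map (\<lambda>_. (map (\<lambda>_. 0) (replicate (Suc t) ()), 0)) (replicate (tm_tapes M) ()), [])" for t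
  have rep: "sim_rep (Suc t) n (run M x n) ((sim_step \<delta> x ^^ n) (i0 t))" if "n \<le> t" for n t x
    using that
  proof (induction n)
    case 0
    have "nthd 0 (replicate k 0) j = (0 :: nat)" for k j
      by (cases "j < k") (auto simp: nthd_nth nthd_beyond)
    then show ?case by (simp add: sim_rep_def run_def init_config_def i0_def del: replicate_Suc)
  next
    case (Suc n)
    then have "sim_rep (Suc t) n (run M x n) ((sim_step \<delta> x ^^ n) (i0 t))" by simp
    from sim_rep_step[OF wf config_ok_run[OF wf] this _ \<delta>', of x] Suc.prems show ?case by (simp add: run_def)
  qed
  have "PF (\<lambda>z. (sim_step \<delta> (fst z) ^^ snd z) (i0 (snd z)))"
  proof (rule PF_funpow[where F = "\<lambda>z. sim_step \<delta> (fst z)" and q = "[:10 * K + 20:]"])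
    show "PF (\<lambda>z. i0 (snd z))" unfolding i0_def by (intro PF_intro)
    show "PF (\<lambda>z. sim_step \<delta> (fst (fst z)) (snd z))"
      by (rule PF_comp2[OF PF_sim_step[OF \<delta>(1)]]) (intro PF_intro)+
    show "sz (sim_step \<delta> (fst z) s) \<le> sz s + poly [:10 * K + 20:] (sz z)" for z :: "bool list \<times> nat" and s
      using sz_sim_step[OF K] by simp
  qed (intro PF_intro)
  then have "PF (\<lambda>z. snd (snd (snd ((sim_step \<delta> (fst z) ^^ snd z) (i0 (snd z))))))" by (intro PF_intro)
  moreover have "snd (snd (snd ((sim_step \<delta> x ^^ t) (i0 t)))) = c_output (run M x t)" for x t
    using rep[of t t x] by (simp add: sim_rep_def)
  ultimately show ?thesis by (intro exI[of _ "\<lambda>z. snd (snd (snd ((sim_step \<delta> (fst z) ^^ snd z) (i0 (snd z)))))"]) auto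
qed


section \<open>Logarithmic space implies polynomial time\<close>

lemma funpow_const: "f c = c \<Longrightarrow> (f ^^ n) c = c"
  by (induction n) auto

lemma run_after_halt: "next_action M x (run M x t) = None \<Longrightarrow> t \<le> t' \<Longrightarrow> run M x t' = run M x t"
proof -
  assume h: "next_action M x (run M x t) = None" and "t \<le> t'"
  then obtain n where "t' = n + t" by (metis le_add_diff_inverse2)
  moreover have "step M x (run M x t) = run M x t" using h by (simp add: step_def)
  ultimately show ?thesis by (simp add: run_def funpow_add funpow_const)
qed

text \<open>The output is write-only and may be long, so it must not count among the configurations;
  it has no influence on the run.\<close>

definition same_but_output :: "config \<Rightarrow> config \<Rightarrow> bool" where
  "same_but_output c c' \<longleftrightarrow> c_state c = c_state c' \<and> c_inhead c = c_inhead c' \<and>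
     c_tapes c = c_tapes c' \<and> c_heads c = c_heads c'"

lemma same_but_output_action: "same_but_output c c' \<Longrightarrow> next_action M x c = next_action M x c'"
  by (simp add: same_but_output_def next_action_def)

lemma same_but_output_step: "same_but_output c c' \<Longrightarrow> same_but_output (step M x c) (step M x c')"
  using same_but_output_action[of c c' M x]
  by (auto simp: step_def same_but_output_def split: option.splits)

lemma same_but_output_steps: "same_but_output c c' \<Longrightarrow> same_but_output ((step M x ^^ n) c) ((step M x ^^ n) c')"
  by (induction n) (auto intro: same_but_output_step)

lemma run_add: "run M x (n + t) = (step M x ^^ n) (run M x t)"
  by (simp add: run_def funpow_add)

text \<open>Cutting out the part between two equal configurations would lead to a halting
  configuration before the first one.\<close>

lemma run_no_repeat:
  assumes halt: "next_action M x (run M x t) = None" and min: "\<And>t'. t' < t \<Longrightarrow> next_action M x (run M x t') \<noteq> None"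
    and "i < j" "j \<le> t"
  shows "\<not> same_but_output (run M x i) (run M x j)"
proof
  assume "same_but_output (run M x i) (run M x j)"
  then have "same_but_output (run M x ((t - j) + i)) (run M x ((t - j) + j))"
    unfolding run_add by (rule same_but_output_steps)
  with halt assms(4) have "next_action M x (run M x ((t - j) + i)) = None"
    by (simp add: same_but_output_action)
  moreover have "(t - j) + i < t" using assms(3,4) by linarith
  ultimately show False using min by blast
qed

lemma run_inhead: "c_inhead (run M x t) \<le> length x + 1"
proof (induction t)
  case 0
  then show ?case by (simp add: run_def init_config_def)
next
  case (Suc t)
  then show ?case by (auto simp: run_def step_def split: option.splits prod.splits)
qed

lemma run_tape_blank:
  assumes wf: "wf_tm M" and heads: "\<And>t r. r < tm_tapes M \<Longrightarrow> c_heads (run M x t) ! r \<le> L"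
  shows "r < tm_tapes M \<Longrightarrow> L < j \<Longrightarrow> (c_tapes (run M x t) ! r) j = 0"
proof (induction t)
  case 0
  then show ?case by (simp add: run_def init_config_def)
next
  case (Suc t)
  show ?case
  proof (cases "next_action M x (run M x t)")
    case None
    with Suc show ?thesis by (simp add: run_def step_def)
  next
    case (Some y)
    obtain q dd acts b where y: "y = (q, dd, acts, b)" by (metis prod_cases4)
    note ok = config_ok_run[OF wf, of x t]
    from ok have l: "length (c_tapes (run M x t)) = tm_tapes M" "length (c_heads (run M x t)) = tm_tapes M"
      by (auto simp: config_ok_def)
    note act = config_ok_action[OF wf ok Some[unfolded y]]
    note st = step_Some(6)[OF Some[unfolded y] l act(2) Suc.prems(1)]
    from heads[OF Suc.prems(1), of t] Suc.prems(2) have "j \<noteq> c_heads (run M x t) ! r" by auto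
    with st Suc show ?thesis by (simp add: run_def)
  qed
qed

text \<open>Up to the first halting time all configurations without output are distinct, so the time
  is at most their number. The factors count control states, input positions, tape contents and head
  positions.\<close>

lemma halting_time_bound:
  assumes wf: "wf_tm M" and halt: "next_action M x (run M x t1) = None"
    and heads: "\<And>t h. h \<in> set (c_heads (run M x t)) \<Longrightarrow> h \<le> L"
  shows "\<exists>t \<le> tm_states M * (length x + 2) * (tm_symbols M ^ Suc L) ^ tm_tapes M * Suc L ^ tm_tapes M.
     next_action M x (run M x t) = None"
proof -
  define t where "t = (LEAST t. next_action M x (run M x t) = None)"
  have halt: "next_action M x (run M x t) = None" unfolding t_def by (rule LeastI, rule halt)
  have min: "next_action M x (run M x t') \<noteq> None" if "t' < t" for t'
    using not_less_Least that unfolding t_def by blast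
  have heads': "c_heads (run M x t) ! r \<le> L" if "r < tm_tapes M" for t r
    using heads config_ok_run[OF wf, of x t] that by (metis config_ok_def nth_mem)
  \<comment> \<open>The first \<open>L + 1\<close> cells of each tape determine it, since no head
    ever gets further and the other cells are still blank.\<close>
  define code where "code c = (c_state c, c_inhead c, map (\<lambda>t. map t [0..<Suc L]) (c_tapes c), c_heads c)" for c :: config
  define S where "S = {..<tm_states M} \<times> {..<length x + 2} \<times>
     {ts. set ts \<subseteq> {ws. set ws \<subseteq> {..<tm_symbols M} \<and> length ws = Suc L} \<and> length ts = tm_tapes M} \<times>
     {hs. set hs \<subseteq> {..<Suc L} \<and> length hs = tm_tapes M}"
  have fin: "finite S" unfolding S_def by (intro finite_cartesian_product finite_lists_length_eq) auto
  have card: "card S = tm_states M * (length x + 2) * (tm_symbols M ^ Suc L) ^ tm_tapes M * Suc L ^ tm_tapes M"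
    unfolding S_def by (simp add: card_cartesian_product card_lists_length_eq finite_lists_length_eq algebra_simps del: power_Suc)
  have sub: "code (run M x t') \<in> S" for t'
  proof -
    note ok = config_ok_run[OF wf, of x t']
    have "t j < tm_symbols M" if "t \<in> set (c_tapes (run M x t'))" for t j
      using that ok by (auto simp: config_ok_def in_set_conv_nth)
    then show ?thesis using ok run_inhead[of M x t'] heads
      by (auto simp: code_def S_def config_ok_def less_Suc_eq_le simp del: upt_Suc)
  qed
  have inj: "inj_on (\<lambda>t. code (run M x t)) {..t}"
  proof (rule linorder_inj_onI)
    fix i j assume ij: "i < j" "i \<in> {..t}" "j \<in> {..t}"
    show "code (run M x i) \<noteq> code (run M x j)"
    proof
      assume c: "code (run M x i) = code (run M x j)"
      have "c_tapes (run M x i) = c_tapes (run M x j)"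
      proof (rule nth_equalityI)
        show "length (c_tapes (run M x i)) = length (c_tapes (run M x j))"
          using config_ok_run[OF wf] by (simp add: config_ok_def)
        fix r assume "r < length (c_tapes (run M x i))"
        then have r: "r < tm_tapes M" "r < length (c_tapes (run M x i))" "r < length (c_tapes (run M x j))"
          using config_ok_run[OF wf] by (simp_all add: config_ok_def)
        from c have "map (\<lambda>t. map t [0..<Suc L]) (c_tapes (run M x i)) ! r =
            map (\<lambda>t. map t [0..<Suc L]) (c_tapes (run M x j)) ! r" by (simp add: code_def)
        with r have m: "map (c_tapes (run M x i) ! r) [0..<Suc L] = map (c_tapes (run M x j) ! r) [0..<Suc L]"
          by (simp del: upt_Suc)
        show "c_tapes (run M x i) ! r = c_tapes (run M x j) ! r"
        proof
          fix k
          show "(c_tapes (run M x i) ! r) k = (c_tapes (run M x j) ! r) k"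
          proof (cases "k \<le> L")
            case True
            with m show ?thesis by (auto simp del: upt_Suc)
          next
            case False
            with run_tape_blank[OF wf heads' r(1)] show ?thesis by simp
          qed
        qed
      qed
      with c have "same_but_output (run M x i) (run M x j)" by (simp add: code_def same_but_output_def)
      with run_no_repeat[OF halt min ij(1)] ij(3) show False by simp
    qed
  qed auto
  have "card {..t} \<le> card S"
    by (rule card_inj_on_le[OF inj _ fin]) (use sub in auto)
  then have "t \<le> card S" by simp
  with halt card show ?thesis by auto
qed

lemma log_power_bound:
  fixes C n :: nat
  assumes "real L \<le> real C * log 2 (real n + 2)"
  shows "2 ^ L \<le> (n + 2) ^ C"
proof -
  have "(2 :: real) ^ L = 2 powr real L" by (simp add: powr_realpow)
  also have "\<dots> \<le> 2 powr (real C * log 2 (real n + 2))" using assms by simp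
  also have "\<dots> = (2 powr log 2 (real n + 2)) powr real C" by (simp only: powr_powr mult.commute)
  also have "\<dots> = (real n + 2) ^ C" by (simp add: powr_realpow)
  finally have "real (2 ^ L) \<le> real ((n + 2) ^ C)" by (simp add: add.commute)
  then show ?thesis by (simp only: of_nat_le_iff)
qed

text \<open>The polynomially many configurations bound the halting time. Simulating for that many
  steps gives the output, as the run is stationary after halting.\<close>

theorem logspace_PF:
  assumes "logspace_computable_on A enc_in enc_out f"
  shows "\<exists>G. PF G \<and> (\<forall>a \<in> A. G (enc_in a) = enc_out (f a))"
proof -
  from assms obtain M c where wf: "wf_tm M" and M: "\<And>a. a \<in> A \<Longrightarrow> \<exists>t. halts_with M (enc_in a) t (enc_out (f a))"
     "\<And>a t h. a \<in> A \<Longrightarrow> h \<in> set (c_heads (run M (enc_in a) t)) \<Longrightarrow>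
        real h \<le> c * log 2 (real (length (enc_in a)) + 2)"
    unfolding logspace_computable_on_def by blast
  \<comment> \<open>The given constant is an arbitrary real number; rounding up turns it into an
    exponent.\<close>
  define C where "C = nat \<lceil>c\<rceil>"
  define g where "g = tm_symbols M"
  have C: "c \<le> real C" unfolding C_def by linarith
  \<comment> \<open>Here \<open>2 * (n + 2) ^ C\<close> bounds \<open>2 ^ Suc L\<close>, hence also
    \<open>Suc L\<close>, and its \<open>g\<close>-th power bounds \<open>g ^ Suc L\<close>, because
    \<open>g \<le> 2 ^ g\<close>.\<close>
  define B where "B n = tm_states M * (n + 2) * ((2 * (n + 2) ^ C) ^ g) ^ tm_tapes M * (2 * (n + 2) ^ C) ^ tm_tapes M" for n
  have "pbd B" unfolding B_def by (intro pbd_intros)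
  then obtain q where q: "\<And>n. B n \<le> poly q n" unfolding pbd_def by blast
  have halts: "c_output (run M (enc_in a) (poly q (length (enc_in a)))) = enc_out (f a)" if a: "a \<in> A" for a
  proof -
    let ?x = "enc_in a" let ?n = "length ?x"
    define L where "L = nat \<lfloor>real C * log 2 (real ?n + 2)\<rfloor>"
    have lg: "0 \<le> log 2 (real ?n + 2)" by simp
    have L: "real L \<le> real C * log 2 (real ?n + 2)" unfolding L_def using lg by simp
    have heads: "h \<le> L" if "h \<in> set (c_heads (run M ?x t))" for t h
    proof -
      have "real h \<le> c * log 2 (real ?n + 2)" by (rule M(2)[OF a that])
      also have "\<dots> \<le> real C * log 2 (real ?n + 2)" using C lg by (rule mult_right_mono)
      finally show ?thesis unfolding L_def by linarith
    qed
    have p: "2 ^ Suc L \<le> 2 * (?n + 2) ^ C" using log_power_bound[OF L] by simp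
    have "g \<le> 2 ^ g" by (rule less_imp_le[OF less_exp])
    then have "g ^ Suc L \<le> (2 ^ g) ^ Suc L" by (rule power_mono) simp
    also have "\<dots> = (2 ^ Suc L) ^ g" by (simp only: power_mult[symmetric] mult.commute)
    also have "\<dots> \<le> (2 * (?n + 2) ^ C) ^ g" by (rule power_mono[OF p]) simp
    finally have s: "g ^ Suc L \<le> (2 * (?n + 2) ^ C) ^ g" .
    have "Suc L \<le> 2 ^ Suc L" by (rule less_imp_le[OF less_exp])
    with p have l: "Suc L \<le> 2 * (?n + 2) ^ C" by (meson le_trans)
    have bound: "tm_states M * (?n + 2) * (g ^ Suc L) ^ tm_tapes M * Suc L ^ tm_tapes M \<le> B ?n"
      unfolding B_def by (intro mult_le_mono power_mono s l order_refl) auto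
    from M(1)[OF a] obtain t0 where t0: "halts_with M ?x t0 (enc_out (f a))" by blast
    then have "next_action M ?x (run M ?x t0) = None" by (simp add: halts_with_def)
    then have "\<exists>t \<le> tm_states M * (?n + 2) * (tm_symbols M ^ Suc L) ^ tm_tapes M * Suc L ^ tm_tapes M.
       next_action M ?x (run M ?x t) = None"
      by (rule halting_time_bound[OF wf]) (rule heads)
    then obtain t where t': "t \<le> tm_states M * (?n + 2) * (g ^ Suc L) ^ tm_tapes M * Suc L ^ tm_tapes M"
      and t2: "next_action M ?x (run M ?x t) = None" unfolding g_def by blast
    have t: "t \<le> poly q ?n" using t' bound q[of ?n] by linarith
    from run_after_halt[OF t2 t] have 1: "run M ?x (poly q ?n) = run M ?x t" .
    \<comment> \<open>\<open>t\<close> is the halting time with the known bound, \<open>t0\<close>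
      the one with the known output; the run is stationary after either.\<close>
    have "run M ?x t = run M ?x t0"
    proof (cases "t \<le> t0")
      case True
      from run_after_halt[OF t2 True] show ?thesis by simp
    next
      case False
      from t0 have "next_action M ?x (run M ?x t0) = None" by (simp add: halts_with_def)
      from False show ?thesis by (intro run_after_halt[OF \<open>next_action M ?x (run M ?x t0) = None\<close>]) simp
    qed
    moreover from t0 have "c_output (run M ?x t0) = enc_out (f a)" by (simp add: halts_with_def)
    ultimately show ?thesis using 1 by simp
  qed
  from PF_run_output[OF wf] obtain F where F: "PF F" "\<And>x t. F (x, t) = c_output (run M x t)" by blast
  have "PF (\<lambda>x. F (x, poly q (length x)))" by (intro PF_intro PF_comp[OF F(1)])
  with halts show ?thesis by (intro exI[of _ "\<lambda>x. F (x, poly q (length x))"]) (simp add: F(2))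
qed

lemma PF_enc_nat [PF_intro]: "PFon D n \<Longrightarrow> PFon D (\<lambda>e. enc_nat (n e))"
proof -
  assume n: "PFon D n"
  have "PFon D (\<lambda>e. map (\<lambda>_. True) (replicate (n e) ()) @ [False])" by (intro PF_intro n)
  then show ?thesis by (simp add: enc_nat_def)
qed

lemma PF_enc_list [PF_intro]:
  assumes "PFon D l" "PF (\<lambda>z. F (fst z) (snd z))"
  shows "PFon D (\<lambda>e. enc_list (F e) (l e))"
  unfolding enc_list_def by (intro PF_intro assms(1) PF_comp2[OF assms(2)])

lemma PFon_enc_eq: "PFon D g \<Longrightarrow> (\<And>x. x \<in> D \<Longrightarrow> tr (g x) = tr (f x)) \<Longrightarrow> PFon D f"
  by (rule PFon_transfer[of D g]) auto

section \<open>From clauses to hitting sets\<close>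

type_synonym 'v clause = "'v list \<times> 'v list"

definition holds_clause :: "'v set \<Rightarrow> 'v clause \<Rightarrow> bool" where
  "holds_clause \<sigma> c \<longleftrightarrow> (set (fst c) \<subseteq> \<sigma> \<longrightarrow> set (snd c) \<inter> \<sigma> \<noteq> {})"

definition satisfiable :: "'v clause list \<Rightarrow> bool" where
  "satisfiable cs \<longleftrightarrow> (\<exists>\<sigma>. \<forall>c \<in> set cs. holds_clause \<sigma> c)"

text \<open>Repetitions are kept: \<open>index_of\<close> uses the first occurrence only, and the
  pairs at the other positions cost one element each without constraining anything.\<close>

definition clause_atoms :: "'v clause list \<Rightarrow> 'v list" where
  "clause_atoms cs = concat (map (\<lambda>c. fst c @ snd c) cs)"

definition index_of :: "'v list \<Rightarrow> 'v \<Rightarrow> nat" where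
  "index_of U a = hd (filter (\<lambda>i. nthd a U i = a) [0..<length U])"

lemma index_of:
  assumes "a \<in> set U"
  shows "index_of U a < length U" "U ! index_of U a = a"
proof -
  from assms have "filter (\<lambda>i. nthd a U i = a) [0..<length U] \<noteq> []"
    by (auto simp: filter_empty_conv in_set_conv_nth nthd_nth)
  then have "index_of U a \<in> set (filter (\<lambda>i. nthd a U i = a) [0..<length U])"
    unfolding index_of_def by (rule hd_in_set)
  then show "index_of U a < length U" "U ! index_of U a = a" by (auto simp: nthd_nth)
qed

text \<open>The atom at position \<open>i\<close> becomes \<open>2 i + 1\<close>, its negation \<open>2 i + 2\<close>; the bound allows only
  one element of each such pair.\<close>

definition clause_elems :: "'v list \<Rightarrow> 'v clause \<Rightarrow> nat list" where
  "clause_elems U c = map (\<lambda>a. 2 * index_of U a + 2) (fst c) @ map (\<lambda>a. 2 * index_of U a + 1) (snd c)"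

definition hs_lists :: "'v clause list \<Rightarrow> nat list list" where
  "hs_lists cs = map (\<lambda>i. [2 * i + 1, 2 * i + 2]) [0..<length (clause_atoms cs)] @
     map (clause_elems (clause_atoms cs)) cs"

definition hs_of_clauses :: "'v clause list \<Rightarrow> hitting_set_instance" where
  "hs_of_clauses cs = \<lparr>hs_size = 2 * length (clause_atoms cs), hs_sets = map set (hs_lists cs),
     hs_bound = length (clause_atoms cs)\<rparr>"

lemma hs_lists_range:
  assumes "xs \<in> set (hs_lists cs)"
  shows "set xs \<subseteq> {1..2 * length (clause_atoms cs)}"
  using assms index_of(1)[of _ "clause_atoms cs"]
  by (fastforce simp: hs_lists_def clause_elems_def clause_atoms_def)

lemma hs_instance_of_clauses:
  assumes "cs \<noteq> []" "\<And>c. c \<in> set cs \<Longrightarrow> fst c @ snd c \<noteq> []"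
  shows "hs_instance (hs_of_clauses cs)"
proof -
  let ?n = "length (clause_atoms cs)"
  have n: "1 \<le> ?n" using assms by (cases cs) (auto simp: clause_atoms_def Suc_le_eq)
  have ne: "xs \<noteq> []" if "xs \<in> set (hs_lists cs)" for xs
    using that assms(2) by (auto simp: hs_lists_def clause_elems_def)
  have "i \<in> \<Union> (set (map set (hs_lists cs)))" if "i \<in> {1..2 * ?n}" for i
  proof -
    have "i \<in> set [2 * ((i - 1) div 2) + 1, 2 * ((i - 1) div 2) + 2]" using that by auto
    moreover have "(i - 1) div 2 < ?n" using that by auto
    ultimately show ?thesis unfolding hs_lists_def by fastforce
  qed
  with hs_lists_range[of _ cs] have "\<Union> (set (map set (hs_lists cs))) = {1..2 * ?n}" by fastforce
  with n ne hs_lists_range[of _ cs] show ?thesis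
    unfolding hs_instance_def hs_of_clauses_def by auto
qed

lemma hs_positive_of_clauses: "hs_positive (hs_of_clauses cs) \<longleftrightarrow> satisfiable cs"
proof
  let ?U = "clause_atoms cs"
  let ?n = "length ?U"
  assume "hs_positive (hs_of_clauses cs)"
  then obtain H where H: "H \<subseteq> {1..2 * ?n}" "card H \<le> ?n" "\<And>xs. xs \<in> set (hs_lists cs) \<Longrightarrow> H \<inter> set xs \<noteq> {}"
    unfolding hs_positive_def hs_of_clauses_def by auto
  have fin: "finite H" using H(1) finite_subset by blast
  \<comment> \<open>\<open>g\<close> maps both elements of pair \<open>i\<close> to
    \<open>i\<close>. All \<open>?n\<close> pairs are hit by at most \<open>?n\<close> elements, so
    \<open>g\<close> is injective on \<open>H\<close> and no pair contributes both of its
    elements.\<close>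
  define g where "g h = (h - 1) div 2" for h :: nat
  have "{..<?n} \<subseteq> g ` H"
  proof
    fix i assume i: "i \<in> {..<?n}"
    then have "H \<inter> {2 * i + 1, 2 * i + 2} \<noteq> {}"
      using H(3)[of "[2 * i + 1, 2 * i + 2]"] by (force simp: hs_lists_def)
    then show "i \<in> g ` H" by (auto simp: g_def intro: rev_image_eqI)
  qed
  then have "?n \<le> card (g ` H)" using card_mono[of "g ` H" "{..<?n}"] fin by simp
  with H(2) card_image_le[OF fin, of g] have "card (g ` H) = card H" by simp
  then have inj: "inj_on g H" by (rule eq_card_imp_inj_on[OF fin])
  have one: "\<not> (2 * i + 1 \<in> H \<and> 2 * i + 2 \<in> H)" for i
    using inj_onD[OF inj, of "2 * i + 1" "2 * i + 2"] by (auto simp: g_def)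
  define \<sigma> where "\<sigma> = {a. 2 * index_of ?U a + 1 \<in> H}"
  have "holds_clause \<sigma> c" if "c \<in> set cs" for c
  proof -
    have "H \<inter> set (clause_elems ?U c) \<noteq> {}" using H(3) that by (auto simp: hs_lists_def)
    then show ?thesis using one by (fastforce simp: clause_elems_def holds_clause_def \<sigma>_def)
  qed
  then show "satisfiable cs" unfolding satisfiable_def by blast
next
  let ?U = "clause_atoms cs"
  let ?n = "length ?U"
  assume "satisfiable cs"
  then obtain \<sigma> where \<sigma>: "\<And>c. c \<in> set cs \<Longrightarrow> holds_clause \<sigma> c" unfolding satisfiable_def by blast
  define h where "h i = (if ?U ! i \<in> \<sigma> then 2 * i + 1 else 2 * i + 2)" for i
  let ?H = "h ` {..<?n}"
  have "?H \<subseteq> {1..2 * ?n}" by (auto simp: h_def)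
  moreover have "card ?H \<le> ?n" using card_image_le[of "{..<?n}" h] by simp
  moreover have "?H \<inter> set xs \<noteq> {}" if "xs \<in> set (hs_lists cs)" for xs
  proof -
    from that consider i where "i < ?n" "xs = [2 * i + 1, 2 * i + 2]" | c where "c \<in> set cs" "xs = clause_elems ?U c"
      by (auto simp: hs_lists_def)
    then show ?thesis
    proof cases
      case 1
      then have "h i \<in> ?H \<inter> set xs" by (auto simp: h_def)
      then show ?thesis by blast
    next
      case 2
      have U: "a \<in> set ?U" if "a \<in> set (fst c) \<union> set (snd c)" for a
        using that 2(1) by (auto simp: clause_atoms_def)
      from \<sigma>[OF 2(1)] consider a where "a \<in> set (fst c)" "a \<notin> \<sigma>" | a where "a \<in> set (snd c)" "a \<in> \<sigma>"
        unfolding holds_clause_def by blast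
      then show ?thesis
      proof cases
        case (1 a)
        with U[of a] index_of[of a ?U] have "h (index_of ?U a) \<in> ?H \<inter> set xs"
          by (auto simp: h_def 2(2) clause_elems_def)
        then show ?thesis by blast
      next
        case (2 a)
        with U[of a] index_of[of a ?U] have "h (index_of ?U a) \<in> ?H \<inter> set xs"
          by (auto simp: h_def \<open>xs = _\<close> clause_elems_def)
        then show ?thesis by blast
      qed
    qed
  qed
  ultimately show "hs_positive (hs_of_clauses cs)"
    unfolding hs_positive_def hs_of_clauses_def by (intro exI[of _ ?H]) auto
qed

lemma PF_clause_atoms [PF_intro]: "PFon D cs \<Longrightarrow> PFon D (\<lambda>e. clause_atoms (cs e))"
  unfolding clause_atoms_def by (intro PF_intro)

lemma PF_index_of [PF_intro]:
  fixes U :: "'e :: enc \<Rightarrow> 'v :: enc list"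
  assumes "PFon D U" "PFon D a"
  shows "PFon D (\<lambda>e. index_of (U e) (a e))"
proof -
  have "PF (\<lambda>z :: 'v list \<times> 'v. index_of (fst z) (snd z))" unfolding index_of_def by (intro PF_intro)
  from PF_comp2[OF this assms] show ?thesis .
qed

lemma PF_clause_elems [PF_intro]:
  fixes U :: "'e :: enc \<Rightarrow> 'v :: enc list"
  assumes "PFon D U" "PFon D c"
  shows "PFon D (\<lambda>e. clause_elems (U e) (c e))"
proof -
  have "PF (\<lambda>z :: 'v list \<times> 'v clause. clause_elems (fst z) (snd z))" unfolding clause_elems_def by (intro PF_intro)
  from PF_comp2[OF this assms] show ?thesis .
qed

lemma PF_hs_lists [PF_intro]:
  fixes cs :: "'e :: enc \<Rightarrow> 'v :: enc clause list"
  assumes "PFon D cs"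
  shows "PFon D (\<lambda>e. hs_lists (cs e))"
proof -
  have "PF (\<lambda>cs :: 'v clause list. hs_lists cs)" unfolding hs_lists_def by (intro PF_intro)
  from PF_comp[OF this assms] show ?thesis .
qed

lemma sorted_list_of_set_filter: "S \<subseteq> {..<n} \<Longrightarrow> sorted_list_of_set S = filter (\<lambda>i. i \<in> S) [0..<n]" for S :: "nat set"
proof -
  assume "S \<subseteq> {..<n}"
  then have "set (filter (\<lambda>i. i \<in> S) [0..<n]) = S" by auto
  moreover have "sorted_list_of_set (set (filter (\<lambda>i. i \<in> S) [0..<n])) = filter (\<lambda>i. i \<in> S) [0..<n]"
    by (rule sorted_list_of_set.idem_if_sorted_distinct) (auto simp: sorted_wrt_filter)
  ultimately show ?thesis by simp
qed

lemma PF_enc_hs_of_clauses: "PF (\<lambda>cs :: 'v :: enc clause list. enc_hs (hs_of_clauses cs))"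
proof -
  have "PF (\<lambda>cs :: 'v clause list. enc_nat (2 * length (clause_atoms cs)) @
     enc_list (\<lambda>xs. enc_list enc_nat (filter (\<lambda>i. i \<in> set xs) [0..<2 * length (clause_atoms cs) + 1])) (hs_lists cs) @
     enc_nat (length (clause_atoms cs)))" by (intro PF_intro)
  then show ?thesis
  proof (rule PFon_cong)
    fix cs :: "'v clause list"
    have "sorted_list_of_set (set xs) = filter (\<lambda>i. i \<in> set xs) [0..<2 * length (clause_atoms cs) + 1]"
      if "xs \<in> set (hs_lists cs)" for xs
      by (rule sorted_list_of_set_filter) (use hs_lists_range[OF that] in auto)
    then have "enc_list (\<lambda>C. enc_list enc_nat (sorted_list_of_set C)) (map set (hs_lists cs)) =
       enc_list (\<lambda>xs. enc_list enc_nat (filter (\<lambda>i. i \<in> set xs) [0..<2 * length (clause_atoms cs) + 1])) (hs_lists cs)"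
      by (simp add: enc_list_def comp_def cong: map_cong del: upt_Suc)
    then show "enc_nat (2 * length (clause_atoms cs)) @
     enc_list (\<lambda>xs. enc_list enc_nat (filter (\<lambda>i. i \<in> set xs) [0..<2 * length (clause_atoms cs) + 1])) (hs_lists cs) @
     enc_nat (length (clause_atoms cs)) = enc_hs (hs_of_clauses cs)"
      by (simp add: enc_hs_def hs_of_clauses_def)
  qed
qed

section \<open>The Cook--Levin construction\<close>

text \<open>Besides the configurations, the symbols under the heads and the actions taken get atoms
  of their own, so that for a fixed machine every clause has bounded length. \<open>AInput\<close>
  describes the input tape, part of which is the unknown certificate.\<close>

datatype atom = AState nat nat | AInHead nat nat | AHead nat nat nat | ACell nat nat nat nat
  | ARead nat input_symbol | AWork nat nat nat | AMove nat direction | AWrite nat nat nat direction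
  | AInput nat input_symbol

instantiation atom :: enc
begin
definition "tr_atom a = (case a of
    AState t q \<Rightarrow> tr (0 :: nat, t, q)
  | AInHead t i \<Rightarrow> tr (1 :: nat, t, i)
  | AHead t j i \<Rightarrow> tr (2 :: nat, t, j, i)
  | ACell t j i s \<Rightarrow> tr (3 :: nat, t, j, i, s)
  | ARead t a \<Rightarrow> tr (4 :: nat, t, a)
  | AWork t j s \<Rightarrow> tr (5 :: nat, t, j, s)
  | AMove t d \<Rightarrow> tr (6 :: nat, t, d)
  | AWrite t j s d \<Rightarrow> tr (7 :: nat, t, j, s, d)
  | AInput i a \<Rightarrow> tr (8 :: nat, i, a))"
instance
proof
  fix a b :: atom
  show "tr a = tr b \<Longrightarrow> a = b"
    by (cases a; cases b) (simp_all add: tr_atom_def tr_prod_def)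
qed
end

lemma PF_atoms [PF_intro]:
  "PFon D t \<Longrightarrow> PFon D q \<Longrightarrow> PFon D (\<lambda>e. AState (t e) (q e))"
  "PFon D t \<Longrightarrow> PFon D i \<Longrightarrow> PFon D (\<lambda>e. AInHead (t e) (i e))"
  "PFon D t \<Longrightarrow> PFon D j \<Longrightarrow> PFon D i \<Longrightarrow> PFon D (\<lambda>e. AHead (t e) (j e) (i e))"
  "PFon D t \<Longrightarrow> PFon D j \<Longrightarrow> PFon D i \<Longrightarrow> PFon D s \<Longrightarrow> PFon D (\<lambda>e. ACell (t e) (j e) (i e) (s e))"
  "PFon D t \<Longrightarrow> PFon D a \<Longrightarrow> PFon D (\<lambda>e. ARead (t e) (a e))"
  "PFon D t \<Longrightarrow> PFon D j \<Longrightarrow> PFon D s \<Longrightarrow> PFon D (\<lambda>e. AWork (t e) (j e) (s e))"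
  "PFon D t \<Longrightarrow> PFon D d \<Longrightarrow> PFon D (\<lambda>e. AMove (t e) (d e))"
  "PFon D t \<Longrightarrow> PFon D j \<Longrightarrow> PFon D s \<Longrightarrow> PFon D d \<Longrightarrow> PFon D (\<lambda>e. AWrite (t e) (j e) (s e) (d e))"
  "PFon D i \<Longrightarrow> PFon D a \<Longrightarrow> PFon D (\<lambda>e. AInput (i e) (a e))"
  subgoal by (rule PFon_enc_eq[of _ "\<lambda>e. (0 :: nat, t e, q e)"]) (intro PF_intro, assumption+, simp add: tr_atom_def)
  subgoal by (rule PFon_enc_eq[of _ "\<lambda>e. (1 :: nat, t e, i e)"]) (intro PF_intro, assumption+, simp add: tr_atom_def)
  subgoal by (rule PFon_enc_eq[of _ "\<lambda>e. (2 :: nat, t e, j e, i e)"]) (intro PF_intro, assumption+, simp add: tr_atom_def)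
  subgoal by (rule PFon_enc_eq[of _ "\<lambda>e. (3 :: nat, t e, j e, i e, s e)"]) (intro PF_intro, assumption+, simp add: tr_atom_def)
  subgoal by (rule PFon_enc_eq[of _ "\<lambda>e. (4 :: nat, t e, a e)"]) (intro PF_intro, assumption+, simp add: tr_atom_def)
  subgoal by (rule PFon_enc_eq[of _ "\<lambda>e. (5 :: nat, t e, j e, s e)"]) (intro PF_intro, assumption+, simp add: tr_atom_def)
  subgoal by (rule PFon_enc_eq[of _ "\<lambda>e. (6 :: nat, t e, d e)"]) (intro PF_intro, assumption+, simp add: tr_atom_def)
  subgoal by (rule PFon_enc_eq[of _ "\<lambda>e. (7 :: nat, t e, j e, s e, d e)"]) (intro PF_intro, assumption+, simp add: tr_atom_def)
  subgoal by (rule PFon_enc_eq[of _ "\<lambda>e. (8 :: nat, i e, a e)"]) (intro PF_intro, assumption+, simp add: tr_atom_def)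
  done

type_synonym transition = "nat \<times> input_symbol \<times> nat list \<times> nat \<times> direction \<times> (nat \<times> direction) list \<times> bool option"

definition all_symbols :: "input_symbol list" where
  "all_symbols = [LeftEnd, InBit False, InBit True, RightEnd]"

definition all_directions :: "direction list" where
  "all_directions = [MoveLeft, Stay, MoveRight]"

lemma set_all [simp]: "set all_symbols = UNIV" "set all_directions = UNIV"
proof -
  have "a \<in> set all_symbols" for a by (cases a) (auto simp: all_symbols_def)
  moreover have "d \<in> set all_directions" for d by (cases d) (auto simp: all_directions_def)
  ultimately show "set all_symbols = UNIV" "set all_directions = UNIV" by auto
qed

definition init_clauses :: "nat \<Rightarrow> nat \<Rightarrow> atom clause list" where
  "init_clauses m T = [([], [AState 0 0]), ([], [AInHead 0 0])] @
     concat (map (\<lambda>j. ([], [AHead 0 j 0]) # map (\<lambda>i. ([], [ACell 0 j i 0])) [0..<Suc T]) [0..<m])"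

text \<open>\<open>pre\<close> is the known part of the input. The cells after it, up to
  \<open>Z\<close>, guess the certificate together with its length: each holds a bit or the end
  marker, and the end marker spreads to the right.\<close>

definition input_clauses :: "bool list \<Rightarrow> nat \<Rightarrow> atom clause list" where
  "input_clauses pre Z = [([], [AInput 0 LeftEnd]), ([], [AInput (Suc Z) RightEnd])] @
     map (\<lambda>i. ([], [AInput (Suc i) (if nthd False pre i then InBit True else InBit False)])) [0..<length pre] @
     concat (map (\<lambda>i. [([], [AInput i (InBit False), AInput i (InBit True), AInput i RightEnd]),
        ([AInput i RightEnd], [AInput (Suc i) RightEnd])]) [Suc (length pre)..<Suc Z])"

text \<open>The empty alternative at the end yields a purely negative clause: a transition that
  emits \<open>False\<close> must not be enabled. Acceptance is expressed in this way, as the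
  machine answers with a single bit.\<close>

definition transition_clauses :: "nat \<Rightarrow> nat \<Rightarrow> transition \<Rightarrow> atom clause list" where
  "transition_clauses m t \<tau> =
     map (\<lambda>Q. (AState t (fst \<tau>) # ARead t (fst (snd \<tau>)) #
            map (\<lambda>j. AWork t j (nthd 0 (fst (snd (snd \<tau>))) j)) [0..<m], Q))
       ([[AState (Suc t) (fst (snd (snd (snd \<tau>))))], [AMove t (fst (snd (snd (snd (snd \<tau>)))))]] @
        map (\<lambda>j. [AWrite t j (fst (nthd (0, Stay) (fst (snd (snd (snd (snd (snd \<tau>)))))) j))
            (snd (nthd (0, Stay) (fst (snd (snd (snd (snd (snd \<tau>)))))) j))]) [0..<m] @
        (if snd (snd (snd (snd (snd (snd \<tau>))))) = Some False then [[]] else []))"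

definition cell_clauses :: "nat \<Rightarrow> nat \<Rightarrow> nat \<Rightarrow> nat \<Rightarrow> nat \<Rightarrow> atom clause list" where
  "cell_clauses T t j i s =
     ([AHead t j i, ACell t j i s], [AWork t j s]) #
        concat (map (\<lambda>d. [([AHead t j i, AWrite t j s d], [AHead (Suc t) j (move_head d i)]),
          ([AHead t j i, AWrite t j s d], [ACell (Suc t) j i s])]) all_directions) @
        map (\<lambda>i'. ([AHead t j i, ACell t j i' s], [ACell (Suc t) j i' s])) (filter (\<lambda>i'. i' \<noteq> i) [0..<Suc T])"

definition step_clauses :: "transition list \<Rightarrow> nat \<Rightarrow> nat \<Rightarrow> nat \<Rightarrow> nat \<Rightarrow> nat \<Rightarrow> atom clause list" where
  "step_clauses Tr m G T Z t =
     concat (map (\<lambda>i. concat (map (\<lambda>a. ([AInHead t i, AInput i a], [ARead t a]) #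
        map (\<lambda>d. ([AInHead t i, AInput i a, AMove t d],
          [AInHead (Suc t) (if a = RightEnd \<and> d = MoveRight then i else move_head d i)])) all_directions) all_symbols))
       [0..<Suc (Suc Z)]) @
     concat (map (transition_clauses m t) Tr) @
     concat (map (\<lambda>j. concat (map (\<lambda>i. concat (map (cell_clauses T t j i) [0..<G])) [0..<Suc T])) [0..<m])"

section \<open>Reading the clauses as statements about an assignment\<close>

lemma ball_concat_map: "(\<forall>c \<in> set (concat (map f xs)). P c) \<longleftrightarrow> (\<forall>x \<in> set xs. \<forall>c \<in> set (f x). P c)"
  by auto

lemma ball_list_Cons: "(\<forall>c \<in> set (x # xs). P c) \<longleftrightarrow> P x \<and> (\<forall>c \<in> set xs. P c)"
  by simp

lemma ball_list_append: "(\<forall>c \<in> set (xs @ ys). P c) \<longleftrightarrow> (\<forall>c \<in> set xs. P c) \<and> (\<forall>c \<in> set ys. P c)"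
  by auto

lemma ball_map: "(\<forall>c \<in> set (map f xs). P c) \<longleftrightarrow> (\<forall>x \<in> set xs. P (f x))"
  by auto

lemma ball_upt: "(\<forall>i \<in> set [0..<Suc n]. P i) \<longleftrightarrow> (\<forall>i \<le> n. P i)" "(\<forall>i \<in> set [0..<n]. P i) \<longleftrightarrow> (\<forall>i < n. P i)"
  by (auto simp: less_Suc_eq_le simp del: upt_Suc)

lemma holds_clause_simps:
  "holds_clause \<sigma> ([], [c]) \<longleftrightarrow> c \<in> \<sigma>"
  "holds_clause \<sigma> ([a, b], [c]) \<longleftrightarrow> (a \<in> \<sigma> \<longrightarrow> b \<in> \<sigma> \<longrightarrow> c \<in> \<sigma>)"
  "holds_clause \<sigma> ([a, b, d], [c]) \<longleftrightarrow> (a \<in> \<sigma> \<longrightarrow> b \<in> \<sigma> \<longrightarrow> d \<in> \<sigma> \<longrightarrow> c \<in> \<sigma>)"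
  by (auto simp: holds_clause_def)

lemma init_clauses_sat: "(\<forall>c \<in> set (init_clauses m T). holds_clause \<sigma> c) \<longleftrightarrow>
   AState 0 0 \<in> \<sigma> \<and> AInHead 0 0 \<in> \<sigma> \<and> (\<forall>j < m. AHead 0 j 0 \<in> \<sigma>) \<and> (\<forall>j < m. \<forall>i \<le> T. ACell 0 j i 0 \<in> \<sigma>)"
  by (auto simp: init_clauses_def holds_clause_def ball_Un less_Suc_eq_le simp del: upt_Suc)

lemma input_clauses_sat: "(\<forall>c \<in> set (input_clauses pre Z). holds_clause \<sigma> c) \<longleftrightarrow>
   AInput 0 LeftEnd \<in> \<sigma> \<and> AInput (Suc Z) RightEnd \<in> \<sigma> \<and>
   (\<forall>i < length pre. AInput (Suc i) (InBit (pre ! i)) \<in> \<sigma>) \<and>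
   (\<forall>i. length pre < i \<longrightarrow> i \<le> Z \<longrightarrow>
      (AInput i (InBit False) \<in> \<sigma> \<or> AInput i (InBit True) \<in> \<sigma> \<or> AInput i RightEnd \<in> \<sigma>) \<and>
      (AInput i RightEnd \<in> \<sigma> \<longrightarrow> AInput (Suc i) RightEnd \<in> \<sigma>))"
proof -
  have 1: "(if nthd False pre i then InBit True else InBit False) = InBit (pre ! i)" if "i < length pre" for i
    using that by (simp add: nthd_nth)
  have "(\<forall>c \<in> set (map (\<lambda>i. ([], [AInput (Suc i) (if nthd False pre i then InBit True else InBit False)])) [0..<length pre]).
      holds_clause \<sigma> c) \<longleftrightarrow> (\<forall>i < length pre. AInput (Suc i) (InBit (pre ! i)) \<in> \<sigma>)"
    using 1 by (auto simp: holds_clause_def)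
  moreover have "(\<forall>c \<in> set (concat (map (\<lambda>i. [([], [AInput i (InBit False), AInput i (InBit True), AInput i RightEnd]),
        ([AInput i RightEnd], [AInput (Suc i) RightEnd])]) [Suc (length pre)..<Suc Z])). holds_clause \<sigma> c) \<longleftrightarrow>
     (\<forall>i. length pre < i \<longrightarrow> i \<le> Z \<longrightarrow>
      (AInput i (InBit False) \<in> \<sigma> \<or> AInput i (InBit True) \<in> \<sigma> \<or> AInput i RightEnd \<in> \<sigma>) \<and>
      (AInput i RightEnd \<in> \<sigma> \<longrightarrow> AInput (Suc i) RightEnd \<in> \<sigma>))"
    by (auto simp: holds_clause_def Suc_le_eq less_Suc_eq_le simp del: upt_Suc)
  moreover have "(\<forall>c \<in> set [([], [AInput 0 LeftEnd]), ([], [AInput (Suc Z) RightEnd])]. holds_clause \<sigma> c) \<longleftrightarrow>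
     AInput 0 LeftEnd \<in> \<sigma> \<and> AInput (Suc Z) RightEnd \<in> \<sigma>"
    by (simp add: holds_clause_def)
  ultimately show ?thesis unfolding input_clauses_def set_append ball_Un by blast
qed

definition transition_enabled :: "nat \<Rightarrow> nat \<Rightarrow> atom set \<Rightarrow> nat \<Rightarrow> input_symbol \<Rightarrow> nat list \<Rightarrow> bool" where
  "transition_enabled m t \<sigma> q a ws \<longleftrightarrow> AState t q \<in> \<sigma> \<and> ARead t a \<in> \<sigma> \<and> (\<forall>j < m. AWork t j (nthd 0 ws j) \<in> \<sigma>)"

lemma transition_clauses_sat: "(\<forall>c \<in> set (transition_clauses m t (q, a, ws, q', d, acts, b)). holds_clause \<sigma> c) \<longleftrightarrow>
   (transition_enabled m t \<sigma> q a ws \<longrightarrow> AState (Suc t) q' \<in> \<sigma> \<and> AMove t d \<in> \<sigma> \<and>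
     (\<forall>j < m. AWrite t j (fst (nthd (0, Stay) acts j)) (snd (nthd (0, Stay) acts j)) \<in> \<sigma>) \<and> b \<noteq> Some False)"
proof -
  let ?P = "AState t q # ARead t a # map (\<lambda>j. AWork t j (nthd 0 ws j)) [0..<m]"
  have "set ?P \<subseteq> \<sigma> \<longleftrightarrow> transition_enabled m t \<sigma> q a ws" by (auto simp: transition_enabled_def)
  then have "holds_clause \<sigma> (?P, Q) \<longleftrightarrow> (transition_enabled m t \<sigma> q a ws \<longrightarrow> set Q \<inter> \<sigma> \<noteq> {})" for Q
    unfolding holds_clause_def by simp
  then show ?thesis unfolding transition_clauses_def set_map set_append ball_simps fst_conv snd_conv ball_Un by auto
qed

lemma cell_clauses_sat: "(\<forall>c \<in> set (cell_clauses T t j i s). holds_clause \<sigma> c) \<longleftrightarrow>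
   (AHead t j i \<in> \<sigma> \<longrightarrow> ACell t j i s \<in> \<sigma> \<longrightarrow> AWork t j s \<in> \<sigma>) \<and>
   (\<forall>d. AHead t j i \<in> \<sigma> \<longrightarrow> AWrite t j s d \<in> \<sigma> \<longrightarrow> AHead (Suc t) j (move_head d i) \<in> \<sigma>) \<and>
   (\<forall>d. AHead t j i \<in> \<sigma> \<longrightarrow> AWrite t j s d \<in> \<sigma> \<longrightarrow> ACell (Suc t) j i s \<in> \<sigma>) \<and>
   (\<forall>i' \<le> T. i' \<noteq> i \<longrightarrow> AHead t j i \<in> \<sigma> \<longrightarrow> ACell t j i' s \<in> \<sigma> \<longrightarrow> ACell (Suc t) j i' s \<in> \<sigma>)"
proof -
  have 1: "(\<forall>c \<in> set (concat (map (\<lambda>d. [([AHead t j i, AWrite t j s d], [AHead (Suc t) j (move_head d i)]),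
          ([AHead t j i, AWrite t j s d], [ACell (Suc t) j i s])]) all_directions)). holds_clause \<sigma> c) \<longleftrightarrow>
     (\<forall>d. AHead t j i \<in> \<sigma> \<longrightarrow> AWrite t j s d \<in> \<sigma> \<longrightarrow> AHead (Suc t) j (move_head d i) \<in> \<sigma>) \<and>
     (\<forall>d. AHead t j i \<in> \<sigma> \<longrightarrow> AWrite t j s d \<in> \<sigma> \<longrightarrow> ACell (Suc t) j i s \<in> \<sigma>)"
    by (auto simp: holds_clause_simps)
  have 2: "(\<forall>c \<in> set (map (\<lambda>i'. ([AHead t j i, ACell t j i' s], [ACell (Suc t) j i' s])) (filter (\<lambda>i'. i' \<noteq> i) [0..<Suc T])).
      holds_clause \<sigma> c) \<longleftrightarrow>
     (\<forall>i' \<le> T. i' \<noteq> i \<longrightarrow> AHead t j i \<in> \<sigma> \<longrightarrow> ACell t j i' s \<in> \<sigma> \<longrightarrow> ACell (Suc t) j i' s \<in> \<sigma>)"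
    by (auto simp: holds_clause_simps less_Suc_eq_le simp del: upt_Suc)
  show ?thesis
    unfolding cell_clauses_def ball_list_Cons ball_list_append 1 2 holds_clause_simps conj_assoc by (rule refl)
qed

lemma all_conj4: "(\<forall>j < m. \<forall>i \<le> T. \<forall>s < G. P j i s \<and> Q j i s \<and> R j i s \<and> S j i s) \<longleftrightarrow>
   (\<forall>j < m. \<forall>i \<le> T. \<forall>s < G. P j i s) \<and> (\<forall>j < m. \<forall>i \<le> T. \<forall>s < G. Q j i s) \<and>
   (\<forall>j < m. \<forall>i \<le> T. \<forall>s < G. R j i s) \<and> (\<forall>j < m. \<forall>i \<le> T. \<forall>s < G. S j i s)"
  for m T G :: nat
  by (simp only: imp_conjR all_conj_distrib)

lemma step_clauses_sat: "(\<forall>c \<in> set (step_clauses Tr m G T Z t). holds_clause \<sigma> c) \<longleftrightarrow>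
   (\<forall>i \<le> Suc Z. \<forall>a. AInHead t i \<in> \<sigma> \<longrightarrow> AInput i a \<in> \<sigma> \<longrightarrow> ARead t a \<in> \<sigma>) \<and>
   (\<forall>i \<le> Suc Z. \<forall>a d. AInHead t i \<in> \<sigma> \<longrightarrow> AInput i a \<in> \<sigma> \<longrightarrow> AMove t d \<in> \<sigma> \<longrightarrow>
       AInHead (Suc t) (if a = RightEnd \<and> d = MoveRight then i else move_head d i) \<in> \<sigma>) \<and>
   (\<forall>\<tau> \<in> set Tr. \<forall>c \<in> set (transition_clauses m t \<tau>). holds_clause \<sigma> c) \<and>
   (\<forall>j < m. \<forall>i \<le> T. \<forall>s < G. AHead t j i \<in> \<sigma> \<longrightarrow> ACell t j i s \<in> \<sigma> \<longrightarrow> AWork t j s \<in> \<sigma>) \<and>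
   (\<forall>j < m. \<forall>i \<le> T. \<forall>s < G. \<forall>d. AHead t j i \<in> \<sigma> \<longrightarrow> AWrite t j s d \<in> \<sigma> \<longrightarrow> AHead (Suc t) j (move_head d i) \<in> \<sigma>) \<and>
   (\<forall>j < m. \<forall>i \<le> T. \<forall>s < G. \<forall>d. AHead t j i \<in> \<sigma> \<longrightarrow> AWrite t j s d \<in> \<sigma> \<longrightarrow> ACell (Suc t) j i s \<in> \<sigma>) \<and>
   (\<forall>j < m. \<forall>i \<le> T. \<forall>s < G. \<forall>i' \<le> T. i' \<noteq> i \<longrightarrow> AHead t j i \<in> \<sigma> \<longrightarrow> ACell t j i' s \<in> \<sigma> \<longrightarrow> ACell (Suc t) j i' s \<in> \<sigma>)"
  (is "?L \<longleftrightarrow> ?R1 \<and> ?R2 \<and> ?R3 \<and> ?R4 \<and> ?R5 \<and> ?R6 \<and> ?R7")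
proof -
  have A: "(\<forall>c \<in> set (concat (map (\<lambda>i. concat (map (\<lambda>a. ([AInHead t i, AInput i a], [ARead t a]) #
        map (\<lambda>d. ([AInHead t i, AInput i a, AMove t d],
          [AInHead (Suc t) (if a = RightEnd \<and> d = MoveRight then i else move_head d i)])) all_directions) all_symbols))
       [0..<Suc (Suc Z)])). holds_clause \<sigma> c) \<longleftrightarrow> ?R1 \<and> ?R2"
    unfolding ball_concat_map ball_map ball_upt set_all list.set ball_simps holds_clause_simps less_Suc_eq_le
    by (intro iffI conjI allI ballI impI; blast)
  have B: "(\<forall>c \<in> set (concat (map (transition_clauses m t) Tr)). holds_clause \<sigma> c) \<longleftrightarrow> ?R3"
    by simp
  have C: "(\<forall>c \<in> set (concat (map (\<lambda>j. concat (map (\<lambda>i. concat (map (cell_clauses T t j i) [0..<G])) [0..<Suc T])) [0..<m])). holds_clause \<sigma> c) \<longleftrightarrow> ?R4 \<and> ?R5 \<and> ?R6 \<and> ?R7"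
    unfolding ball_concat_map ball_upt(2) ball_upt(1)[of T] cell_clauses_sat less_Suc_eq_le by (rule all_conj4)
  show ?thesis unfolding step_clauses_def set_append ball_Un A B C by (simp only: conj_assoc)
qed

section \<open>Correctness of the tableau\<close>

definition config_facts :: "tm \<Rightarrow> nat \<Rightarrow> atom set \<Rightarrow> nat \<Rightarrow> config \<Rightarrow> bool" where
  "config_facts M T \<sigma> t c \<longleftrightarrow> AState t (c_state c) \<in> \<sigma> \<and> AInHead t (c_inhead c) \<in> \<sigma> \<and>
     (\<forall>j < tm_tapes M. AHead t j (c_heads c ! j) \<in> \<sigma> \<and> c_heads c ! j \<le> t) \<and>
     (\<forall>j < tm_tapes M. \<forall>i \<le> T. ACell t j i ((c_tapes c ! j) i) \<in> \<sigma>)"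

definition transition_set :: "tm \<Rightarrow> transition set" where
  "transition_set M = {(q, a, ws, q', d, acts, b). q < tm_states M \<and> length ws = tm_tapes M \<and>
     set ws \<subseteq> {..<tm_symbols M} \<and> tm_delta M q a ws = Some (q', d, acts, b)}"

lemma finite_transition_set: "finite (transition_set M)"
proof -
  let ?W = "{ws. set ws \<subseteq> {..<tm_symbols M} \<and> length ws = tm_tapes M}"
  have "transition_set M \<subseteq> (\<lambda>((q, a), ws). (q, a, ws, the (tm_delta M q a ws))) `
      (({..<tm_states M} \<times> set all_symbols) \<times> ?W)"
  proof
    fix \<tau> assume "\<tau> \<in> transition_set M"
    then obtain q a ws y where "\<tau> = (q, a, ws, y)" "q < tm_states M" "ws \<in> ?W" "tm_delta M q a ws = Some y"
      unfolding transition_set_def by force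
    then show "\<tau> \<in> (\<lambda>((q, a), ws). (q, a, ws, the (tm_delta M q a ws))) ` (({..<tm_states M} \<times> set all_symbols) \<times> ?W)"
      by (intro image_eqI[of _ _ "((q, a), ws)"]) auto
  qed
  moreover have "finite ((({..<tm_states M} \<times> set all_symbols) \<times> ?W))"
    by (intro finite_cartesian_product finite_lists_length_eq) (simp_all only: finite_set finite_lessThan)
  ultimately show ?thesis by (meson finite_imageI finite_subset)
qed

text \<open>Unit propagation: the true atoms about \<open>c\<close> trigger the clauses that make
  the atoms about its successor true. Since \<open>t < T\<close>, the work heads stay on the cells
  that have clauses.\<close>

lemma tableau_step:
  assumes wf: "wf_tm M" and ok: "config_ok M c" and Tr: "set Tr = transition_set M"
    and sat: "\<And>cl. cl \<in> set (step_clauses Tr (tm_tapes M) (tm_symbols M) T Z t) \<Longrightarrow> holds_clause \<sigma> cl"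
    and input: "\<And>i. i \<le> Suc Z \<Longrightarrow> AInput i (read_input z i) \<in> \<sigma>"
    and z: "length z \<le> Z" and ih: "c_inhead c \<le> length z + 1" and t: "t < T"
    and facts: "config_facts M T \<sigma> t c" and act: "next_action M z c = Some (q', d, acts, b)"
  shows "config_facts M T \<sigma> (Suc t) (step M z c) \<and> b \<noteq> Some False"
proof -
  let ?m = "tm_tapes M" and ?G = "tm_symbols M" and ?i = "c_inhead c"
  let ?a = "read_input z ?i" and ?ws = "tape_reads c"
  have "\<forall>cl \<in> set (step_clauses Tr ?m ?G T Z t). holds_clause \<sigma> cl" using sat by blast
  note S = step_clauses_sat[THEN iffD1, OF this]
  note S1 = S[THEN conjunct1, rule_format]
    and S2 = S[THEN conjunct2, THEN conjunct1, rule_format]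
    and S3 = S[THEN conjunct2, THEN conjunct2, THEN conjunct1, THEN bspec]
    and S4 = S[THEN conjunct2, THEN conjunct2, THEN conjunct2, THEN conjunct1, rule_format]
    and S5 = S[THEN conjunct2, THEN conjunct2, THEN conjunct2, THEN conjunct2, THEN conjunct1, rule_format]
    and S6 = S[THEN conjunct2, THEN conjunct2, THEN conjunct2, THEN conjunct2, THEN conjunct2, THEN conjunct1, rule_format]
    and S7 = S[THEN conjunct2, THEN conjunct2, THEN conjunct2, THEN conjunct2, THEN conjunct2, THEN conjunct2, rule_format]
  from facts have f: "AState t (c_state c) \<in> \<sigma>" "AInHead t ?i \<in> \<sigma>"
     "\<And>j. j < ?m \<Longrightarrow> AHead t j (c_heads c ! j) \<in> \<sigma>" "\<And>j. j < ?m \<Longrightarrow> c_heads c ! j \<le> t"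
     "\<And>j i. j < ?m \<Longrightarrow> i \<le> T \<Longrightarrow> ACell t j i ((c_tapes c ! j) i) \<in> \<sigma>"
    unfolding config_facts_def by blast+
  have hT: "c_heads c ! j \<le> T" if "j < ?m" for j using f(4)[OF that] t by simp
  from ok have l: "c_state c < tm_states M" "length (c_tapes c) = ?m" "length (c_heads c) = ?m"
    "\<And>j i. j < ?m \<Longrightarrow> (c_tapes c ! j) i < ?G" by (auto simp: config_ok_def)
  have iZ: "?i \<le> Suc Z" using ih z by simp
  have ws: "nthd 0 ?ws j = (c_tapes c ! j) (c_heads c ! j)" if "j < ?m" for j
    using that l config_ok_reads(1)[OF ok] by (simp add: nthd_nth tape_reads_nth)
  have read: "ARead t ?a \<in> \<sigma>" by (rule S1[OF iZ f(2) input[OF iZ]])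
  have work: "AWork t j (nthd 0 ?ws j) \<in> \<sigma>" if j: "j < ?m" for j
    unfolding ws[OF j] by (rule S4[OF j hT[OF j] l(4)[OF j] f(3)[OF j] f(5)[OF j hT[OF j]]])
  have "(c_state c, ?a, ?ws, q', d, acts, b) \<in> set Tr"
    unfolding Tr transition_set_def using act l(1) config_ok_reads[OF ok] by (simp add: next_action_reads)
  from S3[OF this] have tr: "AState (Suc t) q' \<in> \<sigma>" "AMove t d \<in> \<sigma>"
     "\<And>j. j < ?m \<Longrightarrow> AWrite t j (fst (nthd (0, Stay) acts j)) (snd (nthd (0, Stay) acts j)) \<in> \<sigma>"
     "b \<noteq> Some False"
    unfolding transition_clauses_sat transition_enabled_def using f(1) read work by blast+
  note ca = config_ok_action[OF wf ok act]
  note st = step_Some[OF act l(2,3) ca(2)]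
  have wr: "AWrite t j (fst (acts ! j)) (snd (acts ! j)) \<in> \<sigma>" if "j < ?m" for j
    using tr(3)[OF that] that ca(2) by (simp add: nthd_nth)
  have head: "AHead (Suc t) j (c_heads (step M z c) ! j) \<in> \<sigma>" if j: "j < ?m" for j
    unfolding st(7)[OF j] by (rule S5[OF j hT[OF j] ca(3)[OF j] f(3)[OF j] wr[OF j]])
  have headT: "c_heads (step M z c) ! j \<le> Suc t" if j: "j < ?m" for j
    unfolding st(7)[OF j] using f(4)[OF j] by (cases "snd (acts ! j)") auto
  have cell: "ACell (Suc t) j i ((c_tapes (step M z c) ! j) i) \<in> \<sigma>" if j: "j < ?m" and i: "i \<le> T" for j i
  proof (cases "i = c_heads c ! j")
    case True
    then have "(c_tapes (step M z c) ! j) i = fst (acts ! j)" by (simp add: st(6)[OF j])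
    then show ?thesis using S6[OF j hT[OF j] ca(3)[OF j] f(3)[OF j] wr[OF j]] True by simp
  next
    case False
    then have "(c_tapes (step M z c) ! j) i = (c_tapes c ! j) i" by (simp add: st(6)[OF j])
    then show ?thesis using S7[OF j hT[OF j] l(4)[OF j] i False f(3)[OF j] f(5)[OF j i]] by simp
  qed
  have mv: "AInHead (Suc t) (if ?a = RightEnd \<and> d = MoveRight then ?i else move_head d ?i) \<in> \<sigma>"
    by (rule S2[OF iZ f(2) input[OF iZ] tr(2)])
  have "(if ?a = RightEnd \<and> d = MoveRight then ?i else move_head d ?i) = min (move_head d ?i) (length z + 1)"
    using ih by (cases d) (auto simp: read_input_def split: if_splits)
  with mv have "AInHead (Suc t) (c_inhead (step M z c)) \<in> \<sigma>" by (simp add: st(2))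
  with tr st(1) head headT cell show ?thesis by (simp add: config_facts_def)
qed

lemma tableau_sound:
  assumes wf: "wf_tm M" and Tr: "set Tr = transition_set M" and pre: "length pre \<le> Z"
    and halts: "\<And>z. length z \<le> Z \<Longrightarrow> \<exists>t \<le> T. halts_with M z t [z \<in> V]"
    and init: "\<And>c. c \<in> set (init_clauses (tm_tapes M) T) \<Longrightarrow> holds_clause \<sigma> c"
    and inp: "\<And>c. c \<in> set (input_clauses pre Z) \<Longrightarrow> holds_clause \<sigma> c"
    and steps: "\<And>t cl. t < T \<Longrightarrow> cl \<in> set (step_clauses Tr (tm_tapes M) (tm_symbols M) T Z t) \<Longrightarrow> holds_clause \<sigma> cl"
  shows "\<exists>y. length y \<le> Z - length pre \<and> pre @ y \<in> V"
proof -
  let ?l = "length pre"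
  have "\<forall>c \<in> set (input_clauses pre Z). holds_clause \<sigma> c" using inp by blast
  note I = input_clauses_sat[THEN iffD1, OF this]
  \<comment> \<open>The first end marker after the prefix delimits the certificate. An assignment
    may mark a cell with both bits; \<open>y\<close> below then takes \<open>True\<close>.\<close>
  define e where "e = (LEAST i. ?l < i \<and> AInput i RightEnd \<in> \<sigma>)"
  have ex: "?l < Suc Z \<and> AInput (Suc Z) RightEnd \<in> \<sigma>" using I pre by simp
  have e: "?l < e" "AInput e RightEnd \<in> \<sigma>" using LeastI[of "\<lambda>i. ?l < i \<and> AInput i RightEnd \<in> \<sigma>", OF ex]
    unfolding e_def by auto
  have eZ: "e \<le> Suc Z" unfolding e_def using ex by (intro Least_le) auto
  have ne: "AInput i RightEnd \<notin> \<sigma>" if "?l < i" "i < e" for i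
    using not_less_Least[of i "\<lambda>i. ?l < i \<and> AInput i RightEnd \<in> \<sigma>"] that unfolding e_def by blast
  define y where "y = map (\<lambda>i. AInput i (InBit True) \<in> \<sigma>) [Suc ?l..<e]"
  let ?z = "pre @ y"
  have ly: "length y = e - Suc ?l" by (simp add: y_def)
  have lz: "length ?z = e - 1" using e(1) ly by simp
  have lZ: "length ?z \<le> Z" using lz eZ by simp
  have end_run: "AInput i RightEnd \<in> \<sigma>" if "e \<le> i" "i \<le> Suc Z" for i
    using that
  proof (induction i rule: dec_induct)
    case base
    show ?case by (rule e(2))
  next
    case (step n)
    then have "?l < n" "n \<le> Z" using e(1) by auto
    with step I show ?case by auto
  qed
  have input: "AInput i (read_input ?z i) \<in> \<sigma>" if i: "i \<le> Suc Z" for i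
  proof -
    consider "i = 0" | "0 < i" "i \<le> ?l" | "?l < i" "i < e" | "e \<le> i" by linarith
    then show ?thesis
    proof cases
      case 1
      then show ?thesis using I by (simp add: read_input_def)
    next
      case 2
      then obtain k where "i = Suc k" "k < ?l" by (cases i) auto
      then show ?thesis using I by (simp add: read_input_def nth_append)
    next
      case 3
      then have "read_input ?z i = InBit (AInput i (InBit True) \<in> \<sigma>)"
        using ly lz e(1) by (auto simp: read_input_def nth_append y_def)
      moreover have "i \<le> Z" using 3 eZ by simp
      ultimately show ?thesis using I 3 ne[OF 3] by (cases "AInput i (InBit True) \<in> \<sigma>") auto
    next
      case 4
      then have "read_input ?z i = RightEnd" using lz e(1) by (auto simp: read_input_def)
      then show ?thesis using end_run[OF 4 i] by simp
    qed
  qed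
  have "\<forall>c \<in> set (init_clauses (tm_tapes M) T). holds_clause \<sigma> c" using init by blast
  note I0 = init_clauses_sat[THEN iffD1, OF this]
  have facts: "config_facts M T \<sigma> t (run M ?z t)"
    if "t \<le> T" "\<And>t'. t' < t \<Longrightarrow> next_action M ?z (run M ?z t') \<noteq> None" for t
    using that
  proof (induction t)
    case 0
    then show ?case using I0 by (simp add: config_facts_def run_def init_config_def)
  next
    case (Suc t)
    from Suc.prems(2)[of t] obtain q' d acts b where a: "next_action M ?z (run M ?z t) = Some (q', d, acts, b)"
      by (metis lessI option.exhaust prod_cases4)
    from Suc.prems have f: "config_facts M T \<sigma> t (run M ?z t)" by (intro Suc.IH) auto
    have "t < T" using Suc.prems(1) by simp
    from tableau_step[OF wf config_ok_run[OF wf] Tr steps[OF this] input lZ run_inhead this f a]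
    show ?case by (simp add: run_def)
  qed
  \<comment> \<open>The final output is a single bit, so a run that never emits \<open>False\<close>
    has answered \<open>True\<close>.\<close>
  have noF: "False \<notin> set (c_output (run M ?z t))" if "t \<le> T" for t
    using that
  proof (induction t)
    case 0
    then show ?case by (simp add: run_def init_config_def)
  next
    case (Suc t)
    then have IH: "False \<notin> set (c_output (run M ?z t))" by simp
    show ?case
    proof (cases "next_action M ?z (run M ?z t)")
      case None
      with IH show ?thesis by (simp add: run_def step_def)
    next
      case (Some w)
      obtain q' d acts b where w: "w = (q', d, acts, b)" by (metis prod_cases4)
      have "next_action M ?z (run M ?z t') \<noteq> None" if "t' < t" for t'
      proof
        assume N: "next_action M ?z (run M ?z t') = None"
        with run_after_halt[OF N less_imp_le[OF that]] Some show False by (metis option.distinct(1))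
      qed
      from facts[OF _ this] Suc.prems have f: "config_facts M T \<sigma> t (run M ?z t)" by simp
      have "t < T" using Suc.prems by simp
      from tableau_step[OF wf config_ok_run[OF wf] Tr steps[OF this] input lZ run_inhead this f Some[unfolded w]]
      have "b \<noteq> Some False" by simp
      with IH Some w show ?thesis by (auto simp: run_def step_def split: option.splits)
    qed
  qed
  from halts[OF lZ] obtain t where "t \<le> T" "halts_with M ?z t [?z \<in> V]" by blast
  with noF[of t] have "?z \<in> V" by (auto simp: halts_with_def)
  with ly eZ show ?thesis by (intro exI[of _ y]) auto
qed

fun run_fact :: "tm \<Rightarrow> bool list \<Rightarrow> atom \<Rightarrow> bool" where
  "run_fact M z (AState t q) \<longleftrightarrow> c_state (run M z t) = q"
| "run_fact M z (AInHead t i) \<longleftrightarrow> c_inhead (run M z t) = i"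
| "run_fact M z (AHead t j i) \<longleftrightarrow> c_heads (run M z t) ! j = i"
| "run_fact M z (ACell t j i s) \<longleftrightarrow> (c_tapes (run M z t) ! j) i = s"
| "run_fact M z (ARead t a) \<longleftrightarrow> read_input z (c_inhead (run M z t)) = a"
| "run_fact M z (AWork t j s) \<longleftrightarrow> tape_reads (run M z t) ! j = s"
| "run_fact M z (AMove t d) \<longleftrightarrow> (\<exists>q acts b. next_action M z (run M z t) = Some (q, d, acts, b))"
| "run_fact M z (AWrite t j s m) \<longleftrightarrow> (\<exists>q d acts b. next_action M z (run M z t) = Some (q, d, acts, b) \<and> acts ! j = (s, m))"
| "run_fact M z (AInput i a) \<longleftrightarrow> read_input z i = a"

lemma tableau_complete:
  assumes wf: "wf_tm M" and Tr: "set Tr = transition_set M"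
    and z: "length z \<le> Z" "z = pre @ y" and V: "z \<in> V" and halts: "\<exists>t \<le> T. halts_with M z t [z \<in> V]"
  defines "\<sigma> \<equiv> {a. run_fact M z a}"
  shows "\<forall>c \<in> set (init_clauses (tm_tapes M) T). holds_clause \<sigma> c"
    "\<forall>c \<in> set (input_clauses pre Z). holds_clause \<sigma> c"
    "t < T \<Longrightarrow> \<forall>c \<in> set (step_clauses Tr (tm_tapes M) (tm_symbols M) T Z t). holds_clause \<sigma> c"
proof -
  show "\<forall>c \<in> set (init_clauses (tm_tapes M) T). holds_clause \<sigma> c"
    unfolding init_clauses_sat by (simp add: \<sigma>_def run_def init_config_def)
  show "\<forall>c \<in> set (input_clauses pre Z). holds_clause \<sigma> c"
    unfolding input_clauses_sat using z by (auto simp: \<sigma>_def read_input_def nth_append)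
  assume t: "t < T"
  let ?m = "tm_tapes M" and ?c = "run M z t"
  from config_ok_run[OF wf, of z t] have l: "length (c_tapes ?c) = ?m" "length (c_heads ?c) = ?m"
    by (auto simp: config_ok_def)
  have sr: "run M z (Suc t) = step M z ?c" by (simp add: run_def)
  \<comment> \<open>Output is never erased, and the final output is \<open>[True]\<close>.\<close>
  have noF: "False \<notin> set (c_output (run M z t))" for t
  proof
    assume F: "False \<in> set (c_output (run M z t))"
    have mono: "set (c_output (run M z t)) \<subseteq> set (c_output (run M z (n + t)))" for n
    proof (induction n)
      case (Suc n)
      then show ?case by (auto simp: run_def step_def split: option.splits prod.splits)
    qed simp
    from halts obtain t0 where t0: "halts_with M z t0 [True]" using V by auto
    from run_after_halt[of M z t0 "t0 + t"] t0 have "c_output (run M z (t0 + t)) = [True]" by (simp add: halts_with_def)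
    with mono[of t0] F show False by auto
  qed
  have act: "transition_enabled ?m t \<sigma> q a ws \<longrightarrow> AState (Suc t) q' \<in> \<sigma> \<and> AMove t d \<in> \<sigma> \<and>
     (\<forall>j < ?m. AWrite t j (fst (nthd (0, Stay) acts j)) (snd (nthd (0, Stay) acts j)) \<in> \<sigma>) \<and> b \<noteq> Some False"
    if "(q, a, ws, q', d, acts, b) \<in> set Tr" for q a ws q' d acts b
  proof
    from that have tr: "length ws = ?m" "tm_delta M q a ws = Some (q', d, acts, b)"
      unfolding Tr transition_set_def by auto
    assume "transition_enabled ?m t \<sigma> q a ws"
    then have en: "c_state ?c = q" "read_input z (c_inhead ?c) = a" "\<forall>j < ?m. tape_reads ?c ! j = nthd 0 ws j"
      by (auto simp: transition_enabled_def \<sigma>_def)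
    have "tape_reads ?c = ws"
      by (rule nth_equalityI) (use en(3) tr(1) config_ok_reads(1)[OF config_ok_run[OF wf]] in \<open>auto simp: nthd_nth\<close>)
    with en tr have na: "next_action M z ?c = Some (q', d, acts, b)" by (simp add: next_action_reads)
    note ca = config_ok_action[OF wf config_ok_run[OF wf] na]
    note st = step_Some[OF na l ca(2)]
    have "c_output (run M z (Suc t)) = c_output ?c @ (case b of None \<Rightarrow> [] | Some v \<Rightarrow> [v])"
      using st(3) by (simp add: sr)
    with noF[of "Suc t"] have "b \<noteq> Some False" by auto
    then show "AState (Suc t) q' \<in> \<sigma> \<and> AMove t d \<in> \<sigma> \<and>
       (\<forall>j < ?m. AWrite t j (fst (nthd (0, Stay) acts j)) (snd (nthd (0, Stay) acts j)) \<in> \<sigma>) \<and> b \<noteq> Some False"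
      using st(1) na ca(2) by (auto simp: \<sigma>_def sr nthd_nth)
  qed
  have stp: "c_inhead (step M z ?c) = min (move_head d (c_inhead ?c)) (length z + 1) \<and>
      (\<forall>j < ?m. c_heads (step M z ?c) ! j = move_head (snd (acts ! j)) (c_heads ?c ! j) \<and>
         c_tapes (step M z ?c) ! j = (c_tapes ?c ! j)(c_heads ?c ! j := fst (acts ! j)))"
    if na: "next_action M z ?c = Some (q', d, acts, b)" for q' d acts b
    using step_Some[OF na l config_ok_action(2)[OF wf config_ok_run[OF wf] na]] by blast
  have frame: "(c_tapes (step M z ?c) ! j) i = (c_tapes ?c ! j) i" if "j < ?m" "i \<noteq> c_heads ?c ! j" for i j
  proof (cases "next_action M z ?c")
    case None
    then show ?thesis by (simp add: step_def)
  next
    case (Some w)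
    obtain q' d acts b where w: "w = (q', d, acts, b)" by (metis prod_cases4)
    from stp[OF Some[unfolded w]] that show ?thesis by simp
  qed
  have inhead: "(if read_input z (c_inhead ?c) = RightEnd \<and> d = MoveRight then c_inhead ?c else move_head d (c_inhead ?c)) =
      c_inhead (step M z ?c)" if "next_action M z ?c = Some (q', d, acts, b)" for q' d acts b
    using stp[OF that] run_inhead[of M z t] by (cases d) (auto simp: read_input_def split: if_splits)
  show "\<forall>c \<in> set (step_clauses Tr ?m (tm_symbols M) T Z t). holds_clause \<sigma> c"
    unfolding step_clauses_sat
  proof (intro conjI ballI)
    fix \<tau> c assume \<tau>: "\<tau> \<in> set Tr" and c: "c \<in> set (transition_clauses ?m t \<tau>)"
    obtain q a ws q' d acts b where e: "\<tau> = (q, a, ws, q', d, acts, b)" by (metis prod_cases7)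
    from act[OF \<tau>[unfolded e]] c show "holds_clause \<sigma> c"
      unfolding e using transition_clauses_sat by blast
  next
    show "\<forall>i \<le> Suc Z. \<forall>a d. AInHead t i \<in> \<sigma> \<longrightarrow> AInput i a \<in> \<sigma> \<longrightarrow> AMove t d \<in> \<sigma> \<longrightarrow>
       AInHead (Suc t) (if a = RightEnd \<and> d = MoveRight then i else move_head d i) \<in> \<sigma>"
      using inhead by (auto simp: \<sigma>_def sr)
  next
    show "\<forall>j < ?m. \<forall>i \<le> T. \<forall>s < tm_symbols M. \<forall>i' \<le> T. i' \<noteq> i \<longrightarrow> AHead t j i \<in> \<sigma> \<longrightarrow> ACell t j i' s \<in> \<sigma> \<longrightarrow>
        ACell (Suc t) j i' s \<in> \<sigma>"
      using frame by (auto simp: \<sigma>_def sr)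
  next
    show "\<forall>j < ?m. \<forall>i \<le> T. \<forall>s < tm_symbols M. \<forall>d. AHead t j i \<in> \<sigma> \<longrightarrow> AWrite t j s d \<in> \<sigma> \<longrightarrow>
        AHead (Suc t) j (move_head d i) \<in> \<sigma>"
      using stp by (fastforce simp: \<sigma>_def sr)
  next
    show "\<forall>j < ?m. \<forall>i \<le> T. \<forall>s < tm_symbols M. \<forall>d. AHead t j i \<in> \<sigma> \<longrightarrow> AWrite t j s d \<in> \<sigma> \<longrightarrow>
        ACell (Suc t) j i s \<in> \<sigma>"
      using stp by (fastforce simp: \<sigma>_def sr)
  qed (auto simp: \<sigma>_def tape_reads_nth l)
qed

definition tableau :: "transition list \<Rightarrow> tm \<Rightarrow> bool list \<Rightarrow> nat \<Rightarrow> nat \<Rightarrow> atom clause list" where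
  "tableau Tr M pre Z T = init_clauses (tm_tapes M) T @ input_clauses pre Z @
     concat (map (step_clauses Tr (tm_tapes M) (tm_symbols M) T Z) [0..<T])"

lemma PF_tableau: "PF (\<lambda>z. tableau Tr M (fst z) (fst (snd z)) (snd (snd z)))"
  unfolding tableau_def init_clauses_def input_clauses_def step_clauses_def transition_clauses_def cell_clauses_def
  by (intro PF_intro)

text \<open>Even the clauses without alternatives have premises; nonempty clauses become the
  nonempty sets required of a hitting set instance.\<close>

lemma clause_nonempty: "c \<in> set (tableau Tr M pre Z T) \<Longrightarrow> fst c @ snd c \<noteq> []"
  by (auto simp: tableau_def init_clauses_def input_clauses_def step_clauses_def transition_clauses_def
      cell_clauses_def simp del: upt_Suc)

theorem hitting_set_hard:
  assumes "L \<in> class_NP"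
  shows "\<exists>R. PF R \<and> (\<forall>x. \<exists>h. hs_instance h \<and> R x = enc_hs h \<and> (x \<in> L \<longleftrightarrow> hs_positive h))"
proof -
  from assms obtain V p where V: "V \<in> class_P"
    and L: "\<And>x. x \<in> L \<longleftrightarrow> (\<exists>y. length y \<le> poly p (length x) \<and> enc_pair x y \<in> V)"
    unfolding class_NP_def by blast
  from V obtain M q where wf: "wf_tm M" and M: "\<And>z. \<exists>t \<le> poly q (length z). halts_with M z t [z \<in> V]"
    unfolding class_P_def polytime_computable_def by blast
  obtain Tr where Tr: "set Tr = transition_set M" using finite_list[OF finite_transition_set] by blast
  define pre where "pre x = enc_list (\<lambda>b. [b]) x" for x :: "bool list"
  \<comment> \<open>\<open>Z x\<close> bounds the length of every pair of \<open>x\<close> and a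
    certificate, so \<open>poly q (Z x)\<close> steps suffice for all of them.\<close>
  define Z where "Z x = length (pre x) + poly p (length x)" for x
  define cs where "cs x = tableau Tr M (pre x) (Z x) (poly q (Z x))" for x
  have halts: "\<exists>t \<le> poly q (Z x). halts_with M z t [z \<in> V]" if "length z \<le> Z x" for x z
    using M[of z] poly_nat_mono[OF that, of q] by (meson le_trans)
  have sat: "satisfiable (cs x) \<longleftrightarrow> x \<in> L" for x
  proof
    assume "satisfiable (cs x)"
    then obtain \<sigma> where \<sigma>: "\<And>c. c \<in> set (cs x) \<Longrightarrow> holds_clause \<sigma> c" unfolding satisfiable_def by blast
    have "\<exists>y. length y \<le> Z x - length (pre x) \<and> pre x @ y \<in> V"
    proof (rule tableau_sound[OF wf Tr])
      show "length (pre x) \<le> Z x" by (simp add: Z_def)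
      show "\<exists>t \<le> poly q (Z x). halts_with M z t [z \<in> V]" if "length z \<le> Z x" for z by (rule halts[OF that])
      show "holds_clause \<sigma> c" if "c \<in> set (init_clauses (tm_tapes M) (poly q (Z x)))" for c
        by (rule \<sigma>) (use that in \<open>simp add: cs_def tableau_def\<close>)
      show "holds_clause \<sigma> c" if "c \<in> set (input_clauses (pre x) (Z x))" for c
        by (rule \<sigma>) (use that in \<open>simp add: cs_def tableau_def\<close>)
      show "holds_clause \<sigma> c" if "t < poly q (Z x)"
          "c \<in> set (step_clauses Tr (tm_tapes M) (tm_symbols M) (poly q (Z x)) (Z x) t)" for t c
        by (rule \<sigma>) (use that in \<open>auto simp: cs_def tableau_def\<close>)
    qed
    then show "x \<in> L" unfolding L by (simp add: Z_def pre_def enc_pair_def)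
  next
    assume "x \<in> L"
    then obtain y where y: "length y \<le> poly p (length x)" "pre x @ y \<in> V"
      unfolding L by (auto simp: pre_def enc_pair_def)
    then have "length (pre x @ y) \<le> Z x" by (simp add: Z_def)
    from tableau_complete[OF wf Tr this refl y(2) halts[OF this]] show "satisfiable (cs x)"
      unfolding satisfiable_def cs_def tableau_def
      by (intro exI[of _ "{a. run_fact M (pre x @ y) a}"]) auto
  qed
  have PFpre: "PF pre" unfolding pre_def[abs_def] by (intro PF_intro)
  have PFZ: "PF Z" unfolding Z_def[abs_def] by (intro PF_intro PF_comp[OF PFpre])
  have "PF cs" unfolding cs_def[abs_def]
    by (intro PF_comp3[OF PF_tableau] PF_intro PFpre PFZ)
  from PF_comp[OF PF_enc_hs_of_clauses this] have "PF (\<lambda>x. enc_hs (hs_of_clauses (cs x)))" .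
  moreover have "cs x \<noteq> []" for x by (simp add: cs_def tableau_def init_clauses_def)
  then have "hs_instance (hs_of_clauses (cs x))" for x
    by (rule hs_instance_of_clauses) (use clause_nonempty in \<open>auto simp: cs_def\<close>)
  ultimately show ?thesis using hs_positive_of_clauses sat by blast
qed

section \<open>Model checking\<close>

text \<open>The controllable predecessor. Of the tuple \<open>\<alpha>\<close> only the components
  of \<open>A\<close> matter; the full tuple guarantees that they are legal actions.\<close>

definition cpre :: "cgs \<Rightarrow> nat set \<Rightarrow> nat set \<Rightarrow> nat \<Rightarrow> bool" where
  "cpre C A Z q \<longleftrightarrow> (\<exists>\<alpha> \<in> action_tuples C q. \<forall>\<beta> \<in> action_tuples C q.
     (\<forall>a \<in> A. \<beta> ! (a - 1) = \<alpha> ! (a - 1)) \<longrightarrow> cgs_trans C q \<beta> \<in> Z)"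

lemma cpre_mono: "cpre C A Y q \<Longrightarrow> Y \<subseteq> Z \<Longrightarrow> cpre C A Z q"
  unfolding cpre_def by blast

text \<open>Turns a rule that picks an action tuple for every history into a concrete path; outcomes
  with prescribed deviations are built in this way.\<close>

primrec play :: "cgs \<Rightarrow> (nat list \<Rightarrow> nat list) \<Rightarrow> nat \<Rightarrow> nat \<Rightarrow> nat list" where
  "play C g q 0 = [q]"
| "play C g q (Suc n) = play C g q n @ [cgs_trans C (last (play C g q n)) (g (play C g q n))]"

lemma map_last_play: "map (\<lambda>i. last (play C g q i)) [0..<Suc n] = play C g q n"
  by (induction n) auto

definition joint_action :: "cgs \<Rightarrow> nat set \<Rightarrow> (nat \<Rightarrow> nat list \<Rightarrow> nat) \<Rightarrow> nat list \<Rightarrow> nat list" where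
  "joint_action C A S h = map (\<lambda>a. if a \<in> A then S a h else 0) [1..<Suc (cgs_agents C)]"

lemma joint_action_nth:
  assumes "a \<in> A" "A \<subseteq> {1..cgs_agents C}"
  shows "joint_action C A S h ! (a - 1) = S a h"
proof -
  from assms have "1 \<le> a" "a \<le> cgs_agents C" by auto
  then have "a - 1 < length [1..<Suc (cgs_agents C)]" "[1..<Suc (cgs_agents C)] ! (a - 1) = a"
    by (auto simp del: upt_Suc)
  with assms(1) show ?thesis by (simp add: joint_action_def del: upt_Suc)
qed

lemma outcome_Suc:
  assumes "\<rho> \<in> outcomes C A q S"
  obtains \<alpha> where "\<alpha> \<in> action_tuples C (\<rho> i)" "\<And>a. a \<in> A \<Longrightarrow> \<alpha> ! (a - 1) = S a (map \<rho> [0..<Suc i])"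
    "\<rho> (Suc i) = cgs_trans C (\<rho> i) \<alpha>"
proof -
  have "\<exists>\<alpha> \<in> action_tuples C (\<rho> i).
            (\<forall>a \<in> A. \<alpha> ! (a - 1) = S a (map \<rho> [0..<Suc i])) \<and> \<rho> (Suc i) = cgs_trans C (\<rho> i) \<alpha>"
    using assms unfolding outcomes_def by (simp only: mem_Collect_eq)
  with that show ?thesis by blast
qed

lemma map_upt_shift: "map \<rho> [0..<Suc (Suc i)] = \<rho> 0 # map (\<lambda>i. \<rho> (Suc i)) [0..<Suc i]"
  by (simp only: upt_conv_Cons[of 0 "Suc (Suc i)"] zero_less_Suc list.map map_Suc_upt[symmetric] map_map comp_def)

lemma outcome_tail:
  assumes "\<rho> \<in> outcomes C A q S"
  shows "(\<lambda>i. \<rho> (Suc i)) \<in> outcomes C A (\<rho> 1) (\<lambda>a h. S a (q # h))"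
proof -
  have q: "\<rho> 0 = q" using assms by (simp add: outcomes_def)
  have "\<exists>\<alpha> \<in> action_tuples C (\<rho> (Suc i)).
      (\<forall>a \<in> A. \<alpha> ! (a - 1) = S a (q # map (\<lambda>i. \<rho> (Suc i)) [0..<Suc i])) \<and>
      \<rho> (Suc (Suc i)) = cgs_trans C (\<rho> (Suc i)) \<alpha>" for i
    using outcome_Suc[OF assms, of "Suc i"] map_upt_shift[of \<rho> i] q by metis
  then show ?thesis unfolding outcomes_def by simp
qed

section \<open>Winning regions and the controllable predecessor\<close>

locale game =
  fixes C :: cgs and P :: "nat set" and k :: nat
  assumes wf: "wf_cgs P C" and agents: "cgs_agents C = k"
begin

lemma trans_state: "q \<in> states C \<Longrightarrow> \<alpha> \<in> action_tuples C q \<Longrightarrow> cgs_trans C q \<alpha> \<in> states C"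
  using wf by (auto simp: wf_cgs_def)

lemma default_action: "q \<in> states C \<Longrightarrow> replicate k 0 \<in> action_tuples C q"
  using wf agents by (auto simp: wf_cgs_def action_tuples_def Suc_le_eq)

lemma joint_action_tuple:
  assumes S: "strategy_profile C A S" and A: "A \<subseteq> {1..k}" and h: "h \<in> histories C"
  shows "joint_action C A S h \<in> action_tuples C (last h)"
proof -
  from h have q: "last h \<in> states C" by (auto simp: histories_def)
  have "joint_action C A S h ! (a - 1) < cgs_acts C (last h) a" if a: "a \<in> {1..k}" for a
  proof -
    have "a - 1 < length [1..<Suc k]" "[1..<Suc k] ! (a - 1) = a" using a by (auto simp del: upt_Suc)
    then have "joint_action C A S h ! (a - 1) = (if a \<in> A then S a h else 0)"
      by (simp add: joint_action_def agents del: upt_Suc)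
    moreover have "1 \<le> cgs_acts C (last h) a" using wf q a agents by (auto simp: wf_cgs_def)
    moreover have "S a h < cgs_acts C (last h) a" if "a \<in> A"
      using S h that by (auto simp: strategy_profile_def strategy_def)
    ultimately show ?thesis by auto
  qed
  then show ?thesis by (auto simp: action_tuples_def agents joint_action_def)
qed

lemma outcome_states:
  assumes "\<rho> \<in> outcomes C A q S" "q \<in> states C"
  shows "\<rho> i \<in> states C"
proof (induction i)
  case 0
  then show ?case using assms by (simp add: outcomes_def)
next
  case (Suc i)
  obtain \<alpha> where "\<alpha> \<in> action_tuples C (\<rho> i)" "\<rho> (Suc i) = cgs_trans C (\<rho> i) \<alpha>"
    using outcome_Suc[OF assms(1), of i] by blast
  with Suc trans_state show ?case by simp
qed

lemma outcome_history:
  assumes "\<rho> \<in> outcomes C A q S" "q \<in> states C"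
  shows "map \<rho> [0..<Suc i] \<in> histories C"
  using outcome_states[OF assms] by (auto simp: histories_def)

lemma play_outcome:
  assumes q: "q \<in> states C"
    and g: "\<And>h. h \<in> histories C \<Longrightarrow> g h \<in> action_tuples C (last h)"
    "\<And>h a. h \<in> histories C \<Longrightarrow> a \<in> A \<Longrightarrow> g h ! (a - 1) = S a h"
  shows "(\<lambda>i. last (play C g q i)) \<in> outcomes C A q S"
proof -
  have h: "play C g q n \<in> histories C" for n
  proof (induction n)
    case 0
    then show ?case using q by (simp add: histories_def)
  next
    case (Suc n)
    then have "last (play C g q n) \<in> states C" by (auto simp: histories_def)
    with Suc g(1)[OF Suc] trans_state show ?case by (auto simp: histories_def)
  qed
  have "\<exists>\<alpha> \<in> action_tuples C (last (play C g q i)).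
     (\<forall>a \<in> A. \<alpha> ! (a - 1) = S a (map (\<lambda>i. last (play C g q i)) [0..<Suc i])) \<and>
     last (play C g q (Suc i)) = cgs_trans C (last (play C g q i)) \<alpha>" for i
    unfolding map_last_play using g[OF h[of i]] by (intro bexI[of _ "g (play C g q i)"]) auto
  then show ?thesis unfolding outcomes_def by simp
qed

text \<open>Without it the quantifier over outcomes could be vacuous, and a coalition might enforce
  a property that fails on every path.\<close>

lemma outcome_exists:
  assumes "q \<in> states C" "A \<subseteq> {1..k}" "strategy_profile C A S"
  shows "\<exists>\<rho>. \<rho> \<in> outcomes C A q S"
proof
  show "(\<lambda>i. last (play C (joint_action C A S) q i)) \<in> outcomes C A q S"
    by (rule play_outcome[OF assms(1)])
       (use joint_action_tuple[OF assms(3,2)] joint_action_nth assms(2) agents in auto)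
qed

lemma memoryless_profile:
  assumes A: "A \<subseteq> {1..k}" and X: "\<And>q. q \<in> states C \<Longrightarrow> f q \<in> action_tuples C q"
  shows "strategy_profile C A (\<lambda>a h. f (last h) ! (a - 1))"
  unfolding strategy_profile_def strategy_def
proof (intro ballI)
  fix a h assume "a \<in> A" and h: "h \<in> histories C"
  then have "last h \<in> states C" by (auto simp: histories_def)
  from X[OF this] \<open>a \<in> A\<close> A agents show "f (last h) ! (a - 1) < cgs_acts C (last h) a"
    by (auto simp: action_tuples_def)
qed

lemma memoryless_outcome:
  assumes "\<rho> \<in> outcomes C A q (\<lambda>a h. f (last h) ! (a - 1))"
  obtains \<alpha> where "\<alpha> \<in> action_tuples C (\<rho> i)" "\<And>a. a \<in> A \<Longrightarrow> \<alpha> ! (a - 1) = f (\<rho> i) ! (a - 1)"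
    "\<rho> (Suc i) = cgs_trans C (\<rho> i) \<alpha>"
  using outcome_Suc[OF assms, of i] by auto

lemma cpre_iff_joint:
  assumes "q \<in> states C" "A \<subseteq> {1..k}"
  shows "cpre C A Z q \<longleftrightarrow> (\<exists>S. strategy_profile C A S \<and> (\<forall>\<rho> \<in> outcomes C A q S. \<rho> 1 \<in> Z))"
proof
  assume "cpre C A Z q"
  then obtain \<alpha> where \<alpha>: "\<alpha> \<in> action_tuples C q" "\<And>\<beta>. \<beta> \<in> action_tuples C q \<Longrightarrow>
     \<forall>a \<in> A. \<beta> ! (a - 1) = \<alpha> ! (a - 1) \<Longrightarrow> cgs_trans C q \<beta> \<in> Z" unfolding cpre_def by blast
  define f where "f q' = (if q' = q then \<alpha> else replicate k 0)" for q'
  have p: "strategy_profile C A (\<lambda>a h. f (last h) ! (a - 1))"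
    by (rule memoryless_profile[OF assms(2)]) (use \<alpha>(1) default_action in \<open>auto simp: f_def\<close>)
  have "\<rho> 1 \<in> Z" if \<rho>: "\<rho> \<in> outcomes C A q (\<lambda>a h. f (last h) ! (a - 1))" for \<rho>
  proof -
    have "\<rho> 0 = q" using \<rho> by (simp add: outcomes_def)
    with memoryless_outcome[OF \<rho>, of 0] \<alpha>(2) show ?thesis by (metis One_nat_def f_def)
  qed
  with p show "\<exists>S. strategy_profile C A S \<and> (\<forall>\<rho> \<in> outcomes C A q S. \<rho> 1 \<in> Z)" by blast
next
  assume "\<exists>S. strategy_profile C A S \<and> (\<forall>\<rho> \<in> outcomes C A q S. \<rho> 1 \<in> Z)"
  then obtain S where S: "strategy_profile C A S" "\<And>\<rho>. \<rho> \<in> outcomes C A q S \<Longrightarrow> \<rho> 1 \<in> Z" by blast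
  have h: "[q] \<in> histories C" using assms(1) by (simp add: histories_def)
  have nth: "joint_action C A S h ! (a - 1) = S a h" if "a \<in> A" for a h
    using joint_action_nth that assms(2) agents by simp
  show "cpre C A Z q" unfolding cpre_def
  proof (intro bexI[of _ "joint_action C A S [q]"] ballI impI)
    fix \<beta> assume \<beta>: "\<beta> \<in> action_tuples C q" "\<forall>a \<in> A. \<beta> ! (a - 1) = joint_action C A S [q] ! (a - 1)"
    \<comment> \<open>The first move is the deviation \<open>\<beta>\<close>, later ones follow
      \<open>S\<close>, so the play is an outcome of \<open>S\<close> whose second state is the
      successor under \<open>\<beta>\<close>.\<close>
    define g where "g h = (if h = [q] then \<beta> else joint_action C A S h)" for h
    have "(\<lambda>i. last (play C g q i)) \<in> outcomes C A q S"
      by (rule play_outcome[OF assms(1)])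
         (use joint_action_tuple[OF S(1) assms(2)] \<beta> nth in \<open>auto simp: g_def\<close>)
    from S(2)[OF this] show "cgs_trans C q \<beta> \<in> Z" by (simp add: g_def)
  qed (use joint_action_tuple[OF S(1) assms(2) h] in simp)
qed

definition winning :: "nat set \<Rightarrow> ((nat \<Rightarrow> nat) \<Rightarrow> bool) \<Rightarrow> nat set" where
  "winning A \<Phi> = {q \<in> states C. \<exists>S. strategy_profile C A S \<and> (\<forall>\<rho> \<in> outcomes C A q S. \<Phi> \<rho>)}"

lemma winning_next: "A \<subseteq> {1..k} \<Longrightarrow> winning A (\<lambda>\<rho>. \<rho> 1 \<in> Z) = {q \<in> states C. cpre C A Z q}"
  using cpre_iff_joint unfolding winning_def by blast

text \<open>At each state of \<open>X\<close> some joint action keeps the play in \<open>X\<close>;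
  playing these actions without memory wins.\<close>

lemma winning_globally_lower:
  assumes A: "A \<subseteq> {1..k}" and X: "X \<subseteq> states C" "X \<subseteq> Z" "\<And>q. q \<in> X \<Longrightarrow> cpre C A X q"
  shows "X \<subseteq> winning A (\<lambda>\<rho>. \<forall>i. \<rho> i \<in> Z)"
proof
  fix q assume q: "q \<in> X"
  from X(3) have "\<forall>q \<in> X. \<exists>\<alpha> \<in> action_tuples C q. \<forall>\<beta> \<in> action_tuples C q.
     (\<forall>a \<in> A. \<beta> ! (a - 1) = \<alpha> ! (a - 1)) \<longrightarrow> cgs_trans C q \<beta> \<in> X" unfolding cpre_def by blast
  then obtain \<alpha> where \<alpha>: "\<And>q. q \<in> X \<Longrightarrow> \<alpha> q \<in> action_tuples C q"
     "\<And>q \<beta>. q \<in> X \<Longrightarrow> \<beta> \<in> action_tuples C q \<Longrightarrow> \<forall>a \<in> A. \<beta> ! (a - 1) = \<alpha> q ! (a - 1) \<Longrightarrow> cgs_trans C q \<beta> \<in> X"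
    by metis
  define f where "f q = (if q \<in> X then \<alpha> q else replicate k 0)" for q
  have p: "strategy_profile C A (\<lambda>a h. f (last h) ! (a - 1))"
    by (rule memoryless_profile[OF A]) (use \<alpha>(1) default_action in \<open>auto simp: f_def\<close>)
  have "\<rho> i \<in> X" if \<rho>: "\<rho> \<in> outcomes C A q (\<lambda>a h. f (last h) ! (a - 1))" for \<rho> i
  proof (induction i)
    case 0
    then show ?case using \<rho> q by (simp add: outcomes_def)
  next
    case (Suc i)
    with memoryless_outcome[OF \<rho>, of i] \<alpha>(2)[OF Suc] show ?case by (metis f_def)
  qed
  with p q X(1,2) show "q \<in> winning A (\<lambda>\<rho>. \<forall>i. \<rho> i \<in> Z)" unfolding winning_def by blast
qed

text \<open>A winning strategy leads back into the winning region, so the region survives every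
  round of the decreasing iteration.\<close>

lemma winning_globally_closed:
  assumes A: "A \<subseteq> {1..k}" and q: "q \<in> winning A (\<lambda>\<rho>. \<forall>i. \<rho> i \<in> Z)"
  shows "q \<in> Z" "cpre C A (winning A (\<lambda>\<rho>. \<forall>i. \<rho> i \<in> Z)) q"
proof -
  from q obtain S where qs: "q \<in> states C" and S: "strategy_profile C A S"
    "\<And>\<rho> i. \<rho> \<in> outcomes C A q S \<Longrightarrow> \<rho> i \<in> Z" unfolding winning_def by blast
  from outcome_exists[OF qs A S(1)] S(2)[of _ 0] show "q \<in> Z" by (auto simp: outcomes_def)
  have "\<rho> 1 \<in> winning A (\<lambda>\<rho>. \<forall>i. \<rho> i \<in> Z)" if \<rho>: "\<rho> \<in> outcomes C A q S" for \<rho>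
  proof -
    have q': "\<rho> 1 \<in> states C" by (rule outcome_states[OF \<rho> qs])
    \<comment> \<open>After a first step the coalition goes on as if the history still started at
      \<open>q\<close>.\<close>
    let ?S = "\<lambda>a h. S a (q # h)"
    have p: "strategy_profile C A ?S" unfolding strategy_profile_def strategy_def
    proof (intro ballI)
      fix a h assume "a \<in> A" "h \<in> histories C"
      moreover then have "q # h \<in> histories C" "last (q # h) = last h" using qs by (auto simp: histories_def)
      ultimately show "S a (q # h) < cgs_acts C (last h) a"
        using S(1) by (metis strategy_def strategy_profile_def)
    qed
    have "\<rho>' i \<in> Z" if \<rho>': "\<rho>' \<in> outcomes C A (\<rho> 1) ?S" for \<rho>' i
    proof -
      let ?\<rho> = "\<lambda>i. case i of 0 \<Rightarrow> q | Suc j \<Rightarrow> \<rho>' j"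
      obtain \<alpha> where \<alpha>: "\<alpha> \<in> action_tuples C q" "\<And>a. a \<in> A \<Longrightarrow> \<alpha> ! (a - 1) = S a [q]" "\<rho> 1 = cgs_trans C q \<alpha>"
        using outcome_Suc[OF \<rho>, of 0] \<rho> by (auto simp: outcomes_def)
      have "?\<rho> \<in> outcomes C A q S" unfolding outcomes_def
      proof (intro CollectI conjI allI)
        fix i
        show "\<exists>\<alpha> \<in> action_tuples C (?\<rho> i). (\<forall>a \<in> A. \<alpha> ! (a - 1) = S a (map ?\<rho> [0..<Suc i])) \<and>
           ?\<rho> (Suc i) = cgs_trans C (?\<rho> i) \<alpha>"
        proof (cases i)
          case 0
          then show ?thesis using \<alpha> \<rho>' by (intro bexI[of _ \<alpha>]) (auto simp: outcomes_def)
        next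
          case (Suc j)
          have "map ?\<rho> [0..<Suc (Suc j)] = q # map \<rho>' [0..<Suc j]" by (subst map_upt_shift) simp
          then show ?thesis using outcome_Suc[OF \<rho>', of j] unfolding Suc by (metis old.nat.simps(5))
        qed
      qed simp
      from S(2)[OF this, of "Suc i"] show ?thesis by simp
    qed
    with p q' show ?thesis unfolding winning_def by blast
  qed
  then show "cpre C A (winning A (\<lambda>\<rho>. \<forall>i. \<rho> i \<in> Z)) q"
    using cpre_iff_joint[OF qs A] S(1) by blast
qed

text \<open>The two closure properties keep every round of the increasing iteration inside the
  winning region.\<close>

lemma winning_finally_closed:
  fixes Z :: "nat set"
  assumes A: "A \<subseteq> {1..k}"
  defines "W \<equiv> winning A (\<lambda>\<rho>. \<exists>i. \<rho> i \<in> Z)"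
  shows "q \<in> states C \<Longrightarrow> q \<in> Z \<Longrightarrow> q \<in> W" "q \<in> states C \<Longrightarrow> cpre C A W q \<Longrightarrow> q \<in> W"
proof -
  assume q: "q \<in> states C"
  {
    assume z: "q \<in> Z"
    have "strategy_profile C A (\<lambda>a h. replicate k 0 ! (a - 1))"
      using memoryless_profile[OF A default_action] by simp
    moreover have "\<exists>i. \<rho> i \<in> Z" if "\<rho> \<in> outcomes C A q (\<lambda>a h. replicate k 0 ! (a - 1))" for \<rho>
      using that z by (auto simp: outcomes_def)
    ultimately have "\<exists>S. strategy_profile C A S \<and> (\<forall>\<rho> \<in> outcomes C A q S. \<exists>i. \<rho> i \<in> Z)"
      by (intro exI[of _ "\<lambda>a h. replicate k 0 ! (a - 1)"] conjI ballI) simp_all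
    with q show "q \<in> W" unfolding W_def winning_def by (intro CollectI conjI)
  next
    assume "cpre C A W q"
    from iffD1[OF cpre_iff_joint[OF q A] this]
    obtain S0 where S0: "strategy_profile C A S0" "\<And>\<rho>. \<rho> \<in> outcomes C A q S0 \<Longrightarrow> \<rho> 1 \<in> W"
      by blast
    have "\<forall>q' \<in> W. \<exists>S. strategy_profile C A S \<and> (\<forall>\<rho> \<in> outcomes C A q' S. \<exists>i. \<rho> i \<in> Z)"
      unfolding W_def winning_def by blast
    then obtain T where T: "\<And>q'. q' \<in> W \<Longrightarrow> strategy_profile C A (T q')"
       "\<And>q' \<rho>. q' \<in> W \<Longrightarrow> \<rho> \<in> outcomes C A q' (T q') \<Longrightarrow> \<exists>i. \<rho> i \<in> Z" by metis
    \<comment> \<open>Winning strategies are glued: the first move is that of \<open>S0\<close>, and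
      from the state reached then its own strategy takes over, with the first state dropped from the
      history.\<close>
    define S where "S a h = (if tl h \<noteq> [] \<and> hd (tl h) \<in> W then T (hd (tl h)) a (tl h) else S0 a h)" for a h
    have p: "strategy_profile C A S" unfolding strategy_profile_def strategy_def
    proof (intro ballI)
      fix a h assume a: "a \<in> A" and h: "h \<in> histories C"
      show "S a h < cgs_acts C (last h) a"
      proof (cases "tl h \<noteq> [] \<and> hd (tl h) \<in> W")
        case True
        then have "tl h \<in> histories C" "last (tl h) = last h" using h
          by (auto simp: histories_def last_tl dest: list.set_sel(2))
        moreover from T(1)[of "hd (tl h)"] True a
        have "strategy C a (T (hd (tl h)) a)" by (simp add: strategy_profile_def)
        ultimately have "T (hd (tl h)) a (tl h) < cgs_acts C (last h) a" by (metis strategy_def)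
        with True show ?thesis by (simp add: S_def)
      next
        case False
        with S0(1) a h show ?thesis by (auto simp: S_def strategy_profile_def strategy_def)
      qed
    qed
    have "\<exists>i. \<rho> i \<in> Z" if \<rho>: "\<rho> \<in> outcomes C A q S" for \<rho>
    proof -
      have \<rho>0: "\<rho> 0 = q" using \<rho> by (simp add: outcomes_def)
      obtain \<alpha> where \<alpha>: "\<alpha> \<in> action_tuples C q" "\<And>a. a \<in> A \<Longrightarrow> \<alpha> ! (a - 1) = S0 a [q]" "\<rho> 1 = cgs_trans C q \<alpha>"
        using outcome_Suc[OF \<rho>, of 0] \<rho>0 by (auto simp: S_def)
      define g where "g h = (if h = [q] then \<alpha> else joint_action C A S0 h)" for h
      have "(\<lambda>i. last (play C g q i)) \<in> outcomes C A q S0"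
        by (rule play_outcome[OF q])
           (use joint_action_tuple[OF S0(1) A] \<alpha> joint_action_nth A agents in \<open>auto simp: g_def\<close>)
      from S0(2)[OF this] \<alpha>(3) have w: "\<rho> 1 \<in> W" by (simp add: g_def)
      from outcome_tail[OF \<rho>] have t: "(\<lambda>i. \<rho> (Suc i)) \<in> outcomes C A (\<rho> 1) (\<lambda>a h. S a (q # h))" .
      have "S a (q # map (\<lambda>i. \<rho> (Suc i)) [0..<Suc i]) = T (\<rho> 1) a (map (\<lambda>i. \<rho> (Suc i)) [0..<Suc i])" for a i
        using w by (simp add: S_def upt_conv_Cons del: upt_Suc)
      with t have "(\<lambda>i. \<rho> (Suc i)) \<in> outcomes C A (\<rho> 1) (T (\<rho> 1))" unfolding outcomes_def by simp
      from T(2)[OF w this] show ?thesis by blast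
    qed
    with p q show "q \<in> W" unfolding W_def winning_def by blast
  }
qed

lemma winning_finally_upper:
  assumes A: "A \<subseteq> {1..k}" and Y: "\<And>q. q \<in> states C \<Longrightarrow> q \<in> Z \<Longrightarrow> q \<in> Y"
    "\<And>q. q \<in> states C \<Longrightarrow> cpre C A Y q \<Longrightarrow> q \<in> Y"
  shows "winning A (\<lambda>\<rho>. \<exists>i. \<rho> i \<in> Z) \<subseteq> Y"
proof (rule subsetI, rule ccontr)
  fix q assume w: "q \<in> winning A (\<lambda>\<rho>. \<exists>i. \<rho> i \<in> Z)" and q: "q \<notin> Y"
  from w obtain S where qs: "q \<in> states C" and S: "strategy_profile C A S"
    "\<And>\<rho>. \<rho> \<in> outcomes C A q S \<Longrightarrow> \<exists>i. \<rho> i \<in> Z" unfolding winning_def by blast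
  have nth: "joint_action C A S h ! (a - 1) = S a h" if "a \<in> A" for a h
    using joint_action_nth that A agents by simp
  \<comment> \<open>Outside \<open>Y\<close> every move of \<open>S\<close> has an answer that stays
    outside \<open>Y\<close>; the answers form a play which never meets \<open>Z\<close>.\<close>
  have "\<forall>h \<in> histories C. \<exists>\<beta>. \<beta> \<in> action_tuples C (last h) \<and> (\<forall>a \<in> A. \<beta> ! (a - 1) = S a h) \<and>
     (last h \<notin> Y \<longrightarrow> cgs_trans C (last h) \<beta> \<notin> Y)"
  proof
    fix h assume h: "h \<in> histories C"
    note j = joint_action_tuple[OF S(1) A h]
    have ls: "last h \<in> states C" using h by (auto simp: histories_def)
    show "\<exists>\<beta>. \<beta> \<in> action_tuples C (last h) \<and> (\<forall>a \<in> A. \<beta> ! (a - 1) = S a h) \<and>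
     (last h \<notin> Y \<longrightarrow> cgs_trans C (last h) \<beta> \<notin> Y)"
    proof (cases "last h \<in> Y")
      case True
      with j nth show ?thesis by blast
    next
      case False
      with Y(2)[OF ls] have "\<not> cpre C A Y (last h)" by blast
      with j nth show ?thesis unfolding cpre_def by metis
    qed
  qed
  then obtain g where g: "\<And>h. h \<in> histories C \<Longrightarrow> g h \<in> action_tuples C (last h)"
    "\<And>h a. h \<in> histories C \<Longrightarrow> a \<in> A \<Longrightarrow> g h ! (a - 1) = S a h"
    "\<And>h. h \<in> histories C \<Longrightarrow> last h \<notin> Y \<Longrightarrow> cgs_trans C (last h) (g h) \<notin> Y" by metis
  let ?\<rho> = "\<lambda>i. last (play C g q i)"
  have \<rho>: "?\<rho> \<in> outcomes C A q S" by (rule play_outcome[OF qs g(1,2)])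
  have h: "play C g q i \<in> histories C" for i
    using outcome_history[OF \<rho> qs, of i] unfolding map_last_play .
  have "?\<rho> i \<notin> Y" for i
  proof (induction i)
    case (Suc i)
    from g(3)[OF h Suc] show ?case by simp
  qed (use q in simp)
  moreover from S(2)[OF \<rho>] obtain i where "?\<rho> i \<in> Z" by blast
  ultimately show False using Y(1)[of "?\<rho> i"] outcome_states[OF \<rho> qs] by blast
qed

lemma finite_states [simp]: "finite (states C)"
  by (simp add: states_def)

end

text \<open>Each proper step increases \<open>m\<close> by at least 1 while \<open>m\<close> is at
  most \<open>N\<close>, so a fixpoint is reached within \<open>N\<close> steps and then
  kept.\<close>

lemma funpow_fixed:
  fixes m :: "'a \<Rightarrow> nat"
  assumes "\<And>n. f ((f ^^ n) x) \<noteq> (f ^^ n) x \<Longrightarrow> m ((f ^^ n) x) < m (f ((f ^^ n) x))"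
    and "\<And>n. m ((f ^^ n) x) \<le> N"
  shows "f ((f ^^ N) x) = (f ^^ N) x"
proof -
  have "\<exists>n \<le> N. f ((f ^^ n) x) = (f ^^ n) x"
  proof (rule ccontr)
    assume "\<not> ?thesis"
    then have ne: "f ((f ^^ n) x) \<noteq> (f ^^ n) x" if "n \<le> N" for n using that by blast
    have "n \<le> m ((f ^^ n) x)" if "n \<le> Suc N" for n
      using that
    proof (induction n)
      case (Suc n)
      then have "n \<le> m ((f ^^ n) x)" by simp
      also have "\<dots> < m (f ((f ^^ n) x))" by (rule assms(1)[OF ne]) (use Suc.prems in simp)
      finally show ?case by simp
    qed simp
    from this[of "Suc N"] assms(2)[of "Suc N"] show False by simp
  qed
  then obtain n where n: "n \<le> N" "f ((f ^^ n) x) = (f ^^ n) x" by blast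
  then obtain j where j: "N = j + n" by (metis le_add_diff_inverse2)
  have "(f ^^ N) x = (f ^^ n) x" using n(2) by (simp add: j funpow_add funpow_const)
  with n(2) show ?thesis by simp
qed

context game
begin

definition f_step :: "nat set \<Rightarrow> nat set \<Rightarrow> nat set" where
  "f_step A Y = {q \<in> states C. q \<in> Y \<or> cpre C A Y q}"

definition g_step :: "nat set \<Rightarrow> nat set \<Rightarrow> nat set" where
  "g_step A X = {q \<in> states C. q \<in> X \<and> cpre C A X q}"

lemma winning_finally:
  assumes A: "A \<subseteq> {1..k}" and Z: "Z \<subseteq> states C"
  shows "winning A (\<lambda>\<rho>. \<exists>i. \<rho> i \<in> Z) = (f_step A ^^ cgs_size C) Z"
proof -
  let ?W = "winning A (\<lambda>\<rho>. \<exists>i. \<rho> i \<in> Z)" and ?Y = "\<lambda>n. (f_step A ^^ n) Z"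
  have sub: "?Y n \<subseteq> states C" for n by (induction n) (use Z in \<open>auto simp: f_step_def\<close>)
  have inc: "?Y n \<subseteq> f_step A (?Y n)" for n using sub[of n] by (auto simp: f_step_def)
  have "f_step A (?Y (cgs_size C)) = ?Y (cgs_size C)"
  proof (rule funpow_fixed[where m = card])
    show "card (?Y n) < card (f_step A (?Y n))" if "f_step A (?Y n) \<noteq> ?Y n" for n
      by (rule psubset_card_mono) (use inc[of n] that in \<open>auto simp: f_step_def\<close>)
    show "card (?Y n) \<le> cgs_size C" for n
      using card_mono[OF finite_states sub[of n]] by (simp add: states_def)
  qed
  then have fix1: "q \<in> ?Y (cgs_size C)" if "q \<in> states C" "cpre C A (?Y (cgs_size C)) q" for q
    using that by (auto simp: f_step_def)
  have ZY: "Z \<subseteq> ?Y n" for n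
  proof (induction n)
    case (Suc n)
    with inc[of n] show ?case by auto
  qed simp
  have "?W \<subseteq> ?Y (cgs_size C)"
    by (rule winning_finally_upper[OF A]) (use ZY fix1 in auto)
  moreover have "?Y n \<subseteq> ?W" for n
  proof (induction n)
    case 0
    show ?case using winning_finally_closed(1)[OF A, of _ Z] Z by (simp add: subset_iff)
  next
    case (Suc n)
    show ?case
    proof
      fix q assume "q \<in> ?Y (Suc n)"
      then have q: "q \<in> states C" "q \<in> ?Y n \<or> cpre C A (?Y n) q" by (auto simp: f_step_def)
      then show "q \<in> ?W" using Suc winning_finally_closed(2)[OF A q(1)] cpre_mono by blast
    qed
  qed
  ultimately show ?thesis by blast
qed

lemma winning_globally:
  assumes A: "A \<subseteq> {1..k}" and Z: "Z \<subseteq> states C"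
  shows "winning A (\<lambda>\<rho>. \<forall>i. \<rho> i \<in> Z) = (g_step A ^^ cgs_size C) Z"
proof -
  let ?W = "winning A (\<lambda>\<rho>. \<forall>i. \<rho> i \<in> Z)" and ?X = "\<lambda>n. (g_step A ^^ n) Z"
  have sub: "?X n \<subseteq> states C" for n by (induction n) (use Z in \<open>auto simp: g_step_def\<close>)
  have dec: "g_step A (?X n) \<subseteq> ?X n" for n by (auto simp: g_step_def)
  have "g_step A (?X (cgs_size C)) = ?X (cgs_size C)"
  proof (rule funpow_fixed[where m = "\<lambda>X. cgs_size C - card X"])
    show "cgs_size C - card (?X n) < cgs_size C - card (g_step A (?X n))" if "g_step A (?X n) \<noteq> ?X n" for n
    proof -
      have "finite (?X n)" using sub finite_states finite_subset by blast
      then have "card (g_step A (?X n)) < card (?X n)" using psubset_card_mono dec[of n] that by blast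
      moreover have "card (?X n) \<le> cgs_size C"
        using card_mono[OF finite_states sub[of n]] by (simp add: states_def)
      ultimately show ?thesis by simp
    qed
  qed simp
  then have "cpre C A (?X (cgs_size C)) q" if "q \<in> ?X (cgs_size C)" for q
    using that by (auto simp: g_step_def)
  moreover have "?X n \<subseteq> Z" for n
  proof (induction n)
    case (Suc n)
    with dec[of n] show ?case by auto
  qed simp
  ultimately have "?X (cgs_size C) \<subseteq> ?W" using winning_globally_lower[OF A sub] by blast
  moreover have "?W \<subseteq> ?X n" for n
  proof (induction n)
    case 0
    show ?case unfolding funpow_0 by (rule subsetI, rule winning_globally_closed(1)[OF A])
  next
    case (Suc n)
    show ?case
    proof
      fix q assume q: "q \<in> ?W"
      then have "q \<in> states C" by (simp add: winning_def)
      moreover have "q \<in> ?X n" using q Suc by blast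
      moreover have "cpre C A (?X n) q" by (rule cpre_mono[OF winning_globally_closed(2)[OF A q] Suc])
      ultimately show "q \<in> ?X (Suc n)" by (simp add: g_step_def[of A "?X n"])
    qed
  qed
  ultimately show ?thesis by blast
qed

definition sat_set :: "sform \<Rightarrow> nat set" where
  "sat_set \<phi> = {q \<in> states C. sat C \<phi> q}"

lemma sat_set_Strat:
  assumes "\<And>\<rho>. (\<And>i. \<rho> i \<in> states C) \<Longrightarrow> path_sat C \<psi> \<rho> \<longleftrightarrow> \<Phi> \<rho>"
  shows "sat_set (Strat A \<psi>) = winning A \<Phi>"
proof -
  have "(\<forall>\<rho> \<in> outcomes C A q S. path_sat C \<psi> \<rho>) \<longleftrightarrow> (\<forall>\<rho> \<in> outcomes C A q S. \<Phi> \<rho>)"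
    if "q \<in> states C" for q S
    by (rule ball_cong[OF refl]) (rule assms, rule outcome_states[OF _ that])
  then have "(\<exists>S. strategy_profile C A S \<and> (\<forall>\<rho> \<in> outcomes C A q S. path_sat C \<psi> \<rho>)) \<longleftrightarrow>
     (\<exists>S. strategy_profile C A S \<and> (\<forall>\<rho> \<in> outcomes C A q S. \<Phi> \<rho>))" if "q \<in> states C" for q
    using that by (simp only:)
  then show ?thesis unfolding sat_set_def winning_def sat.simps by (intro Collect_cong conj_cong refl)
qed

lemma sat_set_Next: "A \<subseteq> {1..k} \<Longrightarrow> sat_set (Strat A (Next \<phi>)) = {q \<in> states C. cpre C A (sat_set \<phi>) q}"
proof -
  assume A: "A \<subseteq> {1..k}"
  have "sat_set (Strat A (Next \<phi>)) = winning A (\<lambda>\<rho>. \<rho> 1 \<in> sat_set \<phi>)"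
    by (rule sat_set_Strat) (auto simp: sat_set_def)
  with winning_next[OF A] show ?thesis by simp
qed

lemma sat_set_Finally: "A \<subseteq> {1..k} \<Longrightarrow> sat_set (Strat A (Finally \<phi>)) = (f_step A ^^ cgs_size C) (sat_set \<phi>)"
proof -
  assume A: "A \<subseteq> {1..k}"
  have "sat_set (Strat A (Finally \<phi>)) = winning A (\<lambda>\<rho>. \<exists>i. \<rho> i \<in> sat_set \<phi>)"
    by (rule sat_set_Strat) (auto simp: sat_set_def)
  moreover have "sat_set \<phi> \<subseteq> states C" by (auto simp: sat_set_def)
  ultimately show ?thesis using winning_finally[OF A] by simp
qed

lemma sat_set_Globally: "A \<subseteq> {1..k} \<Longrightarrow> sat_set (Strat A (Globally \<phi>)) = (g_step A ^^ cgs_size C) (sat_set \<phi>)"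
proof -
  assume A: "A \<subseteq> {1..k}"
  have "sat_set (Strat A (Globally \<phi>)) = winning A (\<lambda>\<rho>. \<forall>i. \<rho> i \<in> sat_set \<phi>)"
    by (rule sat_set_Strat) (auto simp: sat_set_def)
  moreover have "sat_set \<phi> \<subseteq> states C" by (auto simp: sat_set_def)
  ultimately show ?thesis using winning_globally[OF A] by simp
qed

end

section \<open>Tabulated instances\<close>

type_synonym row = "nat list \<times> nat list \<times> nat list"
type_synonym cdata = "nat \<times> nat list \<times> row list"
type_synonym idata = "nat list \<times> cdata list \<times> cdata list \<times> nat"

text \<open>Labels, actions and transitions are functions on all numbers; a row keeps the finite
  part that the encoding shows, the values at one state.\<close>

definition row_of :: "cgs \<Rightarrow> nat \<Rightarrow> row" where
  "row_of C q = (sorted_list_of_set (cgs_label C q), map (cgs_acts C q) [1..<Suc (cgs_agents C)],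
     map (cgs_trans C q) (product_lists (map (\<lambda>a. [0..<cgs_acts C q a]) [1..<Suc (cgs_agents C)])))"

definition cdata_of :: "cgs \<Rightarrow> cdata" where
  "cdata_of C = (cgs_size C, sorted_list_of_set (cgs_init C), map (row_of C) [0..<cgs_size C])"

definition idata_of :: "learn_instance \<Rightarrow> idata" where
  "idata_of I = (sorted_list_of_set (li_props I), map cdata_of (li_pos I), map cdata_of (li_neg I), li_bound I)"

definition enc_row :: "row \<Rightarrow> bool list" where
  "enc_row r = enc_list enc_nat (fst r) @ enc_list enc_nat (fst (snd r)) @ enc_list enc_nat (snd (snd r))"

definition enc_cdata :: "cdata \<Rightarrow> bool list" where
  "enc_cdata d = enc_nat (fst d) @ enc_list enc_nat (fst (snd d)) @ enc_list enc_row (snd (snd d))"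

definition enc_idata :: "idata \<Rightarrow> bool list" where
  "enc_idata d = enc_list enc_nat (fst d) @ enc_list enc_cdata (fst (snd d)) @
     enc_list enc_cdata (fst (snd (snd d))) @ enc_nat (snd (snd (snd d)))"

lemma enc_list_map: "enc_list e (map f xs) = enc_list (\<lambda>x. e (f x)) xs"
  by (simp add: enc_list_def comp_def)

lemma enc_cdata_of: "enc_cdata (cdata_of C) = enc_cgs C"
  by (simp add: enc_cdata_def cdata_of_def enc_cgs_def enc_list_map enc_row_def row_of_def del: upt_Suc)

lemma enc_idata_of: "enc_idata (idata_of I) = enc_learn I"
  by (simp add: enc_idata_def idata_of_def enc_learn_def enc_list_map enc_cdata_of)

lemma PF_enc_row [PF_intro]: "PFon D f \<Longrightarrow> PFon D (\<lambda>e. enc_row (f e))"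
  unfolding enc_row_def by (intro PF_intro)

lemma PF_enc_cdata [PF_intro]: "PFon D f \<Longrightarrow> PFon D (\<lambda>e. enc_cdata (f e))"
  unfolding enc_cdata_def by (intro PF_intro)

lemma PF_enc_idata [PF_intro]: "PFon D f \<Longrightarrow> PFon D (\<lambda>e. enc_idata (f e))"
  unfolding enc_idata_def by (intro PF_intro)

primrec tuples :: "nat \<Rightarrow> nat list \<Rightarrow> nat list list" where
  "tuples 0 acts = [[]]"
| "tuples (Suc k) acts = concat (map (\<lambda>x. map (\<lambda>ys. x # ys) (tuples k (tl acts))) [0..<hd acts])"

lemma tuples_eq: "length acts = k \<Longrightarrow> tuples k acts = product_lists (map (\<lambda>n. [0..<n]) acts)"
  by (induction k arbitrary: acts) (auto simp: length_Suc_conv)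

text \<open>Recursion on the fixed number \<open>k\<close> of agents: each level is one more
  computable map, so the program depends on \<open>k\<close> but its time stays polynomial.\<close>

lemma PF_tuples [PF_intro]: "PFon D f \<Longrightarrow> PFon D (\<lambda>e. tuples k (f e))"
proof (rule PF_comp[of "tuples k"], induction k)
  case 0
  then show ?case by (simp add: PF_const)
next
  case (Suc k)
  then have IH: "PF (tuples k)" by simp
  have "PF (\<lambda>acts. concat (map (\<lambda>x. map (\<lambda>ys. x # ys) (tuples k (tl acts))) [0..<hd acts]))"
    by (intro PF_intro PF_comp[OF IH])
  then show ?case by (rule PFon_cong) simp
qed

text \<open>Strictly increasing lists are the canonical codes of finite sets. The sum bounds every
  member, so filtering an interval reproduces the list without any sorting.\<close>

definition strict :: "nat list \<Rightarrow> bool" where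
  "strict xs \<longleftrightarrow> xs = filter (\<lambda>i. i \<in> set xs) [0..<Suc (sum_list xs)]"

lemma strict_sorted_list: "strict xs \<Longrightarrow> sorted_list_of_set (set xs) = xs"
proof -
  assume s: "strict xs"
  have "sorted (filter (\<lambda>i. i \<in> set xs) [0..<Suc (sum_list xs)])"
    "distinct (filter (\<lambda>i. i \<in> set xs) [0..<Suc (sum_list xs)])"
    by (auto simp: sorted_wrt_filter simp del: upt_Suc)
  with s have "sorted xs" "distinct xs" unfolding strict_def by metis+
  then show ?thesis by (rule sorted_list_of_set.idem_if_sorted_distinct)
qed

lemma strict_sorted_list_of_set: "finite S \<Longrightarrow> strict (sorted_list_of_set S)" for S :: "nat set"
proof -
  assume f: "finite S"
  have "S \<subseteq> {..<Suc (sum_list (sorted_list_of_set S))}"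
    using f member_le_sum_list[of _ "sorted_list_of_set S"] by (auto simp: less_Suc_eq_le)
  from sorted_list_of_set_filter[OF this] f show ?thesis by (simp add: strict_def del: upt_Suc)
qed

lemma PF_strict [PF_intro]: "PFon D f \<Longrightarrow> PFon D (\<lambda>e. strict (f e))"
proof (rule PF_comp[of strict])
  show "PF strict" unfolding strict_def[abs_def] by (intro PF_intro)
qed

definition valid_row :: "nat \<Rightarrow> nat \<Rightarrow> nat list \<Rightarrow> row \<Rightarrow> bool" where
  "valid_row k n ps r \<longleftrightarrow> strict (fst r) \<and> (\<forall>p \<in> set (fst r). p \<in> set ps) \<and>
     length (fst (snd r)) = k \<and> (\<forall>x \<in> set (fst (snd r)). 1 \<le> x) \<and>
     length (snd (snd r)) = length (tuples k (fst (snd r))) \<and> (\<forall>x \<in> set (snd (snd r)). x < n)"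

definition valid_cdata :: "nat \<Rightarrow> nat list \<Rightarrow> cdata \<Rightarrow> bool" where
  "valid_cdata k ps d \<longleftrightarrow> strict (fst (snd d)) \<and> (\<forall>x \<in> set (fst (snd d)). x < fst d) \<and>
     length (snd (snd d)) = fst d \<and> (\<forall>r \<in> set (snd (snd d)). valid_row k (fst d) ps r)"

definition valid_idata :: "nat \<Rightarrow> idata \<Rightarrow> bool" where
  "valid_idata k d \<longleftrightarrow> strict (fst d) \<and> (\<forall>c \<in> set (fst (snd d)). valid_cdata k (fst d) c) \<and>
     (\<forall>c \<in> set (fst (snd (snd d))). valid_cdata k (fst d) c)"

lemma PF_valid_row [PF_intro]:
  assumes "PFon D n" "PFon D ps" "PFon D r"
  shows "PFon D (\<lambda>e. valid_row k (n e) (ps e) (r e))"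
proof (rule PF_comp3[OF _ assms])
  show "PF (\<lambda>z. valid_row k (fst z) (fst (snd z)) (snd (snd z)))" unfolding valid_row_def by (intro PF_intro)
qed

lemma PF_valid_cdata [PF_intro]:
  assumes "PFon D ps" "PFon D d"
  shows "PFon D (\<lambda>e. valid_cdata k (ps e) (d e))"
proof (rule PF_comp2[OF _ assms])
  show "PF (\<lambda>z. valid_cdata k (fst z) (snd z))" unfolding valid_cdata_def by (intro PF_intro)
qed

lemma PF_valid_idata [PF_intro]:
  assumes "PFon D d"
  shows "PFon D (\<lambda>e. valid_idata k (d e))"
proof (rule PF_comp[OF _ assms])
  show "PF (valid_idata k)" unfolding valid_idata_def[abs_def] by (intro PF_intro)
qed

lemma set_product_lists_acts:
  "set (product_lists (map (\<lambda>a. [0..<cgs_acts C q a]) [1..<Suc (cgs_agents C)])) = action_tuples C q"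
proof -
  have "list_all2 (\<lambda>x ys. x \<in> set ys) \<alpha> (map (\<lambda>a. [0..<cgs_acts C q a]) [1..<Suc (cgs_agents C)]) \<longleftrightarrow>
     \<alpha> \<in> action_tuples C q" for \<alpha>
  proof
    assume l: "list_all2 (\<lambda>x ys. x \<in> set ys) \<alpha> (map (\<lambda>a. [0..<cgs_acts C q a]) [1..<Suc (cgs_agents C)])"
    have "\<alpha> ! (a - 1) < cgs_acts C q a" if "a \<in> {1..cgs_agents C}" for a
      using list_all2_nthD2[OF l, of "a - 1"] that by (auto simp del: upt_Suc)
    with list_all2_lengthD[OF l] show "\<alpha> \<in> action_tuples C q" by (auto simp: action_tuples_def)
  next
    assume a: "\<alpha> \<in> action_tuples C q"
    have "\<alpha> ! i < cgs_acts C q (Suc i)" if "i < cgs_agents C" for i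
      using a that by (auto simp: action_tuples_def dest: bspec[of _ _ "Suc i"])
    with a show "list_all2 (\<lambda>x ys. x \<in> set ys) \<alpha> (map (\<lambda>a. [0..<cgs_acts C q a]) [1..<Suc (cgs_agents C)])"
      by (auto simp: list_all2_conv_all_nth action_tuples_def simp del: upt_Suc)
  qed
  then show ?thesis by (auto simp: product_lists_set simp del: upt_Suc)
qed

lemma tuples_row_of:
  "cgs_agents C = k \<Longrightarrow> tuples k (fst (snd (row_of C q))) =
     product_lists (map (\<lambda>a. [0..<cgs_acts C q a]) [1..<Suc (cgs_agents C)])"
  by (subst tuples_eq) (auto simp: row_of_def comp_def simp del: upt_Suc)

lemma valid_cdata_of:
  assumes "finite P" "wf_cgs P C" "cgs_agents C = k"
  shows "valid_cdata k (sorted_list_of_set P) (cdata_of C)"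
proof -
  have init: "finite (cgs_init C)" "cgs_init C \<subseteq> {..<cgs_size C}"
    using assms(2) by (auto simp: wf_cgs_def states_def intro: finite_subset)
  have "valid_row k (cgs_size C) (sorted_list_of_set P) (row_of C q)" if q: "q < cgs_size C" for q
  proof -
    have w: "cgs_label C q \<subseteq> P" "\<And>a. a \<in> {1..k} \<Longrightarrow> 1 \<le> cgs_acts C q a"
      "\<And>\<alpha>. \<alpha> \<in> action_tuples C q \<Longrightarrow> cgs_trans C q \<alpha> < cgs_size C"
      using assms(2,3) q by (auto simp: wf_cgs_def states_def)
    from w(1) assms(1) have fl: "finite (cgs_label C q)" by (rule finite_subset)
    have t: "length (snd (snd (row_of C q))) = length (tuples k (fst (snd (row_of C q))))"
      unfolding tuples_row_of[OF assms(3)] by (simp add: row_of_def)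
    have r: "\<forall>x \<in> set (snd (snd (row_of C q))). x < cgs_size C"
      using w(3) unfolding row_of_def snd_conv set_map set_product_lists_acts by blast
    show ?thesis unfolding valid_row_def
      using t r w(1,2) fl assms(1,3) strict_sorted_list_of_set[OF fl]
      by (auto simp: row_of_def simp del: upt_Suc)
  qed
  with init strict_sorted_list_of_set[OF init(1)] show ?thesis
    by (auto simp: valid_cdata_def cdata_of_def)
qed

lemma valid_idata_of: "wf_learn_instance k I \<Longrightarrow> valid_idata k (idata_of I)"
  using valid_cdata_of strict_sorted_list_of_set
  by (auto simp: wf_learn_instance_def valid_idata_def idata_of_def)

text \<open>Recovers a structure with the given table from valid data; outside the table its values
  are arbitrary.\<close>

definition cgs_of :: "nat \<Rightarrow> cdata \<Rightarrow> cgs" where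
  "cgs_of k d = \<lparr>cgs_agents = k, cgs_size = fst d, cgs_init = set (fst (snd d)),
     cgs_label = (\<lambda>q. set (fst (snd (snd d) ! q))),
     cgs_acts = (\<lambda>q a. fst (snd (snd (snd d) ! q)) ! (a - 1)),
     cgs_trans = (\<lambda>q \<alpha>. the (map_of (zip (tuples k (fst (snd (snd (snd d) ! q)))) (snd (snd (snd (snd d) ! q)))) \<alpha>))\<rparr>"

lemma cgs_agents_of [simp]: "cgs_agents (cgs_of k d) = k"
  by (simp add: cgs_of_def)

lemma distinct_product_lists_upt: "distinct (product_lists (map (\<lambda>n. [0..<n]) acts))"
  by (rule distinct_product_lists) auto

lemma cgs_of_valid:
  assumes v: "valid_cdata k ps d"
  shows "wf_cgs (set ps) (cgs_of k d)" "cgs_agents (cgs_of k d) = k" "cdata_of (cgs_of k d) = d"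
proof -
  obtain n i rows where d: "d = (n, i, rows)" by (cases d)
  let ?C = "cgs_of k d"
  show ag: "cgs_agents ?C = k" by (simp add: cgs_of_def)
  have st: "states ?C = {..<n}" by (simp add: states_def cgs_of_def d)
  from v have rows: "length rows = n" "strict i" "\<forall>x \<in> set i. x < n" "\<And>q. q < n \<Longrightarrow> valid_row k n ps (rows ! q)"
    by (auto simp: valid_cdata_def d)
  have row: "row_of ?C q = rows ! q" "\<And>\<alpha>. \<alpha> \<in> action_tuples ?C q \<Longrightarrow> cgs_trans ?C q \<alpha> < n"
    "\<And>a. a \<in> {1..k} \<Longrightarrow> 1 \<le> cgs_acts ?C q a" "cgs_label ?C q \<subseteq> set ps" if q: "q < n" for q
  proof -
    obtain l a t where r: "rows ! q = (l, a, t)" by (cases "rows ! q")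
    from rows(4)[OF q] r have w: "strict l" "set l \<subseteq> set ps" "length a = k" "\<forall>x \<in> set a. 1 \<le> x"
      "length t = length (tuples k a)" "\<forall>x \<in> set t. x < n" by (auto simp: valid_row_def)
    show "cgs_label ?C q \<subseteq> set ps" using w(2) by (simp add: cgs_of_def d r)
    have acts: "map (cgs_acts ?C q) [1..<Suc k] = a"
      by (rule nth_equalityI) (use w(3) in \<open>auto simp: cgs_of_def d r simp del: upt_Suc\<close>)
    have "map (\<lambda>a. [0..<cgs_acts ?C q a]) [1..<Suc k] = map (\<lambda>n. [0..<n]) (map (cgs_acts ?C q) [1..<Suc k])"
      by (simp only: map_map comp_def)
    then have tup: "product_lists (map (\<lambda>a. [0..<cgs_acts ?C q a]) [1..<Suc (cgs_agents ?C)]) = tuples k a"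
      unfolding tuples_eq[OF w(3)] ag acts by simp
    have tr: "cgs_trans ?C q \<alpha> = the (map_of (zip (tuples k a) t) \<alpha>)" for \<alpha>
      by (simp add: cgs_of_def d r)
    have dist: "distinct (tuples k a)" using distinct_product_lists_upt by (simp add: tuples_eq[OF w(3)])
    have "map (cgs_trans ?C q) (tuples k a) = t"
    proof (rule nth_equalityI)
      fix j assume "j < length (map (cgs_trans ?C q) (tuples k a))"
      then have "j < length (tuples k a)" by simp
      with w(5) dist show "map (cgs_trans ?C q) (tuples k a) ! j = t ! j"
        by (simp add: tr map_of_zip_nth)
    qed (use w(5) in simp)
    with tup acts ag strict_sorted_list[OF w(1)] show "row_of ?C q = rows ! q"
      by (simp add: row_of_def r, simp add: cgs_of_def d r)
    show "1 \<le> cgs_acts ?C q a'" if "a' \<in> {1..k}" for a'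
      using that w(3,4) by (auto simp: cgs_of_def d r Suc_le_eq)
    fix \<alpha> assume "\<alpha> \<in> action_tuples ?C q"
    then have "\<alpha> \<in> set (tuples k a)" using set_product_lists_acts[of ?C q] tup by simp
    then have "cgs_trans ?C q \<alpha> \<in> set t"
      using \<open>map (cgs_trans ?C q) (tuples k a) = t\<close> by (metis image_eqI list.set_map)
    with w(6) show "cgs_trans ?C q \<alpha> < n" by blast
  qed
  show "wf_cgs (set ps) ?C"
    unfolding wf_cgs_def st ag using row(2-4) rows(3) by (auto simp: cgs_of_def d)
  have "map (row_of ?C) [0..<n] = rows" by (rule nth_equalityI) (use rows(1) row(1) in auto)
  with strict_sorted_list[OF rows(2)] show "cdata_of ?C = d"
    by (simp add: cdata_of_def, simp add: cgs_of_def d)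
qed

text \<open>A certificate brings a table, not an instance; this provides the instance behind it, as
  soundness of the verifier requires.\<close>

lemma valid_idata_instance:
  assumes "valid_idata k d"
  shows "\<exists>I. wf_learn_instance k I \<and> idata_of I = d"
proof -
  obtain ps P N B where d: "d = (ps, P, N, B)" by (metis prod_cases4)
  let ?I = "\<lparr>li_props = set ps, li_pos = map (cgs_of k) P, li_neg = map (cgs_of k) N, li_bound = B\<rparr>"
  from assms have v: "strict ps" "\<And>c. c \<in> set P \<Longrightarrow> valid_cdata k ps c" "\<And>c. c \<in> set N \<Longrightarrow> valid_cdata k ps c"
    by (auto simp: valid_idata_def d)
  have "wf_learn_instance k ?I" using v cgs_of_valid by (auto simp: wf_learn_instance_def)
  moreover have "map (\<lambda>c. cdata_of (cgs_of k c)) P = P"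
    by (rule map_idI) (rule cgs_of_valid(3)[OF v(2)])
  moreover have "map (\<lambda>c. cdata_of (cgs_of k c)) N = N"
    by (rule map_idI) (rule cgs_of_valid(3)[OF v(3)])
  ultimately have "wf_learn_instance k ?I \<and> idata_of ?I = d"
    using strict_sorted_list[OF v(1)] by (simp add: idata_of_def d comp_def)
  then show ?thesis by blast
qed

section \<open>Formulas as straight-line programs\<close>

text \<open>A node is \<open>(kind, op, i, j, A)\<close>, where \<open>i\<close> is a proposition for kind 0 and otherwise \<open>i\<close> and \<open>j\<close>
  point to earlier nodes.\<close>

type_synonym node = "nat \<times> binop \<times> nat \<times> nat \<times> nat list"

definition all_binops :: "binop list" where
  "all_binops = concat (map (\<lambda>f. [Plain f, Negated f]) [OpOr, OpAnd, OpImp, OpRevImp, OpIff])"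

lemma set_all_binops: "set all_binops = UNIV"
proof -
  have "b \<in> set all_binops" for b
  proof (cases b)
    case (Plain f) then show ?thesis by (cases f) (auto simp: all_binops_def)
  next
    case (Negated f) then show ?thesis by (cases f) (auto simp: all_binops_def)
  qed
  then show ?thesis by auto
qed

instantiation binop :: enc
begin
definition "tr_binop b = tr (index_of all_binops b)"
instance
proof
  fix a b :: binop
  assume "tr a = tr b"
  then have "index_of all_binops a = index_of all_binops b" by (simp add: tr_binop_def)
  moreover have "all_binops ! index_of all_binops a = a" "all_binops ! index_of all_binops b = b"
    by (rule index_of(2), simp add: set_all_binops)+
  ultimately show "a = b" by metis
qed
end

instance binop :: finite
  by standard (metis List.finite_set set_all_binops)

lemma PF_binop_sem [PF_intro]:
  assumes "PFon D f" "PFon D a" "PFon D b"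
  shows "PFon D (\<lambda>e. binop_sem (f e) (a e) (b e))"
  by (rule PF_comp3[OF _ assms]) (rule PF_finite_UNIV)

definition node_form :: "sform list \<Rightarrow> node \<Rightarrow> sform" where
  "node_form fs \<nu> = (case \<nu> of (kind, f, i, j, A) \<Rightarrow>
     if kind = 0 then Prop i
     else if kind = 1 then Neg (nthd (Prop 0) fs i)
     else if kind = 2 then Bin f (nthd (Prop 0) fs i) (nthd (Prop 0) fs j)
     else if kind = 3 then Strat (set A) (Next (nthd (Prop 0) fs i))
     else if kind = 4 then Strat (set A) (Finally (nthd (Prop 0) fs i))
     else Strat (set A) (Globally (nthd (Prop 0) fs i)))"

definition node_forms :: "node list \<Rightarrow> sform list" where
  "node_forms ns = fold (\<lambda>\<nu> fs. fs @ [node_form fs \<nu>]) ns []"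

lemma node_forms_Nil [simp]: "node_forms [] = []"
  by (simp add: node_forms_def)

lemma node_forms_snoc [simp]: "node_forms (ns @ [\<nu>]) = node_forms ns @ [node_form (node_forms ns) \<nu>]"
  by (simp add: node_forms_def)

lemma length_node_forms [simp]: "length (node_forms ns) = length ns"
  by (induction ns rule: rev_induct) auto

definition node_ok :: "nat \<Rightarrow> unop set \<Rightarrow> binop set \<Rightarrow> nat list \<Rightarrow> nat \<Rightarrow> node \<Rightarrow> bool" where
  "node_ok k Ut Bl ps pos \<nu> \<longleftrightarrow>
     (fst \<nu> = 0 \<and> fst (snd (snd \<nu>)) \<in> set ps) \<or>
     (fst \<nu> = 1 \<and> OpNot \<in> Ut \<and> fst (snd (snd \<nu>)) < pos) \<or>
     (fst \<nu> = 2 \<and> fst (snd \<nu>) \<in> Bl \<and> fst (snd (snd \<nu>)) < pos \<and> fst (snd (snd (snd \<nu>))) < pos) \<or>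
     ((fst \<nu> = 3 \<and> OpX \<in> Ut \<or> fst \<nu> = 4 \<and> OpF \<in> Ut \<or> fst \<nu> = 5 \<and> OpG \<in> Ut) \<and> fst (snd (snd \<nu>)) < pos \<and>
        (\<forall>a \<in> set (snd (snd (snd (snd \<nu>)))). 1 \<le> a \<and> a \<le> k))"

lemma PF_binop_mem [PF_intro]: "PFon D f \<Longrightarrow> PFon D (\<lambda>e. f e \<in> (Bl :: binop set))"
  by (rule PF_comp[of "\<lambda>b. b \<in> Bl"]) (rule PF_finite_UNIV)

lemma PF_node_ok:
  "PF (\<lambda>z. node_ok k Ut Bl (fst z) (fst (snd z)) (snd (snd z)))"
  unfolding node_ok_def
  by (intro PF_intro)

section \<open>Evaluating straight-line programs on tables\<close>

definition row_edges :: "nat \<Rightarrow> row \<Rightarrow> (nat list \<times> nat) list" where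
  "row_edges k r = zip (tuples k (fst (snd r))) (snd (snd r))"

definition cpre_list :: "(nat list \<times> nat) list \<Rightarrow> nat list \<Rightarrow> nat list \<Rightarrow> bool" where
  "cpre_list E A Z \<longleftrightarrow> (\<exists>e \<in> set E. \<forall>e' \<in> set E.
     (\<forall>a \<in> set A. nthd 0 (fst e') (a - 1) = nthd 0 (fst e) (a - 1)) \<longrightarrow> snd e' \<in> set Z)"

lemma PF_row_edges [PF_intro]: "PFon D r \<Longrightarrow> PFon D (\<lambda>e. row_edges k (r e))"
  unfolding row_edges_def by (intro PF_intro)

lemma PF_cpre_list [PF_intro]:
  assumes "PFon D E" "PFon D A" "PFon D Z"
  shows "PFon D (\<lambda>e. cpre_list (E e) (A e) (Z e))"
proof (rule PF_comp3[OF _ assms])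
  show "PF (\<lambda>z. cpre_list (fst z) (fst (snd z)) (snd (snd z)))" unfolding cpre_list_def by (intro PF_intro)
qed

definition data_row :: "cdata \<Rightarrow> nat \<Rightarrow> row" where
  "data_row d q = nthd ([], [], []) (snd (snd d)) q"

definition f_list :: "nat \<Rightarrow> cdata \<Rightarrow> nat list \<Rightarrow> nat list \<Rightarrow> nat list" where
  "f_list k d A Y = filter (\<lambda>q. q \<in> set Y \<or> cpre_list (row_edges k (data_row d q)) A Y) [0..<fst d]"

definition g_list :: "nat \<Rightarrow> cdata \<Rightarrow> nat list \<Rightarrow> nat list \<Rightarrow> nat list" where
  "g_list k d A Y = filter (\<lambda>q. q \<in> set Y \<and> cpre_list (row_edges k (data_row d q)) A Y) [0..<fst d]"

text \<open>Each branch, even an iteration, ends as a filter of \<open>[0..<fst d]\<close>. Hence no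
  value exceeds that list in size, whatever the node and the earlier values are, and evaluation is a
  fold with additive growth.\<close>

definition node_val :: "nat \<Rightarrow> cdata \<Rightarrow> nat list list \<Rightarrow> node \<Rightarrow> nat list" where
  "node_val k d vs \<nu> =
    (if fst \<nu> = 0 then filter (\<lambda>q. fst (snd (snd \<nu>)) \<in> set (fst (data_row d q))) [0..<fst d]
     else if fst \<nu> = 1 then filter (\<lambda>q. q \<notin> set (nthd [] vs (fst (snd (snd \<nu>))))) [0..<fst d]
     else if fst \<nu> = 2 then filter (\<lambda>q. binop_sem (fst (snd \<nu>)) (q \<in> set (nthd [] vs (fst (snd (snd \<nu>)))))
        (q \<in> set (nthd [] vs (fst (snd (snd (snd \<nu>))))))) [0..<fst d]
     else if fst \<nu> = 3 then filter (\<lambda>q. cpre_list (row_edges k (data_row d q)) (snd (snd (snd (snd \<nu>))))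
        (nthd [] vs (fst (snd (snd \<nu>))))) [0..<fst d]
     else if fst \<nu> = 4 then filter (\<lambda>q. q \<in> set ((f_list k d (snd (snd (snd (snd \<nu>)))) ^^ fst d)
        (nthd [] vs (fst (snd (snd \<nu>)))))) [0..<fst d]
     else filter (\<lambda>q. q \<in> set ((g_list k d (snd (snd (snd (snd \<nu>)))) ^^ fst d)
        (nthd [] vs (fst (snd (snd \<nu>)))))) [0..<fst d])"

definition eval_nodes :: "nat \<Rightarrow> cdata \<Rightarrow> node list \<Rightarrow> nat list list" where
  "eval_nodes k d ns = fold (\<lambda>\<nu> vs. vs @ [node_val k d vs \<nu>]) ns []"

lemma sz_filter_le: "sz (filter P xs) \<le> sz xs"
  by (induction xs) auto

lemma PF_data_row [PF_intro]: "PFon D d \<Longrightarrow> PFon D q \<Longrightarrow> PFon D (\<lambda>e. data_row (d e) (q e))"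
  unfolding data_row_def by (intro PF_intro)

lemma sz_upt_poly: "\<exists>q. \<forall>d :: nat \<times> 'b :: enc. sz [0..<fst d] \<le> poly q (sz d)"
proof -
  have "PF (\<lambda>d :: nat \<times> 'b. [0..<fst d])" by (intro PF_intro)
  from PFon_size[OF this] show ?thesis by auto
qed

lemma PF_iterate:
  fixes F :: "cdata \<Rightarrow> nat list \<Rightarrow> nat list \<Rightarrow> nat list"
  assumes F: "PF (\<lambda>z. F (fst z) (fst (snd z)) (snd (snd z)))" and sz: "\<And>d A Y. sz (F d A Y) \<le> sz [0..<fst d]"
    and "PFon D d" "PFon D A" "PFon D Y"
  shows "PFon D (\<lambda>e. (F (d e) (A e) ^^ fst (d e)) (Y e))"
proof (rule PF_comp3[OF _ assms(3-5)])
  obtain q where q: "\<And>d :: cdata. sz [0..<fst d] \<le> poly q (sz d)" using sz_upt_poly by blast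
  show "PF (\<lambda>z. (F (fst z) (fst (snd z)) ^^ fst (fst z)) (snd (snd z)))"
  proof (rule PF_funpow[where F = "\<lambda>z. F (fst z) (fst (snd z))" and q = q])
    show "PF (\<lambda>z. F (fst (fst z)) (fst (snd (fst z))) (snd z))"
      by (rule PF_comp3[OF F]) (intro PF_intro)+
    show "sz (F (fst z) (fst (snd z)) s) \<le> sz s + poly q (sz z)" for z :: "cdata \<times> nat list \<times> nat list" and s
    proof -
      have "sz (F (fst z) (fst (snd z)) s) \<le> poly q (sz (fst z))" using sz q order_trans by blast
      also have "\<dots> \<le> poly q (sz z)" by (rule poly_nat_mono) (cases z, simp)
      finally show ?thesis by simp
    qed
  qed (intro PF_intro)+
qed

lemma PF_f_list: "PF (\<lambda>z. f_list k (fst z) (fst (snd z)) (snd (snd z)))"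
  unfolding f_list_def by (intro PF_intro)

lemma PF_g_list: "PF (\<lambda>z. g_list k (fst z) (fst (snd z)) (snd (snd z)))"
  unfolding g_list_def by (intro PF_intro)

lemma PF_f_iterate [PF_intro]:
  "PFon D d \<Longrightarrow> PFon D A \<Longrightarrow> PFon D Y \<Longrightarrow> PFon D (\<lambda>e. (f_list k (d e) (A e) ^^ fst (d e)) (Y e))"
  by (rule PF_iterate[OF PF_f_list]) (simp_all add: f_list_def sz_filter_le)

lemma PF_g_iterate [PF_intro]:
  "PFon D d \<Longrightarrow> PFon D A \<Longrightarrow> PFon D Y \<Longrightarrow> PFon D (\<lambda>e. (g_list k (d e) (A e) ^^ fst (d e)) (Y e))"
  by (rule PF_iterate[OF PF_g_list]) (simp_all add: g_list_def sz_filter_le)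

lemma PF_node_val: "PF (\<lambda>z. node_val k (fst z) (fst (snd z)) (snd (snd z)))"
  unfolding node_val_def by (intro PF_intro)

lemma sz_node_val: "sz (node_val k d vs \<nu>) \<le> sz [0..<fst d]"
  by (simp add: node_val_def sz_filter_le)

lemma PF_eval_nodes [PF_intro]:
  assumes "PFon D d" "PFon D ns"
  shows "PFon D (\<lambda>e. eval_nodes k (d e) (ns e))"
proof (rule PF_comp2[OF _ assms])
  obtain q where q: "\<And>d :: cdata. sz [0..<fst d] \<le> poly q (sz d)" using sz_upt_poly by blast
  show "PF (\<lambda>z. eval_nodes k (fst z) (snd z))"
    unfolding eval_nodes_def
  proof (rule PFon_fold_add[where b = "\<lambda>z \<nu> vs. vs @ [node_val k (fst z) vs \<nu>]" and q = "[:2:] + q"])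
    show "PF (\<lambda>z. snd (snd z) @ [node_val k (fst (fst z)) (snd (snd z)) (fst (snd z))])"
      by (intro PF_intro PF_comp3[OF PF_node_val])
    fix z :: "cdata \<times> node list" and \<nu> vs
    have "sz (vs @ [node_val k (fst z) vs \<nu>]) \<le> sz vs + (2 + sz [0..<fst (fst z)])"
      using sz_append_le[of vs "[node_val k (fst z) vs \<nu>]"] sz_node_val[of k "fst z" vs \<nu>] by simp
    moreover have "poly q (sz (fst z)) \<le> poly q (sz z + sz \<nu>)" by (rule poly_nat_mono) (cases z, simp)
    ultimately show "sz (vs @ [node_val k (fst z) vs \<nu>]) \<le> sz vs + poly ([:2:] + q) (sz z + sz \<nu>)"
      using q[of "fst z"] by simp
  qed (intro PF_intro)+
qed

definition sat_list :: "cgs \<Rightarrow> sform \<Rightarrow> nat list" where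
  "sat_list C \<phi> = filter (sat C \<phi>) [0..<cgs_size C]"

context game
begin

lemma set_sat_list: "set (sat_list C \<phi>) = sat_set \<phi>"
  by (auto simp: sat_list_def sat_set_def states_def)

lemma cpre_list_iff:
  assumes q: "q \<in> states C" and A: "set A \<subseteq> {1..k}"
  shows "cpre_list (row_edges k (data_row (cdata_of C) q)) A Z \<longleftrightarrow> cpre C (set A) (set Z) q"
proof -
  let ?T = "product_lists (map (\<lambda>a. [0..<cgs_acts C q a]) [1..<Suc (cgs_agents C)])"
  have "data_row (cdata_of C) q = row_of C q"
    using q by (simp add: data_row_def cdata_of_def nthd_nth states_def)
  then have "row_edges k (data_row (cdata_of C) q) = zip ?T (map (cgs_trans C q) ?T)"
    unfolding row_edges_def by (simp only: tuples_row_of[OF agents]) (simp add: row_of_def)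
  also have "\<dots> = map (\<lambda>\<alpha>. (\<alpha>, cgs_trans C q \<alpha>)) ?T" by (simp add: zip_map2 zip_same_conv_map)
  finally have E: "set (row_edges k (data_row (cdata_of C) q)) = (\<lambda>\<alpha>. (\<alpha>, cgs_trans C q \<alpha>)) ` action_tuples C q"
    by (simp only: set_map set_product_lists_acts)
  have nth: "nthd 0 \<alpha> (a - 1) = \<alpha> ! (a - 1)" if "\<alpha> \<in> action_tuples C q" "a \<in> set A" for \<alpha> a
  proof -
    have "1 \<le> a" "a \<le> k" using that(2) A by auto
    then have "a - 1 < length \<alpha>" using that(1) agents by (auto simp: action_tuples_def)
    then show ?thesis by (rule nthd_nth)
  qed
  have "(\<forall>a \<in> set A. nthd 0 \<beta> (a - 1) = nthd 0 \<alpha> (a - 1)) \<longleftrightarrow> (\<forall>a \<in> set A. \<beta> ! (a - 1) = \<alpha> ! (a - 1))"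
    if "\<alpha> \<in> action_tuples C q" "\<beta> \<in> action_tuples C q" for \<alpha> \<beta>
    by (rule ball_cong[OF refl]) (simp only: nth that)
  then show ?thesis unfolding cpre_list_def cpre_def E by simp
qed

lemma f_list_set: "set A \<subseteq> {1..k} \<Longrightarrow> set (f_list k (cdata_of C) A Y) = f_step (set A) (set Y)"
  using cpre_list_iff by (auto simp: f_list_def f_step_def states_def cdata_of_def[of C] fst_conv)

lemma g_list_set: "set A \<subseteq> {1..k} \<Longrightarrow> set (g_list k (cdata_of C) A Y) = g_step (set A) (set Y)"
  using cpre_list_iff by (auto simp: g_list_def g_step_def states_def cdata_of_def[of C] fst_conv)

lemma f_iterate_set: "set A \<subseteq> {1..k} \<Longrightarrow>
   set ((f_list k (cdata_of C) A ^^ n) Y) = (f_step (set A) ^^ n) (set Y)"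
  by (induction n) (simp_all add: f_list_set)

lemma g_iterate_set: "set A \<subseteq> {1..k} \<Longrightarrow>
   set ((g_list k (cdata_of C) A ^^ n) Y) = (g_step (set A) ^^ n) (set Y)"
  by (induction n) (simp_all add: g_list_set)

lemma fst_cdata_of: "fst (cdata_of C) = cgs_size C"
  by (simp add: cdata_of_def)

lemma sat_list_eqI: "(\<And>q. q \<in> states C \<Longrightarrow> Q q \<longleftrightarrow> q \<in> sat_set \<phi>) \<Longrightarrow>
    filter Q [0..<fst (cdata_of C)] = sat_list C \<phi>"
  unfolding sat_list_def fst_cdata_of
  by (rule filter_cong) (auto simp: sat_set_def states_def)

lemma node_val_sat:
  assumes ok: "node_ok k Ut Bl ps (length fs) \<nu>" and fin: "\<And>q. q \<in> states C \<Longrightarrow> finite (cgs_label C q)"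
  shows "node_val k (cdata_of C) (map (sat_list C) fs) \<nu> = sat_list C (node_form fs \<nu>)"
proof -
  obtain kind f i j A where \<nu>: "\<nu> = (kind, f, i, j, A)" by (metis prod_cases5)
  have v: "nthd [] (map (sat_list C) fs) i = sat_list C (nthd (Prop 0) fs i)" if "i < length fs" for i
    using that by (simp add: nthd_nth)
  have lab: "set (fst (data_row (cdata_of C) q)) = cgs_label C q \<or> infinite (cgs_label C q)" if "q \<in> states C" for q
    using that by (cases "finite (cgs_label C q)") (auto simp: data_row_def cdata_of_def nthd_nth states_def row_of_def)
  consider "kind = 0" | "kind = 1" "i < length fs" | "kind = 2" "i < length fs" "j < length fs"
    | "kind = 3" "i < length fs" "set A \<subseteq> {1..k}" | "kind = 4" "i < length fs" "set A \<subseteq> {1..k}"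
    | "kind = 5" "i < length fs" "set A \<subseteq> {1..k}"
  proof -
    have "(\<forall>a \<in> set A. 1 \<le> a \<and> a \<le> k) \<longleftrightarrow> set A \<subseteq> {1..k}" by (auto simp: subset_iff)
    with ok that show ?thesis unfolding node_ok_def \<nu> fst_conv snd_conv by blast
  qed
  then show ?thesis
  proof cases
    case 1
    have "set (fst (data_row (cdata_of C) q)) = cgs_label C q" if "q \<in> states C" for q
      using lab[OF that] fin[OF that] by blast
    with 1 show ?thesis unfolding node_val_def node_form_def \<nu>
      by (auto intro!: sat_list_eqI) (auto simp: sat_set_def)
  next
    case 2
    show ?thesis unfolding node_val_def node_form_def \<nu> using 2
      by (auto simp: v set_sat_list intro!: sat_list_eqI) (auto simp: sat_set_def)
  next
    case 3
    then show ?thesis unfolding node_val_def node_form_def \<nu>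
      by (auto simp: v set_sat_list intro!: sat_list_eqI) (auto simp: sat_set_def)
  next
    case 4
    then show ?thesis unfolding node_val_def node_form_def \<nu>
      by (auto simp: v set_sat_list cpre_list_iff sat_set_Next intro!: sat_list_eqI)
  next
    case 5
    then show ?thesis unfolding node_val_def node_form_def \<nu>
      by (auto simp: v set_sat_list f_iterate_set sat_set_Finally fst_cdata_of[symmetric] intro!: sat_list_eqI)
  next
    case 6
    then show ?thesis unfolding node_val_def node_form_def \<nu>
      by (auto simp: v set_sat_list g_iterate_set sat_set_Globally fst_cdata_of[symmetric] intro!: sat_list_eqI)
  qed
qed

end

abbreviation nodes_ok :: "nat \<Rightarrow> unop set \<Rightarrow> binop set \<Rightarrow> nat list \<Rightarrow> node list \<Rightarrow> bool" where
  "nodes_ok k Ut Bl ps ns \<equiv> \<forall>pos < length ns. node_ok k Ut Bl ps pos (ns ! pos)"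

lemma nodes_ok_snoc: "nodes_ok k Ut Bl ps (ns @ [\<nu>]) \<longleftrightarrow> nodes_ok k Ut Bl ps ns \<and> node_ok k Ut Bl ps (length ns) \<nu>"
  by (auto simp: nth_append less_Suc_eq)

lemma (in game) eval_nodes_sat:
  assumes "\<And>q. q \<in> states C \<Longrightarrow> finite (cgs_label C q)"
  shows "nodes_ok k Ut Bl ps ns \<Longrightarrow> eval_nodes k (cdata_of C) ns = map (sat_list C) (node_forms ns)"
proof (induction ns rule: rev_induct)
  case Nil
  then show ?case by (simp add: eval_nodes_def)
next
  case (snoc \<nu> ns)
  from snoc.prems have ok: "nodes_ok k Ut Bl ps ns" "node_ok k Ut Bl ps (length (node_forms ns)) \<nu>"
    unfolding nodes_ok_snoc by simp_all
  from node_val_sat[OF ok(2) assms] snoc.IH[OF ok(1)] show ?case by (simp add: eval_nodes_def)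
qed

lemma node_form_fragment:
  assumes "node_ok k Ut Bl ps (length fs) \<nu>"
    and "\<forall>\<phi> \<in> set fs. in_fragment k (set ps) Ut Bl \<phi> \<and> subformulas \<phi> \<subseteq> set fs"
  shows "in_fragment k (set ps) Ut Bl (node_form fs \<nu>) \<and> subformulas (node_form fs \<nu>) \<subseteq> insert (node_form fs \<nu>) (set fs)"
proof -
  obtain kind f i j A where \<nu>: "\<nu> = (kind, f, i, j, A)" by (metis prod_cases5)
  have n: "nthd (Prop 0) fs i \<in> set fs" if "i < length fs" for i using that by (simp add: nthd_nth)
  have A: "(\<forall>a \<in> set A. 1 \<le> a \<and> a \<le> k) \<longleftrightarrow> set A \<subseteq> {1..k}" by (auto simp: subset_iff)
  show ?thesis
    using assms(1) assms(2)[rule_format, OF n[of i]] assms(2)[rule_format, OF n[of j]]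
    unfolding node_ok_def node_form_def \<nu> prod.case fst_conv snd_conv A
    by (elim disjE conjE; simp; blast)
qed

lemma node_forms_fragment:
  "nodes_ok k Ut Bl ps ns \<Longrightarrow> \<forall>\<phi> \<in> set (node_forms ns). in_fragment k (set ps) Ut Bl \<phi> \<and> subformulas \<phi> \<subseteq> set (node_forms ns)"
proof (induction ns rule: rev_induct)
  case (snoc \<nu> ns)
  from snoc.prems have ok: "nodes_ok k Ut Bl ps ns" "node_ok k Ut Bl ps (length (node_forms ns)) \<nu>"
    unfolding nodes_ok_snoc by simp_all
  note IH = snoc.IH[OF ok(1)]
  from node_form_fragment[OF ok(2) IH] IH show ?case by auto
qed simp

lemma is_Bin_node_form: "is_Bin (node_form fs \<nu>) \<longleftrightarrow> fst \<nu> = 2"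
  by (cases \<nu>) (auto simp: node_form_def)

lemma node_forms_bin: "length (filter is_Bin (node_forms ns)) = length (filter (\<lambda>\<nu>. fst \<nu> = 2) ns)"
  by (induction ns rule: rev_induct) (auto simp: is_Bin_node_form)

text \<open>Different nodes may denote the same formula, so the number of nodes bounds the number of
  distinct subformulas from above only, which is the direction soundness needs.\<close>

lemma node_forms_sizes:
  assumes "nodes_ok k Ut Bl ps ns" "ns \<noteq> []"
  defines "\<phi> \<equiv> last (node_forms ns)"
  shows "in_fragment k (set ps) Ut Bl \<phi>" "formula_size \<phi> \<le> length ns"
    "binary_size \<phi> \<le> length (filter (\<lambda>\<nu>. fst \<nu> = 2) ns)"
proof -
  have "node_forms ns \<noteq> []" using assms(2) length_node_forms[of ns] by (metis length_0_conv)
  then have "\<phi> \<in> set (node_forms ns)" by (simp add: \<phi>_def)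
  with node_forms_fragment[OF assms(1)] have \<phi>: "in_fragment k (set ps) Ut Bl \<phi>" "subformulas \<phi> \<subseteq> set (node_forms ns)"
    by auto
  show "in_fragment k (set ps) Ut Bl \<phi>" by (rule \<phi>(1))
  have "card (subformulas \<phi>) \<le> card (set (node_forms ns))" by (rule card_mono[OF _ \<phi>(2)]) simp
  also have "\<dots> \<le> length ns" using card_length[of "node_forms ns"] by simp
  finally show "formula_size \<phi> \<le> length ns" by (simp add: formula_size_def)
  have "card {\<chi> \<in> subformulas \<phi>. is_Bin \<chi>} \<le> card (set (filter is_Bin (node_forms ns)))"
    by (rule card_mono) (use \<phi>(2) in auto)
  also have "\<dots> \<le> length (filter (\<lambda>\<nu>. fst \<nu> = 2) ns)"
    using card_length[of "filter is_Bin (node_forms ns)"] by (simp add: node_forms_bin)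
  finally show "binary_size \<phi> \<le> length (filter (\<lambda>\<nu>. fst \<nu> = 2) ns)" by (simp add: binary_size_def)
qed

section \<open>From formulas to straight-line programs\<close>

lemma subformulas_self [simp]: "\<phi> \<in> subformulas \<phi>"
  by (cases \<phi>) auto

lemma finite_subformulas [simp]: "finite (subformulas \<phi>)" "finite (path_subformulas \<psi>)"
  by (induction \<phi> and \<psi>) auto

lemma subformulas_trans:
  "\<chi> \<in> subformulas \<phi> \<Longrightarrow> subformulas \<chi> \<subseteq> subformulas \<phi>"
  "\<chi> \<in> path_subformulas \<psi> \<Longrightarrow> subformulas \<chi> \<subseteq> path_subformulas \<psi>"
  by (induction \<phi> and \<psi>) auto

lemma subformulas_size:
  "\<chi> \<in> subformulas \<phi> \<Longrightarrow> \<chi> = \<phi> \<or> size \<chi> < size \<phi>"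
  "\<chi> \<in> path_subformulas \<psi> \<Longrightarrow> size \<chi> < size \<psi>"
  by (induction \<phi> and \<psi>) fastforce+

lemma subformulas_fragment:
  "\<chi> \<in> subformulas \<phi> \<Longrightarrow> in_fragment k P Ut Bl \<phi> \<Longrightarrow> in_fragment k P Ut Bl \<chi>"
  "\<chi> \<in> path_subformulas \<psi> \<Longrightarrow> in_path_fragment k P Ut Bl \<psi> \<Longrightarrow> in_fragment k P Ut Bl \<chi>"
  by (induction \<phi> and \<psi>) auto

fun node_for :: "sform list \<Rightarrow> sform \<Rightarrow> node" where
  "node_for L (Prop r) = (0, Plain OpOr, r, 0, [])"
| "node_for L (Neg \<phi>) = (1, Plain OpOr, index_of L \<phi>, 0, [])"
| "node_for L (Bin f \<phi> \<chi>) = (2, f, index_of L \<phi>, index_of L \<chi>, [])"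
| "node_for L (Strat A (Next \<phi>)) = (3, Plain OpOr, index_of L \<phi>, 0, sorted_list_of_set A)"
| "node_for L (Strat A (Finally \<phi>)) = (4, Plain OpOr, index_of L \<phi>, 0, sorted_list_of_set A)"
| "node_for L (Strat A (Globally \<phi>)) = (5, Plain OpOr, index_of L \<phi>, 0, sorted_list_of_set A)"

text \<open>Fields that do not affect the formula are normalised: coalitions are listed without
  repetition, and a second pointer that is never followed is 0. Otherwise they could make a
  certificate arbitrarily long.\<close>

definition tidy :: "nat \<Rightarrow> node \<Rightarrow> bool" where
  "tidy k \<nu> \<longleftrightarrow> (fst \<nu> = 2 \<or> fst (snd (snd (snd \<nu>))) = 0) \<and>
     (\<exists>A \<subseteq> {1..k}. snd (snd (snd (snd \<nu>))) = sorted_list_of_set A)"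

lemma node_for_tidy:
  assumes "in_fragment k P Ut Bl \<phi>"
  shows "tidy k (node_for L \<phi>)"
proof (cases \<phi>)
  case (Strat A \<psi>)
  with assms have "A \<subseteq> {1..k}" by simp
  then show ?thesis unfolding Strat by (cases \<psi>) (auto simp: tidy_def)
qed (auto simp: tidy_def intro!: exI[of _ "{}"])

lemma node_for_bin: "fst (node_for L \<phi>) = 2 \<longleftrightarrow> is_Bin \<phi>"
  by (cases "(L, \<phi>)" rule: node_for.cases) auto

lemma node_for_correct:
  assumes sub: "\<And>\<chi>. \<chi> \<in> subformulas \<phi> - {\<phi>} \<Longrightarrow> index_of L \<chi> < m \<and> L ! index_of L \<chi> = \<chi>"
    and m: "m \<le> length L" and frag: "in_fragment k (set ps) Ut Bl \<phi>"
  shows "node_form (take m L) (node_for L \<phi>) = \<phi> \<and> node_ok k Ut Bl ps m (node_for L \<phi>)"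
proof -
  have n: "nthd (Prop 0) (take m L) (index_of L \<chi>) = \<chi> \<and> index_of L \<chi> < m" if "\<chi> \<in> subformulas \<phi>" "\<chi> \<noteq> \<phi>" for \<chi>
    using sub[of \<chi>] that m by (simp add: nthd_nth)
  have A: "set (sorted_list_of_set A) = A" "\<forall>a \<in> A. Suc 0 \<le> a \<and> a \<le> k" if "A \<subseteq> {1..k}" for A :: "nat set"
  proof -
    have "finite A" using that finite_subset by blast
    then show "set (sorted_list_of_set A) = A" by simp
  qed (use that in auto)
  have ch: "nthd (Prop 0) (take m L) (index_of L \<chi>) = \<chi> \<and> index_of L \<chi> < m"
    if "\<chi> \<in> subformulas \<phi>" "size \<chi> < size \<phi>" for \<chi>
    using n[OF that(1)] that(2) by blast
  note defs = node_form_def node_ok_def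
  show ?thesis
  proof (cases \<phi>)
    case (Prop r)
    with frag show ?thesis by (simp add: defs)
  next
    case (Neg a)
    with frag ch[of a] show ?thesis by (simp add: defs)
  next
    case (Bin f a b)
    with frag ch[of a] ch[of b] show ?thesis by (simp add: defs)
  next
    case (Strat A \<psi>)
    with frag have B: "A \<subseteq> {1..k}" by simp
    show ?thesis
    proof (cases \<psi>)
      case (Next a)
      with frag Strat ch[of a] A[OF B] show ?thesis by (simp add: defs)
    next
      case (Finally a)
      with frag Strat ch[of a] A[OF B] show ?thesis by (simp add: defs)
    next
      case (Globally a)
      with frag Strat ch[of a] A[OF B] show ?thesis by (simp add: defs)
    qed
  qed
qed

lemma sorted_wrt_size_index:
  assumes "distinct L" "sorted (map size L)" "\<chi> \<in> set L" "p < length L" "size \<chi> < size (L ! p)"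
  shows "index_of L \<chi> < p"
proof (rule ccontr)
  assume "\<not> index_of L \<chi> < p"
  then have "map size L ! p \<le> map size L ! index_of L \<chi>"
    using assms index_of(1)[OF assms(3)] by (intro sorted_nth_mono) auto
  with assms index_of[OF assms(3)] show False by simp
qed

lemma formula_nodes:
  assumes frag: "in_fragment k (set ps) Ut Bl \<phi>"
  shows "\<exists>ns. nodes_ok k Ut Bl ps ns \<and> ns \<noteq> [] \<and> last (node_forms ns) = \<phi> \<and> length ns = formula_size \<phi> \<and>
     length (filter (\<lambda>\<nu>. fst \<nu> = 2) ns) = binary_size \<phi> \<and>
     (\<forall>\<nu> \<in> set ns. tidy k \<nu>)"
proof -
  obtain xs where xs: "set xs = subformulas \<phi>" "distinct xs" using finite_distinct_list[OF finite_subformulas(1)] by blast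
  \<comment> \<open>Proper subformulas are smaller, so ordering by size puts arguments before the
    formulas that use them, and the whole formula last.\<close>
  define L where "L = sort_key size xs"
  have L: "set L = subformulas \<phi>" "distinct L" "sorted (map size L)" using xs by (auto simp: L_def)
  define ns where "ns = map (node_for L) L"
  have cor: "node_form (take m L) (node_for L (L ! m)) = L ! m \<and> node_ok k Ut Bl ps m (node_for L (L ! m))"
    if m: "m < length L" for m
  proof (rule node_for_correct)
    have mem: "L ! m \<in> subformulas \<phi>" using m L(1) nth_mem by blast
    show "in_fragment k (set ps) Ut Bl (L ! m)" by (rule subformulas_fragment(1)[OF mem frag])
    fix \<chi> assume \<chi>: "\<chi> \<in> subformulas (L ! m) - {L ! m}"
    then have c: "\<chi> \<in> set L" using subformulas_trans(1)[OF mem] L(1) by blast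
    have "size \<chi> < size (L ! m)" using subformulas_size(1)[of \<chi> "L ! m"] \<chi> by blast
    then show "index_of L \<chi> < m \<and> L ! index_of L \<chi> = \<chi>"
      using sorted_wrt_size_index[OF L(2,3) c m] index_of(2)[OF c] by simp
  qed (use m in simp)
  have "node_forms (take m ns) = take m L" if "m \<le> length L" for m
    using that
  proof (induction m)
    case (Suc m)
    then have m: "m < length L" by simp
    then have "take (Suc m) ns = take m ns @ [node_for L (L ! m)]" by (simp add: ns_def take_Suc_conv_app_nth)
    with Suc cor[OF m] m show ?case by (simp add: take_Suc_conv_app_nth)
  qed simp
  from this[of "length L"] have forms: "node_forms ns = L" by (simp add: ns_def)
  have ok: "nodes_ok k Ut Bl ps ns" using cor by (simp add: ns_def)
  have ne: "L \<noteq> []" using L(1) subformulas_self by (metis empty_iff list.set(1))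
  have "last L = \<phi>"
  proof (rule ccontr)
    assume c: "last L \<noteq> \<phi>"
    have "\<phi> \<in> set L" using L(1) by simp
    then obtain i where i: "i < length L" "L ! i = \<phi>" by (auto simp: in_set_conv_nth)
    have "map size L ! i \<le> map size L ! (length L - 1)" by (rule sorted_nth_mono[OF L(3)]) (use i in auto)
    then have "size \<phi> \<le> size (last L)" using i ne by (simp add: last_conv_nth)
    moreover have "last L \<in> subformulas \<phi>" using ne L(1) last_in_set by blast
    then have "size (last L) < size \<phi>" using subformulas_size(1) c by blast
    ultimately show False by simp
  qed
  moreover have "length ns = formula_size \<phi>"
    using distinct_card[OF L(2)] by (simp add: ns_def formula_size_def L(1))
  moreover have "length (filter (\<lambda>\<nu>. fst \<nu> = 2) ns) = binary_size \<phi>"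
  proof -
    have "length (filter (\<lambda>\<nu>. fst \<nu> = 2) ns) = length (filter is_Bin L)"
      by (simp add: ns_def filter_map comp_def node_for_bin)
    also have "\<dots> = card (set (filter is_Bin L))" using distinct_card[of "filter is_Bin L"] L(2) by simp
    finally show ?thesis by (simp add: binary_size_def L(1))
  qed
  moreover have "tidy k (node_for L \<chi>)" if "\<chi> \<in> set L" for \<chi>
    by (rule node_for_tidy, rule subformulas_fragment(1)[OF _ frag]) (use that L(1) in simp)
  ultimately show ?thesis using ok ne forms by (intro exI[of _ ns]) (auto simp: ns_def)
qed

section \<open>The verifier\<close>

text \<open>The decoded instance \<open>d\<close> is part of the certificate and is tested by
  encoding it again, which replaces parsing of the input by a comparison.\<close>

definition check :: "nat \<Rightarrow> unop set \<Rightarrow> binop set \<Rightarrow> nat \<Rightarrow> bool list \<Rightarrow> idata \<Rightarrow> node list \<Rightarrow> bool" where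
  "check k Ut Bl n x d ns \<longleftrightarrow> enc_idata d = x \<and> valid_idata k d \<and> ns \<noteq> [] \<and> length ns \<le> snd (snd (snd d)) \<and>
     length (filter (\<lambda>\<nu>. fst \<nu> = 2) ns) \<le> n \<and>
     (\<forall>pos \<in> set [0..<length ns]. node_ok k Ut Bl (fst d) pos (nthd (0, Plain OpOr, 0, 0, []) ns pos)) \<and>
     (\<forall>c \<in> set (fst (snd d)). \<forall>q \<in> set (fst (snd c)). q \<in> set (hd (rev (eval_nodes k c ns)))) \<and>
     (\<forall>c \<in> set (fst (snd (snd d))). \<exists>q \<in> set (fst (snd c)). q \<notin> set (hd (rev (eval_nodes k c ns))))"

lemma PF_check: "PF (\<lambda>z. check k Ut Bl n (fst z) (fst (snd z)) (snd (snd z)))"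
  unfolding check_def by (intro PF_intro PF_comp3[OF PF_node_ok])

lemma check_nodes_ok:
  "(\<forall>pos \<in> set [0..<length ns]. node_ok k Ut Bl ps pos (nthd d ns pos)) \<longleftrightarrow> nodes_ok k Ut Bl ps ns"
  by (auto simp: nthd_nth)

lemma check_structure:
  assumes wf: "wf_learn_instance k I" and C: "C \<in> set (li_pos I) \<union> set (li_neg I)"
    and ok: "nodes_ok k Ut Bl ps ns" and ne: "ns \<noteq> []"
  shows "(\<forall>q \<in> set (fst (snd (cdata_of C))). q \<in> set (hd (rev (eval_nodes k (cdata_of C) ns)))) \<longleftrightarrow>
     satisfies C (last (node_forms ns))"
proof -
  from wf C have g: "wf_cgs (li_props I) C" "cgs_agents C = k" "finite (li_props I)"
    by (auto simp: wf_learn_instance_def)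
  interpret game C "li_props I" k by standard (use g in auto)
  have i: "cgs_init C \<subseteq> states C" using g(1) by (simp add: wf_cgs_def)
  then have fi: "finite (cgs_init C)" by (rule finite_subset) simp
  have fl: "finite (cgs_label C q)" if "q \<in> states C" for q
  proof -
    have "cgs_label C q \<subseteq> li_props I" using g(1) that by (simp add: wf_cgs_def)
    then show ?thesis by (rule finite_subset[OF _ g(3)])
  qed
  have nn: "node_forms ns \<noteq> []" using ne length_node_forms[of ns] by (metis length_0_conv)
  have "hd (rev (eval_nodes k (cdata_of C) ns)) = sat_list C (last (node_forms ns))"
    using nn by (simp add: eval_nodes_sat[OF fl ok] hd_rev last_map)
  then show ?thesis using i fi
    by (auto simp: set_sat_list sat_set_def satisfies_def cdata_of_def)
qed

lemma check_learn_positive: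
  assumes "check k Ut Bl n x (idata_of I) ns" and I: "wf_learn_instance k I"
  shows "learn_positive k Ut Bl n I"
proof -
  have d: "fst (idata_of I) = sorted_list_of_set (li_props I)" "fst (snd (idata_of I)) = map cdata_of (li_pos I)"
    "fst (snd (snd (idata_of I))) = map cdata_of (li_neg I)" "snd (snd (snd (idata_of I))) = li_bound I"
    by (auto simp: idata_of_def)
  from assms(1) have c: "ns \<noteq> []" "length ns \<le> li_bound I" "length (filter (\<lambda>\<nu>. fst \<nu> = 2) ns) \<le> n"
    "nodes_ok k Ut Bl (sorted_list_of_set (li_props I)) ns"
    "\<forall>c \<in> set (map cdata_of (li_pos I)). \<forall>q \<in> set (fst (snd c)). q \<in> set (hd (rev (eval_nodes k c ns)))"
    "\<forall>c \<in> set (map cdata_of (li_neg I)). \<exists>q \<in> set (fst (snd c)). q \<notin> set (hd (rev (eval_nodes k c ns)))"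
    unfolding check_def check_nodes_ok d by blast+
  have ps: "set (sorted_list_of_set (li_props I)) = li_props I" using I by (simp add: wf_learn_instance_def)
  let ?\<phi> = "last (node_forms ns)"
  note sz = node_forms_sizes[OF c(4,1), unfolded ps]
  have "satisfies C ?\<phi>" if "C \<in> set (li_pos I)" for C
    using check_structure[OF I _ c(4,1), of C] that c(5) by auto
  moreover have "\<not> satisfies C ?\<phi>" if "C \<in> set (li_neg I)" for C
    using check_structure[OF I _ c(4,1), of C] that c(6) by auto
  ultimately show ?thesis
    unfolding learn_positive_def using sz c(2,3) by (intro exI[of _ ?\<phi>]) auto
qed

lemma check_sound:
  assumes "check k Ut Bl n x d ns"
  shows "x \<in> ATL_Learn k Ut Bl n"
proof -
  from assms have "valid_idata k d" and x: "enc_idata d = x" by (auto simp: check_def)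
  from valid_idata_instance[OF this(1)] obtain I where I: "wf_learn_instance k I" "idata_of I = d" by blast
  with assms have "learn_positive k Ut Bl n I" using check_learn_positive by blast
  with I(1) have "enc_learn I \<in> ATL_Learn k Ut Bl n" unfolding ATL_Learn_def by blast
  with enc_idata_of[of I] I(2) x show ?thesis by simp
qed

lemma check_complete:
  assumes "x \<in> ATL_Learn k Ut Bl n"
  shows "\<exists>d ns. check k Ut Bl n x d ns \<and>
     (\<forall>\<nu> \<in> set ns. tidy k \<nu>)"
proof -
  from assms obtain I where I: "x = enc_learn I" "wf_learn_instance k I" "learn_positive k Ut Bl n I"
    unfolding ATL_Learn_def by blast
  have ps: "set (sorted_list_of_set (li_props I)) = li_props I" using I(2) by (simp add: wf_learn_instance_def)
  from I(3) obtain \<phi> where \<phi>: "in_fragment k (li_props I) Ut Bl \<phi>" "formula_size \<phi> \<le> li_bound I"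
    "binary_size \<phi> \<le> n" "\<forall>C \<in> set (li_pos I). satisfies C \<phi>" "\<forall>C \<in> set (li_neg I). \<not> satisfies C \<phi>"
    unfolding learn_positive_def by blast
  from formula_nodes[of k "sorted_list_of_set (li_props I)" Ut Bl \<phi>, unfolded ps, OF \<phi>(1)] obtain ns where
    ns: "nodes_ok k Ut Bl (sorted_list_of_set (li_props I)) ns" "ns \<noteq> []" "last (node_forms ns) = \<phi>"
    "length ns = formula_size \<phi>" "length (filter (\<lambda>\<nu>. fst \<nu> = 2) ns) = binary_size \<phi>"
    "\<forall>\<nu> \<in> set ns. tidy k \<nu>" by blast
  have d: "fst (idata_of I) = sorted_list_of_set (li_props I)" "fst (snd (idata_of I)) = map cdata_of (li_pos I)"
    "fst (snd (snd (idata_of I))) = map cdata_of (li_neg I)" "snd (snd (snd (idata_of I))) = li_bound I"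
    by (auto simp: idata_of_def)
  have "\<forall>q \<in> set (fst (snd (cdata_of C))). q \<in> set (hd (rev (eval_nodes k (cdata_of C) ns)))" if "C \<in> set (li_pos I)" for C
    using check_structure[OF I(2) _ ns(1,2), of C] that \<phi>(4) ns(3) by auto
  moreover have "\<exists>q \<in> set (fst (snd (cdata_of C))). q \<notin> set (hd (rev (eval_nodes k (cdata_of C) ns)))"
    if "C \<in> set (li_neg I)" for C
    using check_structure[OF I(2) _ ns(1,2), of C] that \<phi>(5) ns(3) by auto
  ultimately have "check k Ut Bl n x (idata_of I) ns"
    unfolding check_def check_nodes_ok d
    using valid_idata_of[OF I(2)] enc_idata_of[of I] I(1) ns \<phi>(2,3) by simp
  with ns(6) show ?thesis by blast
qed

section \<open>Decoding certificates\<close>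

text \<open>For a prefix code read from right to left with a stack of finished trees: an opening bit
  joins the two topmost trees, the first child on top.\<close>

definition push_bit :: "bool \<Rightarrow> tree list \<Rightarrow> tree list" where
  "push_bit b st = (if b then Node (hd st) (hd (tl st)) # tl (tl st) else Leaf # st)"

definition parse_tree :: "bool list \<Rightarrow> tree" where
  "parse_tree y = hd (fold push_bit (rev y) [])"

lemma fold_push_bits: "fold push_bit (rev (bits t)) st = t # st"
  by (induction t arbitrary: st) (auto simp: push_bit_def)

lemma parse_tree_ser: "parse_tree (ser x) = tr x"
  by (simp add: parse_tree_def ser_def fold_push_bits)

lemma PF_Node [PF_intro]: "PFon D f \<Longrightarrow> PFon D g \<Longrightarrow> PFon D (\<lambda>x. Node (f x) (g x))"
  by (rule PFon_enc_eq[of D "\<lambda>x. (f x, g x)"]) (intro PF_intro, assumption+, simp add: tr_simps tr_tree_def)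

text \<open>On malformed words the stack can underflow; \<open>hd []\<close> is then some fixed
  tree, whose size enters the bound.\<close>

lemma sz_push_bit: "sz (push_bit b st) \<le> sz st + (2 * sz (hd ([] :: tree list)) + 4)"
proof (cases b)
  case True
  have n: "sz (Node a c) = Suc (sz a + sz c)" for a c by (simp add: sz_def tr_tree_def)
  show ?thesis
  proof (cases st)
    case Nil
    with True show ?thesis by (simp add: push_bit_def n)
  next
    case (Cons a st')
    with True show ?thesis by (cases st') (simp_all add: push_bit_def n)
  qed
next
  case False
  have "sz Leaf = 1" by (simp add: sz_def tr_tree_def)
  with False show ?thesis by (simp add: push_bit_def)
qed

lemma PF_parse_tree [PF_intro]: "PFon D f \<Longrightarrow> PFon D (\<lambda>e. parse_tree (f e))"
proof (rule PF_comp[of parse_tree])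
  have "PF (\<lambda>y. fold push_bit (rev y) [])"
  proof (rule PFon_fold_add[where b = "\<lambda>e x s. push_bit x s" and q = "[:2 * sz (hd ([] :: tree list)) + 4:]"])
    show "PF (\<lambda>z :: bool list \<times> bool \<times> tree list. push_bit (fst (snd z)) (snd (snd z)))"
      unfolding push_bit_def by (intro PF_intro)
    show "sz (push_bit x s) \<le> sz s + poly [:2 * sz (hd ([] :: tree list)) + 4:] (sz e + sz x)"
      for e :: "bool list" and x s using sz_push_bit[of x s] by simp
  qed (intro PF_intro)+
  then show "PF parse_tree" unfolding parse_tree_def[abs_def] by (intro PF_intro)
qed

text \<open>The code of a list is its right spine, so \<open>spine\<close> leaves the code unchanged.\<close>

primrec spine :: "tree \<Rightarrow> tree list" where
  "spine Leaf = []"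
| "spine (Node a b) = a # spine b"

lemma tr_spine: "tr (spine t) = t"
  by (induction t) (auto simp: tr_tree_def)

lemma spine_tr_list: "spine (tr xs) = map tr xs"
  by (induction xs) auto

lemma PF_spine [PF_intro]: "PFon D f \<Longrightarrow> PFon D (\<lambda>e. spine (f e))"
  by (rule PFon_enc_eq[of D f]) (auto simp: tr_spine tr_tree_def)

lemma PF_tr [PF_intro]: "PFon D f \<Longrightarrow> PFon D (\<lambda>e. tr (f e))"
  by (rule PFon_enc_eq[of D f]) (auto simp: tr_tree_def)

lemma PF_left_right [PF_intro]: "PFon D f \<Longrightarrow> PFon D (\<lambda>e. left (f e))" "PFon D f \<Longrightarrow> PFon D (\<lambda>e. right (f e))"
  by (rule PF_comp[OF PF_left], assumption, rule PF_comp[OF PF_right], assumption)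

lemma left_right_tr [simp]: "left (tr (a, b)) = tr a" "right (tr (a, b)) = tr b"
  by (simp_all add: tr_simps)

definition nat_of_tree :: "tree \<Rightarrow> nat" where
  "nat_of_tree t = length (spine t)"

definition nats_of_tree :: "tree \<Rightarrow> nat list" where
  "nats_of_tree t = map nat_of_tree (spine t)"

definition row_of_tree :: "tree \<Rightarrow> row" where
  "row_of_tree t = (nats_of_tree (left t), nats_of_tree (left (right t)), nats_of_tree (right (right t)))"

definition cdata_of_tree :: "tree \<Rightarrow> cdata" where
  "cdata_of_tree t = (nat_of_tree (left t), nats_of_tree (left (right t)), map row_of_tree (spine (right (right t))))"

definition idata_of_tree :: "tree \<Rightarrow> idata" where
  "idata_of_tree t = (nats_of_tree (left t), map cdata_of_tree (spine (left (right t))),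
     map cdata_of_tree (spine (left (right (right t)))), nat_of_tree (right (right (right t))))"

definition binop_of_tree :: "tree \<Rightarrow> binop" where
  "binop_of_tree t = hd (filter (\<lambda>b. tr b = t) all_binops @ [Plain OpOr])"

definition node_of_tree :: "tree \<Rightarrow> node" where
  "node_of_tree t = (nat_of_tree (left t), binop_of_tree (left (right t)), nat_of_tree (left (right (right t))),
     nat_of_tree (left (right (right (right t)))), nats_of_tree (right (right (right (right t)))))"

lemma nat_of_tree_tr [simp]: "nat_of_tree (tr n) = n"
  by (simp add: nat_of_tree_def tr_nat_def spine_tr_list)

lemma nats_of_tree_tr [simp]: "nats_of_tree (tr ns) = ns"
  by (simp add: nats_of_tree_def spine_tr_list comp_def)

lemma row_of_tree_tr [simp]: "row_of_tree (tr r) = r"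
  by (cases r) (simp add: row_of_tree_def)

lemma cdata_of_tree_tr [simp]: "cdata_of_tree (tr c) = c"
  by (cases c) (simp add: cdata_of_tree_def spine_tr_list comp_def)

lemma idata_of_tree_tr [simp]: "idata_of_tree (tr d) = d"
  by (cases d) (simp add: idata_of_tree_def spine_tr_list comp_def)

lemma binop_of_tree_tr [simp]: "binop_of_tree (tr b) = b"
proof -
  have "filter (\<lambda>b'. tr b' = tr b) all_binops \<noteq> []" using set_all_binops by (auto simp: filter_empty_conv)
  moreover have "b' = b" if "b' \<in> set (filter (\<lambda>b'. tr b' = tr b) all_binops)" for b' using that by simp
  ultimately show ?thesis unfolding binop_of_tree_def by (metis hd_append2 hd_in_set)
qed

lemma node_of_tree_tr [simp]: "node_of_tree (tr \<nu>) = \<nu>"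
  by (cases \<nu>) (simp add: node_of_tree_def)

lemma PF_nat_of_tree [PF_intro]: "PFon D f \<Longrightarrow> PFon D (\<lambda>e. nat_of_tree (f e))"
  unfolding nat_of_tree_def by (intro PF_intro)

lemma PF_nats_of_tree [PF_intro]: "PFon D f \<Longrightarrow> PFon D (\<lambda>e. nats_of_tree (f e))"
  unfolding nats_of_tree_def by (intro PF_intro)

lemma PF_row_of_tree [PF_intro]: "PFon D f \<Longrightarrow> PFon D (\<lambda>e. row_of_tree (f e))"
  unfolding row_of_tree_def by (intro PF_intro)

lemma PF_cdata_of_tree [PF_intro]: "PFon D f \<Longrightarrow> PFon D (\<lambda>e. cdata_of_tree (f e))"
  unfolding cdata_of_tree_def by (intro PF_intro)

lemma PF_idata_of_tree [PF_intro]: "PFon D f \<Longrightarrow> PFon D (\<lambda>e. idata_of_tree (f e))"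
  unfolding idata_of_tree_def by (intro PF_intro)

lemma PF_binop_of_tree [PF_intro]: "PFon D f \<Longrightarrow> PFon D (\<lambda>e. binop_of_tree (f e))"
proof (rule PF_comp[of binop_of_tree])
  show "PF binop_of_tree" unfolding binop_of_tree_def[abs_def] by (intro PF_intro)
qed

lemma PF_node_of_tree [PF_intro]: "PFon D f \<Longrightarrow> PFon D (\<lambda>e. node_of_tree (f e))"
  unfolding node_of_tree_def by (intro PF_intro)

text \<open>A three-state automaton: in state 0 it expects the marker of an entry, in state 1 the
  bit of that entry, and in state 2, after the terminator, it collects the second component.\<close>

definition unpair_step :: "bool \<Rightarrow> nat \<times> bool list \<times> bool list \<Rightarrow> nat \<times> bool list \<times> bool list" where
  "unpair_step b s = (if fst s = 0 then (if b then 1 else 2, snd s)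
     else if fst s = 1 then (0, b # fst (snd s), snd (snd s)) else (2, fst (snd s), b # snd (snd s)))"

definition unpair :: "bool list \<Rightarrow> bool list \<times> bool list" where
  "unpair z = (rev (fst (snd (fold unpair_step z (0, [], [])))), rev (snd (snd (fold unpair_step z (0, [], [])))))"

lemma unpair_enc_pair: "unpair (enc_pair x y) = (x, y)"
proof -
  have 2: "fold unpair_step y (2, xs, ys) = (2, xs, rev y @ ys)" for xs ys
    by (induction y arbitrary: ys) (auto simp: unpair_step_def)
  have 1: "fold unpair_step (enc_list (\<lambda>b. [b]) x @ y) (0, xs, []) = (2, rev x @ xs, rev y)" for xs
    by (induction x arbitrary: xs) (auto simp: enc_list_def unpair_step_def 2)
  show ?thesis unfolding unpair_def enc_pair_def 1 by simp
qed

lemma PF_unpair [PF_intro]: "PFon D f \<Longrightarrow> PFon D (\<lambda>e. unpair (f e))"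
proof (rule PF_comp[of unpair])
  have "PF (\<lambda>z. fold unpair_step z (0, [], []))"
  proof (rule PFon_fold_add[where b = "\<lambda>e x s. unpair_step x s" and q = "[:10, 1:]"])
    show "PF (\<lambda>z :: bool list \<times> bool \<times> nat \<times> bool list \<times> bool list. unpair_step (fst (snd z)) (snd (snd z)))"
      unfolding unpair_step_def by (intro PF_intro)
    show "sz (unpair_step x s) \<le> sz s + poly [:10, 1:] (sz e + sz x)" for e :: "bool list" and x s
      by (cases s) (auto simp: unpair_step_def sz_nat)
  qed (intro PF_intro)+
  then show "PF unpair" unfolding unpair_def[abs_def] by (intro PF_intro)
qed

definition verify :: "nat \<Rightarrow> unop set \<Rightarrow> binop set \<Rightarrow> nat \<Rightarrow> bool list \<Rightarrow> bool" where
  "verify k Ut Bl n z = check k Ut Bl n (fst (unpair z)) (idata_of_tree (left (parse_tree (snd (unpair z)))))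
     (map node_of_tree (spine (right (parse_tree (snd (unpair z))))))"

lemma verify_in_P: "{z. verify k Ut Bl n z} \<in> class_P"
proof -
  have "PF (\<lambda>z. [verify k Ut Bl n z])"
    unfolding verify_def by (intro PF_intro PF_comp3[OF PF_check])
  from PF_polytime_computable[OF this] show ?thesis by (simp add: class_P_def)
qed

text \<open>The slack of 2 makes the estimate inductive: each further component or entry of a
  concatenated code costs one pair node, which the slack absorbs.\<close>

lemma sz_enc_nat: "sz n + 2 \<le> 3 * length (enc_nat n)"
  by (simp add: sz_nat enc_nat_def)

lemma sz_enc_list: "(\<And>x. x \<in> set xs \<Longrightarrow> sz x + 2 \<le> 3 * length (e x)) \<Longrightarrow> sz xs + 2 \<le> 3 * length (enc_list e xs)"
proof (induction xs)
  case (Cons x xs)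
  have "sz x + 2 \<le> 3 * length (e x)" "sz xs + 2 \<le> 3 * length (enc_list e xs)" using Cons by simp_all
  then show ?case by (simp add: enc_list_def)
qed (simp add: enc_list_def)

lemma sz_list_le: "(\<And>x. x \<in> set xs \<Longrightarrow> sz x \<le> w) \<Longrightarrow> sz xs \<le> 1 + length xs * (w + 1)"
proof (induction xs)
  case (Cons x xs)
  have "sz x \<le> w" "sz xs \<le> 1 + length xs * (w + 1)" using Cons by simp_all
  then show ?case by simp
qed simp

lemma sz_enc_row: "sz r + 2 \<le> 3 * length (enc_row r)"
  using sz_enc_list[OF sz_enc_nat, of "fst r"] sz_enc_list[OF sz_enc_nat, of "fst (snd r)"]
    sz_enc_list[OF sz_enc_nat, of "snd (snd r)"]
  by (cases r) (simp add: enc_row_def)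

lemma sz_enc_cdata: "sz c + 2 \<le> 3 * length (enc_cdata c)"
  using sz_enc_nat[of "fst c"] sz_enc_list[OF sz_enc_nat, of "fst (snd c)"] sz_enc_list[OF sz_enc_row, of "snd (snd c)"]
  by (cases c) (simp add: enc_cdata_def)

lemma sz_enc_idata: "sz d + 2 \<le> 3 * length (enc_idata d)"
  using sz_enc_list[OF sz_enc_nat, of "fst d"] sz_enc_list[OF sz_enc_cdata, of "fst (snd d)"]
    sz_enc_list[OF sz_enc_cdata, of "fst (snd (snd d))"] sz_enc_nat[of "snd (snd (snd d))"]
  by (cases d) (simp add: enc_idata_def)

lemma mem_le_enc_list: "i \<in> set xs \<Longrightarrow> i \<le> length (enc_list enc_nat xs)"
  by (induction xs) (auto simp: enc_list_def enc_nat_def)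

lemma sz_sorted_list_le: "A \<subseteq> {1..k} \<Longrightarrow> sz (sorted_list_of_set A) \<le> 1 + k * (2 * k + 2)" for A :: "nat set"
proof -
  assume A: "A \<subseteq> {1..k}"
  then have fin: "finite A" using finite_subset by blast
  have "sz x \<le> 2 * k + 1" if "x \<in> set (sorted_list_of_set A)" for x
    using that A fin by (auto simp: sz_nat)
  from sz_list_le[OF this, of "sorted_list_of_set A"] fin
  have "sz (sorted_list_of_set A) \<le> 1 + card A * (2 * k + 2)" by simp
  moreover have "card A \<le> k" using card_mono[OF _ A] by simp
  ultimately show ?thesis using mult_le_mono1[of "card A" k "2 * k + 2"] by linarith
qed

theorem ATL_Learn_NP: "ATL_Learn k Ut Bl n \<in> class_NP"
proof -
  let ?V = "{z. verify k Ut Bl n z}"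
  have "finite (range (sz :: binop \<Rightarrow> nat))" by simp
  then obtain K where K: "\<And>f :: binop. sz f \<le> K" by (metis finite_nat_set_iff_bounded_le rangeI)
  \<comment> \<open>Bounds the code of one node: the two pointers contribute at most
    \<open>4 * m\<close> as unary numbers, a coalition of distinct agents at most
    \<open>1 + k * (2 * k + 2)\<close>, and the rest is constant.\<close>
  define W where "W m = 4 * m + (K + k * (2 * k + 2) + 30)" for m
  have "pbd (\<lambda>m. 3 * m + m * (W m + 1) + 2)" unfolding W_def by (intro pbd_intros)
  then obtain p where p: "\<And>m. 3 * m + m * (W m + 1) + 2 \<le> poly p m" unfolding pbd_def by blast
  have "x \<in> ATL_Learn k Ut Bl n \<longleftrightarrow> (\<exists>y. length y \<le> poly p (length x) \<and> enc_pair x y \<in> ?V)" for x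
  proof
    assume "x \<in> ATL_Learn k Ut Bl n"
    from check_complete[OF this] obtain d ns where c: "check k Ut Bl n x d ns"
      "\<forall>\<nu> \<in> set ns. tidy k \<nu>" by blast
    let ?m = "length x"
    have v: "verify k Ut Bl n (enc_pair x (ser (d, ns)))"
      using c(1) by (simp add: verify_def unpair_enc_pair parse_tree_ser spine_tr_list comp_def)
    from c(1) have x: "enc_idata d = x" and l: "length ns \<le> snd (snd (snd d))" and ok: "nodes_ok k Ut Bl (fst d) ns"
      unfolding check_def check_nodes_ok by blast+
    \<comment> \<open>The bound is written in unary, so a program of that length is still polynomial
      in the input.\<close>
    have B: "snd (snd (snd d)) \<le> ?m" by (simp add: x[symmetric] enc_idata_def enc_nat_def)
    have ps: "i \<le> ?m" if "i \<in> set (fst d)" for i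
      using mem_le_enc_list[OF that] by (simp add: x[symmetric] enc_idata_def)
    have node: "sz \<nu> \<le> W ?m" if "\<nu> \<in> set ns" for \<nu>
    proof -
      obtain kind f i j A where \<nu>: "\<nu> = (kind, f, i, j, A)" by (metis prod_cases5)
      from that obtain pos where pos: "pos < length ns" "ns ! pos = \<nu>" by (auto simp: in_set_conv_nth)
      with ok have nok: "node_ok k Ut Bl (fst d) pos \<nu>" by blast
      have "kind \<le> 5" using nok by (auto simp: node_ok_def \<nu>)
      moreover have "i \<le> ?m" using nok pos(1) l B ps by (auto simp: node_ok_def \<nu>)
      moreover have "j \<le> ?m" using nok pos(1) l B bspec[OF c(2) that] by (auto simp: node_ok_def tidy_def \<nu>)
      moreover have "sz A \<le> 1 + k * (2 * k + 2)"
        using bspec[OF c(2) that] sz_sorted_list_le by (auto simp: tidy_def \<nu>)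
      ultimately show ?thesis using K[of f] by (simp add: \<nu> W_def sz_nat)
    qed
    have "sz ns \<le> 1 + length ns * (W ?m + 1)"
      by (rule sz_list_le[OF node])
    also have "\<dots> \<le> 1 + ?m * (W ?m + 1)" using mult_le_mono1[of "length ns" ?m "W ?m + 1"] l B by simp
    finally have "sz (d, ns) \<le> 3 * ?m + ?m * (W ?m + 1) + 2" using sz_enc_idata[of d] x by simp
    with p[of ?m] have "length (ser (d, ns)) \<le> poly p ?m" by (simp del: sz_simps)
    with v show "\<exists>y. length y \<le> poly p (length x) \<and> enc_pair x y \<in> ?V" by blast
  next
    assume "\<exists>y. length y \<le> poly p (length x) \<and> enc_pair x y \<in> ?V"
    then show "x \<in> ATL_Learn k Ut Bl n" by (auto simp: verify_def unpair_enc_pair intro: check_sound)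
  qed
  with verify_in_P show ?thesis unfolding class_NP_def by blast
qed

section \<open>Duality in turn-based structures\<close>

locale turn_game = game +
  assumes turn: "turn_based C"
begin

text \<open>What duality uses of a turn-based structure: at each state one agent alone determines
  the successor. The successor sets and their numbering are forgotten.\<close>

lemma owner:
  assumes "q \<in> states C"
  shows "\<exists>a0 \<in> {1..k}. (\<forall>a \<in> {1..k}. a \<noteq> a0 \<longrightarrow> cgs_acts C q a = 1) \<and>
    (\<forall>\<alpha> \<in> action_tuples C q. \<forall>\<beta> \<in> action_tuples C q. \<alpha> ! (a0 - 1) = \<beta> ! (a0 - 1) \<longrightarrow>
       cgs_trans C q \<alpha> = cgs_trans C q \<beta>)"
proof -
  from turn assms obtain AgSt and e :: "nat \<Rightarrow> nat \<Rightarrow> nat" where "AgSt q \<in> {1..cgs_agents C}"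
    "\<forall>a \<in> {1..cgs_agents C} - {AgSt q}. cgs_acts C q a = 1"
    "\<forall>\<alpha> \<in> action_tuples C q. cgs_trans C q \<alpha> = e q (\<alpha> ! (AgSt q - 1))"
    unfolding turn_based_def by blast
  with agents show ?thesis by (intro bexI[of _ "AgSt q"]) auto
qed

text \<open>One-step determinacy. A coalition with the owner of \<open>q\<close> can force every
  possible successor, one without it only what all successors have in common; complementing
  coalition and target exchanges the two cases.\<close>

lemma cpre_dual:
  assumes q: "q \<in> states C" and A: "A \<subseteq> {1..k}"
  shows "cpre C ({1..k} - A) (states C - Z) q \<longleftrightarrow> \<not> cpre C A Z q"
proof -
  from owner[OF q] obtain a0 where a0': "a0 \<in> {1..k}" "\<forall>a \<in> {1..k}. a \<noteq> a0 \<longrightarrow> cgs_acts C q a = 1"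
    "\<forall>\<alpha> \<in> action_tuples C q. \<forall>\<beta> \<in> action_tuples C q. \<alpha> ! (a0 - 1) = \<beta> ! (a0 - 1) \<longrightarrow>
       cgs_trans C q \<alpha> = cgs_trans C q \<beta>" by blast
  note a0 = a0'(1) a0'(2,3)[rule_format]
  have ctl: "cpre C B Y q \<longleftrightarrow> (\<exists>\<alpha> \<in> action_tuples C q. cgs_trans C q \<alpha> \<in> Y)" if "a0 \<in> B" for B Y
  proof
    assume "cpre C B Y q"
    then show "\<exists>\<alpha> \<in> action_tuples C q. cgs_trans C q \<alpha> \<in> Y" unfolding cpre_def by blast
  next
    assume "\<exists>\<alpha> \<in> action_tuples C q. cgs_trans C q \<alpha> \<in> Y"
    then obtain \<alpha> where \<alpha>: "\<alpha> \<in> action_tuples C q" "cgs_trans C q \<alpha> \<in> Y" by blast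
    have "cgs_trans C q \<beta> \<in> Y" if "\<beta> \<in> action_tuples C q" "\<forall>a \<in> B. \<beta> ! (a - 1) = \<alpha> ! (a - 1)" for \<beta>
      using a0(3)[OF that(1) \<alpha>(1)] that(2) \<open>a0 \<in> B\<close> \<alpha>(2) by simp
    with \<alpha>(1) show "cpre C B Y q" unfolding cpre_def by blast
  qed
  have other: "cpre C B Y q \<longleftrightarrow> (\<forall>\<alpha> \<in> action_tuples C q. cgs_trans C q \<alpha> \<in> Y)" if "a0 \<notin> B" "B \<subseteq> {1..k}" for B Y
  proof -
    have "\<alpha> ! (a - 1) = \<beta> ! (a - 1)" if "a \<in> B" "\<alpha> \<in> action_tuples C q" "\<beta> \<in> action_tuples C q" for \<alpha> \<beta> a
    proof -
      have a: "a \<in> {1..k}" "a \<noteq> a0" using that(1) \<open>a0 \<notin> B\<close> \<open>B \<subseteq> {1..k}\<close> by auto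
      have "\<gamma> ! (a - 1) < 1" if "\<gamma> \<in> action_tuples C q" for \<gamma>
      proof -
        from that have "\<forall>a \<in> {1..cgs_agents C}. \<gamma> ! (a - 1) < cgs_acts C q a" by (simp add: action_tuples_def)
        from bspec[OF this, of a] show ?thesis using a(1) a0(2)[OF a] agents by simp
      qed
      from this[OF that(2)] this[OF that(3)] have "\<alpha> ! (a - 1) < 1" "\<beta> ! (a - 1) < 1" by simp_all
      then show ?thesis by simp
    qed
    then show ?thesis unfolding cpre_def using default_action[OF q] by blast
  qed
  show ?thesis
  proof (cases "a0 \<in> A")
    case True
    then have "a0 \<notin> {1..k} - A" by simp
    from ctl[OF True] other[OF this] trans_state[OF q] show ?thesis by auto
  next
    case False
    then have "a0 \<in> {1..k} - A" using a0(1) by simp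
    from ctl[OF this] other[OF False A] trans_state[OF q] show ?thesis by auto
  qed
qed

text \<open>Both fixpoints are reached by equally many rounds, so complementing round by round lifts
  one-step determinacy to reachability and safety games.\<close>

lemma iterate_dual:
  assumes A: "A \<subseteq> {1..k}" and Z: "Z \<subseteq> states C"
  shows "(g_step ({1..k} - A) ^^ n) (states C - Z) = states C - (f_step A ^^ n) Z"
proof (induction n)
  case (Suc n)
  have "(f_step A ^^ n) Z \<subseteq> states C" by (induction n) (use Z in \<open>auto simp: f_step_def\<close>)
  then have "g_step ({1..k} - A) (states C - (f_step A ^^ n) Z) = states C - f_step A ((f_step A ^^ n) Z)"
    unfolding g_step_def f_step_def using cpre_dual[OF _ A] by blast
  with Suc show ?case by simp
qed simp

lemma sat_set_subset: "sat_set \<phi> \<subseteq> states C"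
  by (auto simp: sat_set_def)

lemma dual_Next:
  assumes "A \<subseteq> {1..k}" "sat_set \<phi>' = states C - sat_set \<phi>"
  shows "sat_set (Strat ({1..k} - A) (Next \<phi>')) = states C - sat_set (Strat A (Next \<phi>))"
  using assms cpre_dual[OF _ assms(1)] by (auto simp: sat_set_Next)

lemma dual_Finally:
  assumes "A \<subseteq> {1..k}" "sat_set \<phi>' = states C - sat_set \<phi>"
  shows "sat_set (Strat ({1..k} - A) (Globally \<phi>')) = states C - sat_set (Strat A (Finally \<phi>))"
  using assms iterate_dual[OF assms(1) sat_set_subset] by (simp add: sat_set_Finally sat_set_Globally)

lemma dual_Globally:
  assumes "A \<subseteq> {1..k}" "sat_set \<phi>' = states C - sat_set \<phi>"
  shows "sat_set (Strat ({1..k} - A) (Finally \<phi>')) = states C - sat_set (Strat A (Globally \<phi>))"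
proof -
  let ?B = "{1..k} - A"
  \<comment> \<open>Complementing twice reduces this case to the previous one.\<close>
  have "{1..k} - ?B = A" using assms(1) by blast
  moreover have "sat_set \<phi> = states C - sat_set \<phi>'" using assms(2) sat_set_subset[of \<phi>] by blast
  ultimately have "sat_set (Strat A (Globally \<phi>)) = states C - sat_set (Strat ?B (Finally \<phi>'))"
    using dual_Finally[of ?B \<phi> \<phi>'] by simp
  with sat_set_subset show ?thesis by blast
qed

end

section \<open>Propositions and constant subformulas\<close>

primrec fprops :: "sform \<Rightarrow> nat set" and path_fprops :: "pform \<Rightarrow> nat set" where
  "fprops (Prop r) = {r}"
| "fprops (Neg \<phi>) = fprops \<phi>"
| "fprops (Bin f \<phi> \<chi>) = fprops \<phi> \<union> fprops \<chi>"
| "fprops (Strat A \<psi>) = path_fprops \<psi>"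
| "path_fprops (Next \<phi>) = fprops \<phi>"
| "path_fprops (Finally \<phi>) = fprops \<phi>"
| "path_fprops (Globally \<phi>) = fprops \<phi>"

text \<open>The truth value in a structure all of whose states carry the label \<open>v\<close>.\<close>

primrec psat :: "nat set \<Rightarrow> sform \<Rightarrow> bool" and path_psat :: "nat set \<Rightarrow> pform \<Rightarrow> bool" where
  "psat v (Prop r) \<longleftrightarrow> r \<in> v"
| "psat v (Neg \<phi>) \<longleftrightarrow> \<not> psat v \<phi>"
| "psat v (Bin f \<phi> \<chi>) \<longleftrightarrow> binop_sem f (psat v \<phi>) (psat v \<chi>)"
| "psat v (Strat A \<psi>) \<longleftrightarrow> path_psat v \<psi>"
| "path_psat v (Next \<phi>) \<longleftrightarrow> psat v \<phi>"
| "path_psat v (Finally \<phi>) \<longleftrightarrow> psat v \<phi>"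
| "path_psat v (Globally \<phi>) \<longleftrightarrow> psat v \<phi>"

lemma psat_cong:
  "(\<forall>r \<in> fprops \<phi>. r \<in> v \<longleftrightarrow> r \<in> w) \<Longrightarrow> psat v \<phi> = psat w \<phi>"
  "(\<forall>r \<in> path_fprops \<psi>. r \<in> v \<longleftrightarrow> r \<in> w) \<Longrightarrow> path_psat v \<psi> = path_psat w \<psi>"
  by (induction \<phi> and \<psi>) auto

lemma fprops_fragment:
  "in_fragment k P Ut Bl \<phi> \<Longrightarrow> fprops \<phi> \<subseteq> P"
  "in_path_fragment k P Ut Bl \<psi> \<Longrightarrow> path_fprops \<psi> \<subseteq> P"
  by (induction \<phi> and \<psi>) auto

text \<open>Some profile exists and every profile has an outcome, so a constant path property passes
  through the quantifiers unchanged.\<close>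

lemma (in game) const_Strat:
  assumes A: "A \<subseteq> {1..k}" and q: "q \<in> states C"
    and c: "\<And>\<rho>. (\<And>i. \<rho> i \<in> states C) \<Longrightarrow> path_sat C \<psi> \<rho> = d"
  shows "sat C (Strat A \<psi>) q = d"
proof -
  have p: "strategy_profile C A (\<lambda>a h. replicate k 0 ! (a - 1))"
    using memoryless_profile[OF A default_action] by simp
  have c': "path_sat C \<psi> \<rho> = d" if "\<rho> \<in> outcomes C A q S" for \<rho> S
    by (rule c) (rule outcome_states[OF that q])
  show ?thesis
  proof (cases d)
    case True
    then have "\<forall>\<rho> \<in> outcomes C A q (\<lambda>a h. replicate k 0 ! (a - 1)). path_sat C \<psi> \<rho>" using c' by simp
    with p True show ?thesis unfolding sat.simps by blast
  next
    case False
    have "\<exists>\<rho> \<in> outcomes C A q S. \<not> path_sat C \<psi> \<rho>" if "strategy_profile C A S" for S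
      using outcome_exists[OF q A that] c' False by blast
    with False show ?thesis unfolding sat.simps by blast
  qed
qed

text \<open>With all propositions in \<open>Q\<close> it evaluates formulas on one-state structures;
  with only the new ones it shows that subformulas without \<open>p\<close> and \<open>pbar\<close>
  are constant on the padded structures.\<close>

lemma (in game) sat_const:
  assumes c: "\<And>q r. q \<in> states C \<Longrightarrow> r \<in> Q \<Longrightarrow> r \<in> cgs_label C q \<longleftrightarrow> r \<in> v"
  shows "in_fragment k P' Ut Bl \<phi> \<Longrightarrow> fprops \<phi> \<subseteq> Q \<Longrightarrow> q \<in> states C \<Longrightarrow> sat C \<phi> q = psat v \<phi>"
    "in_path_fragment k P' Ut Bl \<psi> \<Longrightarrow> path_fprops \<psi> \<subseteq> Q \<Longrightarrow> (\<And>i. \<rho> i \<in> states C) \<Longrightarrow> path_sat C \<psi> \<rho> = path_psat v \<psi>"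
proof (induction \<phi> and \<psi> arbitrary: q and \<rho>)
  case (Prop r)
  then show ?case using c by simp
next
  case (Strat A \<psi>)
  show ?case unfolding psat.simps
    by (rule const_Strat) (use Strat in auto)
qed auto

definition relabel :: "cgs \<Rightarrow> (nat \<Rightarrow> nat set) \<Rightarrow> cgs" where
  "relabel C l = C\<lparr>cgs_label := l\<rparr>"

lemma relabel_simps [simp]:
  "cgs_label (relabel C l) = l" "cgs_size (relabel C l) = cgs_size C" "cgs_init (relabel C l) = cgs_init C"
  "cgs_agents (relabel C l) = cgs_agents C" "cgs_acts (relabel C l) = cgs_acts C" "cgs_trans (relabel C l) = cgs_trans C"
  "states (relabel C l) = states C"
  by (simp_all add: relabel_def states_def)

lemma relabel_tuples [simp]: "action_tuples (relabel C l) q = action_tuples C q"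
  by (simp add: action_tuples_def)

lemma relabel_profile [simp]: "strategy_profile (relabel C l) A S = strategy_profile C A S"
  by (simp add: strategy_profile_def strategy_def histories_def)

lemma relabel_outcomes [simp]: "outcomes (relabel C l) A q S = outcomes C A q S"
  by (simp add: outcomes_def)

lemma relabel_turn_based [simp]: "turn_based (relabel C l) = turn_based C"
  by (simp add: turn_based_def)

lemma (in game) Strat_cong:
  assumes "\<And>\<rho>. (\<And>i. \<rho> i \<in> states C) \<Longrightarrow> path_sat (relabel C l) \<psi>' \<rho> = path_sat C \<psi> \<rho>" "q \<in> states C"
  shows "sat (relabel C l) (Strat A \<psi>') q = sat C (Strat A \<psi>) q"
proof -
  have "(\<forall>\<rho> \<in> outcomes C A q S. path_sat (relabel C l) \<psi>' \<rho>) \<longleftrightarrow> (\<forall>\<rho> \<in> outcomes C A q S. path_sat C \<psi> \<rho>)" for S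
    by (rule ball_cong[OF refl]) (rule assms(1), rule outcome_states[OF _ assms(2)])
  then show ?thesis by simp
qed

section \<open>Substituting for the leaf of a formula without binary operators\<close>

primrec msub :: "(nat \<Rightarrow> sform) \<Rightarrow> sform \<Rightarrow> sform" and path_msub :: "(nat \<Rightarrow> sform) \<Rightarrow> pform \<Rightarrow> pform" where
  "msub \<theta> (Prop r) = \<theta> r"
| "msub \<theta> (Neg \<phi>) = Neg (msub \<theta> \<phi>)"
| "msub \<theta> (Bin f \<phi> \<chi>) = Bin f (msub \<theta> \<phi>) (msub \<theta> \<chi>)"
| "msub \<theta> (Strat A \<psi>) = Strat A (path_msub \<theta> \<psi>)"
| "path_msub \<theta> (Next \<phi>) = Next (msub \<theta> \<phi>)"
| "path_msub \<theta> (Finally \<phi>) = Finally (msub \<theta> \<phi>)"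
| "path_msub \<theta> (Globally \<phi>) = Globally (msub \<theta> \<phi>)"

lemma (in game) msub_sat:
  assumes \<theta>: "\<And>q r. q \<in> states C \<Longrightarrow> r \<in> P' \<Longrightarrow> sat (relabel C l) (\<theta> r) q \<longleftrightarrow> r \<in> cgs_label C q"
  shows "in_fragment k P' U {} \<phi> \<Longrightarrow> q \<in> states C \<Longrightarrow> sat (relabel C l) (msub \<theta> \<phi>) q = sat C \<phi> q"
    "in_path_fragment k P' U {} \<psi> \<Longrightarrow> (\<And>i. \<rho> i \<in> states C) \<Longrightarrow> path_sat (relabel C l) (path_msub \<theta> \<psi>) \<rho> = path_sat C \<psi> \<rho>"
proof (induction \<phi> and \<psi> arbitrary: q and \<rho>)
  case (Strat A \<psi>)
  show ?case unfolding msub.simps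
    by (rule Strat_cong) (use Strat in auto)
qed (use \<theta> in auto)

text \<open>Where all states have the same label, temporal and strategic operators are the identity,
  so without negations and binary operators the value of the leaf is the value of the
  formula.\<close>

lemma msub_psat:
  assumes "\<And>r. r \<in> P' \<Longrightarrow> psat v (\<theta> r) = d" "OpNot \<notin> U"
  shows "in_fragment k P' U {} \<phi> \<Longrightarrow> psat v (msub \<theta> \<phi>) = d"
    "in_path_fragment k P' U {} \<psi> \<Longrightarrow> path_psat v (path_msub \<theta> \<psi>) = d"
  by (induction \<phi> and \<psi>) (use assms in auto)

lemma msub_fragment:
  assumes "\<And>r. r \<in> P' \<Longrightarrow> in_fragment k P Ut Bl (\<theta> r)" "U \<subseteq> Ut"
  shows "in_fragment k P' U {} \<phi> \<Longrightarrow> in_fragment k P Ut Bl (msub \<theta> \<phi>)"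
    "in_path_fragment k P' U {} \<psi> \<Longrightarrow> in_path_fragment k P Ut Bl (path_msub \<theta> \<psi>)"
  by (induction \<phi> and \<psi>) (use assms in auto)

text \<open>Without binary operators a formula is a chain over a single leaf; the substitution
  trades that one node for at most \<open>m\<close>.\<close>

lemma msub_size:
  assumes "\<And>r. r \<in> P' \<Longrightarrow> card (subformulas (\<theta> r)) \<le> m"
  shows "in_fragment k P' U {} \<phi> \<Longrightarrow> card (subformulas (msub \<theta> \<phi>)) + 1 \<le> card (subformulas \<phi>) + m"
    "in_path_fragment k P' U {} \<psi> \<Longrightarrow> card (path_subformulas (path_msub \<theta> \<psi>)) + 1 \<le> card (path_subformulas \<psi>) + m"
proof (induction \<phi> and \<psi>)
  case (Neg \<phi>)
  have "Neg \<phi> \<notin> subformulas \<phi>" using subformulas_size(1)[of "Neg \<phi>" \<phi>] by auto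
  with Neg show ?case by (simp add: card_insert_if)
next
  case (Strat A \<psi>)
  have "Strat A \<psi> \<notin> path_subformulas \<psi>" using subformulas_size(2)[of "Strat A \<psi>" \<psi>] by auto
  with Strat show ?case by (simp add: card_insert_if)
qed (use assms in auto)

lemma msub_bin:
  assumes "\<And>r. r \<in> P' \<Longrightarrow> card {\<chi> \<in> subformulas (\<theta> r). is_Bin \<chi>} \<le> m"
  shows "in_fragment k P' U {} \<phi> \<Longrightarrow> card {\<chi> \<in> subformulas (msub \<theta> \<phi>). is_Bin \<chi>} \<le> m"
    "in_path_fragment k P' U {} \<psi> \<Longrightarrow> card {\<chi> \<in> path_subformulas (path_msub \<theta> \<psi>). is_Bin \<chi>} \<le> m"
proof (induction \<phi> and \<psi>)
  case (Neg \<phi>)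
  have "{\<chi> \<in> subformulas (msub \<theta> (Neg \<phi>)). is_Bin \<chi>} = {\<chi> \<in> subformulas (msub \<theta> \<phi>). is_Bin \<chi>}" by auto
  with Neg show ?case by simp
next
  case (Strat A \<psi>)
  have "{\<chi> \<in> subformulas (msub \<theta> (Strat A \<psi>)). is_Bin \<chi>} = {\<chi> \<in> path_subformulas (path_msub \<theta> \<psi>). is_Bin \<chi>}" by auto
  with Strat show ?case by simp
qed (use assms in auto)

section \<open>Absorbing binary operators\<close>

lemma binop_neutral: "\<exists>c s. \<forall>x. binop_sem f x c = (x \<noteq> s)"
proof (cases f)
  case (Plain g)
  show ?thesis
  proof (cases g)
    case OpOr then show ?thesis using Plain by (intro exI[of _ False]) auto
  next
    case OpAnd then show ?thesis using Plain by (intro exI[of _ True] exI[of _ False]) auto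
  next
    case OpImp then show ?thesis using Plain by (intro exI[of _ False] exI[of _ True]) auto
  next
    case OpRevImp then show ?thesis using Plain by (intro exI[of _ True] exI[of _ False]) auto
  next
    case OpIff then show ?thesis using Plain by (intro exI[of _ True] exI[of _ False]) auto
  qed
next
  case (Negated g)
  show ?thesis
  proof (cases g)
    case OpOr then show ?thesis using Negated by (intro exI[of _ False] exI[of _ True]) auto
  next
    case OpAnd then show ?thesis using Negated by (intro exI[of _ True]) auto
  next
    case OpImp then show ?thesis using Negated by (intro exI[of _ False]) auto
  next
    case OpRevImp then show ?thesis using Negated by (intro exI[of _ True]) auto
  next
    case OpIff then show ?thesis using Negated by (intro exI[of _ True]) auto
  qed
qed

text \<open>None of the operators ignores its second argument; this is what forces each new
  proposition to occur in a separating formula.\<close>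

lemma binop_depends: "\<exists>x. binop_sem f x c \<noteq> binop_sem f x (\<not> c)"
proof -
  have "\<exists>x. logical_op_sem g x c \<noteq> logical_op_sem g x (\<not> c)" for g by (cases g) auto
  then show ?thesis by (cases f) auto
qed

text \<open>A comb with \<open>r\<close> at the bottom left. Each new proposition adds an operator
  and a leaf, which is where the factor 2 in the size bounds comes from.\<close>

definition theta :: "binop \<Rightarrow> nat list \<Rightarrow> nat \<Rightarrow> sform" where
  "theta f qs r = foldl (\<lambda>\<phi> x. Bin f \<phi> (Prop x)) (Prop r) qs"

lemma theta_snoc: "theta f (qs @ [x]) r = Bin f (theta f qs r) (Prop x)"
  by (simp add: theta_def)

lemma theta_Nil [simp]: "theta f [] r = Prop r"
  by (simp add: theta_def)

lemma theta_size: "card (subformulas (theta f qs r)) \<le> 2 * length qs + 1"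
proof (induction qs rule: rev_induct)
  case (snoc x qs)
  have "card (subformulas (theta f (qs @ [x]) r)) \<le> Suc (card (subformulas (theta f qs r) \<union> {Prop x}))"
    by (simp add: theta_snoc card_insert_if)
  also have "card (subformulas (theta f qs r) \<union> {Prop x}) \<le> card (subformulas (theta f qs r)) + 1"
    using card_Un_le[of "subformulas (theta f qs r)" "{Prop x}"] by simp
  finally show ?case using snoc by simp
qed simp

lemma theta_bin: "card {\<chi> \<in> subformulas (theta f qs r). is_Bin \<chi>} \<le> length qs"
proof (induction qs rule: rev_induct)
  case (snoc x qs)
  have "{\<chi> \<in> subformulas (theta f (qs @ [x]) r). is_Bin \<chi>} =
     insert (theta f (qs @ [x]) r) {\<chi> \<in> subformulas (theta f qs r). is_Bin \<chi>}" by (auto simp: theta_snoc)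
  with snoc show ?case by (simp add: card_insert_if)
qed simp

lemma theta_fragment: "r \<in> P \<Longrightarrow> set qs \<subseteq> P \<Longrightarrow> qs = [] \<or> f \<in> Bl \<Longrightarrow> in_fragment k P Ut Bl (theta f qs r)"
  by (induction qs rule: rev_induct) (auto simp: theta_snoc)

lemma theta_sat: "sat C (theta f qs r) q = foldl (\<lambda>y x. binop_sem f y (x \<in> cgs_label C q)) (r \<in> cgs_label C q) qs"
  by (induction qs rule: rev_induct) (auto simp: theta_snoc)

lemma theta_psat: "psat v (theta f qs r) = foldl (\<lambda>y x. binop_sem f y (x \<in> v)) (r \<in> v) qs"
  by (induction qs rule: rev_induct) (auto simp: theta_snoc)

text \<open>Each neutral argument negates if \<open>s\<close> holds, so only the parity of the
  length survives.\<close>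

lemma foldl_neutral:
  assumes "\<And>y. binop_sem f y c = (y \<noteq> s)" "\<And>x. x \<in> set qs \<Longrightarrow> x \<in> v \<longleftrightarrow> c"
  shows "foldl (\<lambda>y x. binop_sem f y (x \<in> v)) y qs = (y \<noteq> (odd (length qs) \<and> s))"
  using assms(2)
proof (induction qs rule: rev_induct)
  case (snoc x qs)
  then show ?case using assms(1) by auto
qed simp

section \<open>Counting propositions against binary operators\<close>

abbreviation prop_nodes :: "sform set \<Rightarrow> sform set" where
  "prop_nodes S \<equiv> {\<chi> \<in> S. \<exists>r. \<chi> = Prop r}"

abbreviation bin_nodes :: "sform set \<Rightarrow> sform set" where
  "bin_nodes S \<equiv> {\<chi> \<in> S. is_Bin \<chi>}"

text \<open>Relative to a closed set \<open>X\<close> of formulas seen before, a formula adds at most one more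
  proposition than binary operators, and not even that one if it shares a subformula with \<open>X\<close>.\<close>

lemma count_new:
  "finite X \<Longrightarrow> (\<And>\<chi>. \<chi> \<in> X \<Longrightarrow> subformulas \<chi> \<subseteq> X) \<Longrightarrow>
     card (prop_nodes (subformulas \<phi> - X)) + (if subformulas \<phi> \<inter> X = {} then 0 else 1) \<le> card (bin_nodes (subformulas \<phi> - X)) + 1"
  "finite X \<Longrightarrow> (\<And>\<chi>. \<chi> \<in> X \<Longrightarrow> subformulas \<chi> \<subseteq> X) \<Longrightarrow>
     card (prop_nodes (path_subformulas \<psi> - X)) + (if path_subformulas \<psi> \<inter> X = {} then 0 else 1) \<le> card (bin_nodes (path_subformulas \<psi> - X)) + 1"
proof (induction \<phi> and \<psi> arbitrary: X and X)
  case (Prop r)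
  show ?case
  proof (cases "Prop r \<in> X")
    case True
    then have "subformulas (Prop r) - X = {}" by simp
    then show ?thesis by (simp only: Collect_empty_eq) simp
  next
    case False
    then have "prop_nodes (subformulas (Prop r) - X) = {Prop r}" "subformulas (Prop r) \<inter> X = {}" by auto
    then show ?thesis by simp
  qed
next
  case (Neg \<phi>)
  show ?case
  proof (cases "Neg \<phi> \<in> X")
    case True
    with Neg.prems(2)[OF True] have "subformulas (Neg \<phi>) - X = {}" by auto
    then show ?thesis by (simp only: Collect_empty_eq) simp
  next
    case False
    then have "prop_nodes (subformulas (Neg \<phi>) - X) = prop_nodes (subformulas \<phi> - X)"
      "bin_nodes (subformulas (Neg \<phi>) - X) = bin_nodes (subformulas \<phi> - X)"
      "subformulas (Neg \<phi>) \<inter> X = subformulas \<phi> \<inter> X" by auto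
    with Neg.IH[OF Neg.prems] show ?thesis by simp
  qed
next
  case (Strat A \<psi>)
  show ?case
  proof (cases "Strat A \<psi> \<in> X")
    case True
    with Strat.prems(2)[OF True] have "subformulas (Strat A \<psi>) - X = {}" by auto
    then show ?thesis by (simp only: Collect_empty_eq) simp
  next
    case False
    then have "prop_nodes (subformulas (Strat A \<psi>) - X) = prop_nodes (path_subformulas \<psi> - X)"
      "bin_nodes (subformulas (Strat A \<psi>) - X) = bin_nodes (path_subformulas \<psi> - X)"
      "subformulas (Strat A \<psi>) \<inter> X = path_subformulas \<psi> \<inter> X" by auto
    with Strat.IH[OF Strat.prems] show ?thesis by simp
  qed
next
  case (Bin f a b)
  let ?\<phi> = "Bin f a b"
  show ?case
  proof (cases "?\<phi> \<in> X")
    case True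
    with Bin.prems(2)[OF True] have "subformulas ?\<phi> - X = {}" by auto
    then show ?thesis by (simp only: Collect_empty_eq) simp
  next
    case False
    \<comment> \<open>The second argument is counted relative to \<open>X\<close> and the first one,
      so nodes shared between them are counted once. The new operator pays for the extra proposition
      that both arguments may bring.\<close>
    let ?Y = "X \<union> subformulas a"
    have Y: "finite ?Y" "\<And>\<chi>. \<chi> \<in> ?Y \<Longrightarrow> subformulas \<chi> \<subseteq> ?Y"
      using Bin.prems subformulas_trans(1) by fastforce+
    have nin: "?\<phi> \<notin> subformulas a" "?\<phi> \<notin> subformulas b"
      using subformulas_size(1)[of ?\<phi> a] subformulas_size(1)[of ?\<phi> b] by auto
    have "prop_nodes (subformulas ?\<phi> - X) = prop_nodes (subformulas a - X) \<union> prop_nodes (subformulas b - ?Y)"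
      by auto
    moreover have "prop_nodes (subformulas a - X) \<inter> prop_nodes (subformulas b - ?Y) = {}" by auto
    ultimately have p: "card (prop_nodes (subformulas ?\<phi> - X)) =
        card (prop_nodes (subformulas a - X)) + card (prop_nodes (subformulas b - ?Y))"
      using card_Un_disjoint[of "prop_nodes (subformulas a - X)" "prop_nodes (subformulas b - ?Y)"] by simp
    have e: "bin_nodes (subformulas ?\<phi> - X) = insert ?\<phi> (bin_nodes (subformulas a - X) \<union> bin_nodes (subformulas b - ?Y))"
      using False by auto
    have "bin_nodes (subformulas a - X) \<inter> bin_nodes (subformulas b - ?Y) = {}" by auto
    moreover have "?\<phi> \<notin> bin_nodes (subformulas a - X) \<union> bin_nodes (subformulas b - ?Y)" using nin by auto
    ultimately have bb: "card (bin_nodes (subformulas ?\<phi> - X)) =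
        Suc (card (bin_nodes (subformulas a - X)) + card (bin_nodes (subformulas b - ?Y)))"
      unfolding e using card_Un_disjoint[of "bin_nodes (subformulas a - X)" "bin_nodes (subformulas b - ?Y)"]
        card_insert_disjoint[of "bin_nodes (subformulas a - X) \<union> bin_nodes (subformulas b - ?Y)" ?\<phi>]
      by (simp only:) simp
    have "(if subformulas ?\<phi> \<inter> X = {} then 0 else 1) \<le>
       (if subformulas a \<inter> X = {} then 0 else 1) + (if subformulas b \<inter> ?Y = {} then 0 else 1 :: nat)"
      using False by auto
    with Bin.IH(1)[OF Bin.prems] Bin.IH(2)[OF Y] p bb show ?thesis by linarith
  qed
qed auto

text \<open>Equality in \<open>count_props\<close>: the operators are only just enough to join the
  propositions.\<close>

definition tight :: "sform \<Rightarrow> bool" where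
  "tight \<phi> \<longleftrightarrow> card (prop_nodes (subformulas \<phi>)) = card (bin_nodes (subformulas \<phi>)) + 1"

lemma count_props: "card (prop_nodes (subformulas \<phi>)) \<le> card (bin_nodes (subformulas \<phi>)) + 1"
  using count_new(1)[of "{}" \<phi>] by simp

lemma prop_nodes_fprops:
  "prop_nodes (subformulas \<phi>) = Prop ` fprops \<phi>" "prop_nodes (path_subformulas \<psi>) = Prop ` path_fprops \<psi>"
proof (induction \<phi> and \<psi>)
  case (Bin f a b)
  have "prop_nodes (subformulas (Bin f a b)) = prop_nodes (subformulas a) \<union> prop_nodes (subformulas b)" by auto
  then show ?case unfolding Bin by (simp only: fprops.simps image_Un)
qed auto

lemma card_prop_nodes: "card (prop_nodes (subformulas \<phi>)) = card (fprops \<phi>)"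
  unfolding prop_nodes_fprops by (rule card_image) (simp add: inj_on_def)

lemma tight_Neg: "tight (Neg \<phi>) \<Longrightarrow> tight \<phi>"
proof -
  have "prop_nodes (subformulas (Neg \<phi>)) = prop_nodes (subformulas \<phi>)"
    "bin_nodes (subformulas (Neg \<phi>)) = bin_nodes (subformulas \<phi>)" by auto
  then show "tight (Neg \<phi>) \<Longrightarrow> tight \<phi>" by (simp add: tight_def)
qed

lemma size_Neg: "formula_size (Neg \<phi>) = Suc (formula_size \<phi>)" "binary_size (Neg \<phi>) = binary_size \<phi>"
proof -
  have "Neg \<phi> \<notin> subformulas \<phi>" using subformulas_size(1)[of "Neg \<phi>" \<phi>] by auto
  then show "formula_size (Neg \<phi>) = Suc (formula_size \<phi>)" by (simp add: formula_size_def)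
  have "bin_nodes (subformulas (Neg \<phi>)) = bin_nodes (subformulas \<phi>)" by auto
  then show "binary_size (Neg \<phi>) = binary_size \<phi>" by (simp add: binary_size_def)
qed

lemma tight_Strat: "tight (Strat A \<psi>) \<Longrightarrow> path_subformulas \<psi> = subformulas \<phi> \<Longrightarrow> tight \<phi>"
proof -
  assume t: "tight (Strat A \<psi>)" and e: "path_subformulas \<psi> = subformulas \<phi>"
  have "prop_nodes (subformulas (Strat A \<psi>)) = prop_nodes (subformulas \<phi>)"
    "bin_nodes (subformulas (Strat A \<psi>)) = bin_nodes (subformulas \<phi>)" unfolding subformulas.simps e by auto
  with t show "tight \<phi>" by (simp add: tight_def)
qed

lemma size_Strat:
  assumes "path_subformulas \<psi> = subformulas \<phi>"
  shows "formula_size (Strat A \<psi>) = Suc (formula_size \<phi>)" "binary_size (Strat A \<psi>) = binary_size \<phi>"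
proof -
  have "Strat A \<psi> \<notin> path_subformulas \<psi>" using subformulas_size(2)[of "Strat A \<psi>" \<psi>] by auto
  with assms show "formula_size (Strat A \<psi>) = Suc (formula_size \<phi>)" by (simp add: formula_size_def)
  have "bin_nodes (subformulas (Strat A \<psi>)) = bin_nodes (subformulas \<phi>)" unfolding subformulas.simps assms by auto
  then show "binary_size (Strat A \<psi>) = binary_size \<phi>" by (simp add: binary_size_def)
qed

text \<open>A shared subformula would cost the second argument its extra proposition and break
  equality. So the arguments are disjoint, sizes add up, and equality passes to both.\<close>

lemma tight_Bin:
  assumes "tight (Bin f a b)"
  shows "subformulas a \<inter> subformulas b = {}" "tight a" "tight b"
    "formula_size (Bin f a b) = Suc (formula_size a + formula_size b)"
    "binary_size (Bin f a b) = Suc (binary_size a + binary_size b)"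
proof -
  let ?\<phi> = "Bin f a b" and ?X = "subformulas a"
  have nin: "?\<phi> \<notin> subformulas a" "?\<phi> \<notin> subformulas b"
    using subformulas_size(1)[of ?\<phi> a] subformulas_size(1)[of ?\<phi> b] by auto
  have "prop_nodes (subformulas ?\<phi>) = prop_nodes (subformulas a) \<union> prop_nodes (subformulas b - ?X)" by auto
  moreover have "prop_nodes (subformulas a) \<inter> prop_nodes (subformulas b - ?X) = {}" by auto
  ultimately have p: "card (prop_nodes (subformulas ?\<phi>)) = card (prop_nodes (subformulas a)) + card (prop_nodes (subformulas b - ?X))"
    using card_Un_disjoint[of "prop_nodes (subformulas a)" "prop_nodes (subformulas b - ?X)"] by simp
  have e: "bin_nodes (subformulas ?\<phi>) = insert ?\<phi> (bin_nodes (subformulas a) \<union> bin_nodes (subformulas b - ?X))" by auto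
  have "bin_nodes (subformulas a) \<inter> bin_nodes (subformulas b - ?X) = {}" by auto
  moreover have "?\<phi> \<notin> bin_nodes (subformulas a) \<union> bin_nodes (subformulas b - ?X)" using nin by auto
  ultimately have bb: "card (bin_nodes (subformulas ?\<phi>)) = Suc (card (bin_nodes (subformulas a)) + card (bin_nodes (subformulas b - ?X)))"
    unfolding e using card_Un_disjoint[of "bin_nodes (subformulas a)" "bin_nodes (subformulas b - ?X)"]
      card_insert_disjoint[of "bin_nodes (subformulas a) \<union> bin_nodes (subformulas b - ?X)" ?\<phi>]
    by (simp only:) simp
  note cb = count_new(1)[of ?X b, OF finite_subformulas(1) subformulas_trans(1)]
  note t = assms[unfolded tight_def]
  show d: "subformulas a \<inter> subformulas b = {}"
  proof (rule ccontr)
    assume "subformulas a \<inter> subformulas b \<noteq> {}"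
    then have "subformulas b \<inter> ?X \<noteq> {}" by blast
    with cb count_props[of a] p bb t show False by simp
  qed
  then have s: "subformulas b - ?X = subformulas b" by blast
  show "tight a" "tight b" using count_props[of a] count_props[of b] p bb t unfolding s tight_def by linarith+
  show "formula_size ?\<phi> = Suc (formula_size a + formula_size b)"
    using nin d by (simp add: formula_size_def card_Un_disjoint)
  show "binary_size ?\<phi> = Suc (binary_size a + binary_size b)" using bb unfolding s binary_size_def by simp
qed

text \<open>Already the propositions and the operators make up that many nodes.\<close>

lemma tight_size: "tight \<phi> \<Longrightarrow> 2 * binary_size \<phi> + 1 \<le> formula_size \<phi>"
proof -
  assume t: "tight \<phi>"
  have "card (prop_nodes (subformulas \<phi>) \<union> bin_nodes (subformulas \<phi>)) =
     card (prop_nodes (subformulas \<phi>)) + card (bin_nodes (subformulas \<phi>))"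
    by (rule card_Un_disjoint) auto
  moreover have "card (prop_nodes (subformulas \<phi>) \<union> bin_nodes (subformulas \<phi>)) \<le> card (subformulas \<phi>)"
    by (rule card_mono) auto
  ultimately show ?thesis using t by (simp add: tight_def formula_size_def binary_size_def)
qed

section \<open>Decoding instances\<close>

text \<open>The linear bound makes the output of a parser small, so that parsers can be iterated.\<close>

definition parser :: "(bool list \<Rightarrow> 'a :: enc \<times> bool list) \<Rightarrow> bool" where
  "parser D \<longleftrightarrow> PF D \<and> (\<exists>a. \<forall>s. length (snd (D s)) \<le> length s \<and> sz (fst (D s)) + a * length (snd (D s)) \<le> a * length s + a)"

lemma parser_PF: "parser D \<Longrightarrow> PFon E f \<Longrightarrow> PFon E (\<lambda>e. D (f e))"
  unfolding parser_def by (blast intro: PF_comp)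

definition parse_step :: "(bool list \<Rightarrow> 'a \<times> bool list) \<Rightarrow> 'a list \<times> bool \<times> bool list \<Rightarrow> 'a list \<times> bool \<times> bool list" where
  "parse_step D \<sigma> =
     (if fst (snd \<sigma>) then
        if snd (snd \<sigma>) \<noteq> [] \<and> hd (snd (snd \<sigma>)) then
          (fst (D (tl (snd (snd \<sigma>)))) # fst \<sigma>, True, snd (D (tl (snd (snd \<sigma>)))))
        else (fst \<sigma>, False, tl (snd (snd \<sigma>)))
      else \<sigma>)"

text \<open>The word itself, one bit longer, is the clock: on a proper code each active round
  consumes at least one bit, so the terminator is reached in time.\<close>

definition parse_list :: "(bool list \<Rightarrow> 'a \<times> bool list) \<Rightarrow> bool list \<Rightarrow> 'a list \<times> bool list" where
  "parse_list D s = (\<lambda>\<sigma>. (rev (fst \<sigma>), snd (snd \<sigma>))) (fold (\<lambda>_. parse_step D) (True # s) ([], True, s))"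

lemma parse_list_enc:
  assumes "\<And>x r. x \<in> set xs \<Longrightarrow> D (e x @ r) = (x, r)"
  shows "parse_list D (enc_list e xs @ r) = (xs, r)"
proof -
  have stop: "fold (\<lambda>_. parse_step D) zs (acc, False, r) = (acc, False, r)" for zs :: "bool list" and acc r
    by (induction zs) (auto simp: parse_step_def)
  have main: "fold (\<lambda>_. parse_step D) zs (acc, True, enc_list e xs @ r) = (rev xs @ acc, False, r)"
    if "length xs < length zs" for zs :: "bool list" and acc
    using assms that
  proof (induction xs arbitrary: acc zs)
    case Nil
    then obtain z zs' where z: "zs = z # zs'" by (cases zs) auto
    have "parse_step D (acc, True, enc_list e [] @ r) = (acc, False, r)" by (simp add: parse_step_def enc_list_def)
    with z show ?case by (simp add: stop)
  next
    case (Cons x xs)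
    then obtain z zs' where z: "zs = z # zs'" by (cases zs) auto
    have "parse_step D (acc, True, enc_list e (x # xs) @ r) = (x # acc, True, enc_list e xs @ r)"
      using Cons.prems(1)[of x "enc_list e xs @ r"] by (simp add: parse_step_def enc_list_def)
    with Cons.IH[of zs' "x # acc"] Cons.prems z show ?case by simp
  qed
  have "length xs \<le> length (enc_list e xs @ r)"
    by (induction xs) (auto simp: enc_list_def)
  then have "length xs < length (True # enc_list e xs @ r)" by simp
  from main[OF this, of "[]"] show ?thesis unfolding parse_list_def by simp
qed

lemma parser_list:
  fixes D :: "bool list \<Rightarrow> 'a :: enc \<times> bool list"
  assumes D: "parser D"
  shows "parser (parse_list D)"
proof -
  from D obtain a where a: "\<And>s. length (snd (D s)) \<le> length s"
    "\<And>s. sz (fst (D s)) + a * length (snd (D s)) \<le> a * length s + a" unfolding parser_def by blast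
  \<comment> \<open>A potential that no round increases: the marker bit consumed before an entry
    releases \<open>a + 1\<close>, of which \<open>a\<close> covers the excess in the bound for
    \<open>D\<close> and 1 the new list node.\<close>
  let ?m = "\<lambda>\<sigma> :: 'a list \<times> bool \<times> bool list. sz (fst \<sigma>) + (a + 1) * length (snd (snd \<sigma>))"
  have st: "?m (parse_step D \<sigma>) \<le> ?m \<sigma>" "length (snd (snd (parse_step D \<sigma>))) \<le> length (snd (snd \<sigma>))" for \<sigma>
  proof -
    obtain acc b s where \<sigma>: "\<sigma> = (acc, b, s)" by (metis prod_cases3)
    show "?m (parse_step D \<sigma>) \<le> ?m \<sigma>" "length (snd (snd (parse_step D \<sigma>))) \<le> length (snd (snd \<sigma>))"
    proof -
      show "?m (parse_step D \<sigma>) \<le> ?m \<sigma>"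
      proof (cases "b \<and> s \<noteq> [] \<and> hd s")
        case True
        then obtain t where s: "s = True # t" by (cases s) auto
        have "?m (parse_step D \<sigma>) = Suc (sz (fst (D t)) + sz acc) + (a * length (snd (D t)) + length (snd (D t)))"
          using True by (simp add: parse_step_def \<sigma> s)
        also have "\<dots> \<le> Suc (sz acc) + (a * length t + a + length t)" using a(1)[of t] a(2)[of t] by linarith
        finally show ?thesis by (simp add: \<sigma> s)
      next
        case False
        have "(a + 1) * length (tl s) \<le> (a + 1) * length s" by (intro mult_le_mono) simp_all
        with False show ?thesis by (auto simp: parse_step_def \<sigma>)
      qed
      show "length (snd (snd (parse_step D \<sigma>))) \<le> length (snd (snd \<sigma>))"
        using a(1)[of "tl s"] by (auto simp: parse_step_def \<sigma>)
    qed
  qed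
  have inv: "?m (fold (\<lambda>_. parse_step D) zs \<sigma>) \<le> ?m \<sigma> \<and>
      length (snd (snd (fold (\<lambda>_. parse_step D) zs \<sigma>))) \<le> length (snd (snd \<sigma>))" for zs :: "bool list" and \<sigma>
  proof (induction zs arbitrary: \<sigma>)
    case (Cons z zs)
    from Cons[of "parse_step D \<sigma>"] st[of \<sigma>] show ?case by (simp only: fold_simps) (meson order_trans)
  qed simp
  have "PFon UNIV (\<lambda>s. fold (\<lambda>_. parse_step D) (True # s) ([], True, s))"
  proof (rule PFon_fold[where b = "\<lambda>_ _. parse_step D" and Q = "[:8, a + 5:]"])
    show "PF (\<lambda>z :: bool list \<times> bool \<times> 'a list \<times> bool \<times> bool list. parse_step D (snd (snd z)))"
      unfolding parse_step_def by (intro PF_intro parser_PF[OF D])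
    fix s :: "bool list" and n
    let ?\<sigma> = "fold (\<lambda>_. parse_step D) (take n (True # s)) ([], True, s)"
    obtain acc b r where \<sigma>: "?\<sigma> = (acc, b, r)" by (metis prod_cases3)
    from inv[of "take n (True # s)" "([], True, s)", unfolded \<sigma>] have
      i: "sz acc + (a + 1) * length r \<le> 1 + (a + 1) * length s" "length r \<le> length s" by auto
    have "sz ?\<sigma> \<le> sz acc + (4 * length r + 1) + 5"
      unfolding \<sigma> using sz_bool_list[of r] sz_bool_le[of b] by simp
    also have "\<dots> \<le> (a + 1) * length s + 4 * length s + 7" using i by linarith
    also have "\<dots> \<le> poly [:8, a + 5:] (sz s)"
      using mult_le_mono[OF order_refl length_le_sz[of s], of "a + 5"] by (simp add: algebra_simps)
    finally show "sz ?\<sigma> \<le> poly [:8, a + 5:] (sz s)" .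
  qed (intro PF_intro)+
  then have "PF (parse_list D)" unfolding parse_list_def[abs_def] by (intro PF_intro)
  moreover have "length (snd (parse_list D s)) \<le> length s \<and>
      sz (fst (parse_list D s)) + (a + 1) * length (snd (parse_list D s)) \<le> (a + 1) * length s + (a + 1)" for s
    using inv[of "True # s" "([], True, s)"] by (simp only: parse_list_def) simp
  ultimately show ?thesis unfolding parser_def by blast
qed

definition parse_pair :: "(bool list \<Rightarrow> 'a \<times> bool list) \<Rightarrow> (bool list \<Rightarrow> 'b \<times> bool list) \<Rightarrow> bool list \<Rightarrow> ('a \<times> 'b) \<times> bool list" where
  "parse_pair D E s = ((fst (D s), fst (E (snd (D s)))), snd (E (snd (D s))))"

lemma parser_pair:
  assumes D: "parser D" and E: "parser E"
  shows "parser (parse_pair D E)"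
proof -
  from D obtain a where a: "\<And>s. length (snd (D s)) \<le> length s"
    "\<And>s. sz (fst (D s)) + a * length (snd (D s)) \<le> a * length s + a" unfolding parser_def by blast
  from E obtain b where b: "\<And>s. length (snd (E s)) \<le> length s"
    "\<And>s. sz (fst (E s)) + b * length (snd (E s)) \<le> b * length s + b" unfolding parser_def by blast
  have "PF (parse_pair D E)" unfolding parse_pair_def[abs_def] by (intro PF_intro parser_PF[OF D] parser_PF[OF E])
  moreover have "length (snd (parse_pair D E s)) \<le> length s \<and>
      sz (fst (parse_pair D E s)) + (a + b + 1) * length (snd (parse_pair D E s)) \<le> (a + b + 1) * length s + (a + b + 1)" for s
  proof -
    let ?r = "snd (D s)" and ?t = "snd (E (snd (D s)))"
    have "a * length ?t \<le> a * length ?r" "b * length ?r \<le> b * length s"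
      using a(1)[of s] b(1)[of ?r] by simp_all
    with a(1,2)[of s] b(1,2)[of ?r] show ?thesis unfolding parse_pair_def fst_conv snd_conv sz_simps
      by (simp only: distrib_right mult_1) linarith
  qed
  ultimately show ?thesis unfolding parser_def by blast
qed

definition parse_nat :: "bool list \<Rightarrow> nat \<times> bool list" where
  "parse_nat s = (\<lambda>z. (length (fst z), snd z)) (parse_list (Pair ()) s)"

lemma parse_nat_enc [simp]: "parse_nat (enc_nat n @ r) = (n, r)"
proof -
  have "enc_nat n = enc_list (\<lambda>_. []) (replicate n ())"
    by (induction n) (auto simp: enc_nat_def enc_list_def)
  then show ?thesis using parse_list_enc[of "replicate n ()" "Pair ()" "\<lambda>_. []" r] by (simp add: parse_nat_def)
qed

lemma parser_nat: "parser parse_nat"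
proof -
  have "PF (Pair () :: bool list \<Rightarrow> unit \<times> bool list)" by (intro PF_intro)
  then have u: "parser (Pair () :: bool list \<Rightarrow> unit \<times> bool list)" unfolding parser_def by (auto intro: exI[of _ 1])
  note l = parser_list[OF u]
  from l obtain a where a: "\<And>s. length (snd (parse_list (Pair ()) s)) \<le> length s"
    "\<And>s. sz (fst (parse_list (Pair ()) s)) + a * length (snd (parse_list (Pair ()) s)) \<le> a * length s + a"
    unfolding parser_def by blast
  have "PF parse_nat" unfolding parse_nat_def[abs_def] by (intro PF_intro parser_PF[OF l])
  moreover have "length (snd (parse_nat s)) \<le> length s \<and>
      sz (fst (parse_nat s)) + a * length (snd (parse_nat s)) \<le> a * length s + a" for s
  proof -
    obtain us r where p: "parse_list (Pair ()) s = (us, r)" by (metis prod.exhaust)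
    have "sz (length us) = sz us" by (induction us) auto
    with a[of s] show ?thesis by (simp add: parse_nat_def p)
  qed
  ultimately show ?thesis unfolding parser_def by blast
qed

definition "parse_row = parse_pair (parse_list parse_nat) (parse_pair (parse_list parse_nat) (parse_list parse_nat))"
definition "parse_cdata = parse_pair parse_nat (parse_pair (parse_list parse_nat) (parse_list parse_row))"
definition "parse_idata = parse_pair (parse_list parse_nat) (parse_pair (parse_list parse_cdata) (parse_pair (parse_list parse_cdata) parse_nat))"

lemma parser_idata: "parser parse_idata"
  unfolding parse_idata_def parse_cdata_def parse_row_def by (intro parser_pair parser_list parser_nat)

lemma parse_row_enc [simp]: "parse_row (enc_row x @ r) = (x, r)"
  unfolding parse_row_def enc_row_def append_assoc
  by (simp add: parse_pair_def parse_list_enc)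

lemma parse_cdata_enc [simp]: "parse_cdata (enc_cdata x @ r) = (x, r)"
  unfolding parse_cdata_def enc_cdata_def append_assoc
  by (simp add: parse_pair_def parse_list_enc)

lemma parse_idata_enc: "parse_idata (enc_idata x @ r) = (x, r)"
  unfolding parse_idata_def enc_idata_def append_assoc
  by (simp add: parse_pair_def parse_list_enc)

lemma enc_idata_inject: "enc_idata d = enc_idata d' \<Longrightarrow> d = d'"
  using parse_idata_enc[of d "[]"] parse_idata_enc[of d' "[]"] by simp

text \<open>Structures that differ only outside their tables share a code, so a code in the language
  might a priori stem from another, positive instance. Evaluation on the table shows that the answer
  depends on the code alone.\<close>

lemma enc_learn_mem:
  assumes "wf_learn_instance k I"
  shows "enc_learn I \<in> ATL_Learn k Ut Bl n \<longleftrightarrow> learn_positive k Ut Bl n I"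
proof
  assume "enc_learn I \<in> ATL_Learn k Ut Bl n"
  from check_complete[OF this] obtain d ns where c: "check k Ut Bl n (enc_learn I) d ns" by blast
  then have "enc_idata d = enc_idata (idata_of I)" by (simp add: check_def enc_idata_of)
  then have "d = idata_of I" by (rule enc_idata_inject)
  with c assms show "learn_positive k Ut Bl n I" using check_learn_positive by blast
next
  assume "learn_positive k Ut Bl n I"
  with assms show "enc_learn I \<in> ATL_Learn k Ut Bl n" unfolding ATL_Learn_def by blast
qed

text \<open>Appending suffices because the new propositions are chosen larger than \<open>p\<close>
  and \<open>pbar\<close>, so the label lists stay sorted.\<close>

definition lift_cdata :: "nat list \<Rightarrow> cdata \<Rightarrow> cdata" where
  "lift_cdata xs d = (fst d, fst (snd d), map (\<lambda>r. (fst r @ xs, snd r)) (snd (snd d)))"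

definition lift_idata :: "nat list \<Rightarrow> nat list \<Rightarrow> cdata list \<Rightarrow> cdata list \<Rightarrow> nat \<Rightarrow> idata \<Rightarrow> idata" where
  "lift_idata ps xs dp dn m d =
     (ps, dp @ map (lift_cdata xs) (fst (snd d)), dn @ map (lift_cdata xs) (fst (snd (snd d))), snd (snd (snd d)) + m)"

text \<open>Everything but the word \<open>s\<close>, including the added one-state structures, is a
  constant built into the program.\<close>

lemma PF_lift_idata: "PF (\<lambda>s. enc_idata (lift_idata ps xs dp dn m (fst (parse_idata s))))"
  unfolding lift_idata_def lift_cdata_def by (intro PF_intro parser_PF[OF parser_idata])

section \<open>Padding a learning instance\<close>

lemma fragment_mono:
  "in_fragment k P U Bl \<phi> \<Longrightarrow> U \<subseteq> U' \<Longrightarrow> in_fragment k P U' Bl \<phi>"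
  "in_path_fragment k P U Bl \<psi> \<Longrightarrow> U \<subseteq> U' \<Longrightarrow> in_path_fragment k P U' Bl \<psi>"
  by (induction \<phi> and \<psi>) auto

lemma msub_Prop [simp]: "msub Prop \<phi> = \<phi>" "path_msub Prop \<psi> = \<psi>"
  by (induction \<phi> and \<psi>) auto

lemma binary_size_fragment: "in_fragment k P U {} \<phi> \<Longrightarrow> binary_size \<phi> = 0"
proof -
  assume \<phi>: "in_fragment k P U {} \<phi>"
  have "\<not> is_Bin \<chi>" if "\<chi> \<in> subformulas \<phi>" for \<chi>
    using subformulas_fragment(1)[OF that \<phi>] by (cases \<chi>) auto
  then have "bin_nodes (subformulas \<phi>) = {}" by blast
  then show "binary_size \<phi> = 0" unfolding binary_size_def by (simp only: card.empty)
qed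

definition dot :: "nat \<Rightarrow> nat set \<Rightarrow> cgs" where
  "dot k v = \<lparr>cgs_agents = k, cgs_size = 1, cgs_init = {0}, cgs_label = \<lambda>_. v, cgs_acts = \<lambda>_ _. 1, cgs_trans = \<lambda>_ _. 0\<rparr>"

lemma wf_dot: "v \<subseteq> P \<Longrightarrow> wf_cgs P (dot k v)"
  by (auto simp: wf_cgs_def dot_def states_def)

lemma agents_dot [simp]: "cgs_agents (dot k v) = k"
  by (simp add: dot_def)

lemma game_dot: "game (dot k v) v k"
  by standard (simp_all add: wf_dot)

lemma satisfies_dot:
  assumes "in_fragment k P U Bl \<phi>"
  shows "satisfies (dot k v) \<phi> \<longleftrightarrow> psat v \<phi>"
proof -
  have "sat (dot k v) \<phi> 0 = psat v \<phi>"
    by (rule game.sat_const(1)[OF game_dot _ assms, where Q = UNIV]) (auto simp: dot_def states_def)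
  then show ?thesis by (simp add: satisfies_def dot_def)
qed

text \<open>
  The new propositions \<open>qs\<close> are neutral for \<open>f\<close> in the lifted structures, while the one-state
  structures force every formula that separates the padded instance to contain all of them. Such
  a formula has no room for another binary operator, and each of its binary operators has an
  argument that is constant on the lifted structures.
\<close>

locale padding =
  fixes k p pbar :: nat and Ut :: "unop set" and Bl :: "binop set" and f :: binop and c s :: bool and qs :: "nat list"
  assumes distinct_pp: "p \<noteq> pbar" and neutral: "\<And>x. binop_sem f x c = (x \<noteq> s)"
    and distinct_qs: "distinct qs" and fresh: "p \<notin> set qs" "pbar \<notin> set qs" and f: "qs = [] \<or> f \<in> Bl"
begin

definition "X = (if c then set qs else {})"
definition "D = {p, pbar} \<union> set qs"
definition "lift C = relabel C (\<lambda>q. cgs_label C q \<union> X)"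
text \<open>These are the valuations on which \<open>p\<close> and \<open>pbar\<close> agree. Their
  number is exponential in the length of \<open>qs\<close>, which is fixed for the problem.\<close>

definition "vs = map set (subseqs qs) @ map (\<lambda>xs. {p, pbar} \<union> set xs) (subseqs qs)"
text \<open>The leaf \<open>pbar\<close> would define the same target on \<open>vs\<close>, so the
  one-state structures accept a comb over either leaf.\<close>

definition "target v = psat v (theta f qs p)"
definition "pad I = \<lparr>li_props = D,
   li_pos = map (dot k) (filter target vs) @ map lift (li_pos I),
   li_neg = map (dot k) (filter (\<lambda>v. \<not> target v) vs) @ map lift (li_neg I),
   li_bound = li_bound I + 2 * length qs\<rparr>"

lemma set_vs: "set vs = Pow (set qs) \<union> (\<union>) {p, pbar} ` Pow (set qs)"
  by (simp add: vs_def subseqs_powset[symmetric] image_image)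

lemma vs_iff: "v \<in> set vs \<longleftrightarrow> v \<subseteq> D \<and> (p \<in> v \<longleftrightarrow> pbar \<in> v)"
proof
  assume "v \<in> set vs"
  then show "v \<subseteq> D \<and> (p \<in> v \<longleftrightarrow> pbar \<in> v)" using fresh by (auto simp: set_vs D_def)
next
  assume v: "v \<subseteq> D \<and> (p \<in> v \<longleftrightarrow> pbar \<in> v)"
  show "v \<in> set vs"
  proof (cases "p \<in> v")
    case True
    with v have "v = {p, pbar} \<union> (v \<inter> set qs)" by (auto simp: D_def)
    then show ?thesis unfolding set_vs by blast
  next
    case False
    with v have "v \<subseteq> set qs" by (auto simp: D_def)
    then show ?thesis unfolding set_vs by blast
  qed
qed

lemma mem_X: "x \<in> set qs \<Longrightarrow> x \<in> X \<longleftrightarrow> c"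
  by (simp add: X_def)

lemma fresh_X: "x = p \<or> x = pbar \<Longrightarrow> x \<notin> X"
  using fresh by (auto simp: X_def)

lemma X_subset: "X \<subseteq> set qs"
  by (simp add: X_def)

lemma wf_lift: "wf_cgs {p, pbar} C \<Longrightarrow> wf_cgs D (lift C)"
  using X_subset by (auto simp: wf_cgs_def lift_def D_def)

lemma lift_simps [simp]: "states (lift C) = states C" "cgs_init (lift C) = cgs_init C"
  by (simp_all add: lift_def)

lemma wf_pad:
  assumes "wf_learn_instance k I" "li_props I = {p, pbar}"
  shows "wf_learn_instance k (pad I)"
proof -
  have dots: "cgs_agents C = k \<and> wf_cgs D C" if "C \<in> dot k ` set vs" for C
    using that by (auto simp: vs_iff wf_dot)
  have lifts: "cgs_agents C = k \<and> wf_cgs D C" if "C \<in> lift ` (set (li_pos I) \<union> set (li_neg I))" for C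
    using that assms wf_lift by (auto simp: wf_learn_instance_def lift_def)
  have "set (li_pos (pad I)) \<union> set (li_neg (pad I)) \<subseteq> dot k ` set vs \<union> lift ` (set (li_pos I) \<union> set (li_neg I))"
    unfolding pad_def by auto
  moreover have "\<forall>C \<in> dot k ` set vs \<union> lift ` (set (li_pos I) \<union> set (li_neg I)). cgs_agents C = k \<and> wf_cgs D C"
    unfolding ball_Un using dots lifts by blast
  ultimately have *: "\<forall>C \<in> set (li_pos (pad I)) \<union> set (li_neg (pad I)). cgs_agents C = k \<and> wf_cgs D C" by (meson subsetD)
  have "li_props (pad I) = D" "finite D" by (simp_all add: pad_def D_def)
  with * show ?thesis unfolding wf_learn_instance_def by (simp only: simp_thms)
qed

lemma pad_separated:
  assumes \<phi>: "in_fragment k D Ut' Bl' \<phi>"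
  shows "(\<forall>C \<in> set (li_pos (pad I)). satisfies C \<phi>) \<and> (\<forall>C \<in> set (li_neg (pad I)). \<not> satisfies C \<phi>) \<longleftrightarrow>
    (\<forall>v \<in> set vs. psat v \<phi> = target v) \<and>
    (\<forall>C \<in> set (li_pos I). satisfies (lift C) \<phi>) \<and> (\<forall>C \<in> set (li_neg I). \<not> satisfies (lift C) \<phi>)"
proof -
  have "set (li_pos (pad I)) = dot k ` {v \<in> set vs. target v} \<union> lift ` set (li_pos I)"
    "set (li_neg (pad I)) = dot k ` {v \<in> set vs. \<not> target v} \<union> lift ` set (li_neg I)"
    by (auto simp: pad_def)
  then show ?thesis by (simp add: ball_Un satisfies_dot[OF \<phi>]) blast
qed

lemma lift_theta:
  assumes "cgs_label C q = {p} \<or> cgs_label C q = {pbar}" "r \<in> {p, pbar}"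
  shows "sat (lift C) (theta f qs r) q \<longleftrightarrow> (r \<in> cgs_label C q) \<noteq> (odd (length qs) \<and> s)"
proof -
  have "x \<in> cgs_label C q \<union> X \<longleftrightarrow> c" if "x \<in> set qs" for x
    using assms that fresh mem_X[OF that] by auto
  from foldl_neutral[OF neutral this] have
    "sat (lift C) (theta f qs r) q \<longleftrightarrow> (r \<in> cgs_label C q \<union> X) \<noteq> (odd (length qs) \<and> s)"
    by (simp add: theta_sat lift_def)
  with fresh_X[of r] assms(2) show ?thesis by auto
qed

lemma theta_target: "v \<in> set vs \<Longrightarrow> r \<in> {p, pbar} \<Longrightarrow> psat v (theta f qs r) = target v"
  unfolding target_def theta_psat vs_iff by auto

text \<open>Serves both directions: with combs for \<open>\<theta>\<close> it transfers a formula to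
  the padded instance, with \<open>Prop\<close> it brings one back.\<close>

lemma sat_lift:
  assumes C: "cgs_agents C = k" "wf_cgs {p, pbar} C" and \<theta>: "\<And>q r. q \<in> states C \<Longrightarrow> r \<in> {p, pbar} \<Longrightarrow> sat (lift C) (\<theta> r) q \<longleftrightarrow> r \<in> cgs_label C q"
    and \<phi>: "in_fragment k {p, pbar} U {} \<phi>"
  shows "satisfies (lift C) (msub \<theta> \<phi>) = satisfies C \<phi>"
proof -
  interpret game C "{p, pbar}" k by standard (use C in auto)
  have "sat (lift C) (msub \<theta> \<phi>) q = sat C \<phi> q" if "q \<in> states C" for q
    unfolding lift_def by (rule msub_sat(1)[OF _ \<phi> that]) (use \<theta> in \<open>simp add: lift_def\<close>)
  moreover have "cgs_init C \<subseteq> states C" using C(2) by (simp add: wf_cgs_def)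
  ultimately show ?thesis unfolding satisfies_def lift_simps by (meson subsetD)
qed

lemma pad_complete:
  assumes wf: "wf_learn_instance k I" "li_props I = {p, pbar}"
    and proper: "\<And>C. C \<in> set (li_pos I) \<union> set (li_neg I) \<Longrightarrow> proper_labelling p pbar C"
    and pos: "learn_positive k (Ut - {OpNot}) {} 0 I" and n: "length qs \<le> n"
  shows "learn_positive k Ut Bl n (pad I)"
proof -
  from pos obtain \<phi> where \<phi>: "in_fragment k {p, pbar} (Ut - {OpNot}) {} \<phi>" "formula_size \<phi> \<le> li_bound I"
    "\<forall>C \<in> set (li_pos I). satisfies C \<phi>" "\<forall>C \<in> set (li_neg I). \<not> satisfies C \<phi>"
    unfolding learn_positive_def wf(2) by blast
  \<comment> \<open>In the lifted structures the comb negates its leaf if \<open>s\<close> holds and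
    \<open>qs\<close> has odd length; exchanging \<open>p\<close> and \<open>pbar\<close> beforehand
    cancels this, as exactly one of them holds at each state.\<close>
  define t where "t = (\<lambda>r. if odd (length qs) \<and> s then if r = p then pbar else p else r)"
  have t: "r \<in> {p, pbar} \<Longrightarrow> t r \<in> {p, pbar}" for r by (auto simp: t_def)
  define \<theta> where "\<theta> = (\<lambda>r. theta f qs (t r))"
  have frag: "in_fragment k D Ut Bl (msub \<theta> \<phi>)"
  proof (rule msub_fragment(1)[OF _ _ \<phi>(1)])
    show "in_fragment k D Ut Bl (\<theta> r)" if "r \<in> {p, pbar}" for r
      unfolding \<theta>_def by (rule theta_fragment) (use t[OF that] f in \<open>auto simp: D_def\<close>)
  qed auto
  have "formula_size (msub \<theta> \<phi>) \<le> li_bound I + 2 * length qs"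
    using msub_size(1)[of "{p, pbar}" \<theta> "2 * length qs + 1", OF _ \<phi>(1)] theta_size \<phi>(2)
    by (fastforce simp: \<theta>_def formula_size_def)
  moreover have "binary_size (msub \<theta> \<phi>) \<le> length qs"
    unfolding binary_size_def by (rule msub_bin(1)[OF _ \<phi>(1)]) (simp add: \<theta>_def theta_bin)
  \<comment> \<open>A negation in \<open>\<phi>\<close> would turn the target value over; hence this
    direction starts from the fragment without \<open>OpNot\<close>.\<close>
  moreover have "psat v (msub \<theta> \<phi>) = target v" if "v \<in> set vs" for v
    by (rule msub_psat(1)[OF _ _ \<phi>(1)]) (use theta_target[OF that t] in \<open>auto simp: \<theta>_def\<close>)
  moreover have lift: "satisfies (lift C) (msub \<theta> \<phi>) = satisfies C \<phi>" if C: "C \<in> set (li_pos I) \<union> set (li_neg I)" for C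
  proof (rule sat_lift[OF _ _ _ \<phi>(1)])
    show "cgs_agents C = k" "wf_cgs {p, pbar} C" using wf C by (auto simp: wf_learn_instance_def)
    fix q r assume q: "q \<in> states C" and r: "r \<in> {p, pbar}"
    have l: "cgs_label C q = {p} \<or> cgs_label C q = {pbar}" using proper[OF C] q by (simp add: proper_labelling_def)
    have "(t r \<in> cgs_label C q) \<noteq> (odd (length qs) \<and> s) \<longleftrightarrow> r \<in> cgs_label C q"
      using l r distinct_pp by (auto simp: t_def)
    then show "sat (lift C) (\<theta> r) q \<longleftrightarrow> r \<in> cgs_label C q"
      unfolding \<theta>_def lift_theta[OF l t[OF r]] .
  qed
  ultimately show ?thesis
    unfolding learn_positive_def using pad_separated[OF frag, of I] frag \<phi>(3,4) n
    by (intro exI[of _ "msub \<theta> \<phi>"]) (simp add: pad_def)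
qed

text \<open>All new propositions are neutral here, so the target depends on \<open>b\<close>
  alone.\<close>

definition "base b = (if b then {p, pbar} else {}) \<union> X"

lemma base_vs: "base b \<in> set vs"
  using X_subset fresh by (auto simp: vs_iff base_def D_def)

lemma base_qs: "x \<in> set qs \<Longrightarrow> x \<in> base b \<longleftrightarrow> c"
  using mem_X[of x] fresh by (auto simp: base_def)

lemma target_base: "target (base b) \<longleftrightarrow> b \<noteq> (odd (length qs) \<and> s)"
  using foldl_neutral[OF neutral base_qs, of qs b "p \<in> base b"] fresh_X by (simp add: target_def theta_psat base_def)

text \<open>On one-state structures a formula is a Boolean function of its propositions, and the
  target depends on each new proposition and on the common value of \<open>p\<close> and
  \<open>pbar\<close>.\<close>

lemma separating_props:
  assumes sep: "\<And>v. v \<in> set vs \<Longrightarrow> psat v \<phi> = target v"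
  shows "set qs \<subseteq> fprops \<phi>" "p \<in> fprops \<phi> \<or> pbar \<in> fprops \<phi>"
proof -
  show "p \<in> fprops \<phi> \<or> pbar \<in> fprops \<phi>"
  proof (rule ccontr)
    assume n: "\<not> (p \<in> fprops \<phi> \<or> pbar \<in> fprops \<phi>)"
    have "psat (base True) \<phi> = psat (base False) \<phi>" by (rule psat_cong) (use n in \<open>auto simp: base_def\<close>)
    then show False by (auto simp: sep base_vs target_base)
  qed
  show "set qs \<subseteq> fprops \<phi>"
  proof
    fix q assume q: "q \<in> set qs"
    then obtain ys zs where qs: "qs = ys @ q # zs" by (meson split_list)
    obtain x where x: "binop_sem f x c \<noteq> binop_sem f x (\<not> c)" using binop_depends by blast
    \<comment> \<open>The operator depends on its second argument when the first is
      \<open>x\<close>; \<open>b\<close> is chosen so that the comb reaches \<open>q\<close> with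
      the value \<open>x\<close>. Then changing \<open>q\<close> alone changes the target.\<close>
    define b where "b = (x \<noteq> (odd (length ys) \<and> s))"
    define w where "w = (if c then base b - {q} else insert q (base b))"
    have w: "r \<in> w \<longleftrightarrow> r \<in> base b" if "r \<noteq> q" for r using that by (auto simp: w_def)
    have qw: "q \<in> w \<longleftrightarrow> \<not> c" by (simp add: w_def)
    have qb: "q \<in> base b \<longleftrightarrow> c" by (rule base_qs[OF q])
    have d: "q \<notin> set ys" "q \<notin> set zs" using distinct_qs by (auto simp: qs)
    have "q \<noteq> p" "q \<noteq> pbar" using q fresh by auto
    then have wvs: "w \<in> set vs" using base_vs[of b] q by (auto simp: vs_iff w_def D_def)
    have pb: "p \<in> base b \<longleftrightarrow> b" using fresh_X by (simp add: base_def)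
    have fold: "target u \<longleftrightarrow> binop_sem f x (q \<in> u) \<noteq> (odd (length zs) \<and> s)" if u: "\<And>r. r \<noteq> q \<Longrightarrow> r \<in> u \<longleftrightarrow> r \<in> base b" for u
    proof -
      have y: "r \<in> u \<longleftrightarrow> c" if "r \<in> set ys" for r using u[of r] base_qs[of r b] that d by (auto simp: qs)
      have z: "r \<in> u \<longleftrightarrow> c" if "r \<in> set zs" for r using u[of r] base_qs[of r b] that d by (auto simp: qs)
      have "(p \<in> u) = b" using u[of p] pb \<open>q \<noteq> p\<close> by simp
      then have "foldl (\<lambda>y r. binop_sem f y (r \<in> u)) (p \<in> u) ys = x"
        using foldl_neutral[of f c s ys u, OF neutral y] by (auto simp: b_def)
      moreover have "target u = foldl (\<lambda>y r. binop_sem f y (r \<in> u)) (p \<in> u) (ys @ q # zs)"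
        unfolding target_def theta_psat by (simp only: qs)
      ultimately show ?thesis using foldl_neutral[of f c s zs u, OF neutral z] by simp
    qed
    have "target w \<longleftrightarrow> binop_sem f x (\<not> c) \<noteq> (odd (length zs) \<and> s)" using fold[of w] w qw by simp
    moreover have "target (base b) \<longleftrightarrow> binop_sem f x c \<noteq> (odd (length zs) \<and> s)" using fold[of "base b"] qb by simp
    ultimately have "target w \<noteq> target (base b)" using x by auto
    moreover have "psat w \<phi> = psat (base b) \<phi>" if "q \<notin> fprops \<phi>"
      by (rule psat_cong) (metis w that)
    ultimately show "q \<in> fprops \<phi>" using sep[OF wvs] sep[OF base_vs] by blast
  qed
qed

section \<open>Removing binary operators and negations\<close>

definition neutral_on :: "cgs \<Rightarrow> bool" where
  "neutral_on E \<longleftrightarrow> (\<forall>q \<in> states E. \<forall>x \<in> set qs. x \<in> cgs_label E q \<longleftrightarrow> c)"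

definition proper_on :: "cgs \<Rightarrow> bool" where
  "proper_on E \<longleftrightarrow> (\<forall>q \<in> states E. p \<in> cgs_label E q \<longleftrightarrow> pbar \<notin> cgs_label E q)"

text \<open>One value for all structures with neutral new propositions. These include the one-state
  structures labelled \<open>base b\<close>, where a separating formula takes both values.\<close>

definition settled :: "sform \<Rightarrow> bool \<Rightarrow> bool" where
  "settled \<phi> d \<longleftrightarrow> (\<forall>E P. game E P k \<longrightarrow> neutral_on E \<longrightarrow> (\<forall>q \<in> states E. sat E \<phi> q = d))"

lemma settledI: "(\<And>E P q. game E P k \<Longrightarrow> neutral_on E \<Longrightarrow> q \<in> states E \<Longrightarrow> sat E \<phi> q = d) \<Longrightarrow> settled \<phi> d"
  unfolding settled_def by blast

lemma settledD: "settled \<phi> d \<Longrightarrow> game E P k \<Longrightarrow> neutral_on E \<Longrightarrow> q \<in> states E \<Longrightarrow> sat E \<phi> q = d"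
  unfolding settled_def by blast

text \<open>The parameter \<open>d\<close> carries both polarities through the induction, so that a
  negation only flips it. The size condition gives back two nodes for each binary operator, exactly
  the allowance added by \<open>pad\<close>.\<close>

definition similar :: "sform \<Rightarrow> bool \<Rightarrow> sform \<Rightarrow> bool" where
  "similar \<phi> d \<psi> \<longleftrightarrow> in_fragment k {p, pbar} (Ut \<union> {OpF, OpG} - {OpNot}) {} \<psi> \<and>
     formula_size \<psi> + 2 * binary_size \<phi> \<le> formula_size \<phi> \<and>
     (\<forall>E P. turn_game E P k \<longrightarrow> neutral_on E \<longrightarrow> proper_on E \<longrightarrow> (\<forall>q \<in> states E. sat E \<psi> q = (sat E \<phi> q = d)))"

abbreviation "reducible \<phi> \<equiv> (\<exists>d. settled \<phi> d) \<or> (\<forall>d. \<exists>\<psi>. similar \<phi> d \<psi>)"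

text \<open>A truth function of one argument is constant, the identity or the negation; the first
  case settles \<open>\<phi>\<close>, in the other two a formula similar to \<open>a\<close> in a
  suitable polarity also serves \<open>\<phi>\<close>.\<close>

lemma reducible_unary:
  assumes sem: "\<And>E P q. game E P k \<Longrightarrow> neutral_on E \<Longrightarrow> q \<in> states E \<Longrightarrow> sat E \<phi> q = h (sat E a q)"
    and size: "formula_size a + 2 * binary_size \<phi> \<le> formula_size \<phi> + 2 * binary_size a"
    and a: "reducible a"
  shows "reducible \<phi>"
proof (cases "(\<exists>d. settled a d) \<or> h True = h False")
  case True
  then show ?thesis
  proof
    assume "\<exists>d. settled a d"
    then obtain d where "settled a d" ..
    then have "settled \<phi> (h d)" using sem settledD by (intro settledI) simp
    then show ?thesis by blast
  next
    assume "h True = h False"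
    then have "h x = h True" for x by (cases x) auto
    with sem have "settled \<phi> (h True)" by (intro settledI) simp
    then show ?thesis by blast
  qed
next
  case False
  with a have sim: "\<exists>\<psi>. similar a d \<psi>" for d by blast
  from False have h: "h x = d \<longleftrightarrow> x = (d = h True)" for x d by (cases x; cases d) auto
  have "\<exists>\<psi>. similar \<phi> d \<psi>" for d
  proof -
    obtain \<psi> where \<psi>: "similar a (d = h True) \<psi>" using sim by blast
    have "similar \<phi> d \<psi>" unfolding similar_def
    proof (intro conjI allI impI ballI)
      show "in_fragment k {p, pbar} (Ut \<union> {OpF, OpG} - {OpNot}) {} \<psi>" using \<psi> by (simp add: similar_def)
      show "formula_size \<psi> + 2 * binary_size \<phi> \<le> formula_size \<phi>" using \<psi> size by (simp add: similar_def)
      fix E P q assume E: "turn_game E P k" "neutral_on E" "proper_on E" and q: "q \<in> states E"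
      have "game E P k" using E(1) by (simp add: turn_game_def)
      from sem[OF this E(2) q] h have "(sat E \<phi> q = d) = (sat E a q = (d = h True))" by simp
      moreover have "sat E \<psi> q = (sat E a q = (d = h True))" using \<psi> E q unfolding similar_def by blast
      ultimately show "sat E \<psi> q = (sat E \<phi> q = d)" by simp
    qed
    then show ?thesis by blast
  qed
  then show ?thesis by blast
qed

lemma settled_qs:
  assumes "in_fragment k P U B \<phi>" "fprops \<phi> \<subseteq> set qs"
  shows "settled \<phi> (psat X \<phi>)"
  unfolding settled_def
proof (intro allI impI ballI)
  fix E P' q assume "game E P' k" and n: "neutral_on E" and q: "q \<in> states E"
  interpret game E P' k by fact
  show "sat E \<phi> q = psat X \<phi>"
    by (rule sat_const(1)[OF _ assms q]) (use n mem_X in \<open>auto simp: neutral_on_def\<close>)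
qed

text \<open>For the negative polarity, determinacy exchanges the coalition with its complement and
  \<open>Finally\<close> with \<open>Globally\<close>. The target fragment contains both of these;
  \<open>Next\<close> is its own dual and must come from \<open>Ut\<close>.\<close>

lemma reducible_Strat:
  assumes A: "A \<subseteq> {1..k}" and a: "reducible a" and sub: "path_subformulas (T a) = subformulas a"
    and T: "T \<in> {Next, Finally, Globally}" and op: "T = Next \<Longrightarrow> OpX \<in> Ut"
  shows "reducible (Strat A (T a))"
  using a
proof
  assume "\<exists>d. settled a d"
  then obtain d where d: "settled a d" ..
  have "settled (Strat A (T a)) d" unfolding settled_def
  proof (intro allI impI ballI)
    fix E P q assume E: "game E P k" "neutral_on E" and q: "q \<in> states E"
    interpret game E P k by fact
    have "sat E a q = d" if "q \<in> states E" for q using d E that unfolding settled_def by blast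
    then show "sat E (Strat A (T a)) q = d"
      by (intro const_Strat[OF A q]) (use T in auto)
  qed
  then show ?thesis by blast
next
  assume sim: "\<forall>d. \<exists>\<psi>. similar a d \<psi>"
  note sz = size_Strat[OF sub]
  obtain \<psi> where \<psi>: "similar a True \<psi>" using sim by blast
  obtain \<psi>' where \<psi>': "similar a False \<psi>'" using sim by blast
  define T' where "T' = (if T = Finally then Globally else if T = Globally then Finally else T)"
  have ne: "Finally \<noteq> Globally" "Next \<noteq> Finally" "Next \<noteq> Globally" by (metis pform.distinct)+
  have sz\<psi>: "formula_size (Strat B (S \<chi>)) = Suc (formula_size \<chi>)" if "S \<in> {Next, Finally, Globally}" for B S \<chi>
    by (rule size_Strat(1)) (use that in auto)
  have "similar (Strat A (T a)) True (Strat A (T \<psi>))" unfolding similar_def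
  proof (intro conjI allI impI ballI)
    show "in_fragment k {p, pbar} (Ut \<union> {OpF, OpG} - {OpNot}) {} (Strat A (T \<psi>))"
      using \<psi> A T op by (auto simp: similar_def)
    show "formula_size (Strat A (T \<psi>)) + 2 * binary_size (Strat A (T a)) \<le> formula_size (Strat A (T a))"
      using \<psi> sz sz\<psi>[OF T] by (simp add: similar_def)
    fix E P q assume E: "turn_game E P k" "neutral_on E" "proper_on E" and q: "q \<in> states E"
    interpret turn_game E P k by fact
    have mem: "q \<in> sat_set \<chi> \<longleftrightarrow> sat E \<chi> q" if "q \<in> states E" for q \<chi>
      using that unfolding sat_set_def by (simp only: mem_Collect_eq simp_thms)
    have "sat E \<psi> q = sat E a q" if "q \<in> states E" for q using \<psi> E that unfolding similar_def by blast
    then have e: "sat_set \<psi> = sat_set a" by (auto simp: sat_set_def)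
    have "sat_set (Strat A (T \<psi>)) = sat_set (Strat A (T a))"
      using T by (auto simp: sat_set_Next[OF A] sat_set_Finally[OF A] sat_set_Globally[OF A] e)
    with mem[OF q] show "sat E (Strat A (T \<psi>)) q = (sat E (Strat A (T a)) q = True)" by blast
  qed
  moreover have "similar (Strat A (T a)) False (Strat ({1..k} - A) (T' \<psi>'))" unfolding similar_def
  proof (intro conjI allI impI ballI)
    have T': "T' \<in> {Next, Finally, Globally}" using T by (auto simp: T'_def)
    show "in_fragment k {p, pbar} (Ut \<union> {OpF, OpG} - {OpNot}) {} (Strat ({1..k} - A) (T' \<psi>'))"
      using \<psi>' T op ne by (auto simp: similar_def T'_def)
    show "formula_size (Strat ({1..k} - A) (T' \<psi>')) + 2 * binary_size (Strat A (T a)) \<le> formula_size (Strat A (T a))"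
      using \<psi>' sz sz\<psi>[OF T'] by (simp add: similar_def)
    fix E P q assume E: "turn_game E P k" "neutral_on E" "proper_on E" and q: "q \<in> states E"
    interpret turn_game E P k by fact
    have mem: "q \<in> sat_set \<chi> \<longleftrightarrow> sat E \<chi> q" if "q \<in> states E" for q \<chi>
      using that unfolding sat_set_def by (simp only: mem_Collect_eq simp_thms)
    have "sat E \<psi>' q = (\<not> sat E a q)" if "q \<in> states E" for q using \<psi>' E that unfolding similar_def by blast
    then have e: "sat_set \<psi>' = states E - sat_set a" by (auto simp: sat_set_def)
    have "sat_set (Strat ({1..k} - A) (T' \<psi>')) = states E - sat_set (Strat A (T a))"
      using T dual_Next[OF A e] dual_Finally[OF A e] dual_Globally[OF A e] ne by (auto simp: T'_def)
    with mem[OF q] q show "sat E (Strat ({1..k} - A) (T' \<psi>')) q = (sat E (Strat A (T a)) q = False)" by blast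
  qed
  ultimately have "\<exists>\<psi>. similar (Strat A (T a)) d \<psi>" for d by (cases d) auto
  then show ?thesis by blast
qed

lemma reducible_tight:
  assumes r: "r \<in> {p, pbar}"
  shows "tight \<phi> \<Longrightarrow> fprops \<phi> \<subseteq> insert r (set qs) \<Longrightarrow> in_fragment k P Ut B \<phi> \<Longrightarrow> reducible \<phi>"
proof (induction \<phi> rule: measure_induct_rule[where f = size])
  case (less \<phi>)
  show ?case
  proof (cases \<phi>)
    case (Prop x)
    show ?thesis
    proof (cases "x = r")
      case True
      have "\<exists>\<psi>. similar \<phi> d \<psi>" for d
      proof -
        have sz: "formula_size (Prop y) = 1" "binary_size (Prop y) = 0" for y
        proof -
          have "bin_nodes (subformulas (Prop y)) = {}" by auto
          then show "binary_size (Prop y) = 0" unfolding binary_size_def by (simp only: card.empty)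
        qed (simp add: formula_size_def)
        have "similar \<phi> d (Prop (if d then r else if r = p then pbar else p))"
          unfolding similar_def Prop True using r distinct_pp by (auto simp: sz proper_on_def)
        then show ?thesis by blast
      qed
      then show ?thesis by blast
    next
      case False
      with less.prems have "settled \<phi> (psat X \<phi>)" by (intro settled_qs) (auto simp: Prop)
      then show ?thesis by blast
    qed
  next
    case (Neg a)
    have "reducible a"
      by (rule less.IH) (use less.prems tight_Neg in \<open>auto simp: Neg\<close>)
    then show ?thesis
      by (intro reducible_unary[of \<phi> Not a]) (simp_all add: Neg size_Neg)
  next
    case (Bin g a b)
    note t = tight_Bin[OF less.prems(1)[unfolded Bin]]
    have ra: "reducible a" by (rule less.IH) (use less.prems t in \<open>auto simp: Bin\<close>)
    have rb: "reducible b" by (rule less.IH) (use less.prems t in \<open>auto simp: Bin\<close>)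
    \<comment> \<open>Tightness makes the arguments disjoint, so the leaf \<open>r\<close> occurs in
      at most one; the other contains new propositions only and is constant.\<close>
    have "r \<notin> fprops a \<or> r \<notin> fprops b"
    proof (rule ccontr)
      assume "\<not> (r \<notin> fprops a \<or> r \<notin> fprops b)"
      then have "Prop r \<in> prop_nodes (subformulas a)" "Prop r \<in> prop_nodes (subformulas b)"
        unfolding prop_nodes_fprops by auto
      with t(1) show False by blast
    qed
    then show ?thesis
    proof
      assume "r \<notin> fprops b"
      with less.prems have k: "settled b (psat X b)" by (intro settled_qs) (auto simp: Bin)
      show ?thesis
      proof (rule reducible_unary[of \<phi> "\<lambda>x. binop_sem g x (psat X b)" a])
        show "sat E \<phi> q = binop_sem g (sat E a q) (psat X b)"
          if "game E P k" "neutral_on E" "q \<in> states E" for E P q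
        proof -
          have "sat E b q = psat X b" using k that unfolding settled_def by blast
          then show ?thesis by (simp add: Bin)
        qed
        \<comment> \<open>Dropping \<open>b\<close> removes at least
          \<open>2 * binary_size b + 1\<close> nodes and the operator one more, which repays all the
          operators lost.\<close>
        show "formula_size a + 2 * binary_size \<phi> \<le> formula_size \<phi> + 2 * binary_size a"
          using t(4,5) tight_size[OF t(3)] by (simp add: Bin)
      qed (rule ra)
    next
      assume "r \<notin> fprops a"
      with less.prems have k: "settled a (psat X a)" by (intro settled_qs) (auto simp: Bin)
      show ?thesis
      proof (rule reducible_unary[of \<phi> "binop_sem g (psat X a)" b])
        show "sat E \<phi> q = binop_sem g (psat X a) (sat E b q)"
          if "game E P k" "neutral_on E" "q \<in> states E" for E P q
        proof -
          have "sat E a q = psat X a" using k that unfolding settled_def by blast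
          then show ?thesis by (simp add: Bin)
        qed
        show "formula_size b + 2 * binary_size \<phi> \<le> formula_size \<phi> + 2 * binary_size b"
          using t(4,5) tight_size[OF t(2)] by (simp add: Bin)
      qed (rule rb)
    qed
  next
    case (Strat A \<psi>)
    have A: "A \<subseteq> {1..k}" using less.prems by (simp add: Strat)
    have "reducible (Strat A (T a))" if e: "\<psi> = T a" and T: "T \<in> {Next, Finally, Globally}" for T a
    proof (rule reducible_Strat[OF A _ _ T])
      show sub: "path_subformulas (T a) = subformulas a" using T by auto
      show "reducible a"
      proof (rule less.IH)
        show "size a < size \<phi>" using T by (auto simp: Strat e)
        show "tight a" using tight_Strat[OF _ sub] less.prems(1) by (simp add: Strat e)
        show "fprops a \<subseteq> insert r (set qs)" "in_fragment k P Ut B a" using less.prems T by (auto simp: Strat e)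
      qed
      show "OpX \<in> Ut" if "T = Next" using less.prems that by (simp add: Strat e)
    qed
    then show ?thesis unfolding Strat by (cases \<psi>) blast+
  qed
qed

lemma pad_sound:
  assumes wf: "wf_learn_instance k I" "li_props I = {p, pbar}"
    and proper: "\<And>C. C \<in> set (li_pos I) \<union> set (li_neg I) \<Longrightarrow> turn_based C \<and> proper_labelling p pbar C"
    and \<phi>: "in_fragment k D Ut Bl \<phi>" "formula_size \<phi> \<le> li_bound I + 2 * length qs" "binary_size \<phi> \<le> length qs"
    and pos: "\<forall>C \<in> set (li_pos (pad I)). satisfies C \<phi>" and neg: "\<forall>C \<in> set (li_neg (pad I)). \<not> satisfies C \<phi>"
  shows "learn_positive k (Ut \<union> {OpF, OpG}) {} 0 I"
proof -
  from pad_separated[OF \<phi>(1), of I] pos neg have sep: "\<And>v. v \<in> set vs \<Longrightarrow> psat v \<phi> = target v"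
    and lift_pos: "\<And>C. C \<in> set (li_pos I) \<Longrightarrow> satisfies (lift C) \<phi>"
    and lift_neg: "\<And>C. C \<in> set (li_neg I) \<Longrightarrow> \<not> satisfies (lift C) \<phi>" by blast+
  obtain r where r: "r \<in> {p, pbar}" "r \<in> fprops \<phi>" using separating_props(2)[of \<phi>, OF sep] by blast
  have sub: "insert r (set qs) \<subseteq> fprops \<phi>" using separating_props(1)[of \<phi>, OF sep] r(2) by blast
  have card: "card (insert r (set qs)) = Suc (length qs)"
    using r(1) fresh distinct_qs by (auto simp: card_insert_if distinct_card)
  have fin: "finite (fprops \<phi>)"
    using fprops_fragment(1)[OF \<phi>(1)] by (rule finite_subset) (simp add: D_def)
  \<comment> \<open>At least \<open>length qs + 1\<close> propositions are forced, and at most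
    \<open>length qs\<close> operators can join them; equality throughout makes
    \<open>\<phi>\<close> tight and leaves \<open>r\<close> as its only old proposition.\<close>
  have le: "card (fprops \<phi>) \<le> binary_size \<phi> + 1"
    using count_props[of \<phi>] by (simp only: card_prop_nodes binary_size_def)
  have ge: "Suc (length qs) \<le> card (fprops \<phi>)" using card_mono[OF fin sub] card by simp
  have bs: "binary_size \<phi> = length qs" using le ge \<phi>(3) by simp
  have tight: "tight \<phi>" unfolding tight_def card_prop_nodes using le ge bs by (simp add: binary_size_def)
  have fp: "fprops \<phi> = insert r (set qs)" using card_seteq[OF fin sub] le bs card by simp
  \<comment> \<open>A settled formula has one value on the one-state structures for
    \<open>base True\<close> and \<open>base False\<close>, whose targets differ.\<close>
  have nconst: "\<not> settled \<phi> d" for d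
  proof
    assume d: "settled \<phi> d"
    have "psat (base b) \<phi> = d" for b
    proof -
      have "neutral_on (dot k (base b))" using base_qs by (auto simp: neutral_on_def dot_def)
      then have "sat (dot k (base b)) \<phi> 0 = d"
        using d[unfolded settled_def, rule_format, OF game_dot, of "base b" 0] by (simp add: states_def dot_def)
      with satisfies_dot[OF \<phi>(1), of "base b"] show ?thesis by (simp add: satisfies_def dot_def)
    qed
    from this[of True] this[of False] show False by (auto simp: sep base_vs target_base)
  qed
  have "reducible \<phi>" by (rule reducible_tight[OF r(1) tight _ \<phi>(1)]) (simp add: fp)
  with nconst obtain \<psi> where \<psi>: "similar \<phi> True \<psi>" by blast
  then have frag: "in_fragment k {p, pbar} (Ut \<union> {OpF, OpG} - {OpNot}) {} \<psi>" by (simp add: similar_def)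
  have sat: "satisfies C \<psi> = satisfies (lift C) \<phi>" if C: "C \<in> set (li_pos I) \<union> set (li_neg I)" for C
  proof -
    have C': "cgs_agents C = k" "wf_cgs {p, pbar} C" using wf C by (auto simp: wf_learn_instance_def)
    \<comment> \<open>The identity substitution: \<open>\<psi>\<close> mentions no new proposition,
      so it does not see the lifting.\<close>
    have "satisfies (lift C) (msub Prop \<psi>) = satisfies C \<psi>"
      by (rule sat_lift[OF C' _ frag]) (use fresh_X in \<open>auto simp: lift_def\<close>)
    moreover have "sat (lift C) \<psi> q = sat (lift C) \<phi> q" if q: "q \<in> states C" for q
    proof -
      have l: "cgs_label C q = {p} \<or> cgs_label C q = {pbar}" if "q \<in> states C" for q
        using proper[OF C] that by (simp add: proper_labelling_def)
      have "turn_game (lift C) D k"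
        by standard (use wf_lift[OF C'(2)] C'(1) proper[OF C] in \<open>simp_all add: lift_def\<close>)
      moreover have "neutral_on (lift C)" unfolding neutral_on_def
      proof (intro ballI)
        fix q x assume q: "q \<in> states (lift C)" and x: "x \<in> set qs"
        from l[of q] q x fresh have "x \<notin> cgs_label C q" by auto
        with mem_X[OF x] show "x \<in> cgs_label (lift C) q \<longleftrightarrow> c" by (simp add: lift_def)
      qed
      moreover have "proper_on (lift C)" unfolding proper_on_def
      proof
        fix q assume "q \<in> states (lift C)"
        with l[of q] have "cgs_label C q = {p} \<or> cgs_label C q = {pbar}" by simp
        with fresh_X[of p] fresh_X[of pbar] distinct_pp show "p \<in> cgs_label (lift C) q \<longleftrightarrow> pbar \<notin> cgs_label (lift C) q"
          by (auto simp: lift_def)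
      qed
      moreover have "q \<in> states (lift C)" using q by simp
      ultimately have "sat (lift C) \<psi> q = (sat (lift C) \<phi> q = True)" using \<psi> unfolding similar_def by blast
      then show ?thesis by simp
    qed
    ultimately show ?thesis using C'(2) by (simp add: satisfies_def wf_cgs_def) blast
  qed
  have "in_fragment k {p, pbar} (Ut \<union> {OpF, OpG}) {} \<psi>" by (rule fragment_mono(1)[OF frag]) auto
  moreover have "formula_size \<psi> \<le> li_bound I" using \<psi> \<phi>(2) bs by (simp add: similar_def)
  moreover have "binary_size \<psi> \<le> 0" using binary_size_fragment[OF frag] by simp
  ultimately show ?thesis unfolding learn_positive_def wf(2)
    using sat lift_pos lift_neg by (intro exI[of _ \<psi>]) blast
qed

end

section \<open>Padding as an operation on codes\<close>

lemma sorted_list_insert_least: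
  "finite A \<Longrightarrow> (\<And>x. x \<in> A \<Longrightarrow> a < x) \<Longrightarrow> sorted_list_of_set (insert a A) = a # sorted_list_of_set A" for a :: nat
  by (subst sorted_list_of_set_insert) (auto intro!: insort_is_Cons less_imp_le)

lemma (in padding) cdata_of_lift:
  assumes C: "proper_labelling p pbar C" and above: "\<And>x. x \<in> set qs \<Longrightarrow> p < x \<and> pbar < x"
  shows "cdata_of (lift C) = lift_cdata (sorted_list_of_set X) (cdata_of C)"
proof -
  have "finite X" by (simp add: X_def)
  moreover have "a < x" if "x \<in> X" "a = p \<or> a = pbar" for a x using that X_subset above by auto
  ultimately have *: "sorted_list_of_set (insert a X) = [a] @ sorted_list_of_set X" if "a = p \<or> a = pbar" for a
    using that sorted_list_insert_least[of X a] by simp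
  have "sorted_list_of_set (cgs_label C q \<union> X) = sorted_list_of_set (cgs_label C q) @ sorted_list_of_set X"
    if "q < cgs_size C" for q
  proof -
    have "cgs_label C q = {p} \<or> cgs_label C q = {pbar}"
      using C that by (auto simp: proper_labelling_def states_def)
    then obtain a where a: "cgs_label C q = {a}" "a = p \<or> a = pbar" by blast
    have "sorted_list_of_set {a} = [a]" by simp
    with *[OF a(2)] show ?thesis unfolding a(1) insert_is_Un[of a X] by (simp only:)
  qed
  then have "row_of (lift C) q = (fst (row_of C q) @ sorted_list_of_set X, snd (row_of C q))"
    if "q < cgs_size C" for q using that by (simp add: row_of_def lift_def)
  then have "map (row_of (lift C)) [0..<cgs_size C] =
      map (\<lambda>r. (fst r @ sorted_list_of_set X, snd r)) (map (row_of C) [0..<cgs_size C])" by simp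
  moreover have "cgs_size (lift C) = cgs_size C" by (simp add: lift_def)
  ultimately show ?thesis unfolding cdata_of_def lift_cdata_def fst_conv snd_conv lift_simps by (simp only:)
qed

lemma (in padding) pad_props: "li_props (pad I) = D" "li_bound (pad I) = li_bound I + 2 * length qs"
  by (simp_all add: pad_def)

lemma (in padding) idata_of_pad:
  assumes "\<And>C. C \<in> set (li_pos I) \<union> set (li_neg I) \<Longrightarrow> proper_labelling p pbar C"
    and "\<And>x. x \<in> set qs \<Longrightarrow> p < x \<and> pbar < x"
  shows "idata_of (pad I) = lift_idata (sorted_list_of_set D) (sorted_list_of_set X)
    (map cdata_of (map (dot k) (filter target vs))) (map cdata_of (map (dot k) (filter (\<lambda>v. \<not> target v) vs)))
    (2 * length qs) (idata_of I)"
proof -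
  have "map cdata_of (map lift Cs) = map (lift_cdata (sorted_list_of_set X)) (map cdata_of Cs)"
    if "set Cs \<subseteq> set (li_pos I) \<union> set (li_neg I)" for Cs
  proof -
    have "cdata_of (lift C) = lift_cdata (sorted_list_of_set X) (cdata_of C)" if "C \<in> set Cs" for C
      by (rule cdata_of_lift) (use assms that \<open>set Cs \<subseteq> _\<close> in blast)+
    then show ?thesis by simp
  qed
  from this[of "li_pos I"] this[of "li_neg I"] show ?thesis
    by (simp add: idata_of_def pad_def lift_idata_def)
qed

theorem theorem4:
  fixes k :: nat
    and Ut :: "unop set"
    and p pbar :: nat
    and f :: "hitting_set_instance \<Rightarrow> learn_instance"
  assumes "1 \<le> k"
    and "p \<noteq> pbar"
    and "logspace_computable_on {h. hs_instance h} enc_hs enc_learn f"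
    and "\<And>h. hs_instance h \<Longrightarrow> wf_learn_instance k (f h)"
    and "\<And>h. hs_instance h \<Longrightarrow> li_props (f h) = {p, pbar}"
    and "\<And>h C. hs_instance h \<Longrightarrow> C \<in> set (li_pos (f h)) \<union> set (li_neg (f h)) \<Longrightarrow>
           turn_based C \<and> proper_labelling p pbar C"
    and "\<And>h. hs_instance h \<Longrightarrow>
           hs_positive h \<longleftrightarrow> learn_positive k (Ut - {OpNot}) {} 0 (f h)"
    and "\<And>h. hs_instance h \<Longrightarrow>
           hs_positive h \<longleftrightarrow> learn_positive k (Ut \<union> {OpF, OpG}) {} 0 (f h)"
  shows "\<forall>(Bl :: binop set) (n :: nat). NP_complete (ATL_Learn k Ut Bl n)"
proof (intro allI)
  fix Bl :: "binop set" and n :: nat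
  define N where "N = (if Bl = {} then 0 else n)"
  \<comment> \<open>Starting above both \<open>p\<close> and \<open>pbar\<close> makes the new
    propositions fresh and keeps the label lists sorted.\<close>
  define qs where "qs = map (\<lambda>i. p + pbar + 1 + i) [0..<N]"
  \<comment> \<open>If \<open>Bl\<close> is empty, any \<open>g\<close> will do, since
    \<open>qs\<close> is then empty as well.\<close>
  obtain g where g: "Bl = {} \<or> g \<in> Bl" by blast
  obtain c s where cs: "\<And>x. binop_sem g x c = (x \<noteq> s)" using binop_neutral by blast
  have qs: "p < x \<and> pbar < x" if "x \<in> set qs" for x using that by (auto simp: qs_def)
  have len: "length qs = N" by (simp add: qs_def)
  interpret padding k p pbar Ut Bl g c s qs
  proof
    show "distinct qs" by (simp add: qs_def distinct_map inj_on_def)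
    show "p \<notin> set qs" "pbar \<notin> set qs" using qs[of p] qs[of pbar] by auto
    show "qs = [] \<or> g \<in> Bl" using g by (auto simp: qs_def N_def)
  qed (rule assms(2) cs)+
  have pad: "hs_positive h \<longleftrightarrow> learn_positive k Ut Bl n (pad (f h))" if h: "hs_instance h" for h
  proof
    assume "hs_positive h"
    then have "learn_positive k (Ut - {OpNot}) {} 0 (f h)" using assms(7)[OF h] by simp
    then show "learn_positive k Ut Bl n (pad (f h))"
      by (intro pad_complete[OF assms(4,5)[OF h] conjunct2[OF assms(6)[OF h]]]) (simp_all add: len N_def)
  next
    assume "learn_positive k Ut Bl n (pad (f h))"
    then obtain \<phi> where \<phi>: "in_fragment k D Ut Bl \<phi>" "formula_size \<phi> \<le> li_bound (f h) + 2 * length qs"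
      "binary_size \<phi> \<le> n" "\<forall>C \<in> set (li_pos (pad (f h))). satisfies C \<phi>" "\<forall>C \<in> set (li_neg (pad (f h))). \<not> satisfies C \<phi>"
      unfolding learn_positive_def pad_props by metis
    \<comment> \<open>If \<open>Bl\<close> is empty, the fragment itself excludes binary operators,
      in agreement with \<open>N = 0\<close>.\<close>
    have "binary_size \<phi> \<le> length qs"
      using \<phi>(1,3) binary_size_fragment[of k D Ut \<phi>] by (auto simp: len N_def)
    from pad_sound[OF assms(4,5)[OF h] assms(6)[OF h] \<phi>(1,2) this \<phi>(4,5)]
    have "learn_positive k (Ut \<union> {OpF, OpG}) {} 0 (f h)" by simp
    with assms(8)[OF h] show "hs_positive h" by simp
  qed
  have "polytime_reducible L (ATL_Learn k Ut Bl n)" if NP: "L \<in> class_NP" for L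
  proof -
    obtain R where R: "PF R" "\<And>x. \<exists>h. hs_instance h \<and> R x = enc_hs h \<and> (x \<in> L \<longleftrightarrow> hs_positive h)"
      using hitting_set_hard[OF NP] by blast
    obtain G where G: "PF G" "\<And>h. hs_instance h \<Longrightarrow> G (enc_hs h) = enc_learn (f h)"
      using logspace_PF[OF assms(3)] by blast
    define T where "T = (\<lambda>s. enc_idata (lift_idata (sorted_list_of_set D) (sorted_list_of_set X)
      (map cdata_of (map (dot k) (filter target vs))) (map cdata_of (map (dot k) (filter (\<lambda>v. \<not> target v) vs)))
      (2 * length qs) (fst (parse_idata s))))"
    have T: "T (enc_learn (f h)) = enc_learn (pad (f h))" if h: "hs_instance h" for h
    proof -
      have "fst (parse_idata (enc_learn (f h))) = idata_of (f h)"
        using parse_idata_enc[of "idata_of (f h)" "[]"] by (simp add: enc_idata_of)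
      moreover have "idata_of (pad (f h)) = lift_idata (sorted_list_of_set D) (sorted_list_of_set X)
        (map cdata_of (map (dot k) (filter target vs))) (map cdata_of (map (dot k) (filter (\<lambda>v. \<not> target v) vs)))
        (2 * length qs) (idata_of (f h))"
        by (rule idata_of_pad[OF conjunct2[OF assms(6)[OF h]] qs])
      ultimately have "T (enc_learn (f h)) = enc_idata (idata_of (pad (f h)))" unfolding T_def by (simp only:)
      then show ?thesis unfolding enc_idata_of .
    qed
    have "PF T" unfolding T_def by (rule PF_lift_idata)
    then have "PF (\<lambda>x. T (G (R x)))" by (rule PF_comp[OF _ PF_comp[OF G(1) R(1)]])
    then have "polytime_computable (\<lambda>x. T (G (R x)))" by (rule PF_polytime_computable)
    moreover have "x \<in> L \<longleftrightarrow> T (G (R x)) \<in> ATL_Learn k Ut Bl n" for x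
    proof -
      obtain h where h: "hs_instance h" "R x = enc_hs h" "x \<in> L \<longleftrightarrow> hs_positive h" using R(2) by blast
      have "wf_learn_instance k (pad (f h))" using wf_pad assms(4,5)[OF h(1)] by blast
      from enc_learn_mem[OF this] show ?thesis using h pad[OF h(1)] G(2)[OF h(1)] T[OF h(1)] by simp
    qed
    ultimately show ?thesis unfolding polytime_reducible_def by blast
  qed
  then show "NP_complete (ATL_Learn k Ut Bl n)"
    unfolding NP_complete_def NP_hard_def using ATL_Learn_NP by blast
qed

end
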